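(* There is an isomorphism of 2-categories over $\mathbf{CAT}^{\mathbf 2}$ $$\Gamma_{\mathrm n}\colon\mathbf{NClCoFib}\xrightarrow{\ \cong\ }\mathbf{PsAlg}_{\mathrm n}(\mathbb C).$$ It sends a normally cloven cofibration $P$ to the normal pseudoalgebra with action $(L^P,1_B)$ and multiplication cell with components the compositors $\chi^x_{v,u}$. Under this isomorphism: (i) pseudomorphisms are the squares whose total functors preserve cocartesian arrows; (ii) strict pseudoalgebra morphisms are the squares that preserve the designated lifts strictly; (iii) every 2-cell of $\mathbf{CAT}^{\mathbf 2}$ between pseudomorphisms is an algebra transformation.
   Context: $\mathbf{CAT}$ is the strict 2-category of locally small categories, functors and natural transformations. $\mathbf{CAT}^{\mathbf 2}$ is the strict arrow 2-category: objects are functors $P\colon E\to B$; a 1-cell (square) $(T,S)\colon P\to Q$, with $Q\colon F\to C$, is a pair of functors $T\colon E\to F$ (the total functor), $S\colon B\to C$ with $QT=SP$; a 2-cell $(\beta,\alpha)\colon(T,S)\Rightarrow(T',S')$ is a pair of natural transformations $\beta\colon T\Rightarrow T'$, $\alpha\colon S\Rightarrow S'$ with $Q\beta=\alpha P$; compositions are componentwise. **Normally cloven cofibrations.** For $P\colon E\to B$, an arrow $e\colon x\to y$ of $E$ is $P$-cocartesian if for all $g\colon x\to z$ and $v\colon Py\to Pz$ with $Pg=v\,Pe$ there is a unique $h\colon y\to z$ with $he=g$, $Ph=v$. A cleavage chooses, for each $x\in E$ and $u\colon Px\to b$, a $P$-cocartesian arrow (designated lift) $\delta^x_u\colon x\to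 u_!x$ with $P\delta^x_u=u$; it is normal if $\delta^x_{1_{Px}}=1_x$ for all $x$. $\mathbf{NClCoFib}$ has functors with a normal cleavage as objects, squares $(T,S)$ such that $T$ preserves cocartesian arrows as 1-cells, and all 2-cells of $\mathbf{CAT}^{\mathbf 2}$ between them. Designated lifts are preserved strictly by $(T,S)$ if $T\delta^x_u=\delta^{Tx}_{Su}$ for all $x,u$. An arrow is vertical if its image under $P$ is an identity. **Comma 2-monad.** $P\downarrow B$ has objects $(x,u)$ with $x\in E$, $u\colon Px\to b$; an arrow $(f,v)\colon(x,u)\to(y,w)$ consists of $f\colon x\to y$, $v\colon b\to c$ with $vu=w\,Pf$. The 2-monad $\mathbb C$ on $\mathbf{CAT}^{\mathbf 2}$: $\mathbb CP=\mathrm{Cod}_P\colon P\downarrow B\to B$, $(x,u)\mapsto b$, $(f,v)\mapsto v$; $\mathbb C(T,S)=(\overline T,S)$ with $\overline T(x,u)=(Tx,Su)$, $\overline T(f,v)=(Tf,Sv)$; $\mathbb C(\beta,\alpha)=(\overline\beta,\alpha)$ with $\overline\beta_{(x,u)}=(\beta_x,\alpha_b)$; unit $(H^P,1_B)$, $H^Px=(x,1_{Px})$, $H^Pf=(f,Pf)$; multiplication $(M^P,1_B)$, $M^P((x,u),v)=(x,vu)$, $M^P((f,r),s)=(f,s)$. **Action and compositor.** For a cloven cofibration, $L^P\colon P\downarrow B\to E$ is the unique functor with $L^P(x,u)=u_!x$, $PL^P=\mathrm{Cod}_P$ and $L^P(f,v)\delta^x_u=\delta^y_wf$ for every $(f,v)\colon(x,u)\to(y,w)$.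 For composable $u\colon Px\to b$, $v\colon b\to c$, $\chi^x_{v,u}\colon v_!(u_!x)\to(vu)_!x$ is the unique vertical isomorphism with $\chi^x_{v,u}\,\delta^{u_!x}_v\,\delta^x_u=\delta^x_{vu}$; these are the components at $((x,u),v)$ of a natural transformation $\chi\colon L^P\overline{L^P}\Rightarrow L^PM^P$ over $1_B$. **Pseudoalgebras.** For a strict 2-monad $\mathbb T=(\mathbb T,\eta,\mu)$ on $\mathcal K$, a pseudoalgebra is $a\colon\mathbb TX\to X$ with invertible 2-cells $\iota\colon1_X\Rightarrow a\eta_X$, $\chi\colon a\,\mathbb Ta\Rightarrow a\mu_X$ such that (vertical composites of whiskered cells) $(\chi\,\mathbb T\eta_X)(a\,\mathbb T\iota)=1_a$, $(\chi\,\eta_{\mathbb TX})(\iota a)=1_a$, $(\chi\,\mathbb T\mu_X)(a\,\mathbb T\chi)=(\chi\,\mu_{\mathbb TX})(\chi\,\mathbb T^2a)$; it is normal if $\iota$ is an identity. A pseudomorphism $(X,a,\iota^a,\chi^a)\to(Y,b,\iota^b,\chi^b)$ is a 1-cell $f$ with an invertible $\overline f\colon b\,\mathbb Tf\Rightarrow fa$ such that $(\overline f\,\eta_X)(\iota^bf)=f\iota^a$ and $(\overline f\,\mu_X)(\chi^b\,\mathbb T^2f)=(f\chi^a)(\overline f\,\mathbb Ta)(b\,\mathbb T\overline f)$; it is a strict morphism if $\overline f$ is an identity. An algebra transformation $(f,\overline f)\Rightarrow(g,\overline g)$ is a 2-cell $\alpha\colon f\Rightarrow g$ with $(\alpha a)\overline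 f=\overline g(b\,\mathbb T\alpha)$. $\mathbf{PsAlg}_{\mathrm n}(\mathbb T)$ is the 2-category of normal pseudoalgebras, pseudomorphisms and algebra transformations. "Over $\mathbf{CAT}^{\mathbf 2}$" means commuting strictly with the forgetful 2-functors. *)

theory Defs
  imports "HOL-Library.FuncSet"
begin

unbundle cardinal_syntax

section \<open>Strict 2-categories, 2-functors and 2-monads\<close>

text \<open>
  Composition is written in the applicative order: \<open>g \<odot> f\<close> is \<open>f\<close> followed by \<open>g\<close>, and likewise
  for the vertical composition \<open>\<bullet>\<close> and the horizontal composition \<open>\<star>\<close> of 2-cells.
\<close>

record ('o, 'm, 'c) two_cat =
  Cell0 :: "'o set"
  Cell1 :: "'m set"
  Cell2 :: "'c set"
  src1 :: "'m \<Rightarrow> 'o"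
  tgt1 :: "'m \<Rightarrow> 'o"
  src2 :: "'c \<Rightarrow> 'm"
  tgt2 :: "'c \<Rightarrow> 'm"
  one1 :: "'o \<Rightarrow> 'm"
  one2 :: "'m \<Rightarrow> 'c"
  comp1 :: "'m \<Rightarrow> 'm \<Rightarrow> 'm" (infixr \<open>\<odot>\<index>\<close> 70)
  vcomp :: "'c \<Rightarrow> 'c \<Rightarrow> 'c" (infixr \<open>\<bullet>\<index>\<close> 65)
  hcomp :: "'c \<Rightarrow> 'c \<Rightarrow> 'c" (infixr \<open>\<star>\<index>\<close> 70)

locale two_category =
  fixes K :: "('o, 'm, 'c) two_cat" (structure)
  assumes src1_in: "f \<in> Cell1 K \<Longrightarrow> src1 K f \<in> Cell0 K"
    and tgt1_in: "f \<in> Cell1 K \<Longrightarrow> tgt1 K f \<in> Cell0 K"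
    and src2_in: "\<alpha> \<in> Cell2 K \<Longrightarrow> src2 K \<alpha> \<in> Cell1 K"
    and tgt2_in: "\<alpha> \<in> Cell2 K \<Longrightarrow> tgt2 K \<alpha> \<in> Cell1 K"
    and globular_src: "\<alpha> \<in> Cell2 K \<Longrightarrow> src1 K (src2 K \<alpha>) = src1 K (tgt2 K \<alpha>)"
    and globular_tgt: "\<alpha> \<in> Cell2 K \<Longrightarrow> tgt1 K (src2 K \<alpha>) = tgt1 K (tgt2 K \<alpha>)"
    and one1_cell: "x \<in> Cell0 K \<Longrightarrow>
      one1 K x \<in> Cell1 K \<and> src1 K (one1 K x) = x \<and> tgt1 K (one1 K x) = x"
    and one2_cell: "f \<in> Cell1 K \<Longrightarrow>
      one2 K f \<in> Cell2 K \<and> src2 K (one2 K f) = f \<and> tgt2 K (one2 K f) = f"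
    and comp1_cell: "\<lbrakk>f \<in> Cell1 K; g \<in> Cell1 K; tgt1 K f = src1 K g\<rbrakk> \<Longrightarrow>
      g \<odot> f \<in> Cell1 K \<and> src1 K (g \<odot> f) = src1 K f \<and> tgt1 K (g \<odot> f) = tgt1 K g"
    and vcomp_cell: "\<lbrakk>\<alpha> \<in> Cell2 K; \<beta> \<in> Cell2 K; tgt2 K \<alpha> = src2 K \<beta>\<rbrakk> \<Longrightarrow>
      \<beta> \<bullet> \<alpha> \<in> Cell2 K \<and> src2 K (\<beta> \<bullet> \<alpha>) = src2 K \<alpha> \<and> tgt2 K (\<beta> \<bullet> \<alpha>) = tgt2 K \<beta>"
    and hcomp_cell: "\<lbrakk>\<alpha> \<in> Cell2 K; \<beta> \<in> Cell2 K; tgt1 K (src2 K \<alpha>) = src1 K (src2 K \<beta>)\<rbrakk> \<Longrightarrow>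
      \<beta> \<star> \<alpha> \<in> Cell2 K \<and> src2 K (\<beta> \<star> \<alpha>) = src2 K \<beta> \<odot> src2 K \<alpha> \<and>
      tgt2 K (\<beta> \<star> \<alpha>) = tgt2 K \<beta> \<odot> tgt2 K \<alpha>"
    and comp1_one_right: "f \<in> Cell1 K \<Longrightarrow> f \<odot> one1 K (src1 K f) = f"
    and comp1_one_left: "f \<in> Cell1 K \<Longrightarrow> one1 K (tgt1 K f) \<odot> f = f"
    and comp1_assoc: "\<lbrakk>f \<in> Cell1 K; g \<in> Cell1 K; h \<in> Cell1 K;
      tgt1 K f = src1 K g; tgt1 K g = src1 K h\<rbrakk> \<Longrightarrow> h \<odot> (g \<odot> f) = (h \<odot> g) \<odot> f"
    and vcomp_one_right: "\<alpha> \<in> Cell2 K \<Longrightarrow> \<alpha> \<bullet> one2 K (src2 K \<alpha>) = \<alpha>"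
    and vcomp_one_left: "\<alpha> \<in> Cell2 K \<Longrightarrow> one2 K (tgt2 K \<alpha>) \<bullet> \<alpha> = \<alpha>"
    and vcomp_assoc: "\<lbrakk>\<alpha> \<in> Cell2 K; \<beta> \<in> Cell2 K; \<gamma> \<in> Cell2 K;
      tgt2 K \<alpha> = src2 K \<beta>; tgt2 K \<beta> = src2 K \<gamma>\<rbrakk> \<Longrightarrow> \<gamma> \<bullet> (\<beta> \<bullet> \<alpha>) = (\<gamma> \<bullet> \<beta>) \<bullet> \<alpha>"
    and hcomp_one_right: "\<alpha> \<in> Cell2 K \<Longrightarrow> \<alpha> \<star> one2 K (one1 K (src1 K (src2 K \<alpha>))) = \<alpha>"
    and hcomp_one_left: "\<alpha> \<in> Cell2 K \<Longrightarrow> one2 K (one1 K (tgt1 K (src2 K \<alpha>))) \<star> \<alpha> = \<alpha>"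
    and hcomp_assoc: "\<lbrakk>\<alpha> \<in> Cell2 K; \<beta> \<in> Cell2 K; \<gamma> \<in> Cell2 K;
      tgt1 K (src2 K \<alpha>) = src1 K (src2 K \<beta>); tgt1 K (src2 K \<beta>) = src1 K (src2 K \<gamma>)\<rbrakk> \<Longrightarrow>
      \<gamma> \<star> (\<beta> \<star> \<alpha>) = (\<gamma> \<star> \<beta>) \<star> \<alpha>"
    and hcomp_one2: "\<lbrakk>f \<in> Cell1 K; g \<in> Cell1 K; tgt1 K f = src1 K g\<rbrakk> \<Longrightarrow>
      one2 K g \<star> one2 K f = one2 K (g \<odot> f)"
    and interchange: "\<lbrakk>\<alpha> \<in> Cell2 K; \<alpha>' \<in> Cell2 K; \<beta> \<in> Cell2 K; \<beta>' \<in> Cell2 K;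
      tgt2 K \<alpha> = src2 K \<alpha>'; tgt2 K \<beta> = src2 K \<beta>'; tgt1 K (src2 K \<alpha>) = src1 K (src2 K \<beta>)\<rbrakk> \<Longrightarrow>
      (\<beta>' \<bullet> \<beta>) \<star> (\<alpha>' \<bullet> \<alpha>) = (\<beta>' \<star> \<alpha>') \<bullet> (\<beta> \<star> \<alpha>)"

definition hom1 :: "('o, 'm, 'c) two_cat \<Rightarrow> 'o \<Rightarrow> 'o \<Rightarrow> 'm set" where
  "hom1 K x y = {f \<in> Cell1 K. src1 K f = x \<and> tgt1 K f = y}"

definition hom2 :: "('o, 'm, 'c) two_cat \<Rightarrow> 'm \<Rightarrow> 'm \<Rightarrow> 'c set" where
  "hom2 K f g = {\<alpha> \<in> Cell2 K. src2 K \<alpha> = f \<and> tgt2 K \<alpha> = g}"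

definition whisker_left ::
    "('o, 'm, 'c) two_cat \<Rightarrow> 'm \<Rightarrow> 'c \<Rightarrow> 'c" (\<open>(_ \<lhd>\<index> _)\<close> [71, 70] 70) where
  "g \<lhd>\<^bsub>K\<^esub> \<alpha> = one2 K g \<star>\<^bsub>K\<^esub> \<alpha>"

definition whisker_right ::
    "('o, 'm, 'c) two_cat \<Rightarrow> 'c \<Rightarrow> 'm \<Rightarrow> 'c" (\<open>(_ \<rhd>\<index> _)\<close> [71, 70] 70) where
  "\<alpha> \<rhd>\<^bsub>K\<^esub> f = \<alpha> \<star>\<^bsub>K\<^esub> one2 K f"

definition is_identity2 :: "('o, 'm, 'c) two_cat \<Rightarrow> 'c \<Rightarrow> bool" where
  "is_identity2 K \<alpha> \<longleftrightarrow> (\<exists>f \<in> Cell1 K. \<alpha> = one2 K f)"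

definition invertible2 :: "('o, 'm, 'c) two_cat \<Rightarrow> 'c \<Rightarrow> bool" where
  "invertible2 K \<alpha> \<longleftrightarrow> \<alpha> \<in> Cell2 K \<and> (\<exists>\<beta> \<in> hom2 K (tgt2 K \<alpha>) (src2 K \<alpha>).
     \<beta> \<bullet>\<^bsub>K\<^esub> \<alpha> = one2 K (src2 K \<alpha>) \<and> \<alpha> \<bullet>\<^bsub>K\<^esub> \<beta> = one2 K (tgt2 K \<alpha>))"

record ('o, 'm, 'c, 'p, 'n, 'd) two_fun =
  F0 :: "'o \<Rightarrow> 'p"
  F1 :: "'m \<Rightarrow> 'n"
  F2 :: "'c \<Rightarrow> 'd"

locale two_functor =
  K: two_category K + L: two_category L
  for K :: "('o, 'm, 'c) two_cat" and L :: "('p, 'n, 'd) two_cat" +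
  fixes \<Phi> :: "('o, 'm, 'c, 'p, 'n, 'd, 'z) two_fun_scheme"
  assumes F0_in: "x \<in> Cell0 K \<Longrightarrow> F0 \<Phi> x \<in> Cell0 L"
    and F1_in: "f \<in> Cell1 K \<Longrightarrow> F1 \<Phi> f \<in> hom1 L (F0 \<Phi> (src1 K f)) (F0 \<Phi> (tgt1 K f))"
    and F2_in: "\<alpha> \<in> Cell2 K \<Longrightarrow> F2 \<Phi> \<alpha> \<in> hom2 L (F1 \<Phi> (src2 K \<alpha>)) (F1 \<Phi> (tgt2 K \<alpha>))"
    and F1_one: "x \<in> Cell0 K \<Longrightarrow> F1 \<Phi> (one1 K x) = one1 L (F0 \<Phi> x)"
    and F2_one: "f \<in> Cell1 K \<Longrightarrow> F2 \<Phi> (one2 K f) = one2 L (F1 \<Phi> f)"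
    and F1_comp: "\<lbrakk>f \<in> Cell1 K; g \<in> Cell1 K; tgt1 K f = src1 K g\<rbrakk> \<Longrightarrow>
      F1 \<Phi> (g \<odot>\<^bsub>K\<^esub> f) = F1 \<Phi> g \<odot>\<^bsub>L\<^esub> F1 \<Phi> f"
    and F2_vcomp: "\<lbrakk>\<alpha> \<in> Cell2 K; \<beta> \<in> Cell2 K; tgt2 K \<alpha> = src2 K \<beta>\<rbrakk> \<Longrightarrow>
      F2 \<Phi> (\<beta> \<bullet>\<^bsub>K\<^esub> \<alpha>) = F2 \<Phi> \<beta> \<bullet>\<^bsub>L\<^esub> F2 \<Phi> \<alpha>"
    and F2_hcomp: "\<lbrakk>\<alpha> \<in> Cell2 K; \<beta> \<in> Cell2 K; tgt1 K (src2 K \<alpha>) = src1 K (src2 K \<beta>)\<rbrakk> \<Longrightarrow>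
      F2 \<Phi> (\<beta> \<star>\<^bsub>K\<^esub> \<alpha>) = F2 \<Phi> \<beta> \<star>\<^bsub>L\<^esub> F2 \<Phi> \<alpha>"

definition two_isomorphism ::
    "('o, 'm, 'c) two_cat \<Rightarrow> ('p, 'n, 'd) two_cat \<Rightarrow> ('o, 'm, 'c, 'p, 'n, 'd) two_fun \<Rightarrow> bool" where
  "two_isomorphism K L \<Phi> \<longleftrightarrow> two_functor K L \<Phi> \<and>
     (\<exists>\<Psi> :: ('p, 'n, 'd, 'o, 'm, 'c) two_fun. two_functor L K \<Psi> \<and>
        (\<forall>x \<in> Cell0 K. F0 \<Psi> (F0 \<Phi> x) = x) \<and> (\<forall>y \<in> Cell0 L. F0 \<Phi> (F0 \<Psi> y) = y) \<and>
        (\<forall>f \<in> Cell1 K. F1 \<Psi> (F1 \<Phi> f) = f) \<and> (\<forall>g \<in> Cell1 L. F1 \<Phi> (F1 \<Psi> g) = g) \<and>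
        (\<forall>\<alpha> \<in> Cell2 K. F2 \<Psi> (F2 \<Phi> \<alpha>) = \<alpha>) \<and> (\<forall>\<beta> \<in> Cell2 L. F2 \<Phi> (F2 \<Psi> \<beta>) = \<beta>))"

text \<open>\<open>\<Phi>\<close> commutes strictly with \<open>U\<close> and \<open>V\<close>, that is, \<open>V \<circ> \<Phi> = U\<close> on the cells of \<open>K\<close>.\<close>

definition commutes_over ::
    "('o, 'm, 'c) two_cat \<Rightarrow> ('o, 'm, 'c, 'q, 'k, 'e) two_fun \<Rightarrow> ('p, 'n, 'd, 'q, 'k, 'e) two_fun \<Rightarrow>
     ('o, 'm, 'c, 'p, 'n, 'd) two_fun \<Rightarrow> bool" where
  "commutes_over K U V \<Phi> \<longleftrightarrow>
     (\<forall>x \<in> Cell0 K. F0 V (F0 \<Phi> x) = F0 U x) \<and>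
     (\<forall>f \<in> Cell1 K. F1 V (F1 \<Phi> f) = F1 U f) \<and>
     (\<forall>\<alpha> \<in> Cell2 K. F2 V (F2 \<Phi> \<alpha>) = F2 U \<alpha>)"

record ('o, 'm, 'c) two_monad = "('o, 'm, 'c, 'o, 'm, 'c) two_fun" +
  unit :: "'o \<Rightarrow> 'm"
  mult :: "'o \<Rightarrow> 'm"

locale strict_two_monad =
  two_functor K K T
  for K :: "('o, 'm, 'c) two_cat" (structure) and T :: "('o, 'm, 'c) two_monad" +
  assumes unit_in: "x \<in> Cell0 K \<Longrightarrow> unit T x \<in> hom1 K x (F0 T x)"
    and mult_in: "x \<in> Cell0 K \<Longrightarrow> mult T x \<in> hom1 K (F0 T (F0 T x)) (F0 T x)"
    and unit_natural1: "f \<in> Cell1 K \<Longrightarrow>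
      F1 T f \<odot> unit T (src1 K f) = unit T (tgt1 K f) \<odot> f"
    and unit_natural2: "\<alpha> \<in> Cell2 K \<Longrightarrow>
      F2 T \<alpha> \<rhd> unit T (src1 K (src2 K \<alpha>)) = unit T (tgt1 K (src2 K \<alpha>)) \<lhd> \<alpha>"
    and mult_natural1: "f \<in> Cell1 K \<Longrightarrow>
      F1 T f \<odot> mult T (src1 K f) = mult T (tgt1 K f) \<odot> F1 T (F1 T f)"
    and mult_natural2: "\<alpha> \<in> Cell2 K \<Longrightarrow>
      F2 T \<alpha> \<rhd> mult T (src1 K (src2 K \<alpha>)) = mult T (tgt1 K (src2 K \<alpha>)) \<lhd> F2 T (F2 T \<alpha>)"
    and mult_unit: "x \<in> Cell0 K \<Longrightarrow> mult T x \<odot> unit T (F0 T x) = one1 K (F0 T x)"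
    and mult_map_unit: "x \<in> Cell0 K \<Longrightarrow> mult T x \<odot> F1 T (unit T x) = one1 K (F0 T x)"
    and mult_mult: "x \<in> Cell0 K \<Longrightarrow> mult T x \<odot> mult T (F0 T x) = mult T x \<odot> F1 T (mult T x)"

section \<open>Pseudoalgebras\<close>

record ('o, 'm, 'c) psalg =
  pa_obj :: 'o
  pa_act :: 'm
  pa_iota :: 'c
  pa_chi :: 'c

definition pseudoalgebra ::
    "('o, 'm, 'c) two_cat \<Rightarrow> ('o, 'm, 'c) two_monad \<Rightarrow> ('o, 'm, 'c) psalg \<Rightarrow> bool" where
  "pseudoalgebra K T A \<longleftrightarrow>
     (let X = pa_obj A; a = pa_act A; \<iota> = pa_iota A; \<chi> = pa_chi A in
        X \<in> Cell0 K \<and> a \<in> hom1 K (F0 T X) X \<and>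
        \<iota> \<in> hom2 K (one1 K X) (a \<odot>\<^bsub>K\<^esub> unit T X) \<and> invertible2 K \<iota> \<and>
        \<chi> \<in> hom2 K (a \<odot>\<^bsub>K\<^esub> F1 T a) (a \<odot>\<^bsub>K\<^esub> mult T X) \<and> invertible2 K \<chi> \<and>
        (\<chi> \<rhd>\<^bsub>K\<^esub> F1 T (unit T X)) \<bullet>\<^bsub>K\<^esub> (a \<lhd>\<^bsub>K\<^esub> F2 T \<iota>) = one2 K a \<and>
        (\<chi> \<rhd>\<^bsub>K\<^esub> unit T (F0 T X)) \<bullet>\<^bsub>K\<^esub> (\<iota> \<rhd>\<^bsub>K\<^esub> a) = one2 K a \<and>
        (\<chi> \<rhd>\<^bsub>K\<^esub> F1 T (mult T X)) \<bullet>\<^bsub>K\<^esub> (a \<lhd>\<^bsub>K\<^esub> F2 T \<chi>) =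
          (\<chi> \<rhd>\<^bsub>K\<^esub> mult T (F0 T X)) \<bullet>\<^bsub>K\<^esub> (\<chi> \<rhd>\<^bsub>K\<^esub> F1 T (F1 T a)))"

definition normal_pseudoalgebra ::
    "('o, 'm, 'c) two_cat \<Rightarrow> ('o, 'm, 'c) two_monad \<Rightarrow> ('o, 'm, 'c) psalg \<Rightarrow> bool" where
  "normal_pseudoalgebra K T A \<longleftrightarrow> pseudoalgebra K T A \<and> is_identity2 K (pa_iota A)"

record ('o, 'm, 'c) psmor =
  pm_src :: "('o, 'm, 'c) psalg"
  pm_tgt :: "('o, 'm, 'c) psalg"
  pm_map :: 'm
  pm_cell :: 'c

definition pseudomorphism ::
    "('o, 'm, 'c) two_cat \<Rightarrow> ('o, 'm, 'c) two_monad \<Rightarrow> ('o, 'm, 'c) psmor \<Rightarrow> bool" where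
  "pseudomorphism K T m \<longleftrightarrow>
     (let X = pa_obj (pm_src m); a = pa_act (pm_src m);
          \<iota>a = pa_iota (pm_src m); \<chi>a = pa_chi (pm_src m);
          Y = pa_obj (pm_tgt m); b = pa_act (pm_tgt m);
          \<iota>b = pa_iota (pm_tgt m); \<chi>b = pa_chi (pm_tgt m);
          f = pm_map m; \<phi> = pm_cell m in
        pseudoalgebra K T (pm_src m) \<and> pseudoalgebra K T (pm_tgt m) \<and>
        f \<in> hom1 K X Y \<and>
        \<phi> \<in> hom2 K (b \<odot>\<^bsub>K\<^esub> F1 T f) (f \<odot>\<^bsub>K\<^esub> a) \<and> invertible2 K \<phi> \<and>
        (\<phi> \<rhd>\<^bsub>K\<^esub> unit T X) \<bullet>\<^bsub>K\<^esub> (\<iota>b \<rhd>\<^bsub>K\<^esub> f) = f \<lhd>\<^bsub>K\<^esub> \<iota>a \<and>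
        (\<phi> \<rhd>\<^bsub>K\<^esub> mult T X) \<bullet>\<^bsub>K\<^esub> (\<chi>b \<rhd>\<^bsub>K\<^esub> F1 T (F1 T f)) =
          (f \<lhd>\<^bsub>K\<^esub> \<chi>a) \<bullet>\<^bsub>K\<^esub> (\<phi> \<rhd>\<^bsub>K\<^esub> F1 T a) \<bullet>\<^bsub>K\<^esub> (b \<lhd>\<^bsub>K\<^esub> F2 T \<phi>))"

definition strict_morphism ::
    "('o, 'm, 'c) two_cat \<Rightarrow> ('o, 'm, 'c) two_monad \<Rightarrow> ('o, 'm, 'c) psmor \<Rightarrow> bool" where
  "strict_morphism K T m \<longleftrightarrow> pseudomorphism K T m \<and> is_identity2 K (pm_cell m)"

record ('o, 'm, 'c) algtr =
  at_src :: "('o, 'm, 'c) psmor"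
  at_tgt :: "('o, 'm, 'c) psmor"
  at_cell :: 'c

definition algebra_transformation ::
    "('o, 'm, 'c) two_cat \<Rightarrow> ('o, 'm, 'c) two_monad \<Rightarrow> ('o, 'm, 'c) algtr \<Rightarrow> bool" where
  "algebra_transformation K T t \<longleftrightarrow>
     (let m = at_src t; n = at_tgt t; \<alpha> = at_cell t;
          a = pa_act (pm_src m); b = pa_act (pm_tgt m) in
        pseudomorphism K T m \<and> pseudomorphism K T n \<and>
        pm_src m = pm_src n \<and> pm_tgt m = pm_tgt n \<and>
        \<alpha> \<in> hom2 K (pm_map m) (pm_map n) \<and>
        (\<alpha> \<rhd>\<^bsub>K\<^esub> a) \<bullet>\<^bsub>K\<^esub> pm_cell m = pm_cell n \<bullet>\<^bsub>K\<^esub> (b \<lhd>\<^bsub>K\<^esub> F2 T \<alpha>))"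

definition psmor_one ::
    "('o, 'm, 'c) two_cat \<Rightarrow> ('o, 'm, 'c) psalg \<Rightarrow> ('o, 'm, 'c) psmor" where
  "psmor_one K A = \<lparr>pm_src = A, pm_tgt = A, pm_map = one1 K (pa_obj A), pm_cell = one2 K (pa_act A)\<rparr>"

text \<open>
  The composite of \<open>m = (f, \<phi>)\<close> and \<open>n = (g, \<psi>)\<close> has the cell
  \<open>c (T g) (T f) \<Rightarrow> g b (T f) \<Rightarrow> g f a\<close>.
\<close>

definition psmor_comp ::
    "('o, 'm, 'c) two_cat \<Rightarrow> ('o, 'm, 'c) two_monad \<Rightarrow>
     ('o, 'm, 'c) psmor \<Rightarrow> ('o, 'm, 'c) psmor \<Rightarrow> ('o, 'm, 'c) psmor" where
  "psmor_comp K T n m = \<lparr>pm_src = pm_src m, pm_tgt = pm_tgt n,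
     pm_map = pm_map n \<odot>\<^bsub>K\<^esub> pm_map m,
     pm_cell = (pm_map n \<lhd>\<^bsub>K\<^esub> pm_cell m) \<bullet>\<^bsub>K\<^esub> (pm_cell n \<rhd>\<^bsub>K\<^esub> F1 T (pm_map m))\<rparr>"

definition PsAlg\<^sub>n ::
    "('o, 'm, 'c) two_cat \<Rightarrow> ('o, 'm, 'c) two_monad \<Rightarrow>
     (('o, 'm, 'c) psalg, ('o, 'm, 'c) psmor, ('o, 'm, 'c) algtr) two_cat" where
  "PsAlg\<^sub>n K T = \<lparr>
     Cell0 = {A. normal_pseudoalgebra K T A},
     Cell1 = {m. pseudomorphism K T m \<and>
                 normal_pseudoalgebra K T (pm_src m) \<and> normal_pseudoalgebra K T (pm_tgt m)},
     Cell2 = {t. algebra_transformation K T t \<and>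
                 normal_pseudoalgebra K T (pm_src (at_src t)) \<and>
                 normal_pseudoalgebra K T (pm_tgt (at_src t))},
     src1 = pm_src, tgt1 = pm_tgt, src2 = at_src, tgt2 = at_tgt,
     one1 = psmor_one K,
     one2 = (\<lambda>m. \<lparr>at_src = m, at_tgt = m, at_cell = one2 K (pm_map m)\<rparr>),
     comp1 = psmor_comp K T,
     vcomp = (\<lambda>t s. \<lparr>at_src = at_src s, at_tgt = at_tgt t,
                    at_cell = at_cell t \<bullet>\<^bsub>K\<^esub> at_cell s\<rparr>),
     hcomp = (\<lambda>t s. \<lparr>at_src = psmor_comp K T (at_src t) (at_src s),
                    at_tgt = psmor_comp K T (at_tgt t) (at_tgt s),
                    at_cell = at_cell t \<star>\<^bsub>K\<^esub> at_cell s\<rparr>)\<rparr>"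

definition PsAlg_forget ::
    "(('o, 'm, 'c) psalg, ('o, 'm, 'c) psmor, ('o, 'm, 'c) algtr, 'o, 'm, 'c) two_fun" where
  "PsAlg_forget = \<lparr>F0 = pa_obj, F1 = pm_map, F2 = at_cell\<rparr>"

section \<open>The arrow 2-category\<close>

record 'm square =
  sq_src :: 'm
  sq_tgt :: 'm
  sq_total :: 'm
  sq_base :: 'm

record ('m, 'c) sqcell =
  sc_src :: 'm
  sc_tgt :: 'm
  sc_total :: 'c
  sc_base :: 'c

definition is_square :: "('o, 'm, 'c) two_cat \<Rightarrow> 'm square \<Rightarrow> bool" where
  "is_square K s \<longleftrightarrow> sq_src s \<in> Cell1 K \<and> sq_tgt s \<in> Cell1 K \<and>
     sq_total s \<in> hom1 K (src1 K (sq_src s)) (src1 K (sq_tgt s)) \<and>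
     sq_base s \<in> hom1 K (tgt1 K (sq_src s)) (tgt1 K (sq_tgt s)) \<and>
     sq_tgt s \<odot>\<^bsub>K\<^esub> sq_total s = sq_base s \<odot>\<^bsub>K\<^esub> sq_src s"

definition sqcell_src :: "('o, 'm, 'c) two_cat \<Rightarrow> ('m, 'c) sqcell \<Rightarrow> 'm square" where
  "sqcell_src K \<theta> = \<lparr>sq_src = sc_src \<theta>, sq_tgt = sc_tgt \<theta>,
     sq_total = src2 K (sc_total \<theta>), sq_base = src2 K (sc_base \<theta>)\<rparr>"

definition sqcell_tgt :: "('o, 'm, 'c) two_cat \<Rightarrow> ('m, 'c) sqcell \<Rightarrow> 'm square" where
  "sqcell_tgt K \<theta> = \<lparr>sq_src = sc_src \<theta>, sq_tgt = sc_tgt \<theta>,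
     sq_total = tgt2 K (sc_total \<theta>), sq_base = tgt2 K (sc_base \<theta>)\<rparr>"

definition is_sqcell :: "('o, 'm, 'c) two_cat \<Rightarrow> ('m, 'c) sqcell \<Rightarrow> bool" where
  "is_sqcell K \<theta> \<longleftrightarrow> sc_total \<theta> \<in> Cell2 K \<and> sc_base \<theta> \<in> Cell2 K \<and>
     is_square K (sqcell_src K \<theta>) \<and> is_square K (sqcell_tgt K \<theta>) \<and>
     sc_tgt \<theta> \<lhd>\<^bsub>K\<^esub> sc_total \<theta> = sc_base \<theta> \<rhd>\<^bsub>K\<^esub> sc_src \<theta>"

definition arrow_two_cat ::
    "('o, 'm, 'c) two_cat \<Rightarrow> ('m, 'm square, ('m, 'c) sqcell) two_cat" where
  "arrow_two_cat K = \<lparr>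
     Cell0 = Cell1 K,
     Cell1 = {s. is_square K s},
     Cell2 = {\<theta>. is_sqcell K \<theta>},
     src1 = sq_src, tgt1 = sq_tgt, src2 = sqcell_src K, tgt2 = sqcell_tgt K,
     one1 = (\<lambda>p. \<lparr>sq_src = p, sq_tgt = p,
                  sq_total = one1 K (src1 K p), sq_base = one1 K (tgt1 K p)\<rparr>),
     one2 = (\<lambda>s. \<lparr>sc_src = sq_src s, sc_tgt = sq_tgt s,
                  sc_total = one2 K (sq_total s), sc_base = one2 K (sq_base s)\<rparr>),
     comp1 = (\<lambda>t s. \<lparr>sq_src = sq_src s, sq_tgt = sq_tgt t,
                    sq_total = sq_total t \<odot>\<^bsub>K\<^esub> sq_total s,
                    sq_base = sq_base t \<odot>\<^bsub>K\<^esub> sq_base s\<rparr>),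
     vcomp = (\<lambda>\<eta> \<theta>. \<lparr>sc_src = sc_src \<theta>, sc_tgt = sc_tgt \<theta>,
                    sc_total = sc_total \<eta> \<bullet>\<^bsub>K\<^esub> sc_total \<theta>,
                    sc_base = sc_base \<eta> \<bullet>\<^bsub>K\<^esub> sc_base \<theta>\<rparr>),
     hcomp = (\<lambda>\<eta> \<theta>. \<lparr>sc_src = sc_src \<theta>, sc_tgt = sc_tgt \<eta>,
                    sc_total = sc_total \<eta> \<star>\<^bsub>K\<^esub> sc_total \<theta>,
                    sc_base = sc_base \<eta> \<star>\<^bsub>K\<^esub> sc_base \<theta>\<rparr>)\<rparr>"

section \<open>Categories, functors and natural transformations\<close>

text \<open>
  All operations are required to be \<open>undefined\<close> outside their domains, so that equality of
  categories, functors and natural transformations in HOL is the intended strict equality.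
\<close>

record 'u cat =
  Obj :: "'u set"
  Arr :: "'u set"
  Dom :: "'u \<Rightarrow> 'u"
  Cod :: "'u \<Rightarrow> 'u"
  Ide :: "'u \<Rightarrow> 'u"
  Comp :: "'u \<Rightarrow> 'u \<Rightarrow> 'u" (infixr \<open>\<cdot>\<index>\<close> 75)

definition hom :: "'u cat \<Rightarrow> 'u \<Rightarrow> 'u \<Rightarrow> 'u set" where
  "hom C x y = {f \<in> Arr C. Dom C f = x \<and> Cod C f = y}"

locale category =
  fixes C :: "'u cat" (structure)
  assumes Dom_in: "Dom C \<in> Arr C \<rightarrow>\<^sub>E Obj C"
    and Cod_in: "Cod C \<in> Arr C \<rightarrow>\<^sub>E Obj C"
    and Ide_ext: "Ide C \<in> extensional (Obj C)"
    and Ide_in: "x \<in> Obj C \<Longrightarrow> Ide C x \<in> hom C x x"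
    and Comp_ext: "\<not> (f \<in> Arr C \<and> g \<in> Arr C \<and> Cod C f = Dom C g) \<Longrightarrow> g \<cdot> f = undefined"
    and Comp_in: "\<lbrakk>f \<in> Arr C; g \<in> Arr C; Cod C f = Dom C g\<rbrakk> \<Longrightarrow> g \<cdot> f \<in> hom C (Dom C f) (Cod C g)"
    and Comp_Ide: "f \<in> Arr C \<Longrightarrow> f \<cdot> Ide C (Dom C f) = f"
    and Ide_Comp: "f \<in> Arr C \<Longrightarrow> Ide C (Cod C f) \<cdot> f = f"
    and Comp_assoc: "\<lbrakk>f \<in> Arr C; g \<in> Arr C; h \<in> Arr C; Cod C f = Dom C g; Cod C g = Dom C h\<rbrakk> \<Longrightarrow>
      h \<cdot> (g \<cdot> f) = (h \<cdot> g) \<cdot> f"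

text \<open>
  The size bound is a parameter: a set counts as small if its cardinality is below the cardinal
  \<open>\<kappa>\<close>. The usual notion is the instance where \<open>\<kappa>\<close> is the (inaccessible) cardinality of the
  universe of sets; infinity of \<open>\<kappa>\<close> is what closes local smallness under comma categories.
\<close>

definition locally_small :: "'k rel \<Rightarrow> 'u cat \<Rightarrow> bool" where
  "locally_small \<kappa> C \<longleftrightarrow> (\<forall>x \<in> Obj C. \<forall>y \<in> Obj C. |hom C x y| <o \<kappa>)"

record 'u fnctr =
  FDom :: "'u cat"
  FCod :: "'u cat"
  FOb :: "'u \<Rightarrow> 'u"
  FAr :: "'u \<Rightarrow> 'u"

locale is_functor =
  A: category "FDom F" + B: category "FCod F"
  for F :: "'u fnctr" +
  assumes FOb_in: "FOb F \<in> Obj (FDom F) \<rightarrow>\<^sub>E Obj (FCod F)"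
    and FAr_ext: "FAr F \<in> extensional (Arr (FDom F))"
    and FAr_in: "f \<in> Arr (FDom F) \<Longrightarrow>
      FAr F f \<in> hom (FCod F) (FOb F (Dom (FDom F) f)) (FOb F (Cod (FDom F) f))"
    and FAr_Ide: "x \<in> Obj (FDom F) \<Longrightarrow> FAr F (Ide (FDom F) x) = Ide (FCod F) (FOb F x)"
    and FAr_Comp: "\<lbrakk>f \<in> Arr (FDom F); g \<in> Arr (FDom F); Cod (FDom F) f = Dom (FDom F) g\<rbrakk> \<Longrightarrow>
      FAr F (g \<cdot>\<^bsub>FDom F\<^esub> f) = FAr F g \<cdot>\<^bsub>FCod F\<^esub> FAr F f"

definition fun_one :: "'u cat \<Rightarrow> 'u fnctr" where
  "fun_one C = \<lparr>FDom = C, FCod = C, FOb = (\<lambda>x \<in> Obj C. x), FAr = (\<lambda>f \<in> Arr C. f)\<rparr>"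

definition fun_comp :: "'u fnctr \<Rightarrow> 'u fnctr \<Rightarrow> 'u fnctr" where
  "fun_comp G F = \<lparr>FDom = FDom F, FCod = FCod G,
     FOb = compose (Obj (FDom F)) (FOb G) (FOb F), FAr = compose (Arr (FDom F)) (FAr G) (FAr F)\<rparr>"

record 'u nattr =
  NSrc :: "'u fnctr"
  NTgt :: "'u fnctr"
  NAt :: "'u \<Rightarrow> 'u"

locale is_nattr =
  F: is_functor "NSrc \<alpha>" + G: is_functor "NTgt \<alpha>"
  for \<alpha> :: "'u nattr" +
  assumes same_dom: "FDom (NTgt \<alpha>) = FDom (NSrc \<alpha>)"
    and same_cod: "FCod (NTgt \<alpha>) = FCod (NSrc \<alpha>)"
    and NAt_ext: "NAt \<alpha> \<in> extensional (Obj (FDom (NSrc \<alpha>)))"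
    and NAt_in: "x \<in> Obj (FDom (NSrc \<alpha>)) \<Longrightarrow>
      NAt \<alpha> x \<in> hom (FCod (NSrc \<alpha>)) (FOb (NSrc \<alpha>) x) (FOb (NTgt \<alpha>) x)"
    and natural: "f \<in> Arr (FDom (NSrc \<alpha>)) \<Longrightarrow>
      NAt \<alpha> (Cod (FDom (NSrc \<alpha>)) f) \<cdot>\<^bsub>FCod (NSrc \<alpha>)\<^esub> FAr (NSrc \<alpha>) f =
      FAr (NTgt \<alpha>) f \<cdot>\<^bsub>FCod (NSrc \<alpha>)\<^esub> NAt \<alpha> (Dom (FDom (NSrc \<alpha>)) f)"

definition CAT :: "'k rel \<Rightarrow> ('u cat, 'u fnctr, 'u nattr) two_cat" where
  "CAT \<kappa> = \<lparr>
     Cell0 = {C. category C \<and> locally_small \<kappa> C},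
     Cell1 = {F. is_functor F \<and> locally_small \<kappa> (FDom F) \<and> locally_small \<kappa> (FCod F)},
     Cell2 = {\<alpha>. is_nattr \<alpha> \<and> locally_small \<kappa> (FDom (NSrc \<alpha>)) \<and> locally_small \<kappa> (FCod (NSrc \<alpha>))},
     src1 = FDom, tgt1 = FCod, src2 = NSrc, tgt2 = NTgt,
     one1 = fun_one,
     one2 = (\<lambda>F. \<lparr>NSrc = F, NTgt = F, NAt = (\<lambda>x \<in> Obj (FDom F). Ide (FCod F) (FOb F x))\<rparr>),
     comp1 = fun_comp,
     vcomp = (\<lambda>\<beta> \<alpha>. \<lparr>NSrc = NSrc \<alpha>, NTgt = NTgt \<beta>,
       NAt = (\<lambda>x \<in> Obj (FDom (NSrc \<alpha>)). NAt \<beta> x \<cdot>\<^bsub>FCod (NSrc \<alpha>)\<^esub> NAt \<alpha> x)\<rparr>),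
     hcomp = (\<lambda>\<beta> \<alpha>. \<lparr>NSrc = fun_comp (NSrc \<beta>) (NSrc \<alpha>), NTgt = fun_comp (NTgt \<beta>) (NTgt \<alpha>),
       NAt = (\<lambda>x \<in> Obj (FDom (NSrc \<alpha>)).
         NAt \<beta> (FOb (NTgt \<alpha>) x) \<cdot>\<^bsub>FCod (NSrc \<beta>)\<^esub> FAr (NSrc \<beta>) (NAt \<alpha> x))\<rparr>)\<rparr>"

text \<open>\<open>CAT\<^sup>2\<close>, the arrow 2-category of \<open>CAT\<close>.\<close>

abbreviation CAT\<^sub>2 :: "'k rel \<Rightarrow> ('u fnctr, 'u fnctr square, ('u fnctr, 'u nattr) sqcell) two_cat" where
  "CAT\<^sub>2 \<kappa> \<equiv> arrow_two_cat (CAT \<kappa>)"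

section \<open>The comma 2-monad\<close>

text \<open>
  A 2-monad is an endomorphism, so the objects and arrows of a comma category have to inhabit the
  same type as those of the categories it is built from. Over an arbitrary type of atoms the
  following universe is closed under (injective) pairing.
\<close>

datatype 'a univ = Atom 'a | Pr (lft: "'a univ") (rgt: "'a univ")  (\<open>\<langle>_,/ _\<rangle>\<close>)

text \<open>
  An arrow \<open>(f, v)\<close> of a comma category is tagged with its source and target \<open>X\<close>, \<open>Y\<close>, which it
  does not determine.
\<close>

definition carr :: "'a univ \<Rightarrow> 'a univ \<Rightarrow> 'a univ \<Rightarrow> 'a univ \<Rightarrow> 'a univ" where
  "carr X Y f v = \<langle>\<langle>X, Y\<rangle>, \<langle>f, v\<rangle>\<rangle>"

definition carr_src :: "'a univ \<Rightarrow> 'a univ" where "carr_src p = lft (lft p)"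
definition carr_tgt :: "'a univ \<Rightarrow> 'a univ" where "carr_tgt p = rgt (lft p)"
definition carr_top :: "'a univ \<Rightarrow> 'a univ" where "carr_top p = lft (rgt p)"
definition carr_bot :: "'a univ \<Rightarrow> 'a univ" where "carr_bot p = rgt (rgt p)"

definition comma_obj :: "'a univ fnctr \<Rightarrow> 'a univ set" where
  "comma_obj P = {\<langle>x, u\<rangle> | x u. x \<in> Obj (FDom P) \<and> u \<in> Arr (FCod P) \<and> Dom (FCod P) u = FOb P x}"

definition comma_arr :: "'a univ fnctr \<Rightarrow> 'a univ set" where
  "comma_arr P = {carr \<langle>x, u\<rangle> \<langle>y, w\<rangle> f v | x u y w f v.
     \<langle>x, u\<rangle> \<in> comma_obj P \<and> \<langle>y, w\<rangle> \<in> comma_obj P \<and>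
     f \<in> hom (FDom P) x y \<and> v \<in> hom (FCod P) (Cod (FCod P) u) (Cod (FCod P) w) \<and>
     v \<cdot>\<^bsub>FCod P\<^esub> u = w \<cdot>\<^bsub>FCod P\<^esub> FAr P f}"

definition comma :: "'a univ fnctr \<Rightarrow> 'a univ cat" where
  "comma P = \<lparr>
     Obj = comma_obj P,
     Arr = comma_arr P,
     Dom = (\<lambda>p \<in> comma_arr P. carr_src p),
     Cod = (\<lambda>p \<in> comma_arr P. carr_tgt p),
     Ide = (\<lambda>X \<in> comma_obj P.
       carr X X (Ide (FDom P) (lft X)) (Ide (FCod P) (Cod (FCod P) (rgt X)))),
     Comp = (\<lambda>q p. if p \<in> comma_arr P \<and> q \<in> comma_arr P \<and> carr_tgt p = carr_src q
       then carr (carr_src p) (carr_tgt q)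
         (carr_top q \<cdot>\<^bsub>FDom P\<^esub> carr_top p) (carr_bot q \<cdot>\<^bsub>FCod P\<^esub> carr_bot p)
       else undefined)\<rparr>"

definition cod_fun :: "'a univ fnctr \<Rightarrow> 'a univ fnctr" where
  "cod_fun P = \<lparr>FDom = comma P, FCod = FCod P,
     FOb = (\<lambda>X \<in> comma_obj P. Cod (FCod P) (rgt X)), FAr = (\<lambda>p \<in> comma_arr P. carr_bot p)\<rparr>"

definition comma_map_ob :: "'a univ fnctr square \<Rightarrow> 'a univ \<Rightarrow> 'a univ" where
  "comma_map_ob s X = \<langle>FOb (sq_total s) (lft X), FAr (sq_base s) (rgt X)\<rangle>"

definition comma_map :: "'a univ fnctr square \<Rightarrow> 'a univ fnctr" where
  "comma_map s = \<lparr>FDom = comma (sq_src s), FCod = comma (sq_tgt s),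
     FOb = (\<lambda>X \<in> comma_obj (sq_src s). comma_map_ob s X),
     FAr = (\<lambda>p \<in> comma_arr (sq_src s).
       carr (comma_map_ob s (carr_src p)) (comma_map_ob s (carr_tgt p))
         (FAr (sq_total s) (carr_top p)) (FAr (sq_base s) (carr_bot p)))\<rparr>"

text \<open>The cardinal \<open>\<kappa>\<close> only selects the ambient 2-category; the values do not depend on it.\<close>

definition comma_cell :: "'k rel \<Rightarrow> ('a univ fnctr, 'a univ nattr) sqcell \<Rightarrow> 'a univ nattr" where
  "comma_cell \<kappa> \<theta> =
     (let s = src2 (CAT\<^sub>2 \<kappa>) \<theta>; t = tgt2 (CAT\<^sub>2 \<kappa>) \<theta>; P = sc_src \<theta> in
      \<lparr>NSrc = comma_map s, NTgt = comma_map t,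
       NAt = (\<lambda>X \<in> comma_obj P. carr (comma_map_ob s X) (comma_map_ob t X)
         (NAt (sc_total \<theta>) (lft X)) (NAt (sc_base \<theta>) (Cod (FCod P) (rgt X))))\<rparr>)"

definition comma_unit_fun :: "'a univ fnctr \<Rightarrow> 'a univ fnctr" where
  "comma_unit_fun P =
     (let H = (\<lambda>x. \<langle>x, Ide (FCod P) (FOb P x)\<rangle>) in
      \<lparr>FDom = FDom P, FCod = comma P,
       FOb = (\<lambda>x \<in> Obj (FDom P). H x),
       FAr = (\<lambda>f \<in> Arr (FDom P). carr (H (Dom (FDom P) f)) (H (Cod (FDom P) f)) f (FAr P f))\<rparr>)"

definition comma_mult_fun :: "'a univ fnctr \<Rightarrow> 'a univ fnctr" where
  "comma_mult_fun P =
     (let M = (\<lambda>Z. \<langle>lft (lft Z), rgt Z \<cdot>\<^bsub>FCod P\<^esub> rgt (lft Z)\<rangle>) in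
      \<lparr>FDom = comma (cod_fun P), FCod = comma P,
       FOb = (\<lambda>Z \<in> comma_obj (cod_fun P). M Z),
       FAr = (\<lambda>p \<in> comma_arr (cod_fun P).
         carr (M (carr_src p)) (M (carr_tgt p)) (carr_top (carr_top p)) (carr_bot p))\<rparr>)"

definition comma_monad :: "'k rel \<Rightarrow>
    ('a univ fnctr, 'a univ fnctr square, ('a univ fnctr, 'a univ nattr) sqcell) two_monad" where
  "comma_monad \<kappa> = \<lparr>
     F0 = cod_fun,
     F1 = (\<lambda>s. \<lparr>sq_src = cod_fun (sq_src s), sq_tgt = cod_fun (sq_tgt s),
                sq_total = comma_map s, sq_base = sq_base s\<rparr>),
     F2 = (\<lambda>\<theta>. \<lparr>sc_src = cod_fun (sc_src \<theta>), sc_tgt = cod_fun (sc_tgt \<theta>),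
                sc_total = comma_cell \<kappa> \<theta>, sc_base = sc_base \<theta>\<rparr>),
     unit = (\<lambda>P. \<lparr>sq_src = P, sq_tgt = cod_fun P,
                  sq_total = comma_unit_fun P, sq_base = fun_one (FCod P)\<rparr>),
     mult = (\<lambda>P. \<lparr>sq_src = cod_fun (cod_fun P), sq_tgt = cod_fun P,
                  sq_total = comma_mult_fun P, sq_base = fun_one (FCod P)\<rparr>)\<rparr>"

section \<open>Normally cloven cofibrations\<close>

definition cocartesian :: "'u fnctr \<Rightarrow> 'u \<Rightarrow> bool" where
  "cocartesian P e \<longleftrightarrow> e \<in> Arr (FDom P) \<and>
     (\<forall>g \<in> Arr (FDom P). \<forall>v \<in> Arr (FCod P).
        Dom (FDom P) g = Dom (FDom P) e \<longrightarrow>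
        v \<in> hom (FCod P) (FOb P (Cod (FDom P) e)) (FOb P (Cod (FDom P) g)) \<longrightarrow>
        FAr P g = v \<cdot>\<^bsub>FCod P\<^esub> FAr P e \<longrightarrow>
        (\<exists>!h. h \<in> hom (FDom P) (Cod (FDom P) e) (Cod (FDom P) g) \<and>
              h \<cdot>\<^bsub>FDom P\<^esub> e = g \<and> FAr P h = v))"

definition liftable :: "'u fnctr \<Rightarrow> 'u \<Rightarrow> 'u \<Rightarrow> bool" where
  "liftable P x u \<longleftrightarrow> x \<in> Obj (FDom P) \<and> u \<in> Arr (FCod P) \<and> Dom (FCod P) u = FOb P x"

definition normal_cleavage :: "'u fnctr \<Rightarrow> ('u \<Rightarrow> 'u \<Rightarrow> 'u) \<Rightarrow> bool" where
  "normal_cleavage P \<delta> \<longleftrightarrow>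
     (\<forall>x u. liftable P x u \<longrightarrow>
        cocartesian P (\<delta> x u) \<and> Dom (FDom P) (\<delta> x u) = x \<and> FAr P (\<delta> x u) = u) \<and>
     (\<forall>x u. \<not> liftable P x u \<longrightarrow> \<delta> x u = undefined) \<and>
     (\<forall>x \<in> Obj (FDom P). \<delta> x (Ide (FCod P) (FOb P x)) = Ide (FDom P) x)"

record 'u cofib =
  cf_fun :: "'u fnctr"
  cf_lift :: "'u \<Rightarrow> 'u \<Rightarrow> 'u"

record 'u cofmor =
  cm_src :: "'u cofib"
  cm_tgt :: "'u cofib"
  cm_sq :: "'u fnctr square"

record 'u cofcell =
  cc_src :: "'u cofib"
  cc_tgt :: "'u cofib"
  cc_cell :: "('u fnctr, 'u nattr) sqcell"

definition normally_cloven :: "'k rel \<Rightarrow> 'u cofib \<Rightarrow> bool" where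
  "normally_cloven \<kappa> X \<longleftrightarrow> cf_fun X \<in> Cell0 (CAT\<^sub>2 \<kappa>) \<and> normal_cleavage (cf_fun X) (cf_lift X)"

definition preserves_cocartesian :: "'u fnctr square \<Rightarrow> bool" where
  "preserves_cocartesian s \<longleftrightarrow>
     (\<forall>e. cocartesian (sq_src s) e \<longrightarrow> cocartesian (sq_tgt s) (FAr (sq_total s) e))"

definition preserves_lifts :: "'u cofib \<Rightarrow> 'u cofib \<Rightarrow> 'u fnctr square \<Rightarrow> bool" where
  "preserves_lifts X Y s \<longleftrightarrow>
     (\<forall>x u. liftable (cf_fun X) x u \<longrightarrow>
        FAr (sq_total s) (cf_lift X x u) = cf_lift Y (FOb (sq_total s) x) (FAr (sq_base s) u))"

definition cofmor_ok :: "'k rel \<Rightarrow> 'u cofmor \<Rightarrow> bool" where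
  "cofmor_ok \<kappa> m \<longleftrightarrow> normally_cloven \<kappa> (cm_src m) \<and> normally_cloven \<kappa> (cm_tgt m) \<and>
     cm_sq m \<in> hom1 (CAT\<^sub>2 \<kappa>) (cf_fun (cm_src m)) (cf_fun (cm_tgt m)) \<and>
     preserves_cocartesian (cm_sq m)"

definition cofcell_src :: "'k rel \<Rightarrow> 'u cofcell \<Rightarrow> 'u cofmor" where
  "cofcell_src \<kappa> c =
     \<lparr>cm_src = cc_src c, cm_tgt = cc_tgt c, cm_sq = src2 (CAT\<^sub>2 \<kappa>) (cc_cell c)\<rparr>"

definition cofcell_tgt :: "'k rel \<Rightarrow> 'u cofcell \<Rightarrow> 'u cofmor" where
  "cofcell_tgt \<kappa> c =
     \<lparr>cm_src = cc_src c, cm_tgt = cc_tgt c, cm_sq = tgt2 (CAT\<^sub>2 \<kappa>) (cc_cell c)\<rparr>"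

definition NClCoFib :: "'k rel \<Rightarrow> ('u cofib, 'u cofmor, 'u cofcell) two_cat" where
  "NClCoFib \<kappa> = \<lparr>
     Cell0 = {X. normally_cloven \<kappa> X},
     Cell1 = {m. cofmor_ok \<kappa> m},
     Cell2 = {c. cc_cell c \<in> Cell2 (CAT\<^sub>2 \<kappa>) \<and>
                 cofmor_ok \<kappa> (cofcell_src \<kappa> c) \<and> cofmor_ok \<kappa> (cofcell_tgt \<kappa> c)},
     src1 = cm_src, tgt1 = cm_tgt, src2 = cofcell_src \<kappa>, tgt2 = cofcell_tgt \<kappa>,
     one1 = (\<lambda>X. \<lparr>cm_src = X, cm_tgt = X, cm_sq = one1 (CAT\<^sub>2 \<kappa>) (cf_fun X)\<rparr>),
     one2 = (\<lambda>m. \<lparr>cc_src = cm_src m, cc_tgt = cm_tgt m, cc_cell = one2 (CAT\<^sub>2 \<kappa>) (cm_sq m)\<rparr>),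
     comp1 = (\<lambda>n m. \<lparr>cm_src = cm_src m, cm_tgt = cm_tgt n,
                    cm_sq = cm_sq n \<odot>\<^bsub>CAT\<^sub>2 \<kappa>\<^esub> cm_sq m\<rparr>),
     vcomp = (\<lambda>d c. \<lparr>cc_src = cc_src c, cc_tgt = cc_tgt c,
                    cc_cell = cc_cell d \<bullet>\<^bsub>CAT\<^sub>2 \<kappa>\<^esub> cc_cell c\<rparr>),
     hcomp = (\<lambda>d c. \<lparr>cc_src = cc_src c, cc_tgt = cc_tgt d,
                    cc_cell = cc_cell d \<star>\<^bsub>CAT\<^sub>2 \<kappa>\<^esub> cc_cell c\<rparr>)\<rparr>"

definition NClCoFib_forget ::
    "('u cofib, 'u cofmor, 'u cofcell, 'u fnctr, 'u fnctr square, ('u fnctr, 'u nattr) sqcell) two_fun" where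
  "NClCoFib_forget = \<lparr>F0 = cf_fun, F1 = cm_sq, F2 = cc_cell\<rparr>"

section \<open>Action and compositor of a cloven cofibration\<close>

definition push :: "'u cofib \<Rightarrow> 'u \<Rightarrow> 'u \<Rightarrow> 'u" where
  "push X u x = Cod (FDom (cf_fun X)) (cf_lift X x u)"

definition vertical :: "'u fnctr \<Rightarrow> 'u \<Rightarrow> bool" where
  "vertical P h \<longleftrightarrow> h \<in> Arr (FDom P) \<and> (\<exists>b \<in> Obj (FCod P). FAr P h = Ide (FCod P) b)"

definition iso :: "'u cat \<Rightarrow> 'u \<Rightarrow> bool" where
  "iso C h \<longleftrightarrow> h \<in> Arr C \<and> (\<exists>k \<in> hom C (Cod C h) (Dom C h).
     k \<cdot>\<^bsub>C\<^esub> h = Ide C (Dom C h) \<and> h \<cdot>\<^bsub>C\<^esub> k = Ide C (Cod C h))"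

definition action_fun :: "'a univ cofib \<Rightarrow> 'a univ fnctr" where
  "action_fun X =
     (let P = cf_fun X; E = FDom P; \<delta> = cf_lift X in
      THE L. is_functor L \<and> FDom L = comma P \<and> FCod L = E \<and>
        (\<forall>x u. \<langle>x, u\<rangle> \<in> comma_obj P \<longrightarrow> FOb L \<langle>x, u\<rangle> = push X u x) \<and>
        fun_comp P L = cod_fun P \<and>
        (\<forall>x u y w f v. carr \<langle>x, u\<rangle> \<langle>y, w\<rangle> f v \<in> comma_arr P \<longrightarrow>
           FAr L (carr \<langle>x, u\<rangle> \<langle>y, w\<rangle> f v) \<cdot>\<^bsub>E\<^esub> \<delta> x u = \<delta> y w \<cdot>\<^bsub>E\<^esub> f))"

definition action :: "'a univ cofib \<Rightarrow> 'a univ fnctr square" where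
  "action X = \<lparr>sq_src = cod_fun (cf_fun X), sq_tgt = cf_fun X,
     sq_total = action_fun X, sq_base = fun_one (FCod (cf_fun X))\<rparr>"

definition compositor :: "'u cofib \<Rightarrow> 'u \<Rightarrow> 'u \<Rightarrow> 'u \<Rightarrow> 'u" where
  "compositor X v u x =
     (let P = cf_fun X; E = FDom P; B = FCod P; \<delta> = cf_lift X in
      THE h. h \<in> hom E (push X v (push X u x)) (push X (v \<cdot>\<^bsub>B\<^esub> u) x) \<and>
        vertical P h \<and> iso E h \<and>
        h \<cdot>\<^bsub>E\<^esub> (\<delta> (push X u x) v \<cdot>\<^bsub>E\<^esub> \<delta> x u) = \<delta> x (v \<cdot>\<^bsub>B\<^esub> u))"

definition compositor_cell :: "'k rel \<Rightarrow> 'a univ cofib \<Rightarrow> ('a univ fnctr, 'a univ nattr) sqcell" where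
  "compositor_cell \<kappa> X =
     (let P = cf_fun X in
      \<lparr>sc_src = cod_fun (cod_fun P), sc_tgt = P,
       sc_total = \<lparr>NSrc = fun_comp (action_fun X) (comma_map (action X)),
                   NTgt = fun_comp (action_fun X) (comma_mult_fun P),
                   NAt = (\<lambda>Z \<in> comma_obj (cod_fun P). compositor X (rgt Z) (rgt (lft Z)) (lft (lft Z)))\<rparr>,
       sc_base = one2 (CAT \<kappa>) (fun_one (FCod P))\<rparr>)"

definition assoc_pseudoalgebra :: "'k rel \<Rightarrow> 'a univ cofib \<Rightarrow>
    ('a univ fnctr, 'a univ fnctr square, ('a univ fnctr, 'a univ nattr) sqcell) psalg" where
  "assoc_pseudoalgebra \<kappa> X = \<lparr>pa_obj = cf_fun X, pa_act = action X,
     pa_iota = one2 (CAT\<^sub>2 \<kappa>) (one1 (CAT\<^sub>2 \<kappa>) (cf_fun X)),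
     pa_chi = compositor_cell \<kappa> X\<rparr>"

end

theory Submission
  imports Defs
begin

text \<open>
  A cleavage and the action of its algebra determine each other: the lift \<open>\<delta>\<^sub>u : x \<rightarrow> u\<^sub>!x\<close> is the
  image under \<open>L\<close> of the arrow \<open>(1\<^sub>x, u) : (x, 1) \<rightarrow> (x, u)\<close>. For a normal pseudoalgebra this image
  is cocartesian: the filler for \<open>(g, v)\<close> is read off from \<open>L(g, v)\<close>, and it is unique because the unit
  laws for \<open>\<chi>\<close> give \<open>L(\<delta>\<^sub>u, 1) = 1\<close>. Likewise the cell \<open>\<phi>\<close> of a pseudomorphism \<open>(T, S)\<close> is vertical, and
  naturality at \<open>(1\<^sub>x, u)\<close> with the unit law gives \<open>\<phi> \<delta>\<^sub>S\<^sub>u = T \<delta>\<^sub>u\<close>; hence \<open>\<phi>\<close> is determined by \<open>(T, S)\<close>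
  and is invertible exactly if \<open>T\<close> preserves cocartesian arrows. By the same cancellation every
  2-cell between pseudomorphisms is an algebra transformation. So both 2-categories are faithful on 1-cells and
  fully faithful on 2-cells over \<open>CAT\<^sup>2\<close>, from which they inherit all equations.
\<close>

text \<open>Uniqueness of fillers carries the argument. Compositors, comparison cells and the
  isomorphism between a cocartesian arrow and the designated lift with the same source and image are
  instances of one fact (\<open>cocartesian_iso\<close>), and coherence equations are tested after
  composition with a cocartesian composite of lifts. The law L(\<delta>_u, 1) = 1 comes from
  naturality of \<chi> at the arrow ((x, 1), u) -> ((x, u), 1) with components (1, u) and 1: each
  unit law covers one end, and the multiplication sends this arrow to an identity.

  The obstacle is strictness. The two sides of an axiom have equal boundaries only through
  naturality and the monad laws, while extensionality of 2-cells asks for equal boundaries first. So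
  boundaries are computed once over an arbitrary strict 2-monad, and only components are computed in
  \<open>CAT\<^sub>2\<close>. Equality of cleavages is literal, so lifts are
  \<open>undefined\<close> off the liftable pairs. Infinity of \<kappa> bounds the hom-sets of a
  comma category, which embed into products of two hom-sets.\<close>

lemma in_hom [simp]: "f \<in> hom C x y \<longleftrightarrow> f \<in> Arr C \<and> Dom C f = x \<and> Cod C f = y"
  by (simp add: hom_def)

lemma in_hom1 [simp]: "f \<in> hom1 K x y \<longleftrightarrow> f \<in> Cell1 K \<and> src1 K f = x \<and> tgt1 K f = y"
  by (simp add: hom1_def)

lemma in_hom2 [simp]: "\<alpha> \<in> hom2 K f g \<longleftrightarrow> \<alpha> \<in> Cell2 K \<and> src2 K \<alpha> = f \<and> tgt2 K \<alpha> = g"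
  by (simp add: hom2_def)

section \<open>Categories, functors and natural transformations: computation rules and
  extensionality\<close>

context category
begin

lemma Dom_Obj [simp]: "f \<in> Arr C \<Longrightarrow> Dom C f \<in> Obj C"
  using Dom_in by (auto simp: PiE_def)

lemma Cod_Obj [simp]: "f \<in> Arr C \<Longrightarrow> Cod C f \<in> Obj C"
  using Cod_in by (auto simp: PiE_def)

lemma Ide_Arr [simp]:
  assumes "x \<in> Obj C"
  shows "Ide C x \<in> Arr C" "Dom C (Ide C x) = x" "Cod C (Ide C x) = x"
  using Ide_in[OF assms] by auto

lemma Comp_Arr [simp]:
  assumes "f \<in> Arr C" "g \<in> Arr C" "Cod C f = Dom C g"
  shows "g \<cdot> f \<in> Arr C" "Dom C (g \<cdot> f) = Dom C f" "Cod C (g \<cdot> f) = Cod C g"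
  using Comp_in[OF assms] by auto

lemma Comp_Ide_right [simp]: "f \<in> Arr C \<Longrightarrow> Dom C f = x \<Longrightarrow> f \<cdot> Ide C x = f"
  using Comp_Ide by auto

lemma Comp_Ide_left [simp]: "f \<in> Arr C \<Longrightarrow> Cod C f = x \<Longrightarrow> Ide C x \<cdot> f = f"
  using Ide_Comp by auto

lemma Comp_assoc_right [simp]:
  "\<lbrakk>f \<in> Arr C; g \<in> Arr C; h \<in> Arr C; Cod C f = Dom C g; Cod C g = Dom C h\<rbrakk> \<Longrightarrow>
    (h \<cdot> g) \<cdot> f = h \<cdot> (g \<cdot> f)"
  using Comp_assoc by simp

text \<open>Since composites are normalised to the right, an equation for \<open>g \<cdot> f\<close>
  no longer matches inside \<open>g \<cdot> (f \<cdot> h)\<close>. This form rewrites there; it is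
  how naturality squares and lift equations are applied in the middle of a longer composite.\<close>

lemma Comp_reassoc:
  "\<lbrakk>g \<cdot> f = k; f \<in> Arr C; g \<in> Arr C; h \<in> Arr C; Cod C h = Dom C f; Cod C f = Dom C g\<rbrakk> \<Longrightarrow>
    g \<cdot> (f \<cdot> h) = k \<cdot> h"
  by (metis Comp_assoc)

end

text \<open>The categories are parameters although the record already stores them: the projections
  \<open>FDom F\<close> and \<open>FCod F\<close> then simplify to variables, and composable
  functors visibly share a category.\<close>

locale cat_functor =
  fixes F :: "'u fnctr" and A B :: "'u cat"
  assumes is_functor: "is_functor F" and FDom_eq [simp]: "FDom F = A" and FCod_eq [simp]: "FCod F = B"

sublocale cat_functor \<subseteq> A: category A
  using is_functor.axioms(1)[OF is_functor] by simp

sublocale cat_functor \<subseteq> B: category B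
  using is_functor.axioms(2)[OF is_functor] by simp

context cat_functor
begin

lemma FOb_Obj [simp]: "x \<in> Obj A \<Longrightarrow> FOb F x \<in> Obj B"
  using is_functor.FOb_in[OF is_functor] by auto

lemma FOb_ext: "FOb F \<in> extensional (Obj A)"
  using is_functor.FOb_in[OF is_functor] by (auto simp: PiE_def)

lemma FAr_ext: "FAr F \<in> extensional (Arr A)"
  using is_functor.FAr_ext[OF is_functor] by simp

lemma FAr_Arr [simp]:
  assumes "f \<in> Arr A"
  shows "FAr F f \<in> Arr B" "Dom B (FAr F f) = FOb F (Dom A f)" "Cod B (FAr F f) = FOb F (Cod A f)"
  using is_functor.FAr_in[OF is_functor, of f] assms by auto

lemma FAr_Ide [simp]: "x \<in> Obj A \<Longrightarrow> FAr F (Ide A x) = Ide B (FOb F x)"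
  using is_functor.FAr_Ide[OF is_functor] by simp

lemma FAr_Comp [simp]:
  "\<lbrakk>f \<in> Arr A; g \<in> Arr A; Cod A f = Dom A g\<rbrakk> \<Longrightarrow>
    FAr F (g \<cdot>\<^bsub>A\<^esub> f) = FAr F g \<cdot>\<^bsub>B\<^esub> FAr F f"
  using is_functor.FAr_Comp[OF is_functor] by simp

end

lemma cat_functorI:
  assumes "category A" "category B" "FDom F = A" "FCod F = B"
    and "FOb F \<in> extensional (Obj A)" "FAr F \<in> extensional (Arr A)"
    and "\<And>x. x \<in> Obj A \<Longrightarrow> FOb F x \<in> Obj B"
    and "\<And>f. f \<in> Arr A \<Longrightarrow> FAr F f \<in> hom B (FOb F (Dom A f)) (FOb F (Cod A f))"
    and "\<And>x. x \<in> Obj A \<Longrightarrow> FAr F (Ide A x) = Ide B (FOb F x)"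
    and "\<And>f g. \<lbrakk>f \<in> Arr A; g \<in> Arr A; Cod A f = Dom A g\<rbrakk> \<Longrightarrow>
      FAr F (g \<cdot>\<^bsub>A\<^esub> f) = FAr F g \<cdot>\<^bsub>B\<^esub> FAr F f"
  shows "cat_functor F A B"
  using assms by (auto simp: cat_functor_def is_functor_def is_functor_axioms_def PiE_def)

text \<open>Both maps of a functor are \<open>undefined\<close> off the carriers, so agreement on
  objects and arrows already gives equality of the records.\<close>

lemma cat_functor_eqI:
  assumes "cat_functor F A B" "cat_functor G A B"
    and "\<And>x. x \<in> Obj A \<Longrightarrow> FOb F x = FOb G x"
    and "\<And>f. f \<in> Arr A \<Longrightarrow> FAr F f = FAr G f"
  shows "F = G"
proof -
  interpret F: cat_functor F A B by fact
  interpret G: cat_functor G A B by fact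
  have "FOb F = FOb G" by (rule extensionalityI[OF F.FOb_ext G.FOb_ext]) (rule assms(3))
  moreover have "FAr F = FAr G" by (rule extensionalityI[OF F.FAr_ext G.FAr_ext]) (rule assms(4))
  ultimately show ?thesis by (intro fnctr.equality) simp_all
qed

lemma fun_one_sel [simp]:
  "FDom (fun_one C) = C" "FCod (fun_one C) = C"
  "x \<in> Obj C \<Longrightarrow> FOb (fun_one C) x = x" "f \<in> Arr C \<Longrightarrow> FAr (fun_one C) f = f"
  by (simp_all add: fun_one_def)

lemma fun_comp_sel [simp]:
  "FDom (fun_comp G F) = FDom F" "FCod (fun_comp G F) = FCod G"
  "x \<in> Obj (FDom F) \<Longrightarrow> FOb (fun_comp G F) x = FOb G (FOb F x)"
  "f \<in> Arr (FDom F) \<Longrightarrow> FAr (fun_comp G F) f = FAr G (FAr F f)"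
  by (simp_all add: fun_comp_def compose_def)

lemma cat_functor_one:
  assumes "category C" shows "cat_functor (fun_one C) C C"
proof -
  interpret category C by fact
  show ?thesis
    by (rule cat_functorI[OF assms assms]) (simp_all, simp_all add: fun_one_def)
qed

lemma cat_functor_comp:
  assumes "cat_functor F A B" "cat_functor G B C"
  shows "cat_functor (fun_comp G F) A C"
proof -
  interpret F: cat_functor F A B by fact
  interpret G: cat_functor G B C by fact
  show ?thesis
    by (rule cat_functorI[OF F.A.category_axioms G.B.category_axioms])
      (simp_all, simp_all add: fun_comp_def compose_def)
qed

locale cat_nattr =
  fixes \<alpha> :: "'u nattr" and F G :: "'u fnctr" and A B :: "'u cat"
  assumes is_nattr: "is_nattr \<alpha>" and NSrc_eq [simp]: "NSrc \<alpha> = F" and NTgt_eq [simp]: "NTgt \<alpha> = G"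
    and FDom_src: "FDom F = A" and FCod_src: "FCod F = B"

sublocale cat_nattr \<subseteq> F: cat_functor F A B
  using is_nattr.axioms(1)[OF is_nattr] FDom_src FCod_src by (simp add: cat_functor_def)

sublocale cat_nattr \<subseteq> G: cat_functor G A B
  using is_nattr.axioms(2)[OF is_nattr] is_nattr.same_dom[OF is_nattr] is_nattr.same_cod[OF is_nattr]
  by (simp add: cat_functor_def)

context cat_nattr
begin

lemma NAt_ext: "NAt \<alpha> \<in> extensional (Obj A)"
  using is_nattr.NAt_ext[OF is_nattr] by simp

lemma NAt_Arr [simp]:
  assumes "x \<in> Obj A"
  shows "NAt \<alpha> x \<in> Arr B" "Dom B (NAt \<alpha> x) = FOb F x" "Cod B (NAt \<alpha> x) = FOb G x"
  using is_nattr.NAt_in[OF is_nattr, of x] assms by auto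

lemma natural:
  "f \<in> Arr A \<Longrightarrow>
    NAt \<alpha> (Cod A f) \<cdot>\<^bsub>B\<^esub> FAr F f = FAr G f \<cdot>\<^bsub>B\<^esub> NAt \<alpha> (Dom A f)"
  using is_nattr.natural[OF is_nattr, of f] by simp

end

lemma cat_nattrI:
  assumes "cat_functor F A B" "cat_functor G A B" "NSrc \<alpha> = F" "NTgt \<alpha> = G"
    and "NAt \<alpha> \<in> extensional (Obj A)"
    and "\<And>x. x \<in> Obj A \<Longrightarrow> NAt \<alpha> x \<in> hom B (FOb F x) (FOb G x)"
    and "\<And>f. f \<in> Arr A \<Longrightarrow>
      NAt \<alpha> (Cod A f) \<cdot>\<^bsub>B\<^esub> FAr F f = FAr G f \<cdot>\<^bsub>B\<^esub> NAt \<alpha> (Dom A f)"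
  shows "cat_nattr \<alpha> F G A B"
  using assms by (auto simp: cat_nattr_def is_nattr_def is_nattr_axioms_def cat_functor_def)

text \<open>Reduces an equation of 2-cells to components, provided that both sides are known to have
  the same boundary functors. Establishing this proviso is often the larger part of the
  work.\<close>

lemma cat_nattr_eqI:
  assumes "cat_nattr \<alpha> F G A B" "cat_nattr \<beta> F G A B"
    and "\<And>x. x \<in> Obj A \<Longrightarrow> NAt \<alpha> x = NAt \<beta> x"
  shows "\<alpha> = \<beta>"
proof -
  interpret \<alpha>: cat_nattr \<alpha> F G A B by fact
  interpret \<beta>: cat_nattr \<beta> F G A B by fact
  have "NAt \<alpha> = NAt \<beta>" by (rule extensionalityI[OF \<alpha>.NAt_ext \<beta>.NAt_ext]) (rule assms(3))
  then show ?thesis by (intro nattr.equality) simp_all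
qed

section \<open>The 2-category of categories\<close>

lemma CAT_sel [simp]:
  "src1 (CAT \<kappa>) = FDom" "tgt1 (CAT \<kappa>) = FCod" "src2 (CAT \<kappa>) = NSrc" "tgt2 (CAT \<kappa>) = NTgt"
  "one1 (CAT \<kappa>) = fun_one" "comp1 (CAT \<kappa>) = fun_comp"
  by (simp_all add: CAT_def)

lemma Cell0_CAT [simp]: "C \<in> Cell0 (CAT \<kappa>) \<longleftrightarrow> category C \<and> locally_small \<kappa> C"
  by (simp add: CAT_def)

lemma Cell1_CAT:
  "F \<in> Cell1 (CAT \<kappa>) \<longleftrightarrow> cat_functor F (FDom F) (FCod F) \<and> locally_small \<kappa> (FDom F) \<and> locally_small \<kappa> (FCod F)"
  by (simp add: CAT_def cat_functor_def)

lemma Cell2_CAT: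
  "\<alpha> \<in> Cell2 (CAT \<kappa>) \<longleftrightarrow> cat_nattr \<alpha> (NSrc \<alpha>) (NTgt \<alpha>) (FDom (NSrc \<alpha>)) (FCod (NSrc \<alpha>)) \<and>
    locally_small \<kappa> (FDom (NSrc \<alpha>)) \<and> locally_small \<kappa> (FCod (NSrc \<alpha>))"
  by (simp add: CAT_def cat_nattr_def)

lemma Cell1_CAT_I:
  "\<lbrakk>cat_functor F A B; locally_small \<kappa> A; locally_small \<kappa> B\<rbrakk> \<Longrightarrow> F \<in> Cell1 (CAT \<kappa>)"
  by (auto simp: Cell1_CAT cat_functor_def)

lemma Cell2_CAT_I:
  "\<lbrakk>cat_nattr \<alpha> F G A B; locally_small \<kappa> A; locally_small \<kappa> B\<rbrakk> \<Longrightarrow> \<alpha> \<in> Cell2 (CAT \<kappa>)"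
  by (auto simp: Cell2_CAT cat_nattr_def)

lemma one2_CAT_sel [simp]:
  "NSrc (one2 (CAT \<kappa>) F) = F" "NTgt (one2 (CAT \<kappa>) F) = F"
  "x \<in> Obj (FDom F) \<Longrightarrow> NAt (one2 (CAT \<kappa>) F) x = Ide (FCod F) (FOb F x)"
  by (simp_all add: CAT_def)

lemma vcomp_CAT_sel [simp]:
  "NSrc (\<beta> \<bullet>\<^bsub>CAT \<kappa>\<^esub> \<alpha>) = NSrc \<alpha>" "NTgt (\<beta> \<bullet>\<^bsub>CAT \<kappa>\<^esub> \<alpha>) = NTgt \<beta>"
  "x \<in> Obj (FDom (NSrc \<alpha>)) \<Longrightarrow>
    NAt (\<beta> \<bullet>\<^bsub>CAT \<kappa>\<^esub> \<alpha>) x = NAt \<beta> x \<cdot>\<^bsub>FCod (NSrc \<alpha>)\<^esub> NAt \<alpha> x"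
  by (simp_all add: CAT_def)

lemma hcomp_CAT_sel [simp]:
  "NSrc (\<beta> \<star>\<^bsub>CAT \<kappa>\<^esub> \<alpha>) = fun_comp (NSrc \<beta>) (NSrc \<alpha>)"
  "NTgt (\<beta> \<star>\<^bsub>CAT \<kappa>\<^esub> \<alpha>) = fun_comp (NTgt \<beta>) (NTgt \<alpha>)"
  "x \<in> Obj (FDom (NSrc \<alpha>)) \<Longrightarrow>
    NAt (\<beta> \<star>\<^bsub>CAT \<kappa>\<^esub> \<alpha>) x =
      NAt \<beta> (FOb (NTgt \<alpha>) x) \<cdot>\<^bsub>FCod (NSrc \<beta>)\<^esub> FAr (NSrc \<beta>) (NAt \<alpha> x)"
  by (simp_all add: CAT_def)

lemma cat_nattr_one2:
  assumes "cat_functor F A B"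
  shows "cat_nattr (one2 (CAT \<kappa>) F) F F A B"
proof -
  interpret cat_functor F A B by fact
  show ?thesis
    by (rule cat_nattrI[OF assms assms]) (simp_all, simp_all add: CAT_def)
qed

lemma cat_nattr_vcomp:
  assumes "cat_nattr \<alpha> F G A B" "cat_nattr \<beta> G H A B"
  shows "cat_nattr (\<beta> \<bullet>\<^bsub>CAT \<kappa>\<^esub> \<alpha>) F H A B"
proof -
  interpret \<alpha>: cat_nattr \<alpha> F G A B by fact
  interpret \<beta>: cat_nattr \<beta> G H A B by fact
  have "NAt \<beta> (Cod A f) \<cdot>\<^bsub>B\<^esub> (NAt \<alpha> (Cod A f) \<cdot>\<^bsub>B\<^esub> FAr F f)
      = FAr H f \<cdot>\<^bsub>B\<^esub> (NAt \<beta> (Dom A f) \<cdot>\<^bsub>B\<^esub> NAt \<alpha> (Dom A f))"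
    if "f \<in> Arr A" for f
    using that \<alpha>.natural[OF that] \<alpha>.F.B.Comp_reassoc[OF \<beta>.natural[OF that]] by simp
  then show ?thesis
    by (intro cat_nattrI[OF \<alpha>.F.cat_functor_axioms \<beta>.G.cat_functor_axioms])
      (simp_all, simp_all add: CAT_def)
qed

text \<open>The naturality square is pasted from two: the image under H of the square of \<alpha>,
  and the square of \<beta> at the arrow \<open>FAr G f\<close>.\<close>

lemma cat_nattr_hcomp:
  assumes "cat_nattr \<alpha> F G A B" "cat_nattr \<beta> H J B C"
  shows "cat_nattr (\<beta> \<star>\<^bsub>CAT \<kappa>\<^esub> \<alpha>) (fun_comp H F) (fun_comp J G) A C"
proof -
  interpret \<alpha>: cat_nattr \<alpha> F G A B by fact
  interpret \<beta>: cat_nattr \<beta> H J B C by fact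
  have "NAt \<beta> (FOb G (Cod A f)) \<cdot>\<^bsub>C\<^esub> (FAr H (NAt \<alpha> (Cod A f)) \<cdot>\<^bsub>C\<^esub> FAr H (FAr F f))
     = FAr J (FAr G f) \<cdot>\<^bsub>C\<^esub> (NAt \<beta> (FOb G (Dom A f)) \<cdot>\<^bsub>C\<^esub> FAr H (NAt \<alpha> (Dom A f)))"
    if f: "f \<in> Arr A" for f
  proof -
    have "FAr H (NAt \<alpha> (Cod A f)) \<cdot>\<^bsub>C\<^esub> FAr H (FAr F f)
      = FAr H (NAt \<alpha> (Cod A f) \<cdot>\<^bsub>B\<^esub> FAr F f)" using f by simp
    also have "\<dots> = FAr H (FAr G f) \<cdot>\<^bsub>C\<^esub> FAr H (NAt \<alpha> (Dom A f))"
      using f by (simp only: \<alpha>.natural) simp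
    finally show ?thesis
      using f \<beta>.F.B.Comp_reassoc[OF \<beta>.natural[of "FAr G f"]] by simp
  qed
  then show ?thesis
    using cat_functor_comp[OF \<alpha>.F.cat_functor_axioms \<beta>.F.cat_functor_axioms]
      cat_functor_comp[OF \<alpha>.G.cat_functor_axioms \<beta>.G.cat_functor_axioms]
    by (intro cat_nattrI) (simp_all, simp_all add: CAT_def)
qed


lemma fun_comp_assoc:
  assumes "cat_functor F A B" "cat_functor G B C" "cat_functor H C D"
  shows "fun_comp H (fun_comp G F) = fun_comp (fun_comp H G) F"
proof -
  interpret F: cat_functor F A B by fact
  interpret G: cat_functor G B C by fact
  show ?thesis
    by (rule cat_functor_eqI[OF cat_functor_comp[OF cat_functor_comp[OF assms(1,2)] assms(3)]
      cat_functor_comp[OF assms(1) cat_functor_comp[OF assms(2,3)]]]) simp_all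
qed

lemma fun_comp_one:
  assumes "cat_functor F A B"
  shows "fun_comp F (fun_one A) = F" "fun_comp (fun_one B) F = F"
proof -
  interpret cat_functor F A B by fact
  show "fun_comp F (fun_one A) = F"
    by (rule cat_functor_eqI[OF cat_functor_comp[OF cat_functor_one[OF A.category_axioms] assms] assms])
      simp_all
  show "fun_comp (fun_one B) F = F"
    by (rule cat_functor_eqI[OF cat_functor_comp[OF assms cat_functor_one[OF B.category_axioms]] assms])
      simp_all
qed

lemma CAT_vcomp_one:
  assumes "cat_nattr \<alpha> F G A B"
  shows "\<alpha> \<bullet>\<^bsub>CAT \<kappa>\<^esub> one2 (CAT \<kappa>) F = \<alpha>" "one2 (CAT \<kappa>) G \<bullet>\<^bsub>CAT \<kappa>\<^esub> \<alpha> = \<alpha>"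
proof -
  interpret cat_nattr \<alpha> F G A B by fact
  show "\<alpha> \<bullet>\<^bsub>CAT \<kappa>\<^esub> one2 (CAT \<kappa>) F = \<alpha>"
    by (rule cat_nattr_eqI[OF cat_nattr_vcomp[OF cat_nattr_one2[OF F.cat_functor_axioms] assms] assms])
      simp
  show "one2 (CAT \<kappa>) G \<bullet>\<^bsub>CAT \<kappa>\<^esub> \<alpha> = \<alpha>"
    by (rule cat_nattr_eqI[OF cat_nattr_vcomp[OF assms cat_nattr_one2[OF G.cat_functor_axioms]] assms])
      simp
qed

lemma CAT_vcomp_assoc:
  assumes "cat_nattr \<alpha> F G A B" "cat_nattr \<beta> G H A B" "cat_nattr \<gamma> H J A B"
  shows "\<gamma> \<bullet>\<^bsub>CAT \<kappa>\<^esub> (\<beta> \<bullet>\<^bsub>CAT \<kappa>\<^esub> \<alpha>) = (\<gamma> \<bullet>\<^bsub>CAT \<kappa>\<^esub> \<beta>) \<bullet>\<^bsub>CAT \<kappa>\<^esub> \<alpha>"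
proof -
  interpret \<alpha>: cat_nattr \<alpha> F G A B by fact
  interpret \<beta>: cat_nattr \<beta> G H A B by fact
  interpret \<gamma>: cat_nattr \<gamma> H J A B by fact
  show ?thesis
    by (rule cat_nattr_eqI[OF cat_nattr_vcomp[OF cat_nattr_vcomp[OF assms(1,2)] assms(3)]
      cat_nattr_vcomp[OF assms(1) cat_nattr_vcomp[OF assms(2,3)]]]) simp
qed

lemma CAT_hcomp_one:
  assumes "cat_nattr \<alpha> F G A B"
  shows "\<alpha> \<star>\<^bsub>CAT \<kappa>\<^esub> one2 (CAT \<kappa>) (fun_one A) = \<alpha>"
    "one2 (CAT \<kappa>) (fun_one B) \<star>\<^bsub>CAT \<kappa>\<^esub> \<alpha> = \<alpha>"
proof -
  interpret cat_nattr \<alpha> F G A B by fact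
  \<comment> \<open>As it stands the boundary consists of composites with an identity functor; these
    are rewritten to F and G so that components can be compared.\<close>
  have "cat_nattr (\<alpha> \<star>\<^bsub>CAT \<kappa>\<^esub> one2 (CAT \<kappa>) (fun_one A)) F G A B"
    using cat_nattr_hcomp[OF cat_nattr_one2[OF cat_functor_one[OF F.A.category_axioms]] assms]
    by (simp add: fun_comp_one[OF F.cat_functor_axioms] fun_comp_one[OF G.cat_functor_axioms])
  then show "\<alpha> \<star>\<^bsub>CAT \<kappa>\<^esub> one2 (CAT \<kappa>) (fun_one A) = \<alpha>"
    by (rule cat_nattr_eqI[OF _ assms]) simp
  have "cat_nattr (one2 (CAT \<kappa>) (fun_one B) \<star>\<^bsub>CAT \<kappa>\<^esub> \<alpha>) F G A B"
    using cat_nattr_hcomp[OF assms cat_nattr_one2[OF cat_functor_one[OF F.B.category_axioms]]]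
    by (simp add: fun_comp_one[OF F.cat_functor_axioms] fun_comp_one[OF G.cat_functor_axioms])
  then show "one2 (CAT \<kappa>) (fun_one B) \<star>\<^bsub>CAT \<kappa>\<^esub> \<alpha> = \<alpha>"
    by (rule cat_nattr_eqI[OF _ assms]) simp
qed

lemma CAT_hcomp_assoc:
  assumes \<alpha>: "cat_nattr \<alpha> F F' A B" and \<beta>: "cat_nattr \<beta> G G' B C" and \<gamma>: "cat_nattr \<gamma> H H' C D"
  shows "\<gamma> \<star>\<^bsub>CAT \<kappa>\<^esub> (\<beta> \<star>\<^bsub>CAT \<kappa>\<^esub> \<alpha>) = (\<gamma> \<star>\<^bsub>CAT \<kappa>\<^esub> \<beta>) \<star>\<^bsub>CAT \<kappa>\<^esub> \<alpha>"
proof -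
  interpret \<alpha>: cat_nattr \<alpha> F F' A B by fact
  interpret \<beta>: cat_nattr \<beta> G G' B C by fact
  interpret \<gamma>: cat_nattr \<gamma> H H' C D by fact
  have "cat_nattr (\<gamma> \<star>\<^bsub>CAT \<kappa>\<^esub> (\<beta> \<star>\<^bsub>CAT \<kappa>\<^esub> \<alpha>)) (fun_comp (fun_comp H G) F)
    (fun_comp (fun_comp H' G') F') A D"
    using cat_nattr_hcomp[OF cat_nattr_hcomp[OF \<alpha> \<beta>] \<gamma>]
    by (simp add:
        fun_comp_assoc[OF \<alpha>.F.cat_functor_axioms \<beta>.F.cat_functor_axioms \<gamma>.F.cat_functor_axioms]
        fun_comp_assoc[OF \<alpha>.G.cat_functor_axioms \<beta>.G.cat_functor_axioms \<gamma>.G.cat_functor_axioms])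
  then show ?thesis
    by (rule cat_nattr_eqI[OF _ cat_nattr_hcomp[OF \<alpha> cat_nattr_hcomp[OF \<beta> \<gamma>]]]) simp
qed

lemma CAT_hcomp_one2:
  assumes "cat_functor F A B" "cat_functor G B C"
  shows "one2 (CAT \<kappa>) G \<star>\<^bsub>CAT \<kappa>\<^esub> one2 (CAT \<kappa>) F = one2 (CAT \<kappa>) (fun_comp G F)"
proof -
  interpret F: cat_functor F A B by fact
  interpret G: cat_functor G B C by fact
  show ?thesis
    by (rule cat_nattr_eqI[OF cat_nattr_hcomp[OF cat_nattr_one2[OF assms(1)] cat_nattr_one2[OF assms(2)]]
      cat_nattr_one2[OF cat_functor_comp[OF assms]]]) simp
qed

lemma CAT_interchange:
  assumes \<alpha>: "cat_nattr \<alpha> F F' A B" and \<alpha>': "cat_nattr \<alpha>' F' F'' A B"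
    and \<beta>: "cat_nattr \<beta> G G' B C" and \<beta>': "cat_nattr \<beta>' G' G'' B C"
  shows "(\<beta>' \<bullet>\<^bsub>CAT \<kappa>\<^esub> \<beta>) \<star>\<^bsub>CAT \<kappa>\<^esub> (\<alpha>' \<bullet>\<^bsub>CAT \<kappa>\<^esub> \<alpha>) =
    (\<beta>' \<star>\<^bsub>CAT \<kappa>\<^esub> \<alpha>') \<bullet>\<^bsub>CAT \<kappa>\<^esub> (\<beta> \<star>\<^bsub>CAT \<kappa>\<^esub> \<alpha>)"
proof -
  interpret \<alpha>: cat_nattr \<alpha> F F' A B by fact
  interpret \<alpha>': cat_nattr \<alpha>' F' F'' A B by fact
  interpret \<beta>: cat_nattr \<beta> G G' B C by fact
  interpret \<beta>': cat_nattr \<beta>' G' G'' B C by fact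
  \<comment> \<open>Both sides of the interchange law are composites of the same outer arrows; they
    differ in the middle pair only, and exchanging that pair is naturality of \<beta> at the
    components of \<alpha>'.\<close>
  have "FAr G' (NAt \<alpha>' x) \<cdot>\<^bsub>C\<^esub> NAt \<beta> (FOb F' x) = NAt \<beta> (FOb F'' x) \<cdot>\<^bsub>C\<^esub> FAr G (NAt \<alpha>' x)"
    if "x \<in> Obj A" for x
    using that \<beta>.natural[of "NAt \<alpha>' x"] by simp
  note swap = \<beta>.F.B.Comp_reassoc[OF this]
  show ?thesis
    by (rule cat_nattr_eqI[OF
         cat_nattr_hcomp[OF cat_nattr_vcomp[OF \<alpha> \<alpha>'] cat_nattr_vcomp[OF \<beta> \<beta>']]
         cat_nattr_vcomp[OF cat_nattr_hcomp[OF \<alpha> \<beta>] cat_nattr_hcomp[OF \<alpha>' \<beta>']]])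
        (simp add: swap)
qed

lemma two_category_CAT: "two_category (CAT \<kappa> :: ('u cat, 'u fnctr, 'u nattr) two_cat)"
  (is "two_category ?K")
proof -
  have cf: "cat_functor f A B" if "f \<in> Cell1 ?K" "FDom f = A" "FCod f = B" for f A B
    using that by (auto simp: Cell1_CAT)
  have cn: "cat_nattr \<alpha> F G A B"
    if "\<alpha> \<in> Cell2 ?K" "NSrc \<alpha> = F" "NTgt \<alpha> = G" "FDom F = A" "FCod F = B" for \<alpha> F G A B
    using that by (auto simp: Cell2_CAT)
  have cnG: "FDom (NTgt \<alpha>) = FDom (NSrc \<alpha>)" "FCod (NTgt \<alpha>) = FCod (NSrc \<alpha>)"
    if "\<alpha> \<in> Cell2 ?K" for \<alpha>
    using is_nattr.same_dom is_nattr.same_cod cat_nattr.is_nattr[OF cn[OF that refl refl refl refl]]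
    by blast+
  show ?thesis
  proof
    fix f assume f: "f \<in> Cell1 ?K"
    note c = cf[OF f refl refl]
    show "src1 ?K f \<in> Cell0 ?K" "tgt1 ?K f \<in> Cell0 ?K"
      using f is_functor.axioms(1,2)[OF cat_functor.is_functor[OF c]] by (auto simp: Cell1_CAT)
    show "one2 ?K f \<in> Cell2 ?K \<and> src2 ?K (one2 ?K f) = f \<and> tgt2 ?K (one2 ?K f) = f"
      using f cat_nattr_one2[OF c, of \<kappa>] by (auto simp: Cell1_CAT Cell2_CAT)
    show "f \<odot>\<^bsub>?K\<^esub> one1 ?K (src1 ?K f) = f" "one1 ?K (tgt1 ?K f) \<odot>\<^bsub>?K\<^esub> f = f"
      by (simp_all add: fun_comp_one[OF c])
  next
    fix \<alpha> assume \<alpha>: "\<alpha> \<in> Cell2 ?K"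
    note c = cn[OF \<alpha> refl refl refl refl]
    show "src2 ?K \<alpha> \<in> Cell1 ?K" "tgt2 ?K \<alpha> \<in> Cell1 ?K"
      using \<alpha> is_nattr.axioms(1,2)[OF cat_nattr.is_nattr[OF c]] cnG[OF \<alpha>]
      by (auto simp: Cell1_CAT Cell2_CAT cat_functor_def)
    show "src1 ?K (src2 ?K \<alpha>) = src1 ?K (tgt2 ?K \<alpha>)" "tgt1 ?K (src2 ?K \<alpha>) = tgt1 ?K (tgt2 ?K \<alpha>)"
      by (simp_all add: cnG[OF \<alpha>])
    show "\<alpha> \<bullet>\<^bsub>?K\<^esub> one2 ?K (src2 ?K \<alpha>) = \<alpha>" "one2 ?K (tgt2 ?K \<alpha>) \<bullet>\<^bsub>?K\<^esub> \<alpha> = \<alpha>"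
      "\<alpha> \<star>\<^bsub>?K\<^esub> one2 ?K (one1 ?K (src1 ?K (src2 ?K \<alpha>))) = \<alpha>"
      "one2 ?K (one1 ?K (tgt1 ?K (src2 ?K \<alpha>))) \<star>\<^bsub>?K\<^esub> \<alpha> = \<alpha>"
      by (simp_all add: CAT_vcomp_one[OF c] CAT_hcomp_one[OF c])
  next
    fix x assume "x \<in> Cell0 ?K"
    then show "one1 ?K x \<in> Cell1 ?K \<and> src1 ?K (one1 ?K x) = x \<and> tgt1 ?K (one1 ?K x) = x"
      using cat_functor_one[of x] by (simp add: Cell1_CAT)
  next
    fix f g assume fg: "f \<in> Cell1 ?K" "g \<in> Cell1 ?K" "tgt1 ?K f = src1 ?K g"
    have c: "cat_functor f (FDom f) (FCod f)" "cat_functor g (FCod f) (FCod g)"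
      using cf fg by auto
    show "g \<odot>\<^bsub>?K\<^esub> f \<in> Cell1 ?K \<and> src1 ?K (g \<odot>\<^bsub>?K\<^esub> f) = src1 ?K f \<and> tgt1 ?K (g \<odot>\<^bsub>?K\<^esub> f) = tgt1 ?K g"
      using cat_functor_comp[OF c] fg by (simp add: Cell1_CAT)
    show "one2 ?K g \<star>\<^bsub>?K\<^esub> one2 ?K f = one2 ?K (g \<odot>\<^bsub>?K\<^esub> f)"
      by (simp add: CAT_hcomp_one2[OF c])
  next
    fix f g h assume fg: "f \<in> Cell1 ?K" "g \<in> Cell1 ?K" "h \<in> Cell1 ?K" "tgt1 ?K f = src1 ?K g"
      "tgt1 ?K g = src1 ?K h"
    have c: "cat_functor f (FDom f) (FCod f)" "cat_functor g (FCod f) (FCod g)"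
       "cat_functor h (FCod g) (FCod h)"
      using cf fg by auto
    show "h \<odot>\<^bsub>?K\<^esub> (g \<odot>\<^bsub>?K\<^esub> f) = (h \<odot>\<^bsub>?K\<^esub> g) \<odot>\<^bsub>?K\<^esub> f"
      by (simp add: fun_comp_assoc[OF c])
  next
    fix \<alpha> \<beta> assume ab: "\<alpha> \<in> Cell2 ?K" "\<beta> \<in> Cell2 ?K" "tgt2 ?K \<alpha> = src2 ?K \<beta>"
    have c: "cat_nattr \<alpha> (NSrc \<alpha>) (NTgt \<alpha>) (FDom (NSrc \<alpha>)) (FCod (NSrc \<alpha>))"
      "cat_nattr \<beta> (NTgt \<alpha>) (NTgt \<beta>) (FDom (NSrc \<alpha>)) (FCod (NSrc \<alpha>))"
      using cn ab cnG[OF ab(1)] by auto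
    show "\<beta> \<bullet>\<^bsub>?K\<^esub> \<alpha> \<in> Cell2 ?K \<and> src2 ?K (\<beta> \<bullet>\<^bsub>?K\<^esub> \<alpha>) = src2 ?K \<alpha> \<and> tgt2 ?K (\<beta> \<bullet>\<^bsub>?K\<^esub> \<alpha>) = tgt2 ?K \<beta>"
      using cat_nattr_vcomp[OF c, of \<kappa>] ab by (simp add: Cell2_CAT)
  next
    fix \<alpha> \<beta> assume ab: "\<alpha> \<in> Cell2 ?K" "\<beta> \<in> Cell2 ?K" "tgt1 ?K (src2 ?K \<alpha>) = src1 ?K (src2 ?K \<beta>)"
    have c: "cat_nattr \<alpha> (NSrc \<alpha>) (NTgt \<alpha>) (FDom (NSrc \<alpha>)) (FCod (NSrc \<alpha>))"
      "cat_nattr \<beta> (NSrc \<beta>) (NTgt \<beta>) (FCod (NSrc \<alpha>)) (FCod (NSrc \<beta>))"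
      using cn ab by auto
    show "\<beta> \<star>\<^bsub>?K\<^esub> \<alpha> \<in> Cell2 ?K \<and> src2 ?K (\<beta> \<star>\<^bsub>?K\<^esub> \<alpha>) = src2 ?K \<beta> \<odot>\<^bsub>?K\<^esub> src2 ?K \<alpha> \<and>
      tgt2 ?K (\<beta> \<star>\<^bsub>?K\<^esub> \<alpha>) = tgt2 ?K \<beta> \<odot>\<^bsub>?K\<^esub> tgt2 ?K \<alpha>"
      using cat_nattr_hcomp[OF c, of \<kappa>] ab by (simp add: Cell2_CAT)
  next
    fix \<alpha> \<beta> \<gamma> assume ab: "\<alpha> \<in> Cell2 ?K" "\<beta> \<in> Cell2 ?K" "\<gamma> \<in> Cell2 ?K" "tgt2 ?K \<alpha> = src2 ?K \<beta>" "tgt2 ?K \<beta> = src2 ?K \<gamma>"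
    have "FDom (NSrc \<beta>) = FDom (NSrc \<alpha>)" "FCod (NSrc \<beta>) = FCod (NSrc \<alpha>)"
      "FDom (NSrc \<gamma>) = FDom (NSrc \<alpha>)" "FCod (NSrc \<gamma>) = FCod (NSrc \<alpha>)"
      using ab cnG[OF ab(1)] cnG[OF ab(2)] by auto
    then have c: "cat_nattr \<alpha> (NSrc \<alpha>) (NTgt \<alpha>) (FDom (NSrc \<alpha>)) (FCod (NSrc \<alpha>))"
      "cat_nattr \<beta> (NTgt \<alpha>) (NTgt \<beta>) (FDom (NSrc \<alpha>)) (FCod (NSrc \<alpha>))"
      "cat_nattr \<gamma> (NTgt \<beta>) (NTgt \<gamma>) (FDom (NSrc \<alpha>)) (FCod (NSrc \<alpha>))"
      using cn ab by auto
    show "\<gamma> \<bullet>\<^bsub>?K\<^esub> (\<beta> \<bullet>\<^bsub>?K\<^esub> \<alpha>) = (\<gamma> \<bullet>\<^bsub>?K\<^esub> \<beta>) \<bullet>\<^bsub>?K\<^esub> \<alpha>"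
      by (rule CAT_vcomp_assoc[OF c])
  next
    fix \<alpha> \<beta> \<gamma> assume ab: "\<alpha> \<in> Cell2 ?K" "\<beta> \<in> Cell2 ?K" "\<gamma> \<in> Cell2 ?K"
      "tgt1 ?K (src2 ?K \<alpha>) = src1 ?K (src2 ?K \<beta>)" "tgt1 ?K (src2 ?K \<beta>) = src1 ?K (src2 ?K \<gamma>)"
    have c: "cat_nattr \<alpha> (NSrc \<alpha>) (NTgt \<alpha>) (FDom (NSrc \<alpha>)) (FCod (NSrc \<alpha>))"
      "cat_nattr \<beta> (NSrc \<beta>) (NTgt \<beta>) (FCod (NSrc \<alpha>)) (FCod (NSrc \<beta>))"
      "cat_nattr \<gamma> (NSrc \<gamma>) (NTgt \<gamma>) (FCod (NSrc \<beta>)) (FCod (NSrc \<gamma>))"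
      using cn ab by auto
    show "\<gamma> \<star>\<^bsub>?K\<^esub> (\<beta> \<star>\<^bsub>?K\<^esub> \<alpha>) = (\<gamma> \<star>\<^bsub>?K\<^esub> \<beta>) \<star>\<^bsub>?K\<^esub> \<alpha>"
      by (rule CAT_hcomp_assoc[OF c])
  next
    fix \<alpha> \<alpha>' \<beta> \<beta>' assume ab: "\<alpha> \<in> Cell2 ?K" "\<alpha>' \<in> Cell2 ?K" "\<beta> \<in> Cell2 ?K" "\<beta>' \<in> Cell2 ?K"
      "tgt2 ?K \<alpha> = src2 ?K \<alpha>'" "tgt2 ?K \<beta> = src2 ?K \<beta>'" "tgt1 ?K (src2 ?K \<alpha>) = src1 ?K (src2 ?K \<beta>)"
    have c: "cat_nattr \<alpha> (NSrc \<alpha>) (NTgt \<alpha>) (FDom (NSrc \<alpha>)) (FCod (NSrc \<alpha>))"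
      "cat_nattr \<alpha>' (NTgt \<alpha>) (NTgt \<alpha>') (FDom (NSrc \<alpha>)) (FCod (NSrc \<alpha>))"
      "cat_nattr \<beta> (NSrc \<beta>) (NTgt \<beta>) (FCod (NSrc \<alpha>)) (FCod (NSrc \<beta>))"
      "cat_nattr \<beta>' (NTgt \<beta>) (NTgt \<beta>') (FCod (NSrc \<alpha>)) (FCod (NSrc \<beta>))"
      using cn ab cnG[OF ab(1)] cnG[OF ab(3)] by auto
    show "(\<beta>' \<bullet>\<^bsub>?K\<^esub> \<beta>) \<star>\<^bsub>?K\<^esub> (\<alpha>' \<bullet>\<^bsub>?K\<^esub> \<alpha>) = (\<beta>' \<star>\<^bsub>?K\<^esub> \<alpha>') \<bullet>\<^bsub>?K\<^esub> (\<beta> \<star>\<^bsub>?K\<^esub> \<alpha>)"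
      by (rule CAT_interchange[OF c])
  qed
qed

section \<open>The arrow 2-category\<close>

lemma arrow_two_cat_sel [simp]:
  "Cell0 (arrow_two_cat K) = Cell1 K"
  "Cell1 (arrow_two_cat K) = Collect (is_square K)"
  "Cell2 (arrow_two_cat K) = Collect (is_sqcell K)"
  "src1 (arrow_two_cat K) = sq_src" "tgt1 (arrow_two_cat K) = sq_tgt"
  "src2 (arrow_two_cat K) = sqcell_src K" "tgt2 (arrow_two_cat K) = sqcell_tgt K"
  by (simp_all add: arrow_two_cat_def)

lemma arrow_one1_sel [simp]:
  "sq_src (one1 (arrow_two_cat K) p) = p" "sq_tgt (one1 (arrow_two_cat K) p) = p"
  "sq_total (one1 (arrow_two_cat K) p) = one1 K (src1 K p)"
  "sq_base (one1 (arrow_two_cat K) p) = one1 K (tgt1 K p)"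
  by (simp_all add: arrow_two_cat_def)

lemma arrow_comp1_sel [simp]:
  "sq_src (t \<odot>\<^bsub>arrow_two_cat K\<^esub> s) = sq_src s" "sq_tgt (t \<odot>\<^bsub>arrow_two_cat K\<^esub> s) = sq_tgt t"
  "sq_total (t \<odot>\<^bsub>arrow_two_cat K\<^esub> s) = sq_total t \<odot>\<^bsub>K\<^esub> sq_total s"
  "sq_base (t \<odot>\<^bsub>arrow_two_cat K\<^esub> s) = sq_base t \<odot>\<^bsub>K\<^esub> sq_base s"
  by (simp_all add: arrow_two_cat_def)

lemma arrow_one2_sel [simp]:
  "sc_src (one2 (arrow_two_cat K) s) = sq_src s" "sc_tgt (one2 (arrow_two_cat K) s) = sq_tgt s"
  "sc_total (one2 (arrow_two_cat K) s) = one2 K (sq_total s)"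
  "sc_base (one2 (arrow_two_cat K) s) = one2 K (sq_base s)"
  by (simp_all add: arrow_two_cat_def)

lemma arrow_vcomp_sel [simp]:
  "sc_src (\<eta> \<bullet>\<^bsub>arrow_two_cat K\<^esub> \<theta>) = sc_src \<theta>" "sc_tgt (\<eta> \<bullet>\<^bsub>arrow_two_cat K\<^esub> \<theta>) = sc_tgt \<theta>"
  "sc_total (\<eta> \<bullet>\<^bsub>arrow_two_cat K\<^esub> \<theta>) = sc_total \<eta> \<bullet>\<^bsub>K\<^esub> sc_total \<theta>"
  "sc_base (\<eta> \<bullet>\<^bsub>arrow_two_cat K\<^esub> \<theta>) = sc_base \<eta> \<bullet>\<^bsub>K\<^esub> sc_base \<theta>"
  by (simp_all add: arrow_two_cat_def)

lemma arrow_hcomp_sel [simp]: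
  "sc_src (\<eta> \<star>\<^bsub>arrow_two_cat K\<^esub> \<theta>) = sc_src \<theta>" "sc_tgt (\<eta> \<star>\<^bsub>arrow_two_cat K\<^esub> \<theta>) = sc_tgt \<eta>"
  "sc_total (\<eta> \<star>\<^bsub>arrow_two_cat K\<^esub> \<theta>) = sc_total \<eta> \<star>\<^bsub>K\<^esub> sc_total \<theta>"
  "sc_base (\<eta> \<star>\<^bsub>arrow_two_cat K\<^esub> \<theta>) = sc_base \<eta> \<star>\<^bsub>K\<^esub> sc_base \<theta>"
  by (simp_all add: arrow_two_cat_def)

lemma sqcell_src_sel [simp]:
  "sq_src (sqcell_src K \<theta>) = sc_src \<theta>" "sq_tgt (sqcell_src K \<theta>) = sc_tgt \<theta>"
  "sq_total (sqcell_src K \<theta>) = src2 K (sc_total \<theta>)" "sq_base (sqcell_src K \<theta>) = src2 K (sc_base \<theta>)"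
  by (simp_all add: sqcell_src_def)

lemma sqcell_tgt_sel [simp]:
  "sq_src (sqcell_tgt K \<theta>) = sc_src \<theta>" "sq_tgt (sqcell_tgt K \<theta>) = sc_tgt \<theta>"
  "sq_total (sqcell_tgt K \<theta>) = tgt2 K (sc_total \<theta>)" "sq_base (sqcell_tgt K \<theta>) = tgt2 K (sc_base \<theta>)"
  by (simp_all add: sqcell_tgt_def)

lemma square_eqI:
  "\<lbrakk>sq_src s = sq_src t; sq_tgt s = sq_tgt t; sq_total s = sq_total t; sq_base s = sq_base t\<rbrakk> \<Longrightarrow> s = t"
  for s t :: "'m square"
  by simp

lemma sqcell_eqI:
  "\<lbrakk>sc_src s = sc_src t; sc_tgt s = sc_tgt t; sc_total s = sc_total t; sc_base s = sc_base t\<rbrakk> \<Longrightarrow> s = t"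
  for s t :: "('m, 'c) sqcell"
  by simp

context two_category
begin

lemmas cell_simps [simp] = src1_in tgt1_in src2_in tgt2_in globular_src globular_tgt
  conjunct1[OF one1_cell] conjunct1[OF conjunct2[OF one1_cell]] conjunct2[OF conjunct2[OF one1_cell]]
  conjunct1[OF one2_cell] conjunct1[OF conjunct2[OF one2_cell]] conjunct2[OF conjunct2[OF one2_cell]]
  conjunct1[OF comp1_cell] conjunct1[OF conjunct2[OF comp1_cell]] conjunct2[OF conjunct2[OF comp1_cell]]
  conjunct1[OF vcomp_cell] conjunct1[OF conjunct2[OF vcomp_cell]] conjunct2[OF conjunct2[OF vcomp_cell]]
  conjunct1[OF hcomp_cell] conjunct1[OF conjunct2[OF hcomp_cell]] conjunct2[OF conjunct2[OF hcomp_cell]]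

lemma square_one: "p \<in> Cell1 K \<Longrightarrow> is_square K (one1 (arrow_two_cat K) p)"
  by (simp add: is_square_def comp1_one_left comp1_one_right)

lemma square_comp:
  assumes "is_square K s" "is_square K t" "sq_tgt s = sq_src t"
  shows "is_square K (t \<odot>\<^bsub>arrow_two_cat K\<^esub> s)"
proof -
  have "sq_tgt t \<odot> (sq_total t \<odot> sq_total s) = (sq_base t \<odot> sq_src t) \<odot> sq_total s"
    using assms by (simp add: is_square_def comp1_assoc)
  also have "\<dots> = (sq_base t \<odot> sq_base s) \<odot> sq_src s"
    using assms unfolding is_square_def by simp (metis comp1_assoc)
  finally show ?thesis using assms by (simp add: is_square_def)
qed

lemma square_eq_one2:
  "is_square K s \<Longrightarrow> one2 K (sq_tgt s) \<star> one2 K (sq_total s) = one2 K (sq_base s) \<star> one2 K (sq_src s)"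
  by (simp add: is_square_def hcomp_one2)

lemma sqcell_one: "is_square K s \<Longrightarrow> is_sqcell K (one2 (arrow_two_cat K) s) \<and>
    sqcell_src K (one2 (arrow_two_cat K) s) = s \<and> sqcell_tgt K (one2 (arrow_two_cat K) s) = s"
proof -
  assume s: "is_square K s"
  have e: "sqcell_src K (one2 (arrow_two_cat K) s) = s" "sqcell_tgt K (one2 (arrow_two_cat K) s) = s"
    using s by (auto intro!: square_eqI simp: is_square_def)
  then show ?thesis
    using s square_eq_one2[OF s] by (simp add: is_sqcell_def whisker_left_def whisker_right_def)
      (simp add: is_square_def)
qed

lemma sqcell_vcomp:
  assumes "is_sqcell K \<theta>" "is_sqcell K \<eta>" "sqcell_tgt K \<theta> = sqcell_src K \<eta>"
  shows "is_sqcell K (\<eta> \<bullet>\<^bsub>arrow_two_cat K\<^esub> \<theta>) \<and>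
    sqcell_src K (\<eta> \<bullet>\<^bsub>arrow_two_cat K\<^esub> \<theta>) = sqcell_src K \<theta> \<and>
    sqcell_tgt K (\<eta> \<bullet>\<^bsub>arrow_two_cat K\<^esub> \<theta>) = sqcell_tgt K \<eta>"
proof -
  have eqs: "sc_src \<eta> = sc_src \<theta>" "sc_tgt \<eta> = sc_tgt \<theta>"
    "tgt2 K (sc_total \<theta>) = src2 K (sc_total \<eta>)" "tgt2 K (sc_base \<theta>) = src2 K (sc_base \<eta>)"
    using assms(3) by (simp_all add: sqcell_src_def sqcell_tgt_def)
  note sq = assms(1,2)[unfolded is_sqcell_def is_square_def, simplified]
  have e: "sqcell_src K (\<eta> \<bullet>\<^bsub>arrow_two_cat K\<^esub> \<theta>) = sqcell_src K \<theta>"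
    "sqcell_tgt K (\<eta> \<bullet>\<^bsub>arrow_two_cat K\<^esub> \<theta>) = sqcell_tgt K \<eta>"
    using assms(1,2) eqs by (auto intro!: square_eqI simp: is_sqcell_def)
  \<comment> \<open>The identity on the target is doubled, 1 = 1 \<bullet> 1, so that interchange
    splits the whiskering of a vertical composite; after the two compatibility conditions are used,
    the identity on the source is merged again.\<close>
  have "one2 K (sc_tgt \<theta>) \<star> (sc_total \<eta> \<bullet> sc_total \<theta>)
    = (one2 K (sc_tgt \<theta>) \<bullet> one2 K (sc_tgt \<theta>)) \<star> (sc_total \<eta> \<bullet> sc_total \<theta>)"
    using sq vcomp_one_left[of "one2 K (sc_tgt \<theta>)"] by simp
  also have "\<dots> = (sc_base \<eta> \<star> one2 K (sc_src \<theta>)) \<bullet> (sc_base \<theta> \<star> one2 K (sc_src \<theta>))"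
    using sq eqs interchange[of "sc_total \<theta>" "sc_total \<eta>" "one2 K (sc_tgt \<theta>)" "one2 K (sc_tgt \<theta>)"]
    by (simp add: whisker_left_def whisker_right_def)
  also have "\<dots> = (sc_base \<eta> \<bullet> sc_base \<theta>) \<star> (one2 K (sc_src \<theta>) \<bullet> one2 K (sc_src \<theta>))"
    using sq eqs interchange[of "one2 K (sc_src \<theta>)" "one2 K (sc_src \<theta>)" "sc_base \<theta>" "sc_base \<eta>"]
    by simp
  also have "\<dots> = (sc_base \<eta> \<bullet> sc_base \<theta>) \<star> one2 K (sc_src \<theta>)"
    using sq vcomp_one_left[of "one2 K (sc_src \<theta>)"] by simp
  finally show ?thesis
    unfolding is_sqcell_def e using assms(1,2) eqs
    by (simp add: is_sqcell_def whisker_left_def whisker_right_def)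
qed

lemma sqcell_hcomp:
  assumes "is_sqcell K \<theta>" "is_sqcell K \<eta>" "sc_tgt \<theta> = sc_src \<eta>"
  shows "is_sqcell K (\<eta> \<star>\<^bsub>arrow_two_cat K\<^esub> \<theta>) \<and>
    sqcell_src K (\<eta> \<star>\<^bsub>arrow_two_cat K\<^esub> \<theta>) = sqcell_src K \<eta> \<odot>\<^bsub>arrow_two_cat K\<^esub> sqcell_src K \<theta> \<and>
    sqcell_tgt K (\<eta> \<star>\<^bsub>arrow_two_cat K\<^esub> \<theta>) = sqcell_tgt K \<eta> \<odot>\<^bsub>arrow_two_cat K\<^esub> sqcell_tgt K \<theta>"
proof -
  note sq = assms(1,2)[unfolded is_sqcell_def is_square_def, simplified]
  have e: "sqcell_src K (\<eta> \<star>\<^bsub>arrow_two_cat K\<^esub> \<theta>) = sqcell_src K \<eta> \<odot>\<^bsub>arrow_two_cat K\<^esub> sqcell_src K \<theta>"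
    "sqcell_tgt K (\<eta> \<star>\<^bsub>arrow_two_cat K\<^esub> \<theta>) = sqcell_tgt K \<eta> \<odot>\<^bsub>arrow_two_cat K\<^esub> sqcell_tgt K \<theta>"
    using sq assms(3) by (auto intro!: square_eqI)
  have w: "one2 K (sc_tgt \<theta>) \<star> sc_total \<theta> = sc_base \<theta> \<star> one2 K (sc_src \<theta>)"
    "one2 K (sc_tgt \<eta>) \<star> sc_total \<eta> = sc_base \<eta> \<star> one2 K (sc_src \<eta>)"
    using sq by (simp_all add: whisker_left_def whisker_right_def)
  \<comment> \<open>The target functor is moved through the pasting from left to right: the
    condition for \<eta> turns it into the middle functor, and the condition for \<theta> turns that
    into the source.\<close>
  have "one2 K (sc_tgt \<eta>) \<star> (sc_total \<eta> \<star> sc_total \<theta>)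
    = (sc_base \<eta> \<star> one2 K (sc_src \<eta>)) \<star> sc_total \<theta>"
    using sq assms(3) by (simp add: hcomp_assoc w)
  also have "\<dots> = sc_base \<eta> \<star> (one2 K (sc_tgt \<theta>) \<star> sc_total \<theta>)"
    using sq assms(3) by (simp add: hcomp_assoc)
  also have "\<dots> = (sc_base \<eta> \<star> sc_base \<theta>) \<star> one2 K (sc_src \<theta>)"
    unfolding w using sq assms(3) by (simp add: hcomp_assoc)
  finally have "sc_tgt \<eta> \<lhd> (sc_total \<eta> \<star> sc_total \<theta>) = (sc_base \<eta> \<star> sc_base \<theta>) \<rhd> sc_src \<theta>"
    by (simp add: whisker_left_def whisker_right_def)
  moreover have "sc_total \<eta> \<star> sc_total \<theta> \<in> Cell2 K" "sc_base \<eta> \<star> sc_base \<theta> \<in> Cell2 K"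
    using sq assms(3) by simp_all
  ultimately show ?thesis
    unfolding is_sqcell_def e
    using assms square_comp[of "sqcell_src K \<theta>" "sqcell_src K \<eta>"]
      square_comp[of "sqcell_tgt K \<theta>" "sqcell_tgt K \<eta>"]
    by (simp add: is_sqcell_def)
qed

text \<open>Compositions are componentwise, so every equational law holds separately on totals and
  bases. Only closure of squares and of 2-cells mixes the two, and that is settled by the preceding
  lemmas.\<close>

lemma two_category_arrow: "two_category (arrow_two_cat K)"
proof
  fix s assume "s \<in> Cell1 (arrow_two_cat K)"
  then have s: "is_square K s" by simp
  note sd = s[unfolded is_square_def, simplified]
  show "src1 (arrow_two_cat K) s \<in> Cell0 (arrow_two_cat K)"
    "tgt1 (arrow_two_cat K) s \<in> Cell0 (arrow_two_cat K)" using sd by simp_all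
  show "one2 (arrow_two_cat K) s \<in> Cell2 (arrow_two_cat K) \<and>
      src2 (arrow_two_cat K) (one2 (arrow_two_cat K) s) = s \<and>
      tgt2 (arrow_two_cat K) (one2 (arrow_two_cat K) s) = s"
    using sqcell_one[OF s] by simp
  show "s \<odot>\<^bsub>arrow_two_cat K\<^esub> one1 (arrow_two_cat K) (src1 (arrow_two_cat K) s) = s"
    "one1 (arrow_two_cat K) (tgt1 (arrow_two_cat K) s) \<odot>\<^bsub>arrow_two_cat K\<^esub> s = s"
    using sd comp1_one_left[of "sq_total s"] comp1_one_left[of "sq_base s"]
      comp1_one_right[of "sq_total s"] comp1_one_right[of "sq_base s"]
    by (auto intro!: square_eqI)
next
  fix \<theta> assume "\<theta> \<in> Cell2 (arrow_two_cat K)"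
  then have s: "is_sqcell K \<theta>" by simp
  note sd = s[unfolded is_sqcell_def is_square_def, simplified]
  show "src2 (arrow_two_cat K) \<theta> \<in> Cell1 (arrow_two_cat K)"
    "tgt2 (arrow_two_cat K) \<theta> \<in> Cell1 (arrow_two_cat K)" using s by (simp_all add: is_sqcell_def)
  show "src1 (arrow_two_cat K) (src2 (arrow_two_cat K) \<theta>) = src1 (arrow_two_cat K) (tgt2 (arrow_two_cat K) \<theta>)"
    "tgt1 (arrow_two_cat K) (src2 (arrow_two_cat K) \<theta>) = tgt1 (arrow_two_cat K) (tgt2 (arrow_two_cat K) \<theta>)"
    by simp_all
  show "\<theta> \<bullet>\<^bsub>arrow_two_cat K\<^esub> one2 (arrow_two_cat K) (src2 (arrow_two_cat K) \<theta>) = \<theta>"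
    "one2 (arrow_two_cat K) (tgt2 (arrow_two_cat K) \<theta>) \<bullet>\<^bsub>arrow_two_cat K\<^esub> \<theta> = \<theta>"
    using sd by (auto intro!: sqcell_eqI simp: vcomp_one_left vcomp_one_right)
  show "\<theta> \<star>\<^bsub>arrow_two_cat K\<^esub> one2 (arrow_two_cat K) (one1 (arrow_two_cat K) (src1 (arrow_two_cat K) (src2 (arrow_two_cat K) \<theta>))) = \<theta>"
    using sd hcomp_one_right[of "sc_total \<theta>"] hcomp_one_right[of "sc_base \<theta>"]
    by (auto intro!: sqcell_eqI)
  show "one2 (arrow_two_cat K) (one1 (arrow_two_cat K) (tgt1 (arrow_two_cat K) (src2 (arrow_two_cat K) \<theta>))) \<star>\<^bsub>arrow_two_cat K\<^esub> \<theta> = \<theta>"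
    using sd hcomp_one_left[of "sc_total \<theta>"] hcomp_one_left[of "sc_base \<theta>"]
    by (auto intro!: sqcell_eqI)
next
  fix p assume "p \<in> Cell0 (arrow_two_cat K)"
  then show "one1 (arrow_two_cat K) p \<in> Cell1 (arrow_two_cat K) \<and>
      src1 (arrow_two_cat K) (one1 (arrow_two_cat K) p) = p \<and> tgt1 (arrow_two_cat K) (one1 (arrow_two_cat K) p) = p"
    using square_one by simp
next
  fix s t assume "s \<in> Cell1 (arrow_two_cat K)" "t \<in> Cell1 (arrow_two_cat K)"
    "tgt1 (arrow_two_cat K) s = src1 (arrow_two_cat K) t"
  then have st: "is_square K s" "is_square K t" "sq_tgt s = sq_src t" by simp_all
  note sd = st[unfolded is_square_def, simplified]
  show "t \<odot>\<^bsub>arrow_two_cat K\<^esub> s \<in> Cell1 (arrow_two_cat K) \<and>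
      src1 (arrow_two_cat K) (t \<odot>\<^bsub>arrow_two_cat K\<^esub> s) = src1 (arrow_two_cat K) s \<and>
      tgt1 (arrow_two_cat K) (t \<odot>\<^bsub>arrow_two_cat K\<^esub> s) = tgt1 (arrow_two_cat K) t"
    using square_comp[OF st] by simp
  show "one2 (arrow_two_cat K) t \<star>\<^bsub>arrow_two_cat K\<^esub> one2 (arrow_two_cat K) s =
      one2 (arrow_two_cat K) (t \<odot>\<^bsub>arrow_two_cat K\<^esub> s)"
    using sd by (auto intro!: sqcell_eqI simp: hcomp_one2)
next
  fix r s t assume "r \<in> Cell1 (arrow_two_cat K)" "s \<in> Cell1 (arrow_two_cat K)" "t \<in> Cell1 (arrow_two_cat K)"
    "tgt1 (arrow_two_cat K) r = src1 (arrow_two_cat K) s" "tgt1 (arrow_two_cat K) s = src1 (arrow_two_cat K) t"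
  then have "is_square K r" "is_square K s" "is_square K t" "sq_tgt r = sq_src s" "sq_tgt s = sq_src t" by simp_all
  note sd = this[unfolded is_square_def, simplified]
  show "t \<odot>\<^bsub>arrow_two_cat K\<^esub> (s \<odot>\<^bsub>arrow_two_cat K\<^esub> r) = (t \<odot>\<^bsub>arrow_two_cat K\<^esub> s) \<odot>\<^bsub>arrow_two_cat K\<^esub> r"
    using sd by (auto intro!: square_eqI simp: comp1_assoc)
next
  fix \<theta> \<eta> assume "\<theta> \<in> Cell2 (arrow_two_cat K)" "\<eta> \<in> Cell2 (arrow_two_cat K)"
    "tgt2 (arrow_two_cat K) \<theta> = src2 (arrow_two_cat K) \<eta>"
  then show "\<eta> \<bullet>\<^bsub>arrow_two_cat K\<^esub> \<theta> \<in> Cell2 (arrow_two_cat K) \<and>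
      src2 (arrow_two_cat K) (\<eta> \<bullet>\<^bsub>arrow_two_cat K\<^esub> \<theta>) = src2 (arrow_two_cat K) \<theta> \<and>
      tgt2 (arrow_two_cat K) (\<eta> \<bullet>\<^bsub>arrow_two_cat K\<^esub> \<theta>) = tgt2 (arrow_two_cat K) \<eta>"
    using sqcell_vcomp by simp
next
  fix \<theta> \<eta> assume "\<theta> \<in> Cell2 (arrow_two_cat K)" "\<eta> \<in> Cell2 (arrow_two_cat K)"
    "tgt1 (arrow_two_cat K) (src2 (arrow_two_cat K) \<theta>) = src1 (arrow_two_cat K) (src2 (arrow_two_cat K) \<eta>)"
  then show "\<eta> \<star>\<^bsub>arrow_two_cat K\<^esub> \<theta> \<in> Cell2 (arrow_two_cat K) \<and>
      src2 (arrow_two_cat K) (\<eta> \<star>\<^bsub>arrow_two_cat K\<^esub> \<theta>) = src2 (arrow_two_cat K) \<eta> \<odot>\<^bsub>arrow_two_cat K\<^esub> src2 (arrow_two_cat K) \<theta> \<and>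
      tgt2 (arrow_two_cat K) (\<eta> \<star>\<^bsub>arrow_two_cat K\<^esub> \<theta>) = tgt2 (arrow_two_cat K) \<eta> \<odot>\<^bsub>arrow_two_cat K\<^esub> tgt2 (arrow_two_cat K) \<theta>"
    using sqcell_hcomp by simp
next
  fix \<alpha> \<beta> \<gamma> assume "\<alpha> \<in> Cell2 (arrow_two_cat K)" "\<beta> \<in> Cell2 (arrow_two_cat K)" "\<gamma> \<in> Cell2 (arrow_two_cat K)"
    "tgt2 (arrow_two_cat K) \<alpha> = src2 (arrow_two_cat K) \<beta>" "tgt2 (arrow_two_cat K) \<beta> = src2 (arrow_two_cat K) \<gamma>"
  then show "\<gamma> \<bullet>\<^bsub>arrow_two_cat K\<^esub> (\<beta> \<bullet>\<^bsub>arrow_two_cat K\<^esub> \<alpha>) = (\<gamma> \<bullet>\<^bsub>arrow_two_cat K\<^esub> \<beta>) \<bullet>\<^bsub>arrow_two_cat K\<^esub> \<alpha>"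
    by (auto intro!: sqcell_eqI vcomp_assoc simp: is_sqcell_def sqcell_src_def sqcell_tgt_def)
next
  fix \<alpha> \<beta> \<gamma> assume "\<alpha> \<in> Cell2 (arrow_two_cat K)" "\<beta> \<in> Cell2 (arrow_two_cat K)" "\<gamma> \<in> Cell2 (arrow_two_cat K)"
    "tgt1 (arrow_two_cat K) (src2 (arrow_two_cat K) \<alpha>) = src1 (arrow_two_cat K) (src2 (arrow_two_cat K) \<beta>)"
    "tgt1 (arrow_two_cat K) (src2 (arrow_two_cat K) \<beta>) = src1 (arrow_two_cat K) (src2 (arrow_two_cat K) \<gamma>)"
  then show "\<gamma> \<star>\<^bsub>arrow_two_cat K\<^esub> (\<beta> \<star>\<^bsub>arrow_two_cat K\<^esub> \<alpha>) = (\<gamma> \<star>\<^bsub>arrow_two_cat K\<^esub> \<beta>) \<star>\<^bsub>arrow_two_cat K\<^esub> \<alpha>"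
    by (auto intro!: sqcell_eqI simp: hcomp_assoc is_sqcell_def is_square_def)
next
  fix \<alpha> \<alpha>' \<beta> \<beta>' assume "\<alpha> \<in> Cell2 (arrow_two_cat K)" "\<alpha>' \<in> Cell2 (arrow_two_cat K)"
    "\<beta> \<in> Cell2 (arrow_two_cat K)" "\<beta>' \<in> Cell2 (arrow_two_cat K)"
    "tgt2 (arrow_two_cat K) \<alpha> = src2 (arrow_two_cat K) \<alpha>'" "tgt2 (arrow_two_cat K) \<beta> = src2 (arrow_two_cat K) \<beta>'"
    "tgt1 (arrow_two_cat K) (src2 (arrow_two_cat K) \<alpha>) = src1 (arrow_two_cat K) (src2 (arrow_two_cat K) \<beta>)"
  then have h: "is_sqcell K \<alpha>" "is_sqcell K \<alpha>'" "is_sqcell K \<beta>" "is_sqcell K \<beta>'"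
    "sqcell_tgt K \<alpha> = sqcell_src K \<alpha>'" "sqcell_tgt K \<beta> = sqcell_src K \<beta>'" "sc_tgt \<alpha> = sc_src \<beta>"
    by simp_all
  note d = h(1-4)[unfolded is_sqcell_def is_square_def, simplified]
    h(5-6)[unfolded sqcell_src_def sqcell_tgt_def, simplified]
  show "(\<beta>' \<bullet>\<^bsub>arrow_two_cat K\<^esub> \<beta>) \<star>\<^bsub>arrow_two_cat K\<^esub> (\<alpha>' \<bullet>\<^bsub>arrow_two_cat K\<^esub> \<alpha>) =
    (\<beta>' \<star>\<^bsub>arrow_two_cat K\<^esub> \<alpha>') \<bullet>\<^bsub>arrow_two_cat K\<^esub> (\<beta> \<star>\<^bsub>arrow_two_cat K\<^esub> \<alpha>)"
    using d h(7) by (auto intro!: sqcell_eqI interchange)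
qed

end

interpretation CAT2: two_category "CAT\<^sub>2 \<kappa>" for \<kappa>
  by (rule two_category.two_category_arrow[OF two_category_CAT])

section \<open>Squares and 2-cells of functors in pointwise form\<close>

locale cat_square =
  P: cat_functor P E B + Q: cat_functor Q F C + T: cat_functor T E F + S: cat_functor S B C
  for P E B Q F C T S +
  assumes sq_ob [simp]: "x \<in> Obj E \<Longrightarrow> FOb Q (FOb T x) = FOb S (FOb P x)"
    and sq_ar [simp]: "f \<in> Arr E \<Longrightarrow> FAr Q (FAr T f) = FAr S (FAr P f)"

locale cat_sqcell =
  s: cat_square P E B Q F C T S + t: cat_square P E B Q F C T' S' +
  total: cat_nattr \<beta> T T' E F + base: cat_nattr \<alpha> S S' B C
  for P E B Q F C \<beta> T T' \<alpha> S S' +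
  assumes total_base [simp]: "x \<in> Obj E \<Longrightarrow> FAr Q (NAt \<beta> x) = NAt \<alpha> (FOb P x)"

definition loc_small4 where
  "loc_small4 \<kappa> E B F C \<longleftrightarrow> locally_small \<kappa> E \<and> locally_small \<kappa> B \<and> locally_small \<kappa> F \<and> locally_small \<kappa> C"

lemma cat_squareI:
  assumes "cat_functor P E B" "cat_functor Q F C" "cat_functor T E F" "cat_functor S B C"
    and "fun_comp Q T = fun_comp S P"
  shows "cat_square P E B Q F C T S"
proof -
  interpret P: cat_functor P E B by fact
  interpret T: cat_functor T E F by fact
  have "FOb (fun_comp Q T) x = FOb (fun_comp S P) x" "FAr (fun_comp Q T) f = FAr (fun_comp S P) f" for x f
    using assms(5) by simp_all
  then have "x \<in> Obj E \<Longrightarrow> FOb Q (FOb T x) = FOb S (FOb P x)"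
    "f \<in> Arr E \<Longrightarrow> FAr Q (FAr T f) = FAr S (FAr P f)" for x f
    using fun_comp_sel(3)[of x T Q] fun_comp_sel(3)[of x P S]
      fun_comp_sel(4)[of f T Q] fun_comp_sel(4)[of f P S] by simp_all
  then show ?thesis
    using assms(1-4) by (simp add: cat_square_def cat_square_axioms_def)
qed

lemma (in cat_square) fun_comp_eq: "fun_comp Q T = fun_comp S P"
  by (rule cat_functor_eqI[OF cat_functor_comp[OF T.cat_functor_axioms Q.cat_functor_axioms]
        cat_functor_comp[OF P.cat_functor_axioms S.cat_functor_axioms]]) simp_all

lemma (in cat_square) Cell1_CAT2_I:
  assumes "loc_small4 \<kappa> E B F C"
  shows "\<lparr>sq_src = P, sq_tgt = Q, sq_total = T, sq_base = S\<rparr> \<in> Cell1 (CAT\<^sub>2 \<kappa>)"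
  using assms Cell1_CAT_I[OF P.cat_functor_axioms, of \<kappa>] Cell1_CAT_I[OF Q.cat_functor_axioms, of \<kappa>]
    Cell1_CAT_I[OF T.cat_functor_axioms, of \<kappa>] Cell1_CAT_I[OF S.cat_functor_axioms, of \<kappa>]
  by (simp add: is_square_def loc_small4_def fun_comp_eq)

lemma Cell1_CAT2_E:
  assumes "s \<in> Cell1 (CAT\<^sub>2 \<kappa>)"
  obtains P E B Q F C T S where "s = \<lparr>sq_src = P, sq_tgt = Q, sq_total = T, sq_base = S\<rparr>"
    "cat_square P E B Q F C T S" "loc_small4 \<kappa> E B F C"
proof -
  obtain P Q T S where s: "s = \<lparr>sq_src = P, sq_tgt = Q, sq_total = T, sq_base = S\<rparr>"
    by (cases s)
  have "cat_square P (FDom P) (FCod P) Q (FDom Q) (FCod Q) T S"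
    using assms unfolding s by (auto simp: is_square_def Cell1_CAT intro!: cat_squareI)
  moreover have "loc_small4 \<kappa> (FDom P) (FCod P) (FDom Q) (FCod Q)"
    using assms unfolding s by (auto simp: is_square_def Cell1_CAT loc_small4_def)
  ultimately show thesis using that[OF s] by blast
qed

lemma (in cat_sqcell) Cell2_CAT2_I:
  assumes "loc_small4 \<kappa> E B F C"
  shows "\<lparr>sc_src = P, sc_tgt = Q, sc_total = \<beta>, sc_base = \<alpha>\<rparr> \<in> Cell2 (CAT\<^sub>2 \<kappa>)"
proof -
  \<comment> \<open>The two whiskerings have a common boundary only because both squares commute;
    after that, equality of components is the locale assumption \<open>total_base\<close>.\<close>
  have eq: "one2 (CAT \<kappa>) Q \<star>\<^bsub>CAT \<kappa>\<^esub> \<beta> = \<alpha> \<star>\<^bsub>CAT \<kappa>\<^esub> one2 (CAT \<kappa>) P"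
  proof (rule cat_nattr_eqI)
    show "cat_nattr (one2 (CAT \<kappa>) Q \<star>\<^bsub>CAT \<kappa>\<^esub> \<beta>) (fun_comp Q T) (fun_comp Q T') E C"
      by (rule cat_nattr_hcomp[OF total.cat_nattr_axioms cat_nattr_one2[OF s.Q.cat_functor_axioms]])
    show "cat_nattr (\<alpha> \<star>\<^bsub>CAT \<kappa>\<^esub> one2 (CAT \<kappa>) P) (fun_comp Q T) (fun_comp Q T') E C"
      using cat_nattr_hcomp[OF cat_nattr_one2[OF s.P.cat_functor_axioms] base.cat_nattr_axioms]
      by (simp add: s.fun_comp_eq t.fun_comp_eq)
  qed simp
  have "is_sqcell (CAT \<kappa>) \<lparr>sc_src = P, sc_tgt = Q, sc_total = \<beta>, sc_base = \<alpha>\<rparr>"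
    unfolding is_sqcell_def whisker_left_def whisker_right_def
    using s.Cell1_CAT2_I[OF assms] t.Cell1_CAT2_I[OF assms] Cell2_CAT_I[OF total.cat_nattr_axioms, of \<kappa>]
      Cell2_CAT_I[OF base.cat_nattr_axioms, of \<kappa>] assms eq
    by (simp add: sqcell_src_def sqcell_tgt_def loc_small4_def)
  then show ?thesis by simp
qed

lemma Cell2_CAT2_E:
  assumes "\<theta> \<in> Cell2 (CAT\<^sub>2 \<kappa>)"
  obtains P E B Q F C \<beta> T T' \<alpha> S S'
  where "\<theta> = \<lparr>sc_src = P, sc_tgt = Q, sc_total = \<beta>, sc_base = \<alpha>\<rparr>"
    "cat_sqcell P E B Q F C \<beta> T T' \<alpha> S S'" "loc_small4 \<kappa> E B F C"
proof -
  obtain P Q \<beta> \<alpha> where th: "\<theta> = \<lparr>sc_src = P, sc_tgt = Q, sc_total = \<beta>, sc_base = \<alpha>\<rparr>"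
    by (cases \<theta>)
  let ?E = "FDom P" and ?B = "FCod P" and ?F = "FDom Q" and ?C = "FCod Q"
  note d = assms[unfolded th, simplified, unfolded is_sqcell_def is_square_def, simplified]
  have s: "cat_square P ?E ?B Q ?F ?C (NSrc \<beta>) (NSrc \<alpha>)"
    using d by (auto simp: Cell1_CAT intro!: cat_squareI)
  have t: "cat_square P ?E ?B Q ?F ?C (NTgt \<beta>) (NTgt \<alpha>)"
    using d by (auto simp: Cell1_CAT intro!: cat_squareI)
  have "cat_nattr \<beta> (NSrc \<beta>) (NTgt \<beta>) (FDom (NSrc \<beta>)) (FCod (NSrc \<beta>))"
    "cat_nattr \<alpha> (NSrc \<alpha>) (NTgt \<alpha>) (FDom (NSrc \<alpha>)) (FCod (NSrc \<alpha>))"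
    using d unfolding Cell2_CAT by blast+
  then have n: "cat_nattr \<beta> (NSrc \<beta>) (NTgt \<beta>) ?E ?F" "cat_nattr \<alpha> (NSrc \<alpha>) (NTgt \<alpha>) ?B ?C"
    using d by simp_all
  \<comment> \<open>Fresh names replace the projections. With \<open>FDom P\<close> itself in place
    of E, the boundary equations of the locales would be trivial and would rewrite nothing.\<close>
  obtain T T' S S' where X: "NSrc \<beta> = T" "NTgt \<beta> = T'" "NSrc \<alpha> = S" "NTgt \<alpha> = S'" by blast
  obtain E B F C where Y: "?E = E" "?B = B" "?F = F" "?C = C" by blast
  interpret s: cat_square P E B Q F C T S using s X Y by simp
  interpret t: cat_square P E B Q F C T' S' using t X Y by simp
  interpret total: cat_nattr \<beta> T T' E F using n X Y by simp
  interpret base: cat_nattr \<alpha> S S' B C using n X Y by simp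
  have eq: "one2 (CAT \<kappa>) Q \<star>\<^bsub>CAT \<kappa>\<^esub> \<beta> = \<alpha> \<star>\<^bsub>CAT \<kappa>\<^esub> one2 (CAT \<kappa>) P"
    using d by (simp add: whisker_left_def whisker_right_def)
  have "FAr Q (NAt \<beta> x) = NAt \<alpha> (FOb P x)" if "x \<in> Obj E" for x
    using that arg_cong[OF eq, of "\<lambda>n. NAt n x"] by simp
  then have "cat_sqcell P E B Q F C \<beta> T T' \<alpha> S S'"
    by unfold_locales
  moreover have "loc_small4 \<kappa> E B F C"
    using d Y by (auto simp: Cell1_CAT loc_small4_def)
  ultimately show thesis using that[OF th] by blast
qed

text \<open>Equal boundaries fix the source and target functors of both parts, and through them the
  four categories, so the two cells differ at most in their components.\<close>

lemma CAT2_cell_eqI: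
  assumes "\<theta> \<in> Cell2 (CAT\<^sub>2 \<kappa>)" "\<eta> \<in> Cell2 (CAT\<^sub>2 \<kappa>)"
    and "src2 (CAT\<^sub>2 \<kappa>) \<theta> = src2 (CAT\<^sub>2 \<kappa>) \<eta>" "tgt2 (CAT\<^sub>2 \<kappa>) \<theta> = tgt2 (CAT\<^sub>2 \<kappa>) \<eta>"
    and "\<And>x. x \<in> Obj (FDom (sc_src \<theta>)) \<Longrightarrow> NAt (sc_total \<theta>) x = NAt (sc_total \<eta>) x"
    and "\<And>b. b \<in> Obj (FCod (sc_src \<theta>)) \<Longrightarrow> NAt (sc_base \<theta>) b = NAt (sc_base \<eta>) b"
  shows "\<theta> = \<eta>"
proof -
  obtain P E B Q F C \<beta> T T' \<alpha> S S'
    where th: "\<theta> = \<lparr>sc_src = P, sc_tgt = Q, sc_total = \<beta>, sc_base = \<alpha>\<rparr>"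
      and c: "cat_sqcell P E B Q F C \<beta> T T' \<alpha> S S'"
    by (rule Cell2_CAT2_E[OF assms(1)])
  obtain P2 E2 B2 Q2 F2 C2 \<beta>2 T2 T2' \<alpha>2 S2 S2'
    where et: "\<eta> = \<lparr>sc_src = P2, sc_tgt = Q2, sc_total = \<beta>2, sc_base = \<alpha>2\<rparr>"
      and c2: "cat_sqcell P2 E2 B2 Q2 F2 C2 \<beta>2 T2 T2' \<alpha>2 S2 S2'"
    by (rule Cell2_CAT2_E[OF assms(2)])
  interpret c: cat_sqcell P E B Q F C \<beta> T T' \<alpha> S S' by fact
  interpret c2: cat_sqcell P2 E2 B2 Q2 F2 C2 \<beta>2 T2 T2' \<alpha>2 S2 S2' by fact
  have e: "P2 = P" "Q2 = Q" "T2 = T" "S2 = S" "T2' = T'" "S2' = S'"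
    using assms(3,4) by (auto simp: th et sqcell_src_def sqcell_tgt_def)
  have e2: "E2 = E" "B2 = B" "F2 = F" "C2 = C"
    using e c.s.P.FDom_eq c.s.P.FCod_eq c.s.Q.FDom_eq c.s.Q.FCod_eq
      c2.s.P.FDom_eq c2.s.P.FCod_eq c2.s.Q.FDom_eq c2.s.Q.FCod_eq by simp_all
  have "\<beta> = \<beta>2"
    using c.total.cat_nattr_axioms c2.total.cat_nattr_axioms assms(5)
    unfolding e e2 by (intro cat_nattr_eqI) (auto simp: th et)
  moreover have "\<alpha> = \<alpha>2"
    using c.base.cat_nattr_axioms c2.base.cat_nattr_axioms assms(6)
    unfolding e e2 by (intro cat_nattr_eqI) (auto simp: th et)
  ultimately show ?thesis using e by (simp add: th et)
qed

section \<open>Comma categories\<close>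

lemma carr_sel [simp]:
  "carr_src (carr X Y f v) = X" "carr_tgt (carr X Y f v) = Y"
  "carr_top (carr X Y f v) = f" "carr_bot (carr X Y f v) = v"
  by (simp_all add: carr_def carr_src_def carr_tgt_def carr_top_def carr_bot_def)

lemma carr_inject [simp]:
  "carr X Y f v = carr X' Y' f' v' \<longleftrightarrow> X = X' \<and> Y = Y' \<and> f = f' \<and> v = v'"
  by (auto simp: carr_def)

lemma comma_sel [simp]:
  "Obj (comma P) = comma_obj P" "Arr (comma P) = comma_arr P"
  "p \<in> comma_arr P \<Longrightarrow> Dom (comma P) p = carr_src p"
  "p \<in> comma_arr P \<Longrightarrow> Cod (comma P) p = carr_tgt p"
  "X \<in> comma_obj P \<Longrightarrow>
    Ide (comma P) X = carr X X (Ide (FDom P) (lft X)) (Ide (FCod P) (Cod (FCod P) (rgt X)))"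
  "\<lbrakk>p \<in> comma_arr P; q \<in> comma_arr P; carr_tgt p = carr_src q\<rbrakk> \<Longrightarrow>
    q \<cdot>\<^bsub>comma P\<^esub> p = carr (carr_src p) (carr_tgt q)
      (carr_top q \<cdot>\<^bsub>FDom P\<^esub> carr_top p) (carr_bot q \<cdot>\<^bsub>FCod P\<^esub> carr_bot p)"
  by (simp_all add: comma_def)

lemma cod_fun_sel [simp]:
  "FDom (cod_fun P) = comma P" "FCod (cod_fun P) = FCod P"
  "X \<in> comma_obj P \<Longrightarrow> FOb (cod_fun P) X = Cod (FCod P) (rgt X)"
  "p \<in> comma_arr P \<Longrightarrow> FAr (cod_fun P) p = carr_bot p"
  by (simp_all add: cod_fun_def)

text \<open>A product with an infinite factor is no larger than the larger factor, and a product of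
  two finite sets is finite, hence below the infinite r.\<close>

lemma card_of_Times_ordLess_Cinfinite:
  assumes r: "Cinfinite r" and A: "|A| <o r" and B: "|B| <o r"
  shows "|A \<times> B| <o r"
proof -
  consider "finite A" "finite B" | "infinite A" "|B| \<le>o |A|" | "infinite B" "|A| \<le>o |B|"
    using ordLeq_total[OF card_of_Well_order[of A] card_of_Well_order[of B]] card_of_ordLeq_finite
    by metis
  then show ?thesis
  proof cases
    case 1
    then show ?thesis
      using r by (intro finite_ordLess_infinite)
        (auto simp: cinfinite_def Field_card_of card_of_well_order_on dest: card_order_on_well_order_on)
  next
    case 2
    then have "|A \<times> B| \<le>o |A|" by (intro card_of_Times_ordLeq_infinite_Field) (simp_all add: Field_card_of card_of_card_order_on card_of_mono1)
    then show ?thesis using A ordLeq_ordLess_trans by blast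
  next
    case 3
    then have "|A \<times> B| \<le>o |B|" by (intro card_of_Times_ordLeq_infinite_Field) (simp_all add: Field_card_of card_of_card_order_on card_of_mono1)
    then show ?thesis using B ordLeq_ordLess_trans by blast
  qed
qed

locale comma_cat = cat_functor P E B for P :: "'a univ fnctr" and E B
begin

lemma comma_obj_iff [simp]:
  "\<langle>x, u\<rangle> \<in> comma_obj P \<longleftrightarrow> x \<in> Obj E \<and> u \<in> Arr B \<and> Dom B u = FOb P x"
  by (simp add: comma_obj_def)

lemma comma_arr_iff [simp]:
  "carr \<langle>x, u\<rangle> \<langle>y, w\<rangle> f v \<in> comma_arr P \<longleftrightarrow>
    x \<in> Obj E \<and> u \<in> Arr B \<and> Dom B u = FOb P x \<and> y \<in> Obj E \<and> w \<in> Arr B \<and> Dom B w = FOb P y \<and>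
    f \<in> Arr E \<and> Dom E f = x \<and> Cod E f = y \<and>
    v \<in> Arr B \<and> Dom B v = Cod B u \<and> Cod B v = Cod B w \<and> v \<cdot>\<^bsub>B\<^esub> u = w \<cdot>\<^bsub>B\<^esub> FAr P f"
  by (auto simp: comma_arr_def)

lemma comma_objE:
  assumes "X \<in> comma_obj P"
  obtains x u where "X = \<langle>x, u\<rangle>" "x \<in> Obj E" "u \<in> Arr B" "Dom B u = FOb P x"
  using assms by (auto simp: comma_obj_def)

lemma comma_obj_parts:
  assumes "X \<in> comma_obj P"
  shows "lft X \<in> Obj E" "rgt X \<in> Arr B" "Dom B (rgt X) = FOb P (lft X)"
  by (rule comma_objE[OF assms], simp)+

lemma comma_arrE:
  assumes "p \<in> comma_arr P"
  obtains f v u w where "p = carr \<langle>Dom E f, u\<rangle> \<langle>Cod E f, w\<rangle> f v"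
    "f \<in> Arr E" "u \<in> Arr B" "Dom B u = FOb P (Dom E f)" "w \<in> Arr B" "Dom B w = FOb P (Cod E f)"
    "v \<in> Arr B" "Dom B v = Cod B u" "Cod B v = Cod B w" "v \<cdot>\<^bsub>B\<^esub> u = w \<cdot>\<^bsub>B\<^esub> FAr P f"
  using assms by (auto simp: comma_arr_def)

lemma carr_obj:
  assumes "p \<in> comma_arr P" shows "carr_src p \<in> comma_obj P" "carr_tgt p \<in> comma_obj P"
  by (rule comma_arrE[OF assms], simp)+

lemma carr_eta:
  assumes "p \<in> comma_arr P"
  shows "carr (carr_src p) (carr_tgt p) (carr_top p) (carr_bot p) = p"
  by (rule comma_arrE[OF assms], simp)

lemma carr_parts:
  assumes "p \<in> comma_arr P"
  shows "carr_top p \<in> Arr E" "Dom E (carr_top p) = lft (carr_src p)" "Cod E (carr_top p) = lft (carr_tgt p)"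
    "carr_bot p \<in> Arr B" "Dom B (carr_bot p) = Cod B (rgt (carr_src p))"
    "Cod B (carr_bot p) = Cod B (rgt (carr_tgt p))"
  using assms by (auto elim: comma_arrE)

lemma comma_comp_arr:
  assumes "p \<in> comma_arr P" "q \<in> comma_arr P" "carr_tgt p = carr_src q"
  shows "carr (carr_src p) (carr_tgt q) (carr_top q \<cdot>\<^bsub>E\<^esub> carr_top p) (carr_bot q \<cdot>\<^bsub>B\<^esub> carr_bot p)
    \<in> comma_arr P"
  using assms(1)
proof (rule comma_arrE)
  fix f v u w
  assume p: "p = carr \<langle>Dom E f, u\<rangle> \<langle>Cod E f, w\<rangle> f v"
    "f \<in> Arr E" "u \<in> Arr B" "Dom B u = FOb P (Dom E f)" "w \<in> Arr B" "Dom B w = FOb P (Cod E f)"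
    "v \<in> Arr B" "Dom B v = Cod B u" "Cod B v = Cod B w" "v \<cdot>\<^bsub>B\<^esub> u = w \<cdot>\<^bsub>B\<^esub> FAr P f"
  obtain f' v' u' w' where q: "q = carr \<langle>Dom E f', u'\<rangle> \<langle>Cod E f', w'\<rangle> f' v'"
    "f' \<in> Arr E" "u' \<in> Arr B" "Dom B u' = FOb P (Dom E f')" "w' \<in> Arr B" "Dom B w' = FOb P (Cod E f')"
    "v' \<in> Arr B" "Dom B v' = Cod B u'" "Cod B v' = Cod B w'" "v' \<cdot>\<^bsub>B\<^esub> u' = w' \<cdot>\<^bsub>B\<^esub> FAr P f'"
    by (rule comma_arrE[OF assms(2)])
  have e: "Cod E f = Dom E f'" "w = u'" using assms(3) p(1) q(1) by simp_all
  have "v' \<cdot>\<^bsub>B\<^esub> (v \<cdot>\<^bsub>B\<^esub> u) = (v' \<cdot>\<^bsub>B\<^esub> u') \<cdot>\<^bsub>B\<^esub> FAr P f"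
    unfolding p(10) using p(2-9) q(2-9) e by simp
  also have "\<dots> = w' \<cdot>\<^bsub>B\<^esub> (FAr P f' \<cdot>\<^bsub>B\<^esub> FAr P f)"
    unfolding q(10) using p(2-) q(2-) e by simp
  finally show ?thesis using p q e by simp
qed

lemma comma_category: "category (comma P)"
proof
  show "Dom (comma P) \<in> Arr (comma P) \<rightarrow>\<^sub>E Obj (comma P)" "Cod (comma P) \<in> Arr (comma P) \<rightarrow>\<^sub>E Obj (comma P)"
    using carr_obj by (auto simp: comma_def)
  show "Ide (comma P) \<in> extensional (Obj (comma P))" by (simp add: comma_def)
  fix p q
  assume "\<not> (p \<in> Arr (comma P) \<and> q \<in> Arr (comma P) \<and> Cod (comma P) p = Dom (comma P) q)"
  then show "q \<cdot>\<^bsub>comma P\<^esub> p = undefined" by (auto simp: comma_def)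
next
  fix X assume "X \<in> Obj (comma P)"
  then have "X \<in> comma_obj P" by simp
  then show "Ide (comma P) X \<in> hom (comma P) X X" by (rule comma_objE) simp
next
  fix p q
  assume "p \<in> Arr (comma P)" "q \<in> Arr (comma P)" "Cod (comma P) p = Dom (comma P) q"
  then show "q \<cdot>\<^bsub>comma P\<^esub> p \<in> hom (comma P) (Dom (comma P) p) (Cod (comma P) q)"
    using comma_comp_arr[of p q] by simp
next
  fix p assume p: "p \<in> Arr (comma P)"
  then have "p \<in> comma_arr P" by simp
  then obtain f v u w where e: "p = carr \<langle>Dom E f, u\<rangle> \<langle>Cod E f, w\<rangle> f v"
    "f \<in> Arr E" "u \<in> Arr B" "Dom B u = FOb P (Dom E f)" "w \<in> Arr B" "Dom B w = FOb P (Cod E f)"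
    "v \<in> Arr B" "Dom B v = Cod B u" "Cod B v = Cod B w" "v \<cdot>\<^bsub>B\<^esub> u = w \<cdot>\<^bsub>B\<^esub> FAr P f"
    by (rule comma_arrE)
  show "p \<cdot>\<^bsub>comma P\<^esub> Ide (comma P) (Dom (comma P) p) = p"
    "Ide (comma P) (Cod (comma P) p) \<cdot>\<^bsub>comma P\<^esub> p = p"
    unfolding e(1) using e(2-) by simp_all
next
  fix p q r
  assume h: "p \<in> Arr (comma P)" "q \<in> Arr (comma P)" "r \<in> Arr (comma P)"
    "Cod (comma P) p = Dom (comma P) q" "Cod (comma P) q = Dom (comma P) r"
  then show "r \<cdot>\<^bsub>comma P\<^esub> (q \<cdot>\<^bsub>comma P\<^esub> p) = (r \<cdot>\<^bsub>comma P\<^esub> q) \<cdot>\<^bsub>comma P\<^esub> p"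
    using comma_comp_arr[of p q] comma_comp_arr[of q r]
    by (simp add: carr_parts)
qed

lemma cod_functor: "cat_functor (cod_fun P) (comma P) B"
  by (rule cat_functorI[OF comma_category B.category_axioms])
    (auto simp: comma_comp_arr carr_parts carr_obj elim: comma_objE, auto simp: cod_fun_def)

text \<open>Once source and target are fixed, an arrow is determined by its two legs, so the hom-set
  is covered by a product of one hom-set of E and one of B. The infinity of \<kappa> enters through
  the cardinality of this product.\<close>

lemma comma_locally_small:
  assumes \<kappa>: "Cinfinite \<kappa>" and E: "locally_small \<kappa> E" and B: "locally_small \<kappa> B"
  shows "locally_small \<kappa> (comma P)"
  unfolding locally_small_def
proof (intro ballI)
  fix X Y assume XY: "X \<in> Obj (comma P)" "Y \<in> Obj (comma P)"
  obtain x u where X: "X = \<langle>x, u\<rangle>" "x \<in> Obj E" "u \<in> Arr B" using XY by (auto elim: comma_objE)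
  obtain y w where Y: "Y = \<langle>y, w\<rangle>" "y \<in> Obj E" "w \<in> Arr B" using XY by (auto elim: comma_objE)
  let ?H = "hom E x y \<times> hom B (Cod B u) (Cod B w)"
  have "p \<in> (\<lambda>(f, v). carr X Y f v) ` ?H" if "p \<in> hom (comma P) X Y" for p
    using that X Y carr_eta[of p]
    by (intro image_eqI[of _ _ "(carr_top p, carr_bot p)"]) (auto simp: carr_parts)
  then have "hom (comma P) X Y \<subseteq> (\<lambda>(f, v). carr X Y f v) ` ?H" by blast
  then have "|hom (comma P) X Y| \<le>o |?H|"
    by (rule surj_imp_ordLeq)
  moreover have "|hom E x y| <o \<kappa>" "|hom B (Cod B u) (Cod B w)| <o \<kappa>"
    using E B X Y by (auto simp: locally_small_def)
  then have "|?H| <o \<kappa>"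
    by (rule card_of_Times_ordLess_Cinfinite[OF \<kappa>])
  ultimately show "|hom (comma P) X Y| <o \<kappa>" by (rule ordLeq_ordLess_trans)
qed

end

section \<open>The functors and transformations that make up the comma 2-monad\<close>

lemma comma_map_sel [simp]:
  "FDom (comma_map s) = comma (sq_src s)" "FCod (comma_map s) = comma (sq_tgt s)"
  "X \<in> comma_obj (sq_src s) \<Longrightarrow> FOb (comma_map s) X = \<langle>FOb (sq_total s) (lft X), FAr (sq_base s) (rgt X)\<rangle>"
  "p \<in> comma_arr (sq_src s) \<Longrightarrow> FAr (comma_map s) p =
    carr (comma_map_ob s (carr_src p)) (comma_map_ob s (carr_tgt p))
      (FAr (sq_total s) (carr_top p)) (FAr (sq_base s) (carr_bot p))"
  by (simp_all add: comma_map_def comma_map_ob_def)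

lemma comma_map_ob_Pr [simp]:
  "comma_map_ob s \<langle>x, u\<rangle> = \<langle>FOb (sq_total s) x, FAr (sq_base s) u\<rangle>"
  by (simp add: comma_map_ob_def)

lemma comma_map_ext:
  "FOb (comma_map s) \<in> extensional (comma_obj (sq_src s))"
  "FAr (comma_map s) \<in> extensional (comma_arr (sq_src s))"
  by (simp_all add: comma_map_def)

lemma comma_unit_fun_sel [simp]:
  "FDom (comma_unit_fun P) = FDom P" "FCod (comma_unit_fun P) = comma P"
  "x \<in> Obj (FDom P) \<Longrightarrow> FOb (comma_unit_fun P) x = \<langle>x, Ide (FCod P) (FOb P x)\<rangle>"
  "f \<in> Arr (FDom P) \<Longrightarrow> FAr (comma_unit_fun P) f =
    carr \<langle>Dom (FDom P) f, Ide (FCod P) (FOb P (Dom (FDom P) f))\<rangle>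
      \<langle>Cod (FDom P) f, Ide (FCod P) (FOb P (Cod (FDom P) f))\<rangle> f (FAr P f)"
  by (simp_all add: comma_unit_fun_def)

lemma comma_unit_fun_ext:
  "FOb (comma_unit_fun P) \<in> extensional (Obj (FDom P))"
  "FAr (comma_unit_fun P) \<in> extensional (Arr (FDom P))"
  by (simp_all add: comma_unit_fun_def)

lemma comma_mult_fun_sel [simp]:
  "FDom (comma_mult_fun P) = comma (cod_fun P)" "FCod (comma_mult_fun P) = comma P"
  "Z \<in> comma_obj (cod_fun P) \<Longrightarrow>
    FOb (comma_mult_fun P) Z = \<langle>lft (lft Z), rgt Z \<cdot>\<^bsub>FCod P\<^esub> rgt (lft Z)\<rangle>"
  "p \<in> comma_arr (cod_fun P) \<Longrightarrow> FAr (comma_mult_fun P) p =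
    carr \<langle>lft (lft (carr_src p)), rgt (carr_src p) \<cdot>\<^bsub>FCod P\<^esub> rgt (lft (carr_src p))\<rangle>
      \<langle>lft (lft (carr_tgt p)), rgt (carr_tgt p) \<cdot>\<^bsub>FCod P\<^esub> rgt (lft (carr_tgt p))\<rangle>
      (carr_top (carr_top p)) (carr_bot p)"
  by (simp_all add: comma_mult_fun_def)

lemma comma_mult_fun_ext:
  "FOb (comma_mult_fun P) \<in> extensional (comma_obj (cod_fun P))"
  "FAr (comma_mult_fun P) \<in> extensional (comma_arr (cod_fun P))"
  by (simp_all add: comma_mult_fun_def)

context comma_cat
begin

lemma comma_cat_cod: "comma_cat (cod_fun P) (comma P) B"
  by (simp add: comma_cat_def cod_functor)

lemma unit_functor: "cat_functor (comma_unit_fun P) E (comma P)"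
  by (rule cat_functorI[OF A.category_axioms comma_category])
    (use comma_unit_fun_ext[of P] in simp_all)

end

text \<open>A copy of \<open>comma_cat\<close> in which the construction is available twice. As a
  sublocale declaration of \<open>comma_cat\<close> itself, the passage from P to
  \<open>cod_fun P\<close> would repeat without end.\<close>

locale comma_cat2 = comma_cat P E B for P :: "'a univ fnctr" and E B

sublocale comma_cat2 \<subseteq> c: comma_cat "cod_fun P" "comma P" B
  by (rule comma_cat_cod)

context comma_cat2
begin

lemma comma2_objE:
  assumes "Z \<in> comma_obj (cod_fun P)"
  obtains x u v where "Z = \<langle>\<langle>x, u\<rangle>, v\<rangle>" "x \<in> Obj E" "u \<in> Arr B" "Dom B u = FOb P x"
    "v \<in> Arr B" "Dom B v = Cod B u"
proof -
  obtain X v where Z: "Z = \<langle>X, v\<rangle>" "X \<in> Obj (comma P)" "v \<in> Arr B" "Dom B v = FOb (cod_fun P) X"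
    by (rule c.comma_objE[OF assms])
  from Z(2) have "X \<in> comma_obj P" by simp
  then obtain x u where X: "X = \<langle>x, u\<rangle>" "x \<in> Obj E" "u \<in> Arr B" "Dom B u = FOb P x"
    by (rule comma_objE)
  show thesis using that[of x u v] Z X by simp
qed

text \<open>The top leg of an arrow of the double comma category is itself an arrow of
  \<open>comma P\<close>. Flattening it exposes the two stacked commuting squares, one over f and
  one on top of v.\<close>

lemma comma2_arrE:
  assumes "p \<in> comma_arr (cod_fun P)"
  obtains f v u w V W r where
    "p = carr \<langle>\<langle>Dom E f, u\<rangle>, V\<rangle> \<langle>\<langle>Cod E f, w\<rangle>, W\<rangle> (carr \<langle>Dom E f, u\<rangle> \<langle>Cod E f, w\<rangle> f v) r"
    "f \<in> Arr E" "u \<in> Arr B" "Dom B u = FOb P (Dom E f)" "w \<in> Arr B" "Dom B w = FOb P (Cod E f)"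
    "v \<in> Arr B" "Dom B v = Cod B u" "Cod B v = Cod B w" "v \<cdot>\<^bsub>B\<^esub> u = w \<cdot>\<^bsub>B\<^esub> FAr P f"
    "V \<in> Arr B" "Dom B V = Cod B u" "W \<in> Arr B" "Dom B W = Cod B w" "r \<in> Arr B"
    "Dom B r = Cod B V" "Cod B r = Cod B W" "r \<cdot>\<^bsub>B\<^esub> V = W \<cdot>\<^bsub>B\<^esub> v"
proof -
  obtain q r V W where p: "p = carr \<langle>Dom (comma P) q, V\<rangle> \<langle>Cod (comma P) q, W\<rangle> q r"
    "q \<in> Arr (comma P)" "V \<in> Arr B" "Dom B V = FOb (cod_fun P) (Dom (comma P) q)"
    "W \<in> Arr B" "Dom B W = FOb (cod_fun P) (Cod (comma P) q)"
    "r \<in> Arr B" "Dom B r = Cod B V" "Cod B r = Cod B W" "r \<cdot>\<^bsub>B\<^esub> V = W \<cdot>\<^bsub>B\<^esub> FAr (cod_fun P) q"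
    by (rule c.comma_arrE[OF assms])
  from p(2) have "q \<in> comma_arr P" by simp
  then obtain f v u w where q: "q = carr \<langle>Dom E f, u\<rangle> \<langle>Cod E f, w\<rangle> f v"
    "f \<in> Arr E" "u \<in> Arr B" "Dom B u = FOb P (Dom E f)" "w \<in> Arr B" "Dom B w = FOb P (Cod E f)"
    "v \<in> Arr B" "Dom B v = Cod B u" "Cod B v = Cod B w" "v \<cdot>\<^bsub>B\<^esub> u = w \<cdot>\<^bsub>B\<^esub> FAr P f"
    by (rule comma_arrE)
  show thesis
    using p(3-) unfolding q(1) by (intro that[OF _ q(2-), of V W r]) (use q(2-) p(1) in \<open>simp_all add: q(1)\<close>)
qed

lemma mult_fun_arr:
  assumes "p \<in> comma_arr (cod_fun P)"
  shows "FAr (comma_mult_fun P) p \<in> comma_arr P"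
proof (rule comma2_arrE[OF assms])
  fix f v u w V W r
  assume q: "p = carr \<langle>\<langle>Dom E f, u\<rangle>, V\<rangle> \<langle>\<langle>Cod E f, w\<rangle>, W\<rangle> (carr \<langle>Dom E f, u\<rangle> \<langle>Cod E f, w\<rangle> f v) r"
    "f \<in> Arr E" "u \<in> Arr B" "Dom B u = FOb P (Dom E f)" "w \<in> Arr B" "Dom B w = FOb P (Cod E f)"
    "v \<in> Arr B" "Dom B v = Cod B u" "Cod B v = Cod B w" "v \<cdot>\<^bsub>B\<^esub> u = w \<cdot>\<^bsub>B\<^esub> FAr P f"
    "V \<in> Arr B" "Dom B V = Cod B u" "W \<in> Arr B" "Dom B W = Cod B w" "r \<in> Arr B"
    "Dom B r = Cod B V" "Cod B r = Cod B W" "r \<cdot>\<^bsub>B\<^esub> V = W \<cdot>\<^bsub>B\<^esub> v"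
  \<comment> \<open>The square required for the composites \<open>V u\<close> and \<open>W w\<close>
    is the vertical pasting of the two squares of p.\<close>
  have "r \<cdot>\<^bsub>B\<^esub> (V \<cdot>\<^bsub>B\<^esub> u) = W \<cdot>\<^bsub>B\<^esub> (w \<cdot>\<^bsub>B\<^esub> FAr P f)"
    using B.Comp_reassoc[OF q(18)] q(2-17) by simp
  then show ?thesis
    using assms unfolding q(1) using q(2-) by simp
qed

lemma mult_functor: "cat_functor (comma_mult_fun P) (comma (cod_fun P)) (comma P)"
proof (rule cat_functorI[OF c.comma_category comma_category])
  fix Z assume "Z \<in> Obj (comma (cod_fun P))"
  then have "Z \<in> comma_obj (cod_fun P)" by simp
  then obtain X v where Z: "Z = \<langle>X, v\<rangle>" "X \<in> Obj (comma P)" "v \<in> Arr B" "Dom B v = FOb (cod_fun P) X"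
    by (rule c.comma_objE)
  from Z(2) have "X \<in> comma_obj P" by simp
  then obtain x u where X: "X = \<langle>x, u\<rangle>" "x \<in> Obj E" "u \<in> Arr B" "Dom B u = FOb P x"
    by (rule comma_objE)
  show "FOb (comma_mult_fun P) Z \<in> Obj (comma P)"
    "FAr (comma_mult_fun P) (Ide (comma (cod_fun P)) Z) = Ide (comma P) (FOb (comma_mult_fun P) Z)"
    using Z X by simp_all
next
  fix p assume "p \<in> Arr (comma (cod_fun P))"
  then show "FAr (comma_mult_fun P) p \<in> hom (comma P)
      (FOb (comma_mult_fun P) (Dom (comma (cod_fun P)) p)) (FOb (comma_mult_fun P) (Cod (comma (cod_fun P)) p))"
    using mult_fun_arr[of p] by (simp add: c.carr_obj)
next
  fix p q assume "p \<in> Arr (comma (cod_fun P))" "q \<in> Arr (comma (cod_fun P))"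
    "Cod (comma (cod_fun P)) p = Dom (comma (cod_fun P)) q"
  then have pq: "p \<in> comma_arr (cod_fun P)" "q \<in> comma_arr (cod_fun P)" "carr_tgt p = carr_src q"
    by simp_all
  then show "FAr (comma_mult_fun P) (q \<cdot>\<^bsub>comma (cod_fun P)\<^esub> p) =
    FAr (comma_mult_fun P) q \<cdot>\<^bsub>comma P\<^esub> FAr (comma_mult_fun P) p"
    using mult_fun_arr[OF pq(1)] mult_fun_arr[OF pq(2)] c.comma_comp_arr[OF pq]
      c.carr_parts[OF pq(1), simplified] c.carr_parts[OF pq(2), simplified]
    by simp
qed (use comma_mult_fun_ext[of P] in simp_all)

end

locale comma_square = cat_square P E B Q F C T S
  for P :: "'a univ fnctr" and E B and Q :: "'a univ fnctr" and F C T S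

sublocale comma_square \<subseteq> P: comma_cat2 P E B by unfold_locales
sublocale comma_square \<subseteq> Q: comma_cat2 Q F C by unfold_locales

context comma_square
begin

abbreviation "sq \<equiv> \<lparr>sq_src = P, sq_tgt = Q, sq_total = T, sq_base = S\<rparr>"

lemma comma_map_arr:
  assumes "q \<in> comma_arr P"
  shows "FAr (comma_map sq) q \<in> comma_arr Q"
proof -
  obtain f v u w where q: "q = carr \<langle>Dom E f, u\<rangle> \<langle>Cod E f, w\<rangle> f v"
    "f \<in> Arr E" "u \<in> Arr B" "Dom B u = FOb P (Dom E f)" "w \<in> Arr B" "Dom B w = FOb P (Cod E f)"
    "v \<in> Arr B" "Dom B v = Cod B u" "Cod B v = Cod B w" "v \<cdot>\<^bsub>B\<^esub> u = w \<cdot>\<^bsub>B\<^esub> FAr P f"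
    by (rule P.comma_arrE[OF assms])
  have "FAr S v \<cdot>\<^bsub>C\<^esub> FAr S u = FAr S w \<cdot>\<^bsub>C\<^esub> FAr S (FAr P f)"
    using q(2-9) arg_cong[OF q(10), of "FAr S"] by simp
  then show ?thesis
    using assms unfolding q(1) using q(2-) by simp
qed

lemma comma_map_functor: "cat_functor (comma_map sq) (comma P) (comma Q)"
proof (rule cat_functorI[OF P.comma_category Q.comma_category])
  fix X assume "X \<in> Obj (comma P)"
  then have "X \<in> comma_obj P" by simp
  then obtain x u where X: "X = \<langle>x, u\<rangle>" "x \<in> Obj E" "u \<in> Arr B" "Dom B u = FOb P x"
    by (rule P.comma_objE)
  then show "FOb (comma_map sq) X \<in> Obj (comma Q)"
    "FAr (comma_map sq) (Ide (comma P) X) = Ide (comma Q) (FOb (comma_map sq) X)" by simp_all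
next
  fix q assume "q \<in> Arr (comma P)"
  then show "FAr (comma_map sq) q \<in> hom (comma Q) (FOb (comma_map sq) (Dom (comma P) q)) (FOb (comma_map sq) (Cod (comma P) q))"
    using comma_map_arr[of q] by (simp add: P.carr_obj comma_map_ob_def)
next
  fix p q assume "p \<in> Arr (comma P)" "q \<in> Arr (comma P)" "Cod (comma P) p = Dom (comma P) q"
  then have pq: "p \<in> comma_arr P" "q \<in> comma_arr P" "carr_tgt p = carr_src q" by simp_all
  then show "FAr (comma_map sq) (q \<cdot>\<^bsub>comma P\<^esub> p) = FAr (comma_map sq) q \<cdot>\<^bsub>comma Q\<^esub> FAr (comma_map sq) p"
    using comma_map_arr[OF pq(1)] comma_map_arr[OF pq(2)] P.comma_comp_arr[OF pq]
    by (simp add: P.carr_parts)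
qed (use comma_map_ext[of sq] in simp_all)

lemma cod_square: "cat_square (cod_fun P) (comma P) B (cod_fun Q) (comma Q) C (comma_map sq) S"
proof -
  interpret cP: cat_functor "cod_fun P" "comma P" B by (rule P.cod_functor)
  interpret cQ: cat_functor "cod_fun Q" "comma Q" C by (rule Q.cod_functor)
  interpret M: cat_functor "comma_map sq" "comma P" "comma Q" by (rule comma_map_functor)
  show ?thesis
  proof
    fix X assume "X \<in> Obj (comma P)"
    then have X: "X \<in> comma_obj P" by simp
    then show "FOb (cod_fun Q) (FOb (comma_map sq) X) = FOb S (FOb (cod_fun P) X)"
      by (rule P.comma_objE) simp
  next
    fix p assume "p \<in> Arr (comma P)"
    then show "FAr (cod_fun Q) (FAr (comma_map sq) p) = FAr S (FAr (cod_fun P) p)"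
      using comma_map_arr[of p] by simp
  qed
qed

text \<open>Returns the image square to the locale it came from, so that the monad can be applied to
  a square repeatedly by further interpretations.\<close>

lemma cod_comma_square: "comma_square (cod_fun P) (comma P) B (cod_fun Q) (comma Q) C (comma_map sq) S"
  by (simp add: comma_square_def cod_square)

end

context comma_cat2
begin

lemma unit_square: "cat_square P E B (cod_fun P) (comma P) B (comma_unit_fun P) (fun_one B)"
proof -
  interpret cP: cat_functor "cod_fun P" "comma P" B by (rule cod_functor)
  interpret U: cat_functor "comma_unit_fun P" E "comma P" by (rule unit_functor)
  interpret I: cat_functor "fun_one B" B B by (rule cat_functor_one[OF B.category_axioms])
  show ?thesis by unfold_locales simp_all
qed

lemma mult_square:
  "cat_square (cod_fun (cod_fun P)) (comma (cod_fun P)) B (cod_fun P) (comma P) B (comma_mult_fun P) (fun_one B)"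
proof -
  interpret cP: cat_functor "cod_fun P" "comma P" B by (rule cod_functor)
  interpret ccP: cat_functor "cod_fun (cod_fun P)" "comma (cod_fun P)" B by (rule c.cod_functor)
  interpret M: cat_functor "comma_mult_fun P" "comma (cod_fun P)" "comma P" by (rule mult_functor)
  interpret I: cat_functor "fun_one B" B B by (rule cat_functor_one[OF B.category_axioms])
  show ?thesis
  proof
    fix Z assume "Z \<in> Obj (comma (cod_fun P))"
    then have Z: "Z \<in> comma_obj (cod_fun P)" by simp
    from Z show "FOb (cod_fun P) (FOb (comma_mult_fun P) Z) = FOb (fun_one B) (FOb (cod_fun (cod_fun P)) Z)"
    proof (rule c.comma_objE)
      fix X v assume h: "Z = \<langle>X, v\<rangle>" "X \<in> Obj (comma P)" "v \<in> Arr B" "Dom B v = FOb (cod_fun P) X"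
      then have "X \<in> comma_obj P" by simp
      then show ?thesis
        by (rule comma_objE) (use Z h M.FOb_Obj[of Z] in simp)
    qed
  next
    fix p assume "p \<in> Arr (comma (cod_fun P))"
    then show "FAr (cod_fun P) (FAr (comma_mult_fun P) p) = FAr (fun_one B) (FAr (cod_fun (cod_fun P)) p)"
      using mult_fun_arr[of p] by (simp add: c.carr_parts)
  qed
qed

end

lemma comma_cell_sel [simp]:
  "NSrc (comma_cell \<kappa> \<theta>) = comma_map (sqcell_src (CAT \<kappa>) \<theta>)"
  "NTgt (comma_cell \<kappa> \<theta>) = comma_map (sqcell_tgt (CAT \<kappa>) \<theta>)"
  "X \<in> comma_obj (sc_src \<theta>) \<Longrightarrow> NAt (comma_cell \<kappa> \<theta>) X =
    carr (comma_map_ob (sqcell_src (CAT \<kappa>) \<theta>) X) (comma_map_ob (sqcell_tgt (CAT \<kappa>) \<theta>) X)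
      (NAt (sc_total \<theta>) (lft X)) (NAt (sc_base \<theta>) (Cod (FCod (sc_src \<theta>)) (rgt X)))"
  by (simp_all add: comma_cell_def Let_def)

lemma comma_cell_ext: "NAt (comma_cell \<kappa> \<theta>) \<in> extensional (comma_obj (sc_src \<theta>))"
  by (simp add: comma_cell_def Let_def)

locale comma_sqcell = cat_sqcell P E B Q F C \<beta> T T' \<alpha> S S'
  for P :: "'a univ fnctr" and E B and Q :: "'a univ fnctr" and F C \<beta> T T' \<alpha> S S'

sublocale comma_sqcell \<subseteq> s: comma_square P E B Q F C T S by unfold_locales
sublocale comma_sqcell \<subseteq> t: comma_square P E B Q F C T' S' by unfold_locales

context comma_sqcell
begin

abbreviation "sqc \<equiv> \<lparr>sc_src = P, sc_tgt = Q, sc_total = \<beta>, sc_base = \<alpha>\<rparr>"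

lemma sqc_src: "sqcell_src (CAT \<kappa>) sqc = s.sq" "sqcell_tgt (CAT \<kappa>) sqc = t.sq"
  by (simp_all add: sqcell_src_def sqcell_tgt_def)

text \<open>That the component at \<open>\<langle>x, u\<rangle>\<close> is an arrow of the comma
  category is naturality of the base cell at u, combined with the fact that the total cell lies over
  it. Naturality is then that of the two legs.\<close>

lemma comma_cell_nattr:
  "cat_nattr (comma_cell \<kappa> sqc) (comma_map s.sq) (comma_map t.sq) (comma P) (comma Q)"
proof (rule cat_nattrI[OF s.comma_map_functor t.comma_map_functor])
  have ob: "NAt (comma_cell \<kappa> sqc) X \<in> comma_arr Q" if "X \<in> comma_obj P" for X
  proof -
    obtain x u where X: "X = \<langle>x, u\<rangle>" "x \<in> Obj E" "u \<in> Arr B" "Dom B u = FOb P x"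
      by (rule s.P.comma_objE[OF \<open>X \<in> comma_obj P\<close>])
    show ?thesis using that unfolding X using X base.natural[of u] by (simp add: sqc_src)
  qed
  show "NAt (comma_cell \<kappa> sqc) X \<in> hom (comma Q) (FOb (comma_map s.sq) X) (FOb (comma_map t.sq) X)"
    if "X \<in> Obj (comma P)" for X
    using that ob[of X] by (simp add: sqc_src comma_map_ob_def)
  show "NAt (comma_cell \<kappa> sqc) (Cod (comma P) p) \<cdot>\<^bsub>comma Q\<^esub> FAr (comma_map s.sq) p =
    FAr (comma_map t.sq) p \<cdot>\<^bsub>comma Q\<^esub> NAt (comma_cell \<kappa> sqc) (Dom (comma P) p)"
    if "p \<in> Arr (comma P)" for p
  proof -
    have p: "p \<in> comma_arr P" using that by simp
    show ?thesis
      using p s.comma_map_arr[OF p] t.comma_map_arr[OF p] ob[of "carr_src p"] ob[of "carr_tgt p"]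
        s.P.carr_obj[OF p] s.P.carr_parts[OF p]
        total.natural[of "carr_top p"] base.natural[of "carr_bot p"]
      by (simp add: sqc_src comma_map_ob_def)
  qed
qed (use comma_cell_ext[of \<kappa> sqc] in \<open>simp_all add: sqc_src\<close>)

lemma cod_sqcell: "cat_sqcell (cod_fun P) (comma P) B (cod_fun Q) (comma Q) C
  (comma_cell \<kappa> sqc) (comma_map s.sq) (comma_map t.sq) \<alpha> S S'"
proof -
  interpret cs: cat_square "cod_fun P" "comma P" B "cod_fun Q" "comma Q" C "comma_map s.sq" S
    by (rule s.cod_square)
  interpret ct: cat_square "cod_fun P" "comma P" B "cod_fun Q" "comma Q" C "comma_map t.sq" S'
    by (rule t.cod_square)
  interpret cc: cat_nattr "comma_cell \<kappa> sqc" "comma_map s.sq" "comma_map t.sq" "comma P" "comma Q"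
    by (rule comma_cell_nattr)
  show ?thesis
  proof
    fix X assume "X \<in> Obj (comma P)"
    then show "FAr (cod_fun Q) (NAt (comma_cell \<kappa> sqc) X) = NAt \<alpha> (FOb (cod_fun P) X)"
      using cc.NAt_Arr(1)[of X] by simp
  qed
qed

end

lemma comma_monad_sel [simp]:
  "F0 (comma_monad \<kappa>) = cod_fun"
  "sq_src (F1 (comma_monad \<kappa>) s) = cod_fun (sq_src s)" "sq_tgt (F1 (comma_monad \<kappa>) s) = cod_fun (sq_tgt s)"
  "sq_total (F1 (comma_monad \<kappa>) s) = comma_map s" "sq_base (F1 (comma_monad \<kappa>) s) = sq_base s"
  "sc_src (F2 (comma_monad \<kappa>) \<theta>) = cod_fun (sc_src \<theta>)" "sc_tgt (F2 (comma_monad \<kappa>) \<theta>) = cod_fun (sc_tgt \<theta>)"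
  "sc_total (F2 (comma_monad \<kappa>) \<theta>) = comma_cell \<kappa> \<theta>" "sc_base (F2 (comma_monad \<kappa>) \<theta>) = sc_base \<theta>"
  "sq_src (unit (comma_monad \<kappa>) P) = P" "sq_tgt (unit (comma_monad \<kappa>) P) = cod_fun P"
  "sq_total (unit (comma_monad \<kappa>) P) = comma_unit_fun P" "sq_base (unit (comma_monad \<kappa>) P) = fun_one (FCod P)"
  "sq_src (mult (comma_monad \<kappa>) P) = cod_fun (cod_fun P)" "sq_tgt (mult (comma_monad \<kappa>) P) = cod_fun P"
  "sq_total (mult (comma_monad \<kappa>) P) = comma_mult_fun P" "sq_base (mult (comma_monad \<kappa>) P) = fun_one (FCod P)"
  by (simp_all add: comma_monad_def)

text \<open>When a cell is glued to one that has been taken apart already, the shared boundary must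
  carry the old names. This rule and the next two take a cell apart while keeping them.\<close>

lemma Cell1_CAT2_E':
  assumes "s \<in> Cell1 (CAT\<^sub>2 \<kappa>)" "sq_src s = P" "cat_functor P E B"
  obtains Q F C T S where "s = \<lparr>sq_src = P, sq_tgt = Q, sq_total = T, sq_base = S\<rparr>"
    "cat_square P E B Q F C T S" "loc_small4 \<kappa> E B F C"
proof -
  obtain P' E' B' Q F C T S where s: "s = \<lparr>sq_src = P', sq_tgt = Q, sq_total = T, sq_base = S\<rparr>"
    "cat_square P' E' B' Q F C T S" "loc_small4 \<kappa> E' B' F C"
    by (rule Cell1_CAT2_E[OF assms(1)])
  interpret s: cat_square P' E' B' Q F C T S by fact
  interpret P: cat_functor P E B by fact
  have "P' = P" "E' = E" "B' = B" using assms(2) s(1) s.P.FDom_eq s.P.FCod_eq by auto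
  then show thesis using that s by simp
qed

lemma Cell2_CAT2_E':
  assumes "\<theta> \<in> Cell2 (CAT\<^sub>2 \<kappa>)" "sc_src \<theta> = P" "cat_functor P E B"
  obtains Q F C \<beta> T T' \<alpha> S S'
  where "\<theta> = \<lparr>sc_src = P, sc_tgt = Q, sc_total = \<beta>, sc_base = \<alpha>\<rparr>"
    "cat_sqcell P E B Q F C \<beta> T T' \<alpha> S S'" "loc_small4 \<kappa> E B F C"
proof -
  obtain P' E' B' Q F C \<beta> T T' \<alpha> S S' where s: "\<theta> = \<lparr>sc_src = P', sc_tgt = Q, sc_total = \<beta>, sc_base = \<alpha>\<rparr>"
    "cat_sqcell P' E' B' Q F C \<beta> T T' \<alpha> S S'" "loc_small4 \<kappa> E' B' F C"
    by (rule Cell2_CAT2_E[OF assms(1)])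
  interpret s: cat_sqcell P' E' B' Q F C \<beta> T T' \<alpha> S S' by fact
  interpret P: cat_functor P E B by fact
  have "P' = P" "E' = E" "B' = B" using assms(2) s(1) s.s.P.FDom_eq s.s.P.FCod_eq by auto
  then show thesis using that s by simp
qed

lemma Cell2_CAT2_E2:
  assumes "\<theta> \<in> Cell2 (CAT\<^sub>2 \<kappa>)" "cat_square P E B Q F C T S"
    and "sqcell_src (CAT \<kappa>) \<theta> = \<lparr>sq_src = P, sq_tgt = Q, sq_total = T, sq_base = S\<rparr>"
  obtains \<beta> T' \<alpha> S'
  where "\<theta> = \<lparr>sc_src = P, sc_tgt = Q, sc_total = \<beta>, sc_base = \<alpha>\<rparr>"
    "cat_sqcell P E B Q F C \<beta> T T' \<alpha> S S'" "loc_small4 \<kappa> E B F C"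
proof -
  interpret c: cat_square P E B Q F C T S by fact
  obtain Q' F' C' \<beta> T2 T' \<alpha> S2 S' where s: "\<theta> = \<lparr>sc_src = P, sc_tgt = Q', sc_total = \<beta>, sc_base = \<alpha>\<rparr>"
    "cat_sqcell P E B Q' F' C' \<beta> T2 T' \<alpha> S2 S'" "loc_small4 \<kappa> E B F' C'"
    by (rule Cell2_CAT2_E'[OF assms(1) _ c.P.cat_functor_axioms]) (use assms(3) in \<open>auto simp: sqcell_src_def\<close>)
  interpret s: cat_sqcell P E B Q' F' C' \<beta> T2 T' \<alpha> S2 S' by fact
  have "Q' = Q" "T2 = T" "S2 = S" using assms(3) s(1) by (auto simp: sqcell_src_def)
  moreover from this have "F' = F" "C' = C" using s.s.Q.FDom_eq s.s.Q.FCod_eq by auto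
  ultimately show thesis using that s by simp
qed

lemma CAT2_one2_bd:
  assumes "s \<in> Cell1 (CAT\<^sub>2 \<kappa>)"
  shows "sqcell_src (CAT \<kappa>) (one2 (CAT\<^sub>2 \<kappa>) s) = s" "sqcell_tgt (CAT \<kappa>) (one2 (CAT\<^sub>2 \<kappa>) s) = s"
  using CAT2.one2_cell[OF assms] unfolding arrow_two_cat_sel by blast+

lemma cat_square_one: "cat_functor P E B \<Longrightarrow> cat_square P E B P E B (fun_one E) (fun_one B)"
proof -
  assume "cat_functor P E B"
  then interpret cat_functor P E B .
  interpret I: cat_functor "fun_one E" E E by (rule cat_functor_one[OF A.category_axioms])
  interpret J: cat_functor "fun_one B" B B by (rule cat_functor_one[OF B.category_axioms])
  show ?thesis by unfold_locales simp_all
qed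

lemma cat_square_comp:
  assumes "cat_square P E B Q F C T S" "cat_square Q F C R G D T' S'"
  shows "cat_square P E B R G D (fun_comp T' T) (fun_comp S' S)"
proof -
  interpret s: cat_square P E B Q F C T S by fact
  interpret t: cat_square Q F C R G D T' S' by fact
  interpret I: cat_functor "fun_comp T' T" E G by (rule cat_functor_comp[OF s.T.cat_functor_axioms t.T.cat_functor_axioms])
  interpret J: cat_functor "fun_comp S' S" B D by (rule cat_functor_comp[OF s.S.cat_functor_axioms t.S.cat_functor_axioms])
  show ?thesis by unfold_locales simp_all
qed

lemma comma_map_one:
  assumes "cat_functor P E B"
  shows "comma_map \<lparr>sq_src = P, sq_tgt = P, sq_total = fun_one E, sq_base = fun_one B\<rparr> = fun_one (comma P)"
proof -
  interpret comma_square P E B P E B "fun_one E" "fun_one B"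
    using cat_square_one[OF assms] by (simp add: comma_square_def)
  show ?thesis
  proof (rule cat_functor_eqI[OF comma_map_functor cat_functor_one[OF P.comma_category]])
    fix X assume "X \<in> Obj (comma P)"
    then have "X \<in> comma_obj P" by simp
    then show "FOb (comma_map sq) X = FOb (fun_one (comma P)) X"
      by (rule P.comma_objE) simp
  next
    fix p assume "p \<in> Arr (comma P)"
    then have "p \<in> comma_arr P" by simp
    then show "FAr (comma_map sq) p = FAr (fun_one (comma P)) p"
      by (rule P.comma_arrE) simp
  qed
qed

lemma comma_map_comp:
  assumes "cat_square P E B Q F C T S" "cat_square Q F C R G D T' S'"
  shows "comma_map \<lparr>sq_src = P, sq_tgt = R, sq_total = fun_comp T' T, sq_base = fun_comp S' S\<rparr> =
    fun_comp (comma_map \<lparr>sq_src = Q, sq_tgt = R, sq_total = T', sq_base = S'\<rparr>)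
      (comma_map \<lparr>sq_src = P, sq_tgt = Q, sq_total = T, sq_base = S\<rparr>)"
proof -
  interpret s: comma_square P E B Q F C T S using assms by (simp add: comma_square_def)
  interpret t: comma_square Q F C R G D T' S' using assms by (simp add: comma_square_def)
  interpret ts: comma_square P E B R G D "fun_comp T' T" "fun_comp S' S"
    using cat_square_comp[OF assms] by (simp add: comma_square_def)
  show ?thesis
  proof (rule cat_functor_eqI[OF ts.comma_map_functor cat_functor_comp[OF s.comma_map_functor t.comma_map_functor]])
    fix X assume "X \<in> Obj (comma P)"
    then have X: "X \<in> comma_obj P" by simp
    then show "FOb (comma_map ts.sq) X = FOb (fun_comp (comma_map t.sq) (comma_map s.sq)) X"
      by (rule s.P.comma_objE) simp
  next
    fix p assume "p \<in> Arr (comma P)"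
    then have p: "p \<in> comma_arr P" by simp
    then show "FAr (comma_map ts.sq) p = FAr (fun_comp (comma_map t.sq) (comma_map s.sq)) p"
      using s.comma_map_arr[OF p] s.P.comma_obj_parts[OF s.P.carr_obj(1)[OF p]]
        s.P.comma_obj_parts[OF s.P.carr_obj(2)[OF p]]
      by (simp add: s.P.carr_parts comma_map_ob_def)
  qed
qed

section \<open>The comma construction is a strict 2-monad\<close>

locale comma_ambient =
  fixes \<kappa> :: "'k rel"
  assumes Cinf: "Cinfinite \<kappa>"
begin

abbreviation "CC \<equiv> (comma_monad \<kappa> :: ('a univ fnctr, 'a univ fnctr square, ('a univ fnctr, 'a univ nattr) sqcell) two_monad)"

lemma comma_ls: "cat_functor P E B \<Longrightarrow> locally_small \<kappa> E \<Longrightarrow> locally_small \<kappa> B \<Longrightarrow> locally_small \<kappa> (comma P)"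
  for P :: "'a univ fnctr"
  using comma_cat.comma_locally_small[OF _ Cinf] by (simp add: comma_cat_def)

lemma Cell1_cod: "P \<in> Cell1 (CAT \<kappa>) \<Longrightarrow> cod_fun P \<in> Cell1 (CAT \<kappa>)"
  for P :: "'a univ fnctr"
  using comma_cat.cod_functor[of P "FDom P" "FCod P"] comma_ls[of P "FDom P" "FCod P"]
  by (auto simp: Cell1_CAT comma_cat_def)

lemma F1_Cell1:
  assumes "s \<in> Cell1 (CAT\<^sub>2 \<kappa>)"
  shows "F1 CC s \<in> Cell1 (CAT\<^sub>2 \<kappa>)"
proof -
  obtain P E B Q F C T S where s: "s = \<lparr>sq_src = P, sq_tgt = Q, sq_total = T, sq_base = S\<rparr>"
    "cat_square P E B Q F C T S" "loc_small4 \<kappa> E B F C"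
    by (rule Cell1_CAT2_E[OF assms])
  interpret s: comma_square P E B Q F C T S using s by (simp add: comma_square_def)
  interpret c: cat_square "cod_fun P" "comma P" B "cod_fun Q" "comma Q" C "comma_map s.sq" S
    by (rule s.cod_square)
  have "F1 CC s = \<lparr>sq_src = cod_fun P, sq_tgt = cod_fun Q, sq_total = comma_map s.sq, sq_base = S\<rparr>"
    by (rule square_eqI) (simp_all add: s)
  then show ?thesis
    using c.Cell1_CAT2_I[of \<kappa>] s(3) comma_ls[OF s.P.cat_functor_axioms] comma_ls[OF s.Q.cat_functor_axioms]
    by (simp add: loc_small4_def)
qed

lemma F2_Cell2:
  assumes "\<theta> \<in> Cell2 (CAT\<^sub>2 \<kappa>)"
  shows "F2 CC \<theta> \<in> Cell2 (CAT\<^sub>2 \<kappa>)" "sqcell_src (CAT \<kappa>) (F2 CC \<theta>) = F1 CC (sqcell_src (CAT \<kappa>) \<theta>)"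
    "sqcell_tgt (CAT \<kappa>) (F2 CC \<theta>) = F1 CC (sqcell_tgt (CAT \<kappa>) \<theta>)"
proof -
  obtain P E B Q F C \<beta> T T' \<alpha> S S' where s: "\<theta> = \<lparr>sc_src = P, sc_tgt = Q, sc_total = \<beta>, sc_base = \<alpha>\<rparr>"
    "cat_sqcell P E B Q F C \<beta> T T' \<alpha> S S'" "loc_small4 \<kappa> E B F C"
    by (rule Cell2_CAT2_E[OF assms])
  interpret s: comma_sqcell P E B Q F C \<beta> T T' \<alpha> S S' using s by (simp add: comma_sqcell_def)
  interpret c: cat_sqcell "cod_fun P" "comma P" B "cod_fun Q" "comma Q" C
    "comma_cell \<kappa> s.sqc" "comma_map s.s.sq" "comma_map s.t.sq" \<alpha> S S'
    by (rule s.cod_sqcell)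
  have "F2 CC \<theta> = \<lparr>sc_src = cod_fun P, sc_tgt = cod_fun Q, sc_total = comma_cell \<kappa> s.sqc, sc_base = \<alpha>\<rparr>"
    by (rule sqcell_eqI) (simp_all add: s)
  then show "F2 CC \<theta> \<in> Cell2 (CAT\<^sub>2 \<kappa>)"
    using c.Cell2_CAT2_I[of \<kappa>] s(3) comma_ls[OF s.s.P.cat_functor_axioms] comma_ls[OF s.s.Q.cat_functor_axioms]
    by (simp add: loc_small4_def)
  show "sqcell_src (CAT \<kappa>) (F2 CC \<theta>) = F1 CC (sqcell_src (CAT \<kappa>) \<theta>)"
    "sqcell_tgt (CAT \<kappa>) (F2 CC \<theta>) = F1 CC (sqcell_tgt (CAT \<kappa>) \<theta>)"
    by (rule square_eqI; simp)+
qed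

lemma F1_CC_one: "P \<in> Cell1 (CAT \<kappa>) \<Longrightarrow> F1 CC (one1 (CAT\<^sub>2 \<kappa>) P) = one1 (CAT\<^sub>2 \<kappa>) (cod_fun P)"
proof -
  assume "P \<in> Cell1 (CAT \<kappa>)"
  then have P: "cat_functor P (FDom P) (FCod P)" by (simp add: Cell1_CAT)
  have o: "one1 (CAT\<^sub>2 \<kappa>) P = \<lparr>sq_src = P, sq_tgt = P, sq_total = fun_one (FDom P), sq_base = fun_one (FCod P)\<rparr>"
    by (rule square_eqI) simp_all
  show ?thesis
    by (rule square_eqI) (simp_all, simp add: o comma_map_one[OF P])
qed

lemma F1_CC_comp:
  assumes "s \<in> Cell1 (CAT\<^sub>2 \<kappa>)" "t \<in> Cell1 (CAT\<^sub>2 \<kappa>)" "sq_tgt s = sq_src t"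
  shows "F1 CC (t \<odot>\<^bsub>CAT\<^sub>2 \<kappa>\<^esub> s) = F1 CC t \<odot>\<^bsub>CAT\<^sub>2 \<kappa>\<^esub> F1 CC s"
proof -
  obtain P E B Q F C T S where s: "s = \<lparr>sq_src = P, sq_tgt = Q, sq_total = T, sq_base = S\<rparr>"
    "cat_square P E B Q F C T S"
    by (rule Cell1_CAT2_E[OF assms(1)])
  have "sq_src t = Q" "cat_functor Q F C" using s assms(3) by (simp_all add: cat_square_def)
  then obtain R G D T' S' where t: "t = \<lparr>sq_src = Q, sq_tgt = R, sq_total = T', sq_base = S'\<rparr>"
    "cat_square Q F C R G D T' S'"
    by (rule Cell1_CAT2_E'[OF assms(2)])
  have o: "t \<odot>\<^bsub>CAT\<^sub>2 \<kappa>\<^esub> s = \<lparr>sq_src = P, sq_tgt = R, sq_total = fun_comp T' T, sq_base = fun_comp S' S\<rparr>"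
    by (rule square_eqI) (simp_all add: s t)
  show ?thesis
    by (rule square_eqI) (simp_all, simp_all add: o, simp_all add: s t comma_map_comp[OF s(2) t(2)])
qed

lemma unit_Cell1: "P \<in> Cell1 (CAT \<kappa>) \<Longrightarrow> unit CC P \<in> Cell1 (CAT\<^sub>2 \<kappa>)"
proof -
  assume P: "P \<in> Cell1 (CAT \<kappa>)"
  obtain E B where e: "FDom P = E" "FCod P = B" by blast
  interpret comma_cat2 P E B using P e by (simp add: Cell1_CAT comma_cat2_def comma_cat_def)
  have u: "unit CC P = \<lparr>sq_src = P, sq_tgt = cod_fun P, sq_total = comma_unit_fun P, sq_base = fun_one B\<rparr>"
    by (rule square_eqI) simp_all
  show ?thesis
    unfolding u using cat_square.Cell1_CAT2_I[OF unit_square, of \<kappa>] P comma_ls[OF cat_functor_axioms]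
    by (simp add: Cell1_CAT loc_small4_def)
qed

lemma mult_Cell1: "P \<in> Cell1 (CAT \<kappa>) \<Longrightarrow> mult CC P \<in> Cell1 (CAT\<^sub>2 \<kappa>)"
proof -
  assume P: "P \<in> Cell1 (CAT \<kappa>)"
  obtain E B where e: "FDom P = E" "FCod P = B" by blast
  interpret comma_cat2 P E B using P e by (simp add: Cell1_CAT comma_cat2_def comma_cat_def)
  have u: "mult CC P = \<lparr>sq_src = cod_fun (cod_fun P), sq_tgt = cod_fun P, sq_total = comma_mult_fun P, sq_base = fun_one B\<rparr>"
    by (rule square_eqI) simp_all
  show ?thesis
    unfolding u using cat_square.Cell1_CAT2_I[OF mult_square, of \<kappa>] P comma_ls[OF cat_functor_axioms]
      comma_ls[OF c.cat_functor_axioms]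
    by (simp add: Cell1_CAT loc_small4_def)
qed

text \<open>Equations between 2-cells are proved in two moves: functoriality on 1-cells makes the
  boundaries agree, and \<open>CAT2_cell_eqI\<close> leaves an equation between arrows of a comma
  category, which is checked leg by leg.\<close>

lemma comma_two_functor: "two_functor (CAT\<^sub>2 \<kappa>) (CAT\<^sub>2 \<kappa>) CC"
proof
  fix P :: "'a univ fnctr" assume P: "P \<in> Cell0 (CAT\<^sub>2 \<kappa>)"
  then show "F0 CC P \<in> Cell0 (CAT\<^sub>2 \<kappa>)" using Cell1_cod by simp
  show "F1 CC (one1 (CAT\<^sub>2 \<kappa>) P) = one1 (CAT\<^sub>2 \<kappa>) (F0 CC P)" using F1_CC_one P by simp
next
  fix s :: "'a univ fnctr square" assume s: "s \<in> Cell1 (CAT\<^sub>2 \<kappa>)"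
  show "F1 CC s \<in> hom1 (CAT\<^sub>2 \<kappa>) (F0 CC (src1 (CAT\<^sub>2 \<kappa>) s)) (F0 CC (tgt1 (CAT\<^sub>2 \<kappa>) s))"
    using F1_Cell1[OF s] by simp
  obtain P E B Q F C T S where st: "s = \<lparr>sq_src = P, sq_tgt = Q, sq_total = T, sq_base = S\<rparr>"
    "cat_square P E B Q F C T S" by (rule Cell1_CAT2_E[OF s])
  interpret s: comma_square P E B Q F C T S using st by (simp add: comma_square_def)
  interpret M: cat_functor "comma_map s.sq" "comma P" "comma Q" by (rule s.comma_map_functor)
  show "F2 CC (one2 (CAT\<^sub>2 \<kappa>) s) = one2 (CAT\<^sub>2 \<kappa>) (F1 CC s)"
  proof (rule CAT2_cell_eqI)
    have o: "one2 (CAT\<^sub>2 \<kappa>) s \<in> Cell2 (CAT\<^sub>2 \<kappa>)" using CAT2.one2_cell[OF s] by simp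
    show "F2 CC (one2 (CAT\<^sub>2 \<kappa>) s) \<in> Cell2 (CAT\<^sub>2 \<kappa>)" by (rule F2_Cell2[OF o])
    show "one2 (CAT\<^sub>2 \<kappa>) (F1 CC s) \<in> Cell2 (CAT\<^sub>2 \<kappa>)" using CAT2.one2_cell[OF F1_Cell1[OF s]] by simp
    show "src2 (CAT\<^sub>2 \<kappa>) (F2 CC (one2 (CAT\<^sub>2 \<kappa>) s)) = src2 (CAT\<^sub>2 \<kappa>) (one2 (CAT\<^sub>2 \<kappa>) (F1 CC s))"
      "tgt2 (CAT\<^sub>2 \<kappa>) (F2 CC (one2 (CAT\<^sub>2 \<kappa>) s)) = tgt2 (CAT\<^sub>2 \<kappa>) (one2 (CAT\<^sub>2 \<kappa>) (F1 CC s))"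
      by (simp_all only: arrow_two_cat_sel F2_Cell2(2,3)[OF o] CAT2_one2_bd[OF s] CAT2_one2_bd[OF F1_Cell1[OF s]])
  next
    fix X assume "X \<in> Obj (FDom (sc_src (F2 CC (one2 (CAT\<^sub>2 \<kappa>) s))))"
    then have "X \<in> comma_obj P" by (simp add: st)
    then show "NAt (sc_total (F2 CC (one2 (CAT\<^sub>2 \<kappa>) s))) X = NAt (sc_total (one2 (CAT\<^sub>2 \<kappa>) (F1 CC s))) X"
      by (rule s.P.comma_objE) (simp add: st)
  qed simp
next
  fix s t :: "'a univ fnctr square"
  assume "s \<in> Cell1 (CAT\<^sub>2 \<kappa>)" "t \<in> Cell1 (CAT\<^sub>2 \<kappa>)" "tgt1 (CAT\<^sub>2 \<kappa>) s = src1 (CAT\<^sub>2 \<kappa>) t"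
  then show "F1 CC (t \<odot>\<^bsub>CAT\<^sub>2 \<kappa>\<^esub> s) = F1 CC t \<odot>\<^bsub>CAT\<^sub>2 \<kappa>\<^esub> F1 CC s"
    using F1_CC_comp by simp
next
  fix \<theta> :: "('a univ fnctr, 'a univ nattr) sqcell" assume "\<theta> \<in> Cell2 (CAT\<^sub>2 \<kappa>)"
  from F2_Cell2[OF this] show "F2 CC \<theta> \<in> hom2 (CAT\<^sub>2 \<kappa>) (F1 CC (src2 (CAT\<^sub>2 \<kappa>) \<theta>)) (F1 CC (tgt2 (CAT\<^sub>2 \<kappa>) \<theta>))"
    by simp
next
  fix \<theta> \<eta> :: "('a univ fnctr, 'a univ nattr) sqcell"
  assume h: "\<theta> \<in> Cell2 (CAT\<^sub>2 \<kappa>)" "\<eta> \<in> Cell2 (CAT\<^sub>2 \<kappa>)" "tgt2 (CAT\<^sub>2 \<kappa>) \<theta> = src2 (CAT\<^sub>2 \<kappa>) \<eta>"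
  obtain P E B Q F C \<beta> T T' \<alpha> S S' where s: "\<theta> = \<lparr>sc_src = P, sc_tgt = Q, sc_total = \<beta>, sc_base = \<alpha>\<rparr>"
    "cat_sqcell P E B Q F C \<beta> T T' \<alpha> S S'" "loc_small4 \<kappa> E B F C"
    by (rule Cell2_CAT2_E[OF h(1)])
  interpret s: comma_sqcell P E B Q F C \<beta> T T' \<alpha> S S' using s by (simp add: comma_sqcell_def)
  obtain \<beta>' T'' \<alpha>' S'' where t: "\<eta> = \<lparr>sc_src = P, sc_tgt = Q, sc_total = \<beta>', sc_base = \<alpha>'\<rparr>"
    "cat_sqcell P E B Q F C \<beta>' T' T'' \<alpha>' S' S''"
    by (rule Cell2_CAT2_E2[OF h(2) s.t.cat_square_axioms]) (use h(3) s.sqc_src[of \<kappa>] s(1) in simp)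
  interpret t: comma_sqcell P E B Q F C \<beta>' T' T'' \<alpha>' S' S'' using t by (simp add: comma_sqcell_def)
  have st: "\<eta> \<bullet>\<^bsub>CAT\<^sub>2 \<kappa>\<^esub> \<theta> \<in> Cell2 (CAT\<^sub>2 \<kappa>)" "sqcell_src (CAT \<kappa>) (\<eta> \<bullet>\<^bsub>CAT\<^sub>2 \<kappa>\<^esub> \<theta>) = sqcell_src (CAT \<kappa>) \<theta>"
    "sqcell_tgt (CAT \<kappa>) (\<eta> \<bullet>\<^bsub>CAT\<^sub>2 \<kappa>\<^esub> \<theta>) = sqcell_tgt (CAT \<kappa>) \<eta>"
    using CAT2.vcomp_cell[OF h] by simp_all
  have F: "F2 CC \<theta> \<in> Cell2 (CAT\<^sub>2 \<kappa>)" "F2 CC \<eta> \<in> Cell2 (CAT\<^sub>2 \<kappa>)"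
     "tgt2 (CAT\<^sub>2 \<kappa>) (F2 CC \<theta>) = src2 (CAT\<^sub>2 \<kappa>) (F2 CC \<eta>)"
    using F2_Cell2[OF h(1)] F2_Cell2[OF h(2)] h(3) unfolding arrow_two_cat_sel by (blast, blast, metis)
  show "F2 CC (\<eta> \<bullet>\<^bsub>CAT\<^sub>2 \<kappa>\<^esub> \<theta>) = F2 CC \<eta> \<bullet>\<^bsub>CAT\<^sub>2 \<kappa>\<^esub> F2 CC \<theta>"
  proof (rule CAT2_cell_eqI)
    show "F2 CC (\<eta> \<bullet>\<^bsub>CAT\<^sub>2 \<kappa>\<^esub> \<theta>) \<in> Cell2 (CAT\<^sub>2 \<kappa>)" by (rule F2_Cell2[OF st(1)])
    show "F2 CC \<eta> \<bullet>\<^bsub>CAT\<^sub>2 \<kappa>\<^esub> F2 CC \<theta> \<in> Cell2 (CAT\<^sub>2 \<kappa>)" using CAT2.vcomp_cell[OF F] by simp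
    show "src2 (CAT\<^sub>2 \<kappa>) (F2 CC (\<eta> \<bullet>\<^bsub>CAT\<^sub>2 \<kappa>\<^esub> \<theta>)) = src2 (CAT\<^sub>2 \<kappa>) (F2 CC \<eta> \<bullet>\<^bsub>CAT\<^sub>2 \<kappa>\<^esub> F2 CC \<theta>)"
      "tgt2 (CAT\<^sub>2 \<kappa>) (F2 CC (\<eta> \<bullet>\<^bsub>CAT\<^sub>2 \<kappa>\<^esub> \<theta>)) = tgt2 (CAT\<^sub>2 \<kappa>) (F2 CC \<eta> \<bullet>\<^bsub>CAT\<^sub>2 \<kappa>\<^esub> F2 CC \<theta>)"
      using CAT2.vcomp_cell[OF F]
      by (simp_all only: arrow_two_cat_sel F2_Cell2(2,3)[OF st(1)] F2_Cell2(2,3)[OF h(1)] F2_Cell2(2,3)[OF h(2)] st(2,3))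
  next
    fix X assume "X \<in> Obj (FDom (sc_src (F2 CC (\<eta> \<bullet>\<^bsub>CAT\<^sub>2 \<kappa>\<^esub> \<theta>))))"
    then have X: "X \<in> comma_obj P" by (simp add: s)
    interpret sc: cat_nattr "comma_cell \<kappa> s.sqc" "comma_map s.s.sq" "comma_map s.t.sq" "comma P" "comma Q"
      by (rule s.comma_cell_nattr)
    interpret tc: cat_nattr "comma_cell \<kappa> t.sqc" "comma_map s.t.sq" "comma_map t.t.sq" "comma P" "comma Q"
      by (rule t.comma_cell_nattr)
    show "NAt (sc_total (F2 CC (\<eta> \<bullet>\<^bsub>CAT\<^sub>2 \<kappa>\<^esub> \<theta>))) X =
      NAt (sc_total (F2 CC \<eta> \<bullet>\<^bsub>CAT\<^sub>2 \<kappa>\<^esub> F2 CC \<theta>)) X"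
      using X sc.NAt_Arr(1)[of X] tc.NAt_Arr(1)[of X] st(2,3)
      by (elim s.s.P.comma_objE) (simp add: s t s.sqc_src t.sqc_src)
  qed simp
next
  fix \<theta> \<eta> :: "('a univ fnctr, 'a univ nattr) sqcell"
  assume h: "\<theta> \<in> Cell2 (CAT\<^sub>2 \<kappa>)" "\<eta> \<in> Cell2 (CAT\<^sub>2 \<kappa>)"
    "tgt1 (CAT\<^sub>2 \<kappa>) (src2 (CAT\<^sub>2 \<kappa>) \<theta>) = src1 (CAT\<^sub>2 \<kappa>) (src2 (CAT\<^sub>2 \<kappa>) \<eta>)"
  obtain P E B Q F C \<beta> T T' \<alpha> S S' where s: "\<theta> = \<lparr>sc_src = P, sc_tgt = Q, sc_total = \<beta>, sc_base = \<alpha>\<rparr>"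
    "cat_sqcell P E B Q F C \<beta> T T' \<alpha> S S'" "loc_small4 \<kappa> E B F C"
    by (rule Cell2_CAT2_E[OF h(1)])
  interpret s: comma_sqcell P E B Q F C \<beta> T T' \<alpha> S S' using s by (simp add: comma_sqcell_def)
  obtain R G D \<beta>' U U' \<alpha>' V V' where t: "\<eta> = \<lparr>sc_src = Q, sc_tgt = R, sc_total = \<beta>', sc_base = \<alpha>'\<rparr>"
    "cat_sqcell Q F C R G D \<beta>' U U' \<alpha>' V V'"
    by (rule Cell2_CAT2_E'[OF h(2) _ s.s.Q.cat_functor_axioms]) (use h(3) s(1) in simp)
  interpret t: comma_sqcell Q F C R G D \<beta>' U U' \<alpha>' V V' using t by (simp add: comma_sqcell_def)
  have st: "\<eta> \<star>\<^bsub>CAT\<^sub>2 \<kappa>\<^esub> \<theta> \<in> Cell2 (CAT\<^sub>2 \<kappa>)"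
    "sqcell_src (CAT \<kappa>) (\<eta> \<star>\<^bsub>CAT\<^sub>2 \<kappa>\<^esub> \<theta>) = sqcell_src (CAT \<kappa>) \<eta> \<odot>\<^bsub>CAT\<^sub>2 \<kappa>\<^esub> sqcell_src (CAT \<kappa>) \<theta>"
    "sqcell_tgt (CAT \<kappa>) (\<eta> \<star>\<^bsub>CAT\<^sub>2 \<kappa>\<^esub> \<theta>) = sqcell_tgt (CAT \<kappa>) \<eta> \<odot>\<^bsub>CAT\<^sub>2 \<kappa>\<^esub> sqcell_tgt (CAT \<kappa>) \<theta>"
    using CAT2.hcomp_cell[OF h] by simp_all
  have F: "F2 CC \<theta> \<in> Cell2 (CAT\<^sub>2 \<kappa>)" "F2 CC \<eta> \<in> Cell2 (CAT\<^sub>2 \<kappa>)"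
     "tgt1 (CAT\<^sub>2 \<kappa>) (src2 (CAT\<^sub>2 \<kappa>) (F2 CC \<theta>)) = src1 (CAT\<^sub>2 \<kappa>) (src2 (CAT\<^sub>2 \<kappa>) (F2 CC \<eta>))"
    using F2_Cell2[OF h(1)] F2_Cell2[OF h(2)] h(3) by simp_all
  have sq: "sqcell_src (CAT \<kappa>) \<theta> \<in> Cell1 (CAT\<^sub>2 \<kappa>)" "sqcell_src (CAT \<kappa>) \<eta> \<in> Cell1 (CAT\<^sub>2 \<kappa>)"
    "sqcell_tgt (CAT \<kappa>) \<theta> \<in> Cell1 (CAT\<^sub>2 \<kappa>)" "sqcell_tgt (CAT \<kappa>) \<eta> \<in> Cell1 (CAT\<^sub>2 \<kappa>)"
    using CAT2.src2_in[OF h(1)] CAT2.src2_in[OF h(2)] CAT2.tgt2_in[OF h(1)] CAT2.tgt2_in[OF h(2)] by simp_all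
  show "F2 CC (\<eta> \<star>\<^bsub>CAT\<^sub>2 \<kappa>\<^esub> \<theta>) = F2 CC \<eta> \<star>\<^bsub>CAT\<^sub>2 \<kappa>\<^esub> F2 CC \<theta>"
  proof (rule CAT2_cell_eqI)
    show "F2 CC (\<eta> \<star>\<^bsub>CAT\<^sub>2 \<kappa>\<^esub> \<theta>) \<in> Cell2 (CAT\<^sub>2 \<kappa>)" by (rule F2_Cell2[OF st(1)])
    show "F2 CC \<eta> \<star>\<^bsub>CAT\<^sub>2 \<kappa>\<^esub> F2 CC \<theta> \<in> Cell2 (CAT\<^sub>2 \<kappa>)" using CAT2.hcomp_cell[OF F] by simp
    show "src2 (CAT\<^sub>2 \<kappa>) (F2 CC (\<eta> \<star>\<^bsub>CAT\<^sub>2 \<kappa>\<^esub> \<theta>)) = src2 (CAT\<^sub>2 \<kappa>) (F2 CC \<eta> \<star>\<^bsub>CAT\<^sub>2 \<kappa>\<^esub> F2 CC \<theta>)"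
      "tgt2 (CAT\<^sub>2 \<kappa>) (F2 CC (\<eta> \<star>\<^bsub>CAT\<^sub>2 \<kappa>\<^esub> \<theta>)) = tgt2 (CAT\<^sub>2 \<kappa>) (F2 CC \<eta> \<star>\<^bsub>CAT\<^sub>2 \<kappa>\<^esub> F2 CC \<theta>)"
      using CAT2.hcomp_cell[OF F] F1_CC_comp[OF sq(1,2)] F1_CC_comp[OF sq(3,4)] h(3)
      by (simp_all only: arrow_two_cat_sel F2_Cell2(2,3)[OF st(1)] F2_Cell2(2,3)[OF h(1)] F2_Cell2(2,3)[OF h(2)] st(2,3)
        sqcell_src_sel sqcell_tgt_sel)
  next
    fix X assume "X \<in> Obj (FDom (sc_src (F2 CC (\<eta> \<star>\<^bsub>CAT\<^sub>2 \<kappa>\<^esub> \<theta>))))"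
    then have X: "X \<in> comma_obj P" by (simp add: s)
    interpret sc: cat_nattr "comma_cell \<kappa> s.sqc" "comma_map s.s.sq" "comma_map s.t.sq" "comma P" "comma Q"
      by (rule s.comma_cell_nattr)
    interpret tc: cat_nattr "comma_cell \<kappa> t.sqc" "comma_map t.s.sq" "comma_map t.t.sq" "comma Q" "comma R"
      by (rule t.comma_cell_nattr)
    have "NAt (comma_cell \<kappa> t.sqc) (FOb (comma_map s.t.sq) X) \<in> comma_arr R"
      "FAr (comma_map t.s.sq) (NAt (comma_cell \<kappa> s.sqc) X) \<in> comma_arr R"
      "NAt (comma_cell \<kappa> s.sqc) X \<in> comma_arr Q"
      using X sc.NAt_Arr(1)[of X] tc.NAt_Arr(1)[of "FOb (comma_map s.t.sq) X"]
        tc.F.FAr_Arr(1)[of "NAt (comma_cell \<kappa> s.sqc) X"] sc.G.FOb_Obj[of X] by simp_all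
    then show "NAt (sc_total (F2 CC (\<eta> \<star>\<^bsub>CAT\<^sub>2 \<kappa>\<^esub> \<theta>))) X =
      NAt (sc_total (F2 CC \<eta> \<star>\<^bsub>CAT\<^sub>2 \<kappa>\<^esub> F2 CC \<theta>)) X"
      using X st(2,3)
      by (elim s.s.P.comma_objE) (simp add: s t s.sqc_src t.sqc_src)
  qed simp
qed


lemma unit_natural1:
  assumes "s \<in> Cell1 (CAT\<^sub>2 \<kappa>)"
  shows "F1 CC s \<odot>\<^bsub>CAT\<^sub>2 \<kappa>\<^esub> unit CC (sq_src s) = unit CC (sq_tgt s) \<odot>\<^bsub>CAT\<^sub>2 \<kappa>\<^esub> s"
proof -
  obtain P E B Q F C T S where st: "s = \<lparr>sq_src = P, sq_tgt = Q, sq_total = T, sq_base = S\<rparr>"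
    "cat_square P E B Q F C T S" by (rule Cell1_CAT2_E[OF assms])
  interpret s: comma_square P E B Q F C T S using st by (simp add: comma_square_def)
  have "fun_comp (comma_map s.sq) (comma_unit_fun P) = fun_comp (comma_unit_fun Q) T"
    by (rule cat_functor_eqI[OF cat_functor_comp[OF s.P.unit_functor s.comma_map_functor]
      cat_functor_comp[OF s.T.cat_functor_axioms s.Q.unit_functor]]) simp_all
  then show ?thesis
    by (intro square_eqI) (simp_all add: st fun_comp_one[OF s.S.cat_functor_axioms])
qed

lemma mult_natural1:
  assumes "s \<in> Cell1 (CAT\<^sub>2 \<kappa>)"
  shows "F1 CC s \<odot>\<^bsub>CAT\<^sub>2 \<kappa>\<^esub> mult CC (sq_src s) = mult CC (sq_tgt s) \<odot>\<^bsub>CAT\<^sub>2 \<kappa>\<^esub> F1 CC (F1 CC s)"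
proof -
  obtain P E B Q F C T S where st: "s = \<lparr>sq_src = P, sq_tgt = Q, sq_total = T, sq_base = S\<rparr>"
    "cat_square P E B Q F C T S" by (rule Cell1_CAT2_E[OF assms])
  interpret s: comma_square P E B Q F C T S using st by (simp add: comma_square_def)
  interpret c: comma_square "cod_fun P" "comma P" B "cod_fun Q" "comma Q" C "comma_map s.sq" S
    by (rule s.cod_comma_square)
  have F1: "F1 CC s = c.sq" by (rule square_eqI) (simp_all add: st)
  have "fun_comp (comma_map s.sq) (comma_mult_fun P) = fun_comp (comma_mult_fun Q) (comma_map c.sq)"
  proof (rule cat_functor_eqI[OF cat_functor_comp[OF s.P.mult_functor s.comma_map_functor]
      cat_functor_comp[OF c.comma_map_functor s.Q.mult_functor]])
    fix Z assume "Z \<in> Obj (comma (cod_fun P))"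
    then have Z: "Z \<in> comma_obj (cod_fun P)" by simp
    have X: "lft Z \<in> comma_obj P" using s.P.c.comma_obj_parts[OF Z] by simp
    show "FOb (fun_comp (comma_map s.sq) (comma_mult_fun P)) Z = FOb (fun_comp (comma_mult_fun Q) (comma_map c.sq)) Z"
      using Z c.T.FOb_Obj[of "lft Z"] X s.P.mult_functor
      using cat_functor.FOb_Obj[OF s.P.mult_functor, of Z] cat_functor.FOb_Obj[OF c.comma_map_functor, of Z]
        s.P.c.comma_obj_parts[OF Z] s.P.comma_obj_parts[OF X]
      by simp
  next
    fix p assume "p \<in> Arr (comma (cod_fun P))"
    then have p: "p \<in> comma_arr (cod_fun P)" by simp
    show "FAr (fun_comp (comma_map s.sq) (comma_mult_fun P)) p = FAr (fun_comp (comma_mult_fun Q) (comma_map c.sq)) p"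
      using s.P.mult_fun_arr[OF p] c.comma_map_arr[OF p] p
      by (elim s.P.comma2_arrE) simp
  qed
  then show ?thesis
    by (intro square_eqI) (simp_all add: F1, simp_all add: st fun_comp_one[OF s.S.cat_functor_axioms])
qed

lemma unit_natural2:
  assumes h: "\<theta> \<in> Cell2 (CAT\<^sub>2 \<kappa>)"
  shows "F2 CC \<theta> \<rhd>\<^bsub>CAT\<^sub>2 \<kappa>\<^esub> unit CC (sc_src \<theta>) = unit CC (sc_tgt \<theta>) \<lhd>\<^bsub>CAT\<^sub>2 \<kappa>\<^esub> \<theta>"
proof -
  obtain P E B Q F C \<beta> T T' \<alpha> S S' where s: "\<theta> = \<lparr>sc_src = P, sc_tgt = Q, sc_total = \<beta>, sc_base = \<alpha>\<rparr>"
    "cat_sqcell P E B Q F C \<beta> T T' \<alpha> S S'" "loc_small4 \<kappa> E B F C"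
    by (rule Cell2_CAT2_E[OF h])
  interpret s: comma_sqcell P E B Q F C \<beta> T T' \<alpha> S S' using s by (simp add: comma_sqcell_def)
  have PQ: "P \<in> Cell1 (CAT \<kappa>)" "Q \<in> Cell1 (CAT \<kappa>)"
    using s(3) Cell1_CAT_I[OF s.s.P.cat_functor_axioms, of \<kappa>] Cell1_CAT_I[OF s.s.Q.cat_functor_axioms, of \<kappa>]
    by (simp_all add: loc_small4_def)
  note U = unit_Cell1[OF PQ(1)] unit_Cell1[OF PQ(2)]
  note oU = CAT2.one2_cell[OF U(1), THEN conjunct1] CAT2.one2_cell[OF U(2), THEN conjunct1]
  note F = F2_Cell2[OF h]
  have sq: "sqcell_src (CAT \<kappa>) \<theta> \<in> Cell1 (CAT\<^sub>2 \<kappa>)" "sqcell_tgt (CAT \<kappa>) \<theta> \<in> Cell1 (CAT\<^sub>2 \<kappa>)"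
    using CAT2.src2_in[OF h] CAT2.tgt2_in[OF h] by simp_all
  have l: "F2 CC \<theta> \<star>\<^bsub>CAT\<^sub>2 \<kappa>\<^esub> one2 (CAT\<^sub>2 \<kappa>) (unit CC P) \<in> Cell2 (CAT\<^sub>2 \<kappa>) \<and>
    sqcell_src (CAT \<kappa>) (F2 CC \<theta> \<star>\<^bsub>CAT\<^sub>2 \<kappa>\<^esub> one2 (CAT\<^sub>2 \<kappa>) (unit CC P)) =
      F1 CC (sqcell_src (CAT \<kappa>) \<theta>) \<odot>\<^bsub>CAT\<^sub>2 \<kappa>\<^esub> unit CC P \<and>
    sqcell_tgt (CAT \<kappa>) (F2 CC \<theta> \<star>\<^bsub>CAT\<^sub>2 \<kappa>\<^esub> one2 (CAT\<^sub>2 \<kappa>) (unit CC P)) =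
      F1 CC (sqcell_tgt (CAT \<kappa>) \<theta>) \<odot>\<^bsub>CAT\<^sub>2 \<kappa>\<^esub> unit CC P"
    using CAT2.hcomp_cell[OF oU(1) F(1)]
    unfolding arrow_two_cat_sel(4-) F(2,3) CAT2_one2_bd[OF U(1)] by (simp add: s(1))
  have r: "one2 (CAT\<^sub>2 \<kappa>) (unit CC Q) \<star>\<^bsub>CAT\<^sub>2 \<kappa>\<^esub> \<theta> \<in> Cell2 (CAT\<^sub>2 \<kappa>) \<and>
    sqcell_src (CAT \<kappa>) (one2 (CAT\<^sub>2 \<kappa>) (unit CC Q) \<star>\<^bsub>CAT\<^sub>2 \<kappa>\<^esub> \<theta>) =
      unit CC Q \<odot>\<^bsub>CAT\<^sub>2 \<kappa>\<^esub> sqcell_src (CAT \<kappa>) \<theta> \<and>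
    sqcell_tgt (CAT \<kappa>) (one2 (CAT\<^sub>2 \<kappa>) (unit CC Q) \<star>\<^bsub>CAT\<^sub>2 \<kappa>\<^esub> \<theta>) =
      unit CC Q \<odot>\<^bsub>CAT\<^sub>2 \<kappa>\<^esub> sqcell_tgt (CAT \<kappa>) \<theta>"
    using CAT2.hcomp_cell[OF h oU(2)]
    unfolding arrow_two_cat_sel(4-) CAT2_one2_bd[OF U(2)] by (simp add: s(1))
  have "F2 CC \<theta> \<star>\<^bsub>CAT\<^sub>2 \<kappa>\<^esub> one2 (CAT\<^sub>2 \<kappa>) (unit CC P) = one2 (CAT\<^sub>2 \<kappa>) (unit CC Q) \<star>\<^bsub>CAT\<^sub>2 \<kappa>\<^esub> \<theta>"
  proof (rule CAT2_cell_eqI)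
    show "src2 (CAT\<^sub>2 \<kappa>) (F2 CC \<theta> \<star>\<^bsub>CAT\<^sub>2 \<kappa>\<^esub> one2 (CAT\<^sub>2 \<kappa>) (unit CC P)) =
        src2 (CAT\<^sub>2 \<kappa>) (one2 (CAT\<^sub>2 \<kappa>) (unit CC Q) \<star>\<^bsub>CAT\<^sub>2 \<kappa>\<^esub> \<theta>)"
      using l r unit_natural1[OF sq(1)] by (simp only: arrow_two_cat_sel) (simp add: s(1))
    show "tgt2 (CAT\<^sub>2 \<kappa>) (F2 CC \<theta> \<star>\<^bsub>CAT\<^sub>2 \<kappa>\<^esub> one2 (CAT\<^sub>2 \<kappa>) (unit CC P)) =
        tgt2 (CAT\<^sub>2 \<kappa>) (one2 (CAT\<^sub>2 \<kappa>) (unit CC Q) \<star>\<^bsub>CAT\<^sub>2 \<kappa>\<^esub> \<theta>)"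
      using l r unit_natural1[OF sq(2)] by (simp only: arrow_two_cat_sel) (simp add: s(1))
  next
    interpret sc: cat_nattr "comma_cell \<kappa> s.sqc" "comma_map s.s.sq" "comma_map s.t.sq" "comma P" "comma Q"
      by (rule s.comma_cell_nattr)
    fix x assume "x \<in> Obj (FDom (sc_src (F2 CC \<theta> \<star>\<^bsub>CAT\<^sub>2 \<kappa>\<^esub> one2 (CAT\<^sub>2 \<kappa>) (unit CC P))))"
    then have x: "x \<in> Obj E" by simp
    then show "NAt (sc_total (F2 CC \<theta> \<star>\<^bsub>CAT\<^sub>2 \<kappa>\<^esub> one2 (CAT\<^sub>2 \<kappa>) (unit CC P))) x =
      NAt (sc_total (one2 (CAT\<^sub>2 \<kappa>) (unit CC Q) \<star>\<^bsub>CAT\<^sub>2 \<kappa>\<^esub> \<theta>)) x"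
      by (simp add: s(1) s.sqc_src)
  qed (use l r in \<open>simp_all add: s(1)\<close>)
  then show ?thesis by (simp add: whisker_left_def whisker_right_def s(1))
qed

lemma mult_natural2:
  assumes h: "\<theta> \<in> Cell2 (CAT\<^sub>2 \<kappa>)"
  shows "F2 CC \<theta> \<rhd>\<^bsub>CAT\<^sub>2 \<kappa>\<^esub> mult CC (sc_src \<theta>) = mult CC (sc_tgt \<theta>) \<lhd>\<^bsub>CAT\<^sub>2 \<kappa>\<^esub> F2 CC (F2 CC \<theta>)"
proof -
  obtain P E B Q F C \<beta> T T' \<alpha> S S' where s: "\<theta> = \<lparr>sc_src = P, sc_tgt = Q, sc_total = \<beta>, sc_base = \<alpha>\<rparr>"
    "cat_sqcell P E B Q F C \<beta> T T' \<alpha> S S'" "loc_small4 \<kappa> E B F C"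
    by (rule Cell2_CAT2_E[OF h])
  interpret s: comma_sqcell P E B Q F C \<beta> T T' \<alpha> S S' using s by (simp add: comma_sqcell_def)
  interpret cs: comma_sqcell "cod_fun P" "comma P" B "cod_fun Q" "comma Q" C
    "comma_cell \<kappa> s.sqc" "comma_map s.s.sq" "comma_map s.t.sq" \<alpha> S S'
    using s.cod_sqcell by (simp add: comma_sqcell_def)
  \<comment> \<open>Recognises the image of the cell as the cell of the second locale instance, so
    that the component formula for \<open>comma_cell\<close> applies again to the doubly iterated
    cell.\<close>
  have FF: "F2 CC s.sqc = cs.sqc" by (rule sqcell_eqI) simp_all
  have PQ: "P \<in> Cell1 (CAT \<kappa>)" "Q \<in> Cell1 (CAT \<kappa>)"
    using s(3) Cell1_CAT_I[OF s.s.P.cat_functor_axioms, of \<kappa>] Cell1_CAT_I[OF s.s.Q.cat_functor_axioms, of \<kappa>]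
    by (simp_all add: loc_small4_def)
  note U = mult_Cell1[OF PQ(1)] mult_Cell1[OF PQ(2)]
  note oU = CAT2.one2_cell[OF U(1), THEN conjunct1] CAT2.one2_cell[OF U(2), THEN conjunct1]
  note F = F2_Cell2[OF h]
  note G = F2_Cell2[OF F(1)]
  have sq: "sqcell_src (CAT \<kappa>) \<theta> \<in> Cell1 (CAT\<^sub>2 \<kappa>)" "sqcell_tgt (CAT \<kappa>) \<theta> \<in> Cell1 (CAT\<^sub>2 \<kappa>)"
    using CAT2.src2_in[OF h] CAT2.tgt2_in[OF h] by simp_all
  have l: "F2 CC \<theta> \<star>\<^bsub>CAT\<^sub>2 \<kappa>\<^esub> one2 (CAT\<^sub>2 \<kappa>) (mult CC P) \<in> Cell2 (CAT\<^sub>2 \<kappa>) \<and>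
    sqcell_src (CAT \<kappa>) (F2 CC \<theta> \<star>\<^bsub>CAT\<^sub>2 \<kappa>\<^esub> one2 (CAT\<^sub>2 \<kappa>) (mult CC P)) =
      F1 CC (sqcell_src (CAT \<kappa>) \<theta>) \<odot>\<^bsub>CAT\<^sub>2 \<kappa>\<^esub> mult CC P \<and>
    sqcell_tgt (CAT \<kappa>) (F2 CC \<theta> \<star>\<^bsub>CAT\<^sub>2 \<kappa>\<^esub> one2 (CAT\<^sub>2 \<kappa>) (mult CC P)) =
      F1 CC (sqcell_tgt (CAT \<kappa>) \<theta>) \<odot>\<^bsub>CAT\<^sub>2 \<kappa>\<^esub> mult CC P"
    using CAT2.hcomp_cell[OF oU(1) F(1)]
    unfolding arrow_two_cat_sel(4-) F(2,3) CAT2_one2_bd[OF U(1)] by (simp add: s(1))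
  have r: "one2 (CAT\<^sub>2 \<kappa>) (mult CC Q) \<star>\<^bsub>CAT\<^sub>2 \<kappa>\<^esub> F2 CC (F2 CC \<theta>) \<in> Cell2 (CAT\<^sub>2 \<kappa>) \<and>
    sqcell_src (CAT \<kappa>) (one2 (CAT\<^sub>2 \<kappa>) (mult CC Q) \<star>\<^bsub>CAT\<^sub>2 \<kappa>\<^esub> F2 CC (F2 CC \<theta>)) =
      mult CC Q \<odot>\<^bsub>CAT\<^sub>2 \<kappa>\<^esub> F1 CC (F1 CC (sqcell_src (CAT \<kappa>) \<theta>)) \<and>
    sqcell_tgt (CAT \<kappa>) (one2 (CAT\<^sub>2 \<kappa>) (mult CC Q) \<star>\<^bsub>CAT\<^sub>2 \<kappa>\<^esub> F2 CC (F2 CC \<theta>)) =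
      mult CC Q \<odot>\<^bsub>CAT\<^sub>2 \<kappa>\<^esub> F1 CC (F1 CC (sqcell_tgt (CAT \<kappa>) \<theta>))"
    using CAT2.hcomp_cell[OF G(1) oU(2)]
    unfolding arrow_two_cat_sel(4-) CAT2_one2_bd[OF U(2)] G(2,3) F(2,3) by (simp add: s(1))
  have "F2 CC \<theta> \<star>\<^bsub>CAT\<^sub>2 \<kappa>\<^esub> one2 (CAT\<^sub>2 \<kappa>) (mult CC P) = one2 (CAT\<^sub>2 \<kappa>) (mult CC Q) \<star>\<^bsub>CAT\<^sub>2 \<kappa>\<^esub> F2 CC (F2 CC \<theta>)"
  proof (rule CAT2_cell_eqI)
    show "src2 (CAT\<^sub>2 \<kappa>) (F2 CC \<theta> \<star>\<^bsub>CAT\<^sub>2 \<kappa>\<^esub> one2 (CAT\<^sub>2 \<kappa>) (mult CC P)) =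
        src2 (CAT\<^sub>2 \<kappa>) (one2 (CAT\<^sub>2 \<kappa>) (mult CC Q) \<star>\<^bsub>CAT\<^sub>2 \<kappa>\<^esub> F2 CC (F2 CC \<theta>))"
      using l r mult_natural1[OF sq(1)] by (simp only: arrow_two_cat_sel) (simp add: s(1))
    show "tgt2 (CAT\<^sub>2 \<kappa>) (F2 CC \<theta> \<star>\<^bsub>CAT\<^sub>2 \<kappa>\<^esub> one2 (CAT\<^sub>2 \<kappa>) (mult CC P)) =
        tgt2 (CAT\<^sub>2 \<kappa>) (one2 (CAT\<^sub>2 \<kappa>) (mult CC Q) \<star>\<^bsub>CAT\<^sub>2 \<kappa>\<^esub> F2 CC (F2 CC \<theta>))"
      using l r mult_natural1[OF sq(2)] by (simp only: arrow_two_cat_sel) (simp add: s(1))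
  next
    interpret sc: cat_nattr "comma_cell \<kappa> s.sqc" "comma_map s.s.sq" "comma_map s.t.sq" "comma P" "comma Q"
      by (rule s.comma_cell_nattr)
    interpret cc: cat_nattr "comma_cell \<kappa> cs.sqc" "comma_map cs.s.sq" "comma_map cs.t.sq" "comma (cod_fun P)" "comma (cod_fun Q)"
      by (rule cs.comma_cell_nattr)
    fix Z assume "Z \<in> Obj (FDom (sc_src (F2 CC \<theta> \<star>\<^bsub>CAT\<^sub>2 \<kappa>\<^esub> one2 (CAT\<^sub>2 \<kappa>) (mult CC P))))"
    then have Z: "Z \<in> comma_obj (cod_fun P)" by simp
    obtain x u v where z: "Z = \<langle>\<langle>x, u\<rangle>, v\<rangle>" "x \<in> Obj E" "u \<in> Arr B" "Dom B u = FOb P x"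
      "v \<in> Arr B" "Dom B v = Cod B u"
      by (rule s.s.P.comma2_objE[OF Z])
    show "NAt (sc_total (F2 CC \<theta> \<star>\<^bsub>CAT\<^sub>2 \<kappa>\<^esub> one2 (CAT\<^sub>2 \<kappa>) (mult CC P))) Z =
      NAt (sc_total (one2 (CAT\<^sub>2 \<kappa>) (mult CC Q) \<star>\<^bsub>CAT\<^sub>2 \<kappa>\<^esub> F2 CC (F2 CC \<theta>))) Z"
      using z(2-) cs.total.NAt_Arr(1)[of "\<langle>x, v \<cdot>\<^bsub>B\<^esub> u\<rangle>"] cc.NAt_Arr(1)[of Z]
        cat_functor.FAr_Arr(1)[OF s.s.Q.mult_functor cc.NAt_Arr(1)[of Z]]
      unfolding z(1)
      by (simp add: s(1) FF s.sqc_src cs.sqc_src)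
  qed (use l r in \<open>simp_all add: s(1)\<close>)
  then show ?thesis by (simp add: whisker_left_def whisker_right_def s(1))
qed


text \<open>On objects the two unit laws are v 1 = v and 1 v = v in B, and the associativity law is
  (w v) u = w (v u). Strictness of composition in B is thus what makes the 2-monad strict.\<close>

lemma CC_strict_two_monad: "strict_two_monad (CAT\<^sub>2 \<kappa>) CC"
proof -
  interpret two_functor "CAT\<^sub>2 \<kappa>" "CAT\<^sub>2 \<kappa>" CC by (rule comma_two_functor)
  show ?thesis
  proof
    fix P :: "'a univ fnctr" assume P: "P \<in> Cell0 (CAT\<^sub>2 \<kappa>)"
    obtain E B where e: "FDom P = E" "FCod P = B" by blast
    interpret comma_cat2 P E B using P e by (simp add: Cell1_CAT comma_cat2_def comma_cat_def)
    interpret c: comma_cat2 "cod_fun P" "comma P" B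
      using comma_cat_cod by (simp add: comma_cat2_def)
    show "unit CC P \<in> hom1 (CAT\<^sub>2 \<kappa>) P (F0 CC P)" using unit_Cell1[of P] P by simp
    show "mult CC P \<in> hom1 (CAT\<^sub>2 \<kappa>) (F0 CC (F0 CC P)) (F0 CC P)" using mult_Cell1[of P] P by simp
    interpret u: comma_square P E B "cod_fun P" "comma P" B "comma_unit_fun P" "fun_one B"
      using unit_square by (simp add: comma_square_def)
    interpret m: comma_square "cod_fun (cod_fun P)" "comma (cod_fun P)" B "cod_fun P" "comma P" B "comma_mult_fun P" "fun_one B"
      using mult_square by (simp add: comma_square_def)
    have su: "unit CC P = u.sq" and sm: "mult CC P = m.sq" by (rule square_eqI; simp)+
    have I: "fun_comp (fun_one B) (fun_one B) = fun_one B"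
      by (rule fun_comp_one[OF cat_functor_one[OF B.category_axioms]])
    show "mult CC P \<odot>\<^bsub>CAT\<^sub>2 \<kappa>\<^esub> unit CC (F0 CC P) = one1 (CAT\<^sub>2 \<kappa>) (F0 CC P)"
    proof (rule square_eqI)
      have "fun_comp (comma_mult_fun P) (comma_unit_fun (cod_fun P)) = fun_one (comma P)"
      proof (rule cat_functor_eqI[OF cat_functor_comp[OF c.unit_functor mult_functor] cat_functor_one[OF comma_category]])
        fix X assume "X \<in> Obj (comma P)"
        then have X: "X \<in> comma_obj P" by simp
        show "FOb (fun_comp (comma_mult_fun P) (comma_unit_fun (cod_fun P))) X = FOb (fun_one (comma P)) X"
          using X cat_functor.FOb_Obj[OF c.unit_functor, of X] by (elim comma_objE) simp
      next
        fix p assume "p \<in> Arr (comma P)"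
        then have p: "p \<in> comma_arr P" by simp
        show "FAr (fun_comp (comma_mult_fun P) (comma_unit_fun (cod_fun P))) p = FAr (fun_one (comma P)) p"
          using p cat_functor.FAr_Arr(1)[OF c.unit_functor, of p] by (elim comma_arrE) simp
      qed
      then show "sq_total (mult CC P \<odot>\<^bsub>CAT\<^sub>2 \<kappa>\<^esub> unit CC (F0 CC P)) = sq_total (one1 (CAT\<^sub>2 \<kappa>) (F0 CC P))" by simp
    qed (simp_all add: I)
    show "mult CC P \<odot>\<^bsub>CAT\<^sub>2 \<kappa>\<^esub> F1 CC (unit CC P) = one1 (CAT\<^sub>2 \<kappa>) (F0 CC P)"
    proof (rule square_eqI)
      have "fun_comp (comma_mult_fun P) (comma_map u.sq) = fun_one (comma P)"
      proof (rule cat_functor_eqI[OF cat_functor_comp[OF u.comma_map_functor mult_functor] cat_functor_one[OF comma_category]])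
        fix X assume "X \<in> Obj (comma P)"
        then have X: "X \<in> comma_obj P" by simp
        show "FOb (fun_comp (comma_mult_fun P) (comma_map u.sq)) X = FOb (fun_one (comma P)) X"
          using X cat_functor.FOb_Obj[OF u.comma_map_functor, of X] by (elim comma_objE) simp
      next
        fix p assume "p \<in> Arr (comma P)"
        then have p: "p \<in> comma_arr P" by simp
        show "FAr (fun_comp (comma_mult_fun P) (comma_map u.sq)) p = FAr (fun_one (comma P)) p"
          using p cat_functor.FAr_Arr(1)[OF u.comma_map_functor, of p] by (elim comma_arrE) simp
      qed
      then show "sq_total (mult CC P \<odot>\<^bsub>CAT\<^sub>2 \<kappa>\<^esub> F1 CC (unit CC P)) = sq_total (one1 (CAT\<^sub>2 \<kappa>) (F0 CC P))"
        by (simp, simp add: su)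
    qed (simp_all add: I)
    show "mult CC P \<odot>\<^bsub>CAT\<^sub>2 \<kappa>\<^esub> mult CC (F0 CC P) = mult CC P \<odot>\<^bsub>CAT\<^sub>2 \<kappa>\<^esub> F1 CC (mult CC P)"
    proof (rule square_eqI)
      have "fun_comp (comma_mult_fun P) (comma_mult_fun (cod_fun P)) = fun_comp (comma_mult_fun P) (comma_map m.sq)"
      proof (rule cat_functor_eqI[OF cat_functor_comp[OF c.mult_functor mult_functor] cat_functor_comp[OF m.comma_map_functor mult_functor]])
        fix W assume "W \<in> Obj (comma (cod_fun (cod_fun P)))"
        then have W: "W \<in> comma_obj (cod_fun (cod_fun P))" by simp
        obtain X v w where x: "W = \<langle>\<langle>X, v\<rangle>, w\<rangle>" "X \<in> Obj (comma P)" "v \<in> Arr B" "Dom B v = FOb (cod_fun P) X"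
          "w \<in> Arr B" "Dom B w = Cod B v" by (rule c.comma2_objE[OF W])
        from x(2) have "X \<in> comma_obj P" by simp
        then obtain x u where y: "X = \<langle>x, u\<rangle>" "x \<in> Obj E" "u \<in> Arr B" "Dom B u = FOb P x"
          by (rule comma_objE)
        show "FOb (fun_comp (comma_mult_fun P) (comma_mult_fun (cod_fun P))) W = FOb (fun_comp (comma_mult_fun P) (comma_map m.sq)) W"
          using W x(2-) y(2-) unfolding x(1) y(1) by simp
      next
        fix p assume "p \<in> Arr (comma (cod_fun (cod_fun P)))"
        then have p: "p \<in> comma_arr (cod_fun (cod_fun P))" by simp
        obtain q v u w V W r where q: 
          "p = carr \<langle>\<langle>Dom (comma P) q, u\<rangle>, V\<rangle> \<langle>\<langle>Cod (comma P) q, w\<rangle>, W\<rangle> (carr \<langle>Dom (comma P) q, u\<rangle> \<langle>Cod (comma P) q, w\<rangle> q v) r"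
          "q \<in> Arr (comma P)" "u \<in> Arr B" "Dom B u = FOb (cod_fun P) (Dom (comma P) q)" "w \<in> Arr B" "Dom B w = FOb (cod_fun P) (Cod (comma P) q)"
          "v \<in> Arr B" "Dom B v = Cod B u" "Cod B v = Cod B w" "v \<cdot>\<^bsub>B\<^esub> u = w \<cdot>\<^bsub>B\<^esub> FAr (cod_fun P) q"
          "V \<in> Arr B" "Dom B V = Cod B u" "W \<in> Arr B" "Dom B W = Cod B w" "r \<in> Arr B"
          "Dom B r = Cod B V" "Cod B r = Cod B W" "r \<cdot>\<^bsub>B\<^esub> V = W \<cdot>\<^bsub>B\<^esub> v"
          by (rule c.comma2_arrE[OF p])
        from q(2) have "q \<in> comma_arr P" by simp
        then obtain f v' u' w' where qq: "q = carr \<langle>Dom E f, u'\<rangle> \<langle>Cod E f, w'\<rangle> f v'"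
          "f \<in> Arr E" "u' \<in> Arr B" "Dom B u' = FOb P (Dom E f)" "w' \<in> Arr B" "Dom B w' = FOb P (Cod E f)"
          "v' \<in> Arr B" "Dom B v' = Cod B u'" "Cod B v' = Cod B w'" "v' \<cdot>\<^bsub>B\<^esub> u' = w' \<cdot>\<^bsub>B\<^esub> FAr P f"
          by (rule comma_arrE)
        have t: "carr_top p \<in> comma_arr (cod_fun P)" using c.c.carr_parts(1)[OF p] by simp
        have p': "p \<in> comma_arr (sq_src m.sq)" using p by simp
        have o: "carr_src p \<in> comma_obj (cod_fun (cod_fun P))" "carr_tgt p \<in> comma_obj (cod_fun (cod_fun P))"
          using c.c.carr_obj[OF p] .
        have "FAr (fun_comp (comma_mult_fun P) (comma_mult_fun (cod_fun P))) p =
            FAr (comma_mult_fun P) (FAr (comma_mult_fun (cod_fun P)) p)" using p by simp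
        \<comment> \<open>The common value of both composites: the multiplications discard the
          intermediate arrows and keep only the innermost top leg f and the outermost bottom leg
          r.\<close>
        also have "\<dots> = carr \<langle>Dom E f, V \<cdot>\<^bsub>B\<^esub> (u \<cdot>\<^bsub>B\<^esub> u')\<rangle> \<langle>Cod E f, W \<cdot>\<^bsub>B\<^esub> (w \<cdot>\<^bsub>B\<^esub> w')\<rangle> f r"
          unfolding comma_mult_fun_sel(4)[OF c.mult_fun_arr[OF p]] unfolding comma_mult_fun_sel(4)[OF p]
          using q(2-9) q(11-17) qq(2-9) unfolding q(1) qq(1) by simp
        also have "\<dots> = FAr (comma_mult_fun P) (FAr (comma_map m.sq) p)"
          unfolding comma_mult_fun_sel(4)[OF m.comma_map_arr[OF p]] unfolding comma_map_sel(4)[OF p'] square.simps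
            comma_mult_fun_sel(4)[OF t] comma_map_ob_def
          using q(2-9) q(11-17) qq(2-9) o unfolding q(1) qq(1) by simp
        also have "\<dots> = FAr (fun_comp (comma_mult_fun P) (comma_map m.sq)) p" using p by simp
        finally show "FAr (fun_comp (comma_mult_fun P) (comma_mult_fun (cod_fun P))) p = FAr (fun_comp (comma_mult_fun P) (comma_map m.sq)) p" .
      qed
      then show "sq_total (mult CC P \<odot>\<^bsub>CAT\<^sub>2 \<kappa>\<^esub> mult CC (F0 CC P)) = sq_total (mult CC P \<odot>\<^bsub>CAT\<^sub>2 \<kappa>\<^esub> F1 CC (mult CC P))"
        by (simp, simp add: sm)
    qed (simp_all add: I)
  next
    fix s :: "'a univ fnctr square" assume s: "s \<in> Cell1 (CAT\<^sub>2 \<kappa>)"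
    show "F1 CC s \<odot>\<^bsub>CAT\<^sub>2 \<kappa>\<^esub> unit CC (src1 (CAT\<^sub>2 \<kappa>) s) = unit CC (tgt1 (CAT\<^sub>2 \<kappa>) s) \<odot>\<^bsub>CAT\<^sub>2 \<kappa>\<^esub> s"
      using unit_natural1[OF s] by simp
    show "F1 CC s \<odot>\<^bsub>CAT\<^sub>2 \<kappa>\<^esub> mult CC (src1 (CAT\<^sub>2 \<kappa>) s) = mult CC (tgt1 (CAT\<^sub>2 \<kappa>) s) \<odot>\<^bsub>CAT\<^sub>2 \<kappa>\<^esub> F1 CC (F1 CC s)"
      using mult_natural1[OF s] by simp
  next
    fix \<theta> :: "('a univ fnctr, 'a univ nattr) sqcell" assume h: "\<theta> \<in> Cell2 (CAT\<^sub>2 \<kappa>)"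
    show "F2 CC \<theta> \<rhd>\<^bsub>CAT\<^sub>2 \<kappa>\<^esub> unit CC (src1 (CAT\<^sub>2 \<kappa>) (src2 (CAT\<^sub>2 \<kappa>) \<theta>)) =
        unit CC (tgt1 (CAT\<^sub>2 \<kappa>) (src2 (CAT\<^sub>2 \<kappa>) \<theta>)) \<lhd>\<^bsub>CAT\<^sub>2 \<kappa>\<^esub> \<theta>"
      using unit_natural2[OF h] by simp
    show "F2 CC \<theta> \<rhd>\<^bsub>CAT\<^sub>2 \<kappa>\<^esub> mult CC (src1 (CAT\<^sub>2 \<kappa>) (src2 (CAT\<^sub>2 \<kappa>) \<theta>)) =
        mult CC (tgt1 (CAT\<^sub>2 \<kappa>) (src2 (CAT\<^sub>2 \<kappa>) \<theta>)) \<lhd>\<^bsub>CAT\<^sub>2 \<kappa>\<^esub> F2 CC (F2 CC \<theta>)"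
      using mult_natural2[OF h] by simp
  qed
qed

end

section \<open>Cocartesian arrows\<close>

lemma iso_inverse:
  assumes "iso C h"
  obtains k where "h \<in> Arr C" "k \<in> Arr C" "Dom C k = Cod C h" "Cod C k = Dom C h"
    "k \<cdot>\<^bsub>C\<^esub> h = Ide C (Dom C h)" "h \<cdot>\<^bsub>C\<^esub> k = Ide C (Cod C h)"
  using assms by (auto simp: iso_def)

lemma isoI:
  assumes "h \<in> Arr C" "k \<in> Arr C" "Dom C k = Cod C h" "Cod C k = Dom C h"
    "k \<cdot>\<^bsub>C\<^esub> h = Ide C (Dom C h)" "h \<cdot>\<^bsub>C\<^esub> k = Ide C (Cod C h)"
  shows "iso C h"
  using assms by (auto simp: iso_def)

context cat_functor
begin

lemma cocartesian_Arr: "cocartesian F e \<Longrightarrow> e \<in> Arr A"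
  by (simp add: cocartesian_def)

lemma cocartesian_fill:
  assumes "cocartesian F e" "g \<in> Arr A" "Dom A g = Dom A e" "v \<in> Arr B"
    "Dom B v = FOb F (Cod A e)" "Cod B v = FOb F (Cod A g)" "FAr F g = v \<cdot>\<^bsub>B\<^esub> FAr F e"
  obtains h where "h \<in> Arr A" "Dom A h = Cod A e" "Cod A h = Cod A g" "h \<cdot>\<^bsub>A\<^esub> e = g" "FAr F h = v"
  using assms unfolding cocartesian_def FDom_eq FCod_eq in_hom by metis

lemma cocartesian_unique:
  assumes e: "cocartesian F e" and h: "h \<in> Arr A" "Dom A h = Cod A e" and k: "k \<in> Arr A" "Dom A k = Cod A e"
    and eq: "h \<cdot>\<^bsub>A\<^esub> e = k \<cdot>\<^bsub>A\<^esub> e" "FAr F h = FAr F k"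
  shows "h = k"
proof -
  have eA: "e \<in> Arr A" using e by (rule cocartesian_Arr)
  \<comment> \<open>The codomains of h and k agree because those of their composites with e do; this
    places both arrows among the fillers for one and the same problem.\<close>
  have "Cod A h = Cod A (h \<cdot>\<^bsub>A\<^esub> e)" "Cod A k = Cod A (k \<cdot>\<^bsub>A\<^esub> e)" using eA h k by simp_all
  then have c: "Cod A h = Cod A k" using eq by simp
  let ?P = "\<lambda>h'. h' \<in> hom A (Cod A e) (Cod A k) \<and> h' \<cdot>\<^bsub>A\<^esub> e = k \<cdot>\<^bsub>A\<^esub> e \<and> FAr F h' = FAr F k"
  have "\<exists>!h'. ?P h'"
    using e[unfolded cocartesian_def FDom_eq FCod_eq, THEN conjunct2, rule_format,
        of "k \<cdot>\<^bsub>A\<^esub> e" "FAr F k"] eA k by simp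
  moreover have "?P h" "?P k" using h k c eq by simp_all
  ultimately show ?thesis by blast
qed

lemma cocartesianI:
  assumes "e \<in> Arr A"
    and "\<And>g v. \<lbrakk>g \<in> Arr A; Dom A g = Dom A e; v \<in> Arr B; Dom B v = FOb F (Cod A e);
      Cod B v = FOb F (Cod A g); FAr F g = v \<cdot>\<^bsub>B\<^esub> FAr F e\<rbrakk> \<Longrightarrow>
      \<exists>h. h \<in> Arr A \<and> Dom A h = Cod A e \<and> Cod A h = Cod A g \<and> h \<cdot>\<^bsub>A\<^esub> e = g \<and> FAr F h = v"
    and "\<And>h k. \<lbrakk>h \<in> Arr A; k \<in> Arr A; Dom A h = Cod A e; Dom A k = Cod A e;
      h \<cdot>\<^bsub>A\<^esub> e = k \<cdot>\<^bsub>A\<^esub> e; FAr F h = FAr F k\<rbrakk> \<Longrightarrow> h = k"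
  shows "cocartesian F e"
  unfolding cocartesian_def FDom_eq FCod_eq in_hom
  by (intro conjI assms(1) ballI impI ex_ex1I) (use assms(2,3) in \<open>blast, metis\<close>)

text \<open>Fillers are found in two stages, first through d over \<open>v \<cdot> FAr F e\<close>
  and then through e over v; uniqueness is cancelled in the same order.\<close>

lemma cocartesian_comp:
  assumes d: "cocartesian F d" and e: "cocartesian F e" and de: "Cod A d = Dom A e"
  shows "cocartesian F (e \<cdot>\<^bsub>A\<^esub> d)"
proof (rule cocartesianI)
  note A = cocartesian_Arr[OF d] cocartesian_Arr[OF e]
  then show "e \<cdot>\<^bsub>A\<^esub> d \<in> Arr A" using de by simp
  fix g v
  assume g: "g \<in> Arr A" "Dom A g = Dom A (e \<cdot>\<^bsub>A\<^esub> d)" "v \<in> Arr B" "Dom B v = FOb F (Cod A (e \<cdot>\<^bsub>A\<^esub> d))"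
      "Cod B v = FOb F (Cod A g)" "FAr F g = v \<cdot>\<^bsub>B\<^esub> FAr F (e \<cdot>\<^bsub>A\<^esub> d)"
  obtain h where h: "h \<in> Arr A" "Dom A h = Cod A d" "Cod A h = Cod A g" "h \<cdot>\<^bsub>A\<^esub> d = g" "FAr F h = v \<cdot>\<^bsub>B\<^esub> FAr F e"
    by (rule cocartesian_fill[OF d, of g "v \<cdot>\<^bsub>B\<^esub> FAr F e"]) (use g A de in simp_all)
  obtain k where k: "k \<in> Arr A" "Dom A k = Cod A e" "Cod A k = Cod A h" "k \<cdot>\<^bsub>A\<^esub> e = h" "FAr F k = v"
    by (rule cocartesian_fill[OF e, of h v]) (use g h A de in simp_all)
  show "\<exists>h. h \<in> Arr A \<and> Dom A h = Cod A (e \<cdot>\<^bsub>A\<^esub> d) \<and> Cod A h = Cod A g \<and> h \<cdot>\<^bsub>A\<^esub> (e \<cdot>\<^bsub>A\<^esub> d) = g \<and> FAr F h = v"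
    using k h A de A.Comp_reassoc[OF k(4), of d] by (intro exI[of _ k]) simp
next
  note A = cocartesian_Arr[OF d] cocartesian_Arr[OF e]
  fix h k assume hk: "h \<in> Arr A" "k \<in> Arr A" "Dom A h = Cod A (e \<cdot>\<^bsub>A\<^esub> d)" "Dom A k = Cod A (e \<cdot>\<^bsub>A\<^esub> d)"
      "h \<cdot>\<^bsub>A\<^esub> (e \<cdot>\<^bsub>A\<^esub> d) = k \<cdot>\<^bsub>A\<^esub> (e \<cdot>\<^bsub>A\<^esub> d)" "FAr F h = FAr F k"
  have "h \<cdot>\<^bsub>A\<^esub> e = k \<cdot>\<^bsub>A\<^esub> e"
    by (rule cocartesian_unique[OF d]) (use hk A de in simp_all)
  then show "h = k"
    by (rule cocartesian_unique[OF e, rotated 4]) (use hk A de in simp_all)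
qed

text \<open>The filler for g is g composed with the inverse. It lies over the prescribed v because
  the functor sends the inverse of h to an inverse of its image.\<close>

lemma iso_cocartesian: 
  assumes "iso A h"
  shows "cocartesian F h"
proof -
  obtain k where k: "h \<in> Arr A" "k \<in> Arr A" "Dom A k = Cod A h" "Cod A k = Dom A h"
    "k \<cdot>\<^bsub>A\<^esub> h = Ide A (Dom A h)" "h \<cdot>\<^bsub>A\<^esub> k = Ide A (Cod A h)"
    by (rule iso_inverse[OF assms])
  have Fk: "FAr F h \<cdot>\<^bsub>B\<^esub> FAr F k = Ide B (FOb F (Cod A h))"
    using k(1-4) arg_cong[OF k(6), of "FAr F"] by simp
  have cancel: "(g \<cdot>\<^bsub>A\<^esub> h) \<cdot>\<^bsub>A\<^esub> k = g" if "g \<in> Arr A" "Dom A g = Cod A h" for g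
    using that k by simp
  show ?thesis
  proof (rule cocartesianI)
    show "h \<in> Arr A" by fact
    fix g v assume g: "g \<in> Arr A" "Dom A g = Dom A h" "v \<in> Arr B" "Dom B v = FOb F (Cod A h)"
      "Cod B v = FOb F (Cod A g)" "FAr F g = v \<cdot>\<^bsub>B\<^esub> FAr F h"
    have "FAr F (g \<cdot>\<^bsub>A\<^esub> k) = (v \<cdot>\<^bsub>B\<^esub> FAr F h) \<cdot>\<^bsub>B\<^esub> FAr F k" using g(1,2) k by (simp flip: g(6))
    also have "\<dots> = v" using g k Fk by simp
    finally have "FAr F (g \<cdot>\<^bsub>A\<^esub> k) = v" .
    moreover have "(g \<cdot>\<^bsub>A\<^esub> k) \<cdot>\<^bsub>A\<^esub> h = g" using g(1,2) k by simp
    ultimately show "\<exists>k. k \<in> Arr A \<and> Dom A k = Cod A h \<and> Cod A k = Cod A g \<and> k \<cdot>\<^bsub>A\<^esub> h = g \<and> FAr F k = v"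
      using g(1,2) k(1-4) by (intro exI[of _ "g \<cdot>\<^bsub>A\<^esub> k"]) simp
  next
    fix g g' assume "g \<in> Arr A" "g' \<in> Arr A" "Dom A g = Cod A h" "Dom A g' = Cod A h" "g \<cdot>\<^bsub>A\<^esub> h = g' \<cdot>\<^bsub>A\<^esub> h"
    then show "g = g'" using cancel[of g] cancel[of g'] by metis
  qed
qed

text \<open>Filling each arrow through the other over an identity gives a pair of vertical arrows,
  and uniqueness of fillers makes them mutually inverse. Compositors, comparison cells and the
  factorisation of a cocartesian arrow through the designated lift are all obtained from
  this.\<close>

lemma cocartesian_iso:
  assumes d: "cocartesian F d" and e: "cocartesian F e" and de: "Dom A d = Dom A e" "FAr F d = FAr F e"
  obtains h where "h \<in> Arr A" "Dom A h = Cod A d" "Cod A h = Cod A e" "h \<cdot>\<^bsub>A\<^esub> d = e"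
    "FAr F h = Ide B (FOb F (Cod A e))" "iso A h"
proof -
  note A = cocartesian_Arr[OF d] cocartesian_Arr[OF e]
  have c: "FOb F (Cod A d) = FOb F (Cod A e)" using A arg_cong[OF de(2), of "Cod B"] by simp
  obtain h where h: "h \<in> Arr A" "Dom A h = Cod A d" "Cod A h = Cod A e" "h \<cdot>\<^bsub>A\<^esub> d = e" "FAr F h = Ide B (FOb F (Cod A e))"
    by (rule cocartesian_fill[OF d, of e "Ide B (FOb F (Cod A e))"]) (use A c de in simp_all)
  obtain k where k: "k \<in> Arr A" "Dom A k = Cod A e" "Cod A k = Cod A d" "k \<cdot>\<^bsub>A\<^esub> e = d" "FAr F k = Ide B (FOb F (Cod A e))"
    by (rule cocartesian_fill[OF e, of d "Ide B (FOb F (Cod A e))"]) (use A c de in simp_all)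
  have "k \<cdot>\<^bsub>A\<^esub> h = Ide A (Cod A d)"
    by (rule cocartesian_unique[OF d]) (use A h k c in simp_all)
  moreover have "h \<cdot>\<^bsub>A\<^esub> k = Ide A (Cod A e)"
    by (rule cocartesian_unique[OF e]) (use A h k c in simp_all)
  ultimately have "iso A h" using h k by (intro isoI[of h A k]) simp_all
  with h show thesis by (rule that)
qed

end

section \<open>The action and the compositors of a cleavage\<close>

locale cloven = comma_cat2 P E B for P :: "'a univ fnctr" and E B +
  fixes \<delta>
  assumes cleavage: "normal_cleavage P \<delta>"
begin

abbreviation "cof \<equiv> \<lparr>cf_fun = P, cf_lift = \<delta>\<rparr>"

lemma lift:
  assumes "x \<in> Obj E" "u \<in> Arr B" "Dom B u = FOb P x"
  shows lift_cocartesian: "cocartesian P (\<delta> x u)" and lift_Arr [simp]: "\<delta> x u \<in> Arr E"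
    and lift_Dom [simp]: "Dom E (\<delta> x u) = x" and lift_over [simp]: "FAr P (\<delta> x u) = u"
  using cleavage assms cocartesian_Arr[of "\<delta> x u"] by (auto simp: normal_cleavage_def liftable_def)

lemma lift_Cod [simp]:
  "\<lbrakk>x \<in> Obj E; u \<in> Arr B; Dom B u = FOb P x\<rbrakk> \<Longrightarrow> FOb P (Cod E (\<delta> x u)) = Cod B u"
  using FAr_Arr(3)[of "\<delta> x u"] by simp

lemma lift_Ide [simp]: "x \<in> Obj E \<Longrightarrow> \<delta> x (Ide B (FOb P x)) = Ide E x"
  using cleavage by (simp add: normal_cleavage_def)

text \<open>The filling problem that defines the action on arrows: boundary, lift equation and image
  in the base together describe a filler through the cocartesian lift at the source, so exactly one
  arrow qualifies.\<close>

definition act_spec where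
  "act_spec p h \<longleftrightarrow> h \<in> Arr E \<and> Dom E h = Cod E (\<delta> (lft (carr_src p)) (rgt (carr_src p))) \<and>
    Cod E h = Cod E (\<delta> (lft (carr_tgt p)) (rgt (carr_tgt p))) \<and>
    h \<cdot>\<^bsub>E\<^esub> \<delta> (lft (carr_src p)) (rgt (carr_src p)) = \<delta> (lft (carr_tgt p)) (rgt (carr_tgt p)) \<cdot>\<^bsub>E\<^esub> carr_top p \<and>
    FAr P h = carr_bot p"

lemma act_spec_ex1:
  assumes "p \<in> comma_arr P"
  shows "\<exists>!h. act_spec p h"
proof -
  obtain f v u w where p: "p = carr \<langle>Dom E f, u\<rangle> \<langle>Cod E f, w\<rangle> f v"
    "f \<in> Arr E" "u \<in> Arr B" "Dom B u = FOb P (Dom E f)" "w \<in> Arr B" "Dom B w = FOb P (Cod E f)"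
    "v \<in> Arr B" "Dom B v = Cod B u" "Cod B v = Cod B w" "v \<cdot>\<^bsub>B\<^esub> u = w \<cdot>\<^bsub>B\<^esub> FAr P f"
    by (rule comma_arrE[OF assms])
  have c: "cocartesian P (\<delta> (Dom E f) u)" using p by (intro lift_cocartesian) simp_all
  obtain h where "h \<in> Arr E" "Dom E h = Cod E (\<delta> (Dom E f) u)" "Cod E h = Cod E (\<delta> (Cod E f) w \<cdot>\<^bsub>E\<^esub> f)"
    "h \<cdot>\<^bsub>E\<^esub> \<delta> (Dom E f) u = \<delta> (Cod E f) w \<cdot>\<^bsub>E\<^esub> f" "FAr P h = v"
    by (rule cocartesian_fill[OF c, of "\<delta> (Cod E f) w \<cdot>\<^bsub>E\<^esub> f" v]) (use p(2-) in simp_all)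
  then have "act_spec p h" using p(2-) by (simp add: act_spec_def p(1))
  moreover have "h' = h" if "act_spec p h'" for h'
    by (rule cocartesian_unique[OF c])
      (use that \<open>act_spec p h\<close> p(2-) in \<open>simp_all add: act_spec_def p(1)\<close>)
  ultimately show ?thesis by blast
qed

definition L where
  "L = \<lparr>FDom = comma P, FCod = E, FOb = (\<lambda>X \<in> comma_obj P. Cod E (\<delta> (lft X) (rgt X))),
    FAr = (\<lambda>p \<in> comma_arr P. THE h. act_spec p h)\<rparr>"

lemma L_sel: "FDom L = comma P" "FCod L = E" "Z \<in> comma_obj P \<Longrightarrow> FOb L Z = Cod E (\<delta> (lft Z) (rgt Z))"
  by (simp_all add: L_def)

lemma L_arr: "p \<in> comma_arr P \<Longrightarrow> act_spec p (FAr L p)"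
  using theI'[OF act_spec_ex1] by (simp add: L_def)

lemma L_eqI: "p \<in> comma_arr P \<Longrightarrow> act_spec p h \<Longrightarrow> FAr L p = h"
  using act_spec_ex1 L_arr by blast

text \<open>Identities solve the filling problem of an identity and composites of solutions solve
  that of a composite; uniqueness turns this into functoriality.\<close>

lemma L_functor: "cat_functor L (comma P) E"
proof (rule cat_functorI[OF comma_category A.category_axioms])
  fix Z assume "Z \<in> Obj (comma P)"
  then have Z: "Z \<in> comma_obj P" by simp
  then show "FOb L Z \<in> Obj E" by (auto simp: L_sel elim: comma_objE)
  have i: "Ide (comma P) Z \<in> comma_arr P" using category.Ide_Arr(1)[OF comma_category, of Z] Z by simp
  show "FAr L (Ide (comma P) Z) = Ide E (FOb L Z)"
    using i Z by (intro L_eqI) (auto simp: act_spec_def L_sel elim: comma_objE)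
next
  fix p assume "p \<in> Arr (comma P)"
  then show "FAr L p \<in> hom E (FOb L (Dom (comma P) p)) (FOb L (Cod (comma P) p))"
    using L_arr[of p] by (auto simp: act_spec_def L_sel carr_obj)
next
  fix p q assume "p \<in> Arr (comma P)" "q \<in> Arr (comma P)" "Cod (comma P) p = Dom (comma P) q"
  then have pq: "p \<in> comma_arr P" "q \<in> comma_arr P" "carr_tgt p = carr_src q" by simp_all
  have s: "act_spec p (FAr L p)" "act_spec q (FAr L q)" using pq L_arr by auto
  note o = comma_obj_parts[OF carr_obj(1)[OF pq(1)]] comma_obj_parts[OF carr_obj(1)[OF pq(2)]]
    comma_obj_parts[OF carr_obj(2)[OF pq(1)]] comma_obj_parts[OF carr_obj(2)[OF pq(2)]]
  have qL: "FAr L q \<cdot>\<^bsub>E\<^esub> \<delta> (lft (carr_src q)) (rgt (carr_src q)) =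
      \<delta> (lft (carr_tgt q)) (rgt (carr_tgt q)) \<cdot>\<^bsub>E\<^esub> carr_top q"
    using s by (simp add: act_spec_def)
  have "FAr L q \<cdot>\<^bsub>E\<^esub> (FAr L p \<cdot>\<^bsub>E\<^esub> \<delta> (lft (carr_src p)) (rgt (carr_src p))) =
      FAr L q \<cdot>\<^bsub>E\<^esub> (\<delta> (lft (carr_src q)) (rgt (carr_src q)) \<cdot>\<^bsub>E\<^esub> carr_top p)"
    using s pq by (simp add: act_spec_def)
  also have "\<dots> = \<delta> (lft (carr_tgt q)) (rgt (carr_tgt q)) \<cdot>\<^bsub>E\<^esub> (carr_top q \<cdot>\<^bsub>E\<^esub> carr_top p)"
    using A.Comp_reassoc[OF qL] s pq o carr_parts[OF pq(1)] carr_parts[OF pq(2)]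
    by (simp add: act_spec_def)
  finally show "FAr L (q \<cdot>\<^bsub>comma P\<^esub> p) = FAr L q \<cdot>\<^bsub>E\<^esub> FAr L p"
    using comma_comp_arr[OF pq] pq s o by (intro L_eqI) (simp_all add: act_spec_def)
qed (simp_all add: L_def)

end

sublocale cloven \<subseteq> L: cat_functor L "comma P" E by (rule L_functor)

context cloven
begin

lemma FOb_L [simp]:
  "\<lbrakk>x \<in> Obj E; u \<in> Arr B; Dom B u = FOb P x\<rbrakk> \<Longrightarrow> FOb L \<langle>x, u\<rangle> = Cod E (\<delta> x u)"
  by (simp add: L_sel)

lemma FAr_P_L [simp]: "p \<in> comma_arr P \<Longrightarrow> FAr P (FAr L p) = carr_bot p"
  using L_arr by (simp add: act_spec_def)

lemma L_lift:
  "carr \<langle>x, u\<rangle> \<langle>y, w\<rangle> f v \<in> comma_arr P \<Longrightarrow>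
    FAr L (carr \<langle>x, u\<rangle> \<langle>y, w\<rangle> f v) \<cdot>\<^bsub>E\<^esub> \<delta> x u = \<delta> y w \<cdot>\<^bsub>E\<^esub> f"
  using L_arr[of "carr \<langle>x, u\<rangle> \<langle>y, w\<rangle> f v"] by (simp add: act_spec_def del: comma_arr_iff)

text \<open>A functor over B that respects lifts solves the same filling problems as L. The lemma
  serves twice: it evaluates the definite description in \<open>action_fun\<close>, and it
  identifies the action of a normal pseudoalgebra with the action of its own cleavage.\<close>

lemma action_fun_eqI:
  assumes M: "cat_functor M (comma P) E"
    and ob: "\<And>x u. \<langle>x, u\<rangle> \<in> comma_obj P \<Longrightarrow> FOb M \<langle>x, u\<rangle> = Cod E (\<delta> x u)"
    and over: "fun_comp P M = cod_fun P"
    and lift: "\<And>x u y w f v. carr \<langle>x, u\<rangle> \<langle>y, w\<rangle> f v \<in> comma_arr P \<Longrightarrow>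
      FAr M (carr \<langle>x, u\<rangle> \<langle>y, w\<rangle> f v) \<cdot>\<^bsub>E\<^esub> \<delta> x u = \<delta> y w \<cdot>\<^bsub>E\<^esub> f"
  shows "M = L"
proof -
  interpret M: cat_functor M "comma P" E by fact
  show ?thesis
  proof (rule cat_functor_eqI[OF M L_functor])
    fix Z assume "Z \<in> Obj (comma P)"
    then have "Z \<in> comma_obj P" by simp
    then show "FOb M Z = FOb L Z" using ob by (auto elim!: comma_objE simp: L_sel)
  next
    fix p assume "p \<in> Arr (comma P)"
    then have p: "p \<in> comma_arr P" by simp
    obtain x u y w f v where e: "p = carr \<langle>x, u\<rangle> \<langle>y, w\<rangle> f v" using p by (rule comma_arrE)
    have "FAr (fun_comp P M) p = FAr (cod_fun P) p" by (simp add: over)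
    then have "FAr P (FAr M p) = carr_bot p" using p by simp
    moreover have "\<langle>x, u\<rangle> \<in> comma_obj P" "\<langle>y, w\<rangle> \<in> comma_obj P" using carr_obj[OF p] e by simp_all
    ultimately have "act_spec p (FAr M p)"
      unfolding act_spec_def using M.FAr_Arr[of p] p lift[of x u y w f v] ob
      by (simp add: e del: comma_arr_iff comma_obj_iff)
    then show "FAr M p = FAr L p" using L_eqI[OF p] by simp
  qed
qed

lemma L_over: "fun_comp P L = cod_fun P"
proof (rule cat_functor_eqI[OF cat_functor_comp[OF L_functor cat_functor_axioms] cod_functor])
  fix Z assume "Z \<in> Obj (comma P)"
  then have "Z \<in> comma_obj P" by simp
  then show "FOb (fun_comp P L) Z = FOb (cod_fun P) Z"
    by (rule comma_objE) simp
next
  fix p assume "p \<in> Arr (comma P)"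
  then show "FAr (fun_comp P L) p = FAr (cod_fun P) p" by simp
qed

lemma action_fun_eq: "action_fun cof = L"
  unfolding action_fun_def Let_def
proof (rule the_equality)
  show "is_functor L \<and> FDom L = comma (cf_fun cof) \<and> FCod L = FDom (cf_fun cof) \<and>
    (\<forall>x u. \<langle>x, u\<rangle> \<in> comma_obj (cf_fun cof) \<longrightarrow> FOb L \<langle>x, u\<rangle> = push cof u x) \<and>
    fun_comp (cf_fun cof) L = cod_fun (cf_fun cof) \<and>
    (\<forall>x u y w f v. carr \<langle>x, u\<rangle> \<langle>y, w\<rangle> f v \<in> comma_arr (cf_fun cof) \<longrightarrow>
      FAr L (carr \<langle>x, u\<rangle> \<langle>y, w\<rangle> f v) \<cdot>\<^bsub>FDom (cf_fun cof)\<^esub> cf_lift cof x u = cf_lift cof y w \<cdot>\<^bsub>FDom (cf_fun cof)\<^esub> f)"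
    using L_lift L_over L.is_functor by (simp add: push_def)
next
  fix M
  assume "is_functor M \<and> FDom M = comma (cf_fun cof) \<and> FCod M = FDom (cf_fun cof) \<and>
    (\<forall>x u. \<langle>x, u\<rangle> \<in> comma_obj (cf_fun cof) \<longrightarrow> FOb M \<langle>x, u\<rangle> = push cof u x) \<and>
    fun_comp (cf_fun cof) M = cod_fun (cf_fun cof) \<and>
    (\<forall>x u y w f v. carr \<langle>x, u\<rangle> \<langle>y, w\<rangle> f v \<in> comma_arr (cf_fun cof) \<longrightarrow>
      FAr M (carr \<langle>x, u\<rangle> \<langle>y, w\<rangle> f v) \<cdot>\<^bsub>FDom (cf_fun cof)\<^esub> cf_lift cof x u = cf_lift cof y w \<cdot>\<^bsub>FDom (cf_fun cof)\<^esub> f)"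
  then show "M = L"
    by (intro action_fun_eqI) (simp_all add: cat_functor_def push_def)
qed

text \<open>The composite of two designated lifts and the designated lift of the composite are both
  cocartesian over \<open>v \<cdot> u\<close> with source x, so a unique vertical isomorphism
  relates them.\<close>

lemma compositor_spec:
  assumes x: "x \<in> Obj E" "u \<in> Arr B" "Dom B u = FOb P x" "v \<in> Arr B" "Dom B v = Cod B u"
  obtains h where "compositor cof v u x = h" "h \<in> Arr E" "Dom E h = Cod E (\<delta> (Cod E (\<delta> x u)) v)"
    "Cod E h = Cod E (\<delta> x (v \<cdot>\<^bsub>B\<^esub> u))" "FAr P h = Ide B (Cod B v)" "iso E h"
    "h \<cdot>\<^bsub>E\<^esub> (\<delta> (Cod E (\<delta> x u)) v \<cdot>\<^bsub>E\<^esub> \<delta> x u) = \<delta> x (v \<cdot>\<^bsub>B\<^esub> u)"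
proof -
  define d where "d = \<delta> (Cod E (\<delta> x u)) v \<cdot>\<^bsub>E\<^esub> \<delta> x u"
  define e where "e = \<delta> x (v \<cdot>\<^bsub>B\<^esub> u)"
  have d: "cocartesian P d"
    unfolding d_def using x by (intro cocartesian_comp lift_cocartesian) simp_all
  have e: "cocartesian P e"
    unfolding e_def using x by (intro lift_cocartesian) simp_all
  have de: "Dom E d = x" "Dom E e = x" "FAr P d = v \<cdot>\<^bsub>B\<^esub> u" "FAr P e = v \<cdot>\<^bsub>B\<^esub> u"
    "FOb P (Cod E e) = Cod B v" "Cod E d = Cod E (\<delta> (Cod E (\<delta> x u)) v)"
    using x by (simp_all add: d_def e_def)
  obtain h where h: "h \<in> Arr E" "Dom E h = Cod E d" "Cod E h = Cod E e" "h \<cdot>\<^bsub>E\<^esub> d = e"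
    "FAr P h = Ide B (FOb P (Cod E e))" "iso E h"
    by (rule cocartesian_iso[OF d e]) (use de in simp_all)
  have "compositor cof v u x = (THE h. h \<in> hom E (Cod E d) (Cod E e) \<and> vertical P h \<and> iso E h \<and> h \<cdot>\<^bsub>E\<^esub> d = e)"
    unfolding compositor_def Let_def push_def by (simp add: de(6)) (simp add: d_def e_def)
  also have "\<dots> = h"
  proof (rule the_equality)
    show "h \<in> hom E (Cod E d) (Cod E e) \<and> vertical P h \<and> iso E h \<and> h \<cdot>\<^bsub>E\<^esub> d = e"
      using h cocartesian_Arr[OF e] by (auto simp: vertical_def)
    fix k assume k': "k \<in> hom E (Cod E d) (Cod E e) \<and> vertical P k \<and> iso E k \<and> k \<cdot>\<^bsub>E\<^esub> d = e"
    then obtain b where k: "k \<in> Arr E" "Dom E k = Cod E d" "Cod E k = Cod E e" "b \<in> Obj B" "FAr P k = Ide B b" "k \<cdot>\<^bsub>E\<^esub> d = e"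
      by (auto simp: vertical_def)
    \<comment> \<open>Verticality only says that the image is an identity on some object; the
      codomain of k forces which one.\<close>
    have b: "b = FOb P (Cod E e)" using k(4) FAr_Arr(3)[OF k(1)] k(3,5) by simp
    show "k = h"
      by (rule cocartesian_unique[OF d]) (use k h b in simp_all)
  qed
  finally show thesis
    by (rule that) (use h de in \<open>simp_all add: d_def e_def\<close>)
qed

text \<open>The composite lift is cocartesian, so its equation and verticality already single out
  the arrow; invertibility then comes from the compositor. This is the practical test for equations
  about compositors.\<close>

lemma compositor_eqI:
  assumes x: "x \<in> Obj E" "u \<in> Arr B" "Dom B u = FOb P x" "v \<in> Arr B" "Dom B v = Cod B u"
    and h: "h \<in> Arr E" "Dom E h = Cod E (\<delta> (Cod E (\<delta> x u)) v)" "FAr P h = Ide B (Cod B v)"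
      "h \<cdot>\<^bsub>E\<^esub> (\<delta> (Cod E (\<delta> x u)) v \<cdot>\<^bsub>E\<^esub> \<delta> x u) = \<delta> x (v \<cdot>\<^bsub>B\<^esub> u)"
  shows "compositor cof v u x = h"
proof -
  obtain k where k: "compositor cof v u x = k" "k \<in> Arr E" "Dom E k = Cod E (\<delta> (Cod E (\<delta> x u)) v)"
    "FAr P k = Ide B (Cod B v)" "k \<cdot>\<^bsub>E\<^esub> (\<delta> (Cod E (\<delta> x u)) v \<cdot>\<^bsub>E\<^esub> \<delta> x u) = \<delta> x (v \<cdot>\<^bsub>B\<^esub> u)"
    by (rule compositor_spec[OF x])
  have "cocartesian P (\<delta> (Cod E (\<delta> x u)) v \<cdot>\<^bsub>E\<^esub> \<delta> x u)"
    using x by (intro cocartesian_comp lift_cocartesian) simp_all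
  then have "k = h"
    by (rule cocartesian_unique) (use k h x in simp_all)
  then show ?thesis using k by simp
qed

end

section \<open>Boundaries of the pseudoalgebra pasting diagrams\<close>

context two_category
begin

lemma whisker_left_hom2:
  "\<lbrakk>\<alpha> \<in> hom2 K f f'; g \<in> Cell1 K; tgt1 K f = src1 K g\<rbrakk> \<Longrightarrow> g \<lhd> \<alpha> \<in> hom2 K (g \<odot> f) (g \<odot> f')"
  using hcomp_cell[of \<alpha> "one2 K g"] by (simp add: whisker_left_def)

lemma whisker_right_hom2:
  "\<lbrakk>\<alpha> \<in> hom2 K f f'; g \<in> Cell1 K; tgt1 K g = src1 K f\<rbrakk> \<Longrightarrow> \<alpha> \<rhd> g \<in> hom2 K (f \<odot> g) (f' \<odot> g)"
  using hcomp_cell[of "one2 K g" \<alpha>] by (simp add: whisker_right_def)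

lemma vcomp_hom2: "\<lbrakk>\<alpha> \<in> hom2 K f g; \<beta> \<in> hom2 K g h\<rbrakk> \<Longrightarrow> \<beta> \<bullet> \<alpha> \<in> hom2 K f h"
  by simp

lemma one2_hom2: "f \<in> Cell1 K \<Longrightarrow> one2 K f \<in> hom2 K f f"
  by simp

lemma invertible2_one2: "f \<in> Cell1 K \<Longrightarrow> invertible2 K (one2 K f)"
  using vcomp_one_left[of "one2 K f"] by (auto simp: invertible2_def intro!: bexI[of _ "one2 K f"])

end

context strict_two_monad
begin

lemma T1 [simp]:
  assumes "f \<in> Cell1 K"
  shows "F1 T f \<in> Cell1 K" "src1 K (F1 T f) = F0 T (src1 K f)" "tgt1 K (F1 T f) = F0 T (tgt1 K f)"
  using F1_in[OF assms] by simp_all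

lemma T2_hom2: "\<alpha> \<in> hom2 K f g \<Longrightarrow> F2 T \<alpha> \<in> hom2 K (F1 T f) (F1 T g)"
  using F2_in[of \<alpha>] by simp

lemma unit_cell [simp]:
  assumes "x \<in> Cell0 K"
  shows "unit T x \<in> Cell1 K" "src1 K (unit T x) = x" "tgt1 K (unit T x) = F0 T x"
    "mult T x \<in> Cell1 K" "src1 K (mult T x) = F0 T (F0 T x)" "tgt1 K (mult T x) = F0 T x"
  using unit_in[OF assms] mult_in[OF assms] by simp_all

text \<open>The two sides of an axiom are composites whose boundaries are equal only up to
  associativity, naturality of unit and multiplication, and the monad laws. Giving both sides one
  normal form of the boundary here reduces each axiom in \<open>CAT\<^sub>2\<close> to a comparison
  of components.\<close>

lemma psalg_hom2:
  assumes X: "X \<in> Cell0 K" and a: "a \<in> hom1 K (F0 T X) X"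
    and \<chi>: "\<chi> \<in> hom2 K (a \<odot> F1 T a) (a \<odot> mult T X)"
  shows "\<chi> \<rhd> F1 T (unit T X) \<in> hom2 K ((a \<odot> F1 T a) \<odot> F1 T (unit T X)) a"
    and "\<chi> \<rhd> unit T (F0 T X) \<in> hom2 K ((a \<odot> unit T X) \<odot> a) a"
    and "(\<chi> \<rhd> F1 T (mult T X)) \<bullet> (a \<lhd> F2 T \<chi>) \<in> hom2 K ((a \<odot> F1 T a) \<odot> F1 T (F1 T a)) (a \<odot> (mult T X \<odot> F1 T (mult T X)))"
    and "(\<chi> \<rhd> mult T (F0 T X)) \<bullet> (\<chi> \<rhd> F1 T (F1 T a)) \<in> hom2 K ((a \<odot> F1 T a) \<odot> F1 T (F1 T a)) (a \<odot> (mult T X \<odot> F1 T (mult T X)))"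
proof -
  have TX: "F0 T X \<in> Cell0 K" using F0_in[OF X] .
  note s = X TX F0_in[OF TX] a[unfolded in_hom1]
  have e1: "(a \<odot> mult T X) \<odot> F1 T (unit T X) = a"
    using s K.comp1_one_right[of a] by (simp add: mult_map_unit flip: K.comp1_assoc)
  show "\<chi> \<rhd> F1 T (unit T X) \<in> hom2 K ((a \<odot> F1 T a) \<odot> F1 T (unit T X)) a"
    using K.whisker_right_hom2[OF \<chi>, of "F1 T (unit T X)"] s e1 by simp
  have e2: "(a \<odot> mult T X) \<odot> unit T (F0 T X) = a"
    using s K.comp1_one_right[of a] by (simp add: mult_unit flip: K.comp1_assoc)
  have e3: "(a \<odot> F1 T a) \<odot> unit T (F0 T X) = (a \<odot> unit T X) \<odot> a"
    using s unit_natural1[of a] by (simp flip: K.comp1_assoc)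
  show "\<chi> \<rhd> unit T (F0 T X) \<in> hom2 K ((a \<odot> unit T X) \<odot> a) a"
    using K.whisker_right_hom2[OF \<chi>, of "unit T (F0 T X)"] s e2 e3 by simp
  have e4: "a \<odot> F1 T (a \<odot> F1 T a) = (a \<odot> F1 T a) \<odot> F1 T (F1 T a)"
    using s by (simp add: F1_comp K.comp1_assoc)
  have e5: "a \<odot> F1 T (a \<odot> mult T X) = (a \<odot> F1 T a) \<odot> F1 T (mult T X)"
    using s by (simp add: F1_comp K.comp1_assoc)
  have "a \<lhd> F2 T \<chi> \<in> hom2 K ((a \<odot> F1 T a) \<odot> F1 T (F1 T a)) ((a \<odot> F1 T a) \<odot> F1 T (mult T X))"
    using K.whisker_left_hom2[OF T2_hom2[OF \<chi>], of a] s unfolding e4 e5 by simp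
  moreover have "\<chi> \<rhd> F1 T (mult T X) \<in> hom2 K ((a \<odot> F1 T a) \<odot> F1 T (mult T X)) (a \<odot> (mult T X \<odot> F1 T (mult T X)))"
    using K.whisker_right_hom2[OF \<chi>, of "F1 T (mult T X)"] s by (simp add: K.comp1_assoc)
  ultimately show "(\<chi> \<rhd> F1 T (mult T X)) \<bullet> (a \<lhd> F2 T \<chi>) \<in> hom2 K ((a \<odot> F1 T a) \<odot> F1 T (F1 T a)) (a \<odot> (mult T X \<odot> F1 T (mult T X)))"
    by (rule K.vcomp_hom2)
  have e6: "(a \<odot> mult T X) \<odot> F1 T (F1 T a) = (a \<odot> F1 T a) \<odot> mult T (F0 T X)"
    using s mult_natural1[of a] by (simp flip: K.comp1_assoc)
  have e7: "(a \<odot> mult T X) \<odot> mult T (F0 T X) = a \<odot> (mult T X \<odot> F1 T (mult T X))"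
    using s mult_mult[of X] by (simp flip: K.comp1_assoc)
  have "\<chi> \<rhd> F1 T (F1 T a) \<in> hom2 K ((a \<odot> F1 T a) \<odot> F1 T (F1 T a)) ((a \<odot> F1 T a) \<odot> mult T (F0 T X))"
    using K.whisker_right_hom2[OF \<chi>, of "F1 T (F1 T a)"] s unfolding e6 by simp
  moreover have "\<chi> \<rhd> mult T (F0 T X) \<in> hom2 K ((a \<odot> F1 T a) \<odot> mult T (F0 T X)) (a \<odot> (mult T X \<odot> F1 T (mult T X)))"
    using K.whisker_right_hom2[OF \<chi>, of "mult T (F0 T X)"] s unfolding e7 by simp
  ultimately show "(\<chi> \<rhd> mult T (F0 T X)) \<bullet> (\<chi> \<rhd> F1 T (F1 T a)) \<in> hom2 K ((a \<odot> F1 T a) \<odot> F1 T (F1 T a)) (a \<odot> (mult T X \<odot> F1 T (mult T X)))"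
    by (rule K.vcomp_hom2)
qed

text \<open>When \<iota> is an identity so is each whiskering of it, and the boundary collapses
  because a (T a) (T \<eta>) = a T(a \<eta>) = a. Each unit law then says that a whiskering of
  \<chi> is the identity on a.\<close>

lemma normal_psalg_unit_laws:
  assumes X: "X \<in> Cell0 K" and a: "a \<in> hom1 K (F0 T X) X" and n: "a \<odot> unit T X = one1 K X"
    and \<chi>: "\<chi> \<in> hom2 K (a \<odot> F1 T a) (a \<odot> mult T X)"
  shows "(\<chi> \<rhd> F1 T (unit T X)) \<bullet> (a \<lhd> F2 T (one2 K (one1 K X))) = \<chi> \<rhd> F1 T (unit T X)"
    and "(\<chi> \<rhd> unit T (F0 T X)) \<bullet> (one2 K (one1 K X) \<rhd> a) = \<chi> \<rhd> unit T (F0 T X)"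
    and "\<chi> \<rhd> F1 T (unit T X) \<in> hom2 K a a" "\<chi> \<rhd> unit T (F0 T X) \<in> hom2 K a a"
proof -
  have TX: "F0 T X \<in> Cell0 K" using F0_in[OF X] .
  note s = X TX F0_in[OF TX] a[unfolded in_hom1]
  have "(a \<odot> F1 T a) \<odot> F1 T (unit T X) = a \<odot> F1 T (a \<odot> unit T X)"
    using s by (simp add: F1_comp flip: K.comp1_assoc)
  also have "\<dots> = a" unfolding n using s K.comp1_one_right[of a] by (simp add: F1_one)
  finally show 1: "\<chi> \<rhd> F1 T (unit T X) \<in> hom2 K a a"
    using psalg_hom2(1)[OF X a \<chi>] by simp
  have "(a \<odot> unit T X) \<odot> a = a" unfolding n using s K.comp1_one_left[of a] by simp
  then show 2: "\<chi> \<rhd> unit T (F0 T X) \<in> hom2 K a a"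
    using psalg_hom2(2)[OF X a \<chi>] by simp
  have "a \<lhd> F2 T (one2 K (one1 K X)) = one2 K a"
    using s K.comp1_one_right[of a] by (simp add: whisker_left_def F2_one F1_one K.hcomp_one2)
  then show "(\<chi> \<rhd> F1 T (unit T X)) \<bullet> (a \<lhd> F2 T (one2 K (one1 K X))) = \<chi> \<rhd> F1 T (unit T X)"
    using 1 K.vcomp_one_right[of "\<chi> \<rhd> F1 T (unit T X)"] by simp
  have "one2 K (one1 K X) \<rhd> a = one2 K a"
    using s K.comp1_one_left[of a] by (simp add: whisker_right_def K.hcomp_one2)
  then show "(\<chi> \<rhd> unit T (F0 T X)) \<bullet> (one2 K (one1 K X) \<rhd> a) = \<chi> \<rhd> unit T (F0 T X)"
    using 2 K.vcomp_one_right[of "\<chi> \<rhd> unit T (F0 T X)"] by simp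
qed

text \<open>Both sides of the multiplication axiom run from b (T b) (T T f) to f a \<mu>. Their
  intermediate boundaries meet by naturality of \<mu> on one side and by functoriality of T on the
  other.\<close>

lemma psmor_hom2:
  assumes X: "X \<in> Cell0 K" and a: "a \<in> hom1 K (F0 T X) X" and Y: "Y \<in> Cell0 K" and b: "b \<in> hom1 K (F0 T Y) Y"
    and f: "f \<in> hom1 K X Y" and \<phi>: "\<phi> \<in> hom2 K (b \<odot> F1 T f) (f \<odot> a)"
    and \<chi>a: "\<chi>a \<in> hom2 K (a \<odot> F1 T a) (a \<odot> mult T X)" and \<chi>b: "\<chi>b \<in> hom2 K (b \<odot> F1 T b) (b \<odot> mult T Y)"
  shows "\<phi> \<rhd> unit T X \<in> hom2 K ((b \<odot> unit T Y) \<odot> f) (f \<odot> (a \<odot> unit T X))"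
    and "(\<phi> \<rhd> mult T X) \<bullet> (\<chi>b \<rhd> F1 T (F1 T f)) \<in> hom2 K ((b \<odot> F1 T b) \<odot> F1 T (F1 T f)) (f \<odot> (a \<odot> mult T X))"
    and "(f \<lhd> \<chi>a) \<bullet> (\<phi> \<rhd> F1 T a) \<bullet> (b \<lhd> F2 T \<phi>) \<in> hom2 K ((b \<odot> F1 T b) \<odot> F1 T (F1 T f)) (f \<odot> (a \<odot> mult T X))"
proof -
  have TX: "F0 T X \<in> Cell0 K" "F0 T Y \<in> Cell0 K" using F0_in X Y by auto
  note s = X Y TX a[unfolded in_hom1] b[unfolded in_hom1] f[unfolded in_hom1]
  have e1: "(b \<odot> F1 T f) \<odot> unit T X = (b \<odot> unit T Y) \<odot> f"
    using s unit_natural1[of f] by (simp flip: K.comp1_assoc)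
  have e2: "(f \<odot> a) \<odot> unit T X = f \<odot> (a \<odot> unit T X)" using s by (simp add: K.comp1_assoc)
  show "\<phi> \<rhd> unit T X \<in> hom2 K ((b \<odot> unit T Y) \<odot> f) (f \<odot> (a \<odot> unit T X))"
    using K.whisker_right_hom2[OF \<phi>, of "unit T X"] s unfolding e1 e2 by simp
  have e3: "(b \<odot> mult T Y) \<odot> F1 T (F1 T f) = (b \<odot> F1 T f) \<odot> mult T X"
    using s mult_natural1[of f] by (simp flip: K.comp1_assoc)
  have e4: "(f \<odot> a) \<odot> mult T X = f \<odot> (a \<odot> mult T X)" using s by (simp add: K.comp1_assoc)
  have "\<chi>b \<rhd> F1 T (F1 T f) \<in> hom2 K ((b \<odot> F1 T b) \<odot> F1 T (F1 T f)) ((b \<odot> F1 T f) \<odot> mult T X)"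
    using K.whisker_right_hom2[OF \<chi>b, of "F1 T (F1 T f)"] s unfolding e3 by simp
  moreover have "\<phi> \<rhd> mult T X \<in> hom2 K ((b \<odot> F1 T f) \<odot> mult T X) (f \<odot> (a \<odot> mult T X))"
    using K.whisker_right_hom2[OF \<phi>, of "mult T X"] s unfolding e4 by simp
  ultimately show "(\<phi> \<rhd> mult T X) \<bullet> (\<chi>b \<rhd> F1 T (F1 T f)) \<in> hom2 K ((b \<odot> F1 T b) \<odot> F1 T (F1 T f)) (f \<odot> (a \<odot> mult T X))"
    by (rule K.vcomp_hom2)
  have e5: "b \<odot> F1 T (b \<odot> F1 T f) = (b \<odot> F1 T b) \<odot> F1 T (F1 T f)"
    using s by (simp add: F1_comp K.comp1_assoc)
  have e6: "b \<odot> F1 T (f \<odot> a) = (b \<odot> F1 T f) \<odot> F1 T a"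
    using s by (simp add: F1_comp K.comp1_assoc)
  have e7: "(f \<odot> a) \<odot> F1 T a = f \<odot> (a \<odot> F1 T a)" using s by (simp add: K.comp1_assoc)
  have "b \<lhd> F2 T \<phi> \<in> hom2 K ((b \<odot> F1 T b) \<odot> F1 T (F1 T f)) ((b \<odot> F1 T f) \<odot> F1 T a)"
    using K.whisker_left_hom2[OF T2_hom2[OF \<phi>], of b] s unfolding e5 e6 by simp
  moreover have "\<phi> \<rhd> F1 T a \<in> hom2 K ((b \<odot> F1 T f) \<odot> F1 T a) (f \<odot> (a \<odot> F1 T a))"
    using K.whisker_right_hom2[OF \<phi>, of "F1 T a"] s unfolding e7 by simp
  moreover have "f \<lhd> \<chi>a \<in> hom2 K (f \<odot> (a \<odot> F1 T a)) (f \<odot> (a \<odot> mult T X))"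
    using K.whisker_left_hom2[OF \<chi>a, of f] s by simp
  ultimately show "(f \<lhd> \<chi>a) \<bullet> (\<phi> \<rhd> F1 T a) \<bullet> (b \<lhd> F2 T \<phi>) \<in> hom2 K ((b \<odot> F1 T b) \<odot> F1 T (F1 T f)) (f \<odot> (a \<odot> mult T X))"
    by (intro K.vcomp_hom2)
qed

text \<open>Between normal pseudoalgebras the unit axiom loses its two \<iota> factors and reads
  \<phi> \<eta> = 1_f, a statement with equal ends that can be evaluated on components.\<close>

lemma normal_psmor_unit_law:
  assumes X: "X \<in> Cell0 K" and a: "a \<in> hom1 K (F0 T X) X" and Y: "Y \<in> Cell0 K" and b: "b \<in> hom1 K (F0 T Y) Y"
    and f: "f \<in> hom1 K X Y" and \<phi>: "\<phi> \<in> hom2 K (b \<odot> F1 T f) (f \<odot> a)"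
    and n: "a \<odot> unit T X = one1 K X" "b \<odot> unit T Y = one1 K Y"
  shows "(\<phi> \<rhd> unit T X) \<bullet> (one2 K (one1 K Y) \<rhd> f) = \<phi> \<rhd> unit T X"
    and "f \<lhd> one2 K (one1 K X) = one2 K f" and "\<phi> \<rhd> unit T X \<in> hom2 K f f"
proof -
  have TX: "F0 T X \<in> Cell0 K" "F0 T Y \<in> Cell0 K" using F0_in X Y by auto
  note s = X Y TX a[unfolded in_hom1] b[unfolded in_hom1] f[unfolded in_hom1]
  have e1: "(b \<odot> F1 T f) \<odot> unit T X = (b \<odot> unit T Y) \<odot> f"
    using s unit_natural1[of f] by (simp flip: K.comp1_assoc)
  have e2: "(f \<odot> a) \<odot> unit T X = f \<odot> (a \<odot> unit T X)" using s by (simp add: K.comp1_assoc)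
  show 1: "\<phi> \<rhd> unit T X \<in> hom2 K f f"
    using K.whisker_right_hom2[OF \<phi>, of "unit T X"] s K.comp1_one_left[of f] K.comp1_one_right[of f]
    unfolding e1 e2 n by simp
  have "one2 K (one1 K Y) \<rhd> f = one2 K f"
    using s K.comp1_one_left[of f] by (simp add: whisker_right_def K.hcomp_one2)
  then show "(\<phi> \<rhd> unit T X) \<bullet> (one2 K (one1 K Y) \<rhd> f) = \<phi> \<rhd> unit T X"
    using 1 K.vcomp_one_right[of "\<phi> \<rhd> unit T X"] by simp
  show "f \<lhd> one2 K (one1 K X) = one2 K f"
    using s K.comp1_one_right[of f] by (simp add: whisker_left_def K.hcomp_one2)
qed

lemma algtr_hom2:
  assumes X: "X \<in> Cell0 K" and a: "a \<in> hom1 K (F0 T X) X" and Y: "Y \<in> Cell0 K" and b: "b \<in> hom1 K (F0 T Y) Y"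
    and f: "f \<in> hom1 K X Y" and \<phi>: "\<phi> \<in> hom2 K (b \<odot> F1 T f) (f \<odot> a)"
    and g: "g \<in> hom1 K X Y" and \<psi>: "\<psi> \<in> hom2 K (b \<odot> F1 T g) (g \<odot> a)" and \<alpha>: "\<alpha> \<in> hom2 K f g"
  shows "(\<alpha> \<rhd> a) \<bullet> \<phi> \<in> hom2 K (b \<odot> F1 T f) (g \<odot> a)"
    and "\<psi> \<bullet> (b \<lhd> F2 T \<alpha>) \<in> hom2 K (b \<odot> F1 T f) (g \<odot> a)"
proof -
  note s = X Y a[unfolded in_hom1] b[unfolded in_hom1] f[unfolded in_hom1] g[unfolded in_hom1]
  show "(\<alpha> \<rhd> a) \<bullet> \<phi> \<in> hom2 K (b \<odot> F1 T f) (g \<odot> a)"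
    by (rule K.vcomp_hom2[OF \<phi> K.whisker_right_hom2[OF \<alpha>]]) (use s in simp_all)
  show "\<psi> \<bullet> (b \<lhd> F2 T \<alpha>) \<in> hom2 K (b \<odot> F1 T f) (g \<odot> a)"
    by (rule K.vcomp_hom2[OF K.whisker_left_hom2[OF T2_hom2[OF \<alpha>]] \<psi>]) (use s in simp_all)
qed

lemma psmor_comp_hom2:
  assumes X: "X \<in> Cell0 K" and a: "a \<in> hom1 K (F0 T X) X" and Y: "Y \<in> Cell0 K" and b: "b \<in> hom1 K (F0 T Y) Y"
    and Z: "Z \<in> Cell0 K" and c: "c \<in> hom1 K (F0 T Z) Z"
    and f: "f \<in> hom1 K X Y" and \<phi>: "\<phi> \<in> hom2 K (b \<odot> F1 T f) (f \<odot> a)"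
    and g: "g \<in> hom1 K Y Z" and \<psi>: "\<psi> \<in> hom2 K (c \<odot> F1 T g) (g \<odot> b)"
  shows "(g \<lhd> \<phi>) \<bullet> (\<psi> \<rhd> F1 T f) \<in> hom2 K (c \<odot> F1 T (g \<odot> f)) ((g \<odot> f) \<odot> a)"
proof -
  note s = X Y Z a[unfolded in_hom1] b[unfolded in_hom1] c[unfolded in_hom1] f[unfolded in_hom1] g[unfolded in_hom1]
  have e1: "c \<odot> F1 T (g \<odot> f) = (c \<odot> F1 T g) \<odot> F1 T f" using s by (simp add: F1_comp K.comp1_assoc)
  have e2: "(g \<odot> f) \<odot> a = g \<odot> (f \<odot> a)" using s by (simp add: K.comp1_assoc)
  have e3: "(g \<odot> b) \<odot> F1 T f = g \<odot> (b \<odot> F1 T f)" using s by (simp add: K.comp1_assoc)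
  have "\<psi> \<rhd> F1 T f \<in> hom2 K (c \<odot> F1 T (g \<odot> f)) (g \<odot> (b \<odot> F1 T f))"
    using K.whisker_right_hom2[OF \<psi>, of "F1 T f"] s unfolding e1 e3 by simp
  moreover have "g \<lhd> \<phi> \<in> hom2 K (g \<odot> (b \<odot> F1 T f)) ((g \<odot> f) \<odot> a)"
    using K.whisker_left_hom2[OF \<phi>, of g] s unfolding e2 by simp
  ultimately show ?thesis by (rule K.vcomp_hom2)
qed

end

section \<open>Testing 2-cells of \<open>CAT\<^sub>2\<close> for equality and invertibility on
  components\<close>

declare comma_sel(5) [simp del]

text \<open>Identities of comma categories now stay folded and are accessed through their legs; in
  folded form, preservation of identities by a functor applies to them directly.\<close>

lemma (in comma_cat) Ide_comma [simp]:
  assumes "Z \<in> comma_obj P"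
  shows "Ide (comma P) Z \<in> comma_arr P" "carr_src (Ide (comma P) Z) = Z" "carr_tgt (Ide (comma P) Z) = Z"
    "carr_top (Ide (comma P) Z) = Ide E (lft Z)" "carr_bot (Ide (comma P) Z) = Ide B (Cod B (rgt Z))"
  using assms category.Ide_Arr(1)[OF comma_category, of Z] by (simp_all add: comma_sel(5))

lemma CAT2_hom2_eqI:
  assumes "\<theta> \<in> hom2 (CAT\<^sub>2 \<kappa>) s t" "\<eta> \<in> hom2 (CAT\<^sub>2 \<kappa>) s t"
    and "\<And>x. x \<in> Obj (FDom (sq_src s)) \<Longrightarrow> NAt (sc_total \<theta>) x = NAt (sc_total \<eta>) x"
    and "\<And>b. b \<in> Obj (FCod (sq_src s)) \<Longrightarrow> NAt (sc_base \<theta>) b = NAt (sc_base \<eta>) b"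
  shows "\<theta> = \<eta>"
proof -
  have st: "src2 (CAT\<^sub>2 \<kappa>) \<theta> = s" "src2 (CAT\<^sub>2 \<kappa>) \<eta> = s" "tgt2 (CAT\<^sub>2 \<kappa>) \<theta> = t" "tgt2 (CAT\<^sub>2 \<kappa>) \<eta> = t"
    "\<theta> \<in> Cell2 (CAT\<^sub>2 \<kappa>)" "\<eta> \<in> Cell2 (CAT\<^sub>2 \<kappa>)"
    using assms(1,2) unfolding in_hom2 by blast+
  have "sc_src \<theta> = sq_src s" using st(1) by auto
  then show ?thesis
    using assms(3,4) by (intro CAT2_cell_eqI[where \<kappa> = \<kappa>]) (simp_all only: st)
qed

lemma invertible2I:
  "\<lbrakk>\<alpha> \<in> hom2 K f g; \<beta> \<in> hom2 K g f; \<beta> \<bullet>\<^bsub>K\<^esub> \<alpha> = one2 K f; \<alpha> \<bullet>\<^bsub>K\<^esub> \<beta> = one2 K g\<rbrakk> \<Longrightarrow> invertible2 K \<alpha>"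
  by (auto simp: invertible2_def)

lemma cat_nattr_inverse:
  assumes "cat_nattr \<alpha> F G A B" and iso: "\<And>x. x \<in> Obj A \<Longrightarrow> iso B (NAt \<alpha> x)"
  obtains \<beta> where "cat_nattr \<beta> G F A B"
    "\<And>x. x \<in> Obj A \<Longrightarrow> NAt \<beta> x \<cdot>\<^bsub>B\<^esub> NAt \<alpha> x = Ide B (FOb F x)"
    "\<And>x. x \<in> Obj A \<Longrightarrow> NAt \<alpha> x \<cdot>\<^bsub>B\<^esub> NAt \<beta> x = Ide B (FOb G x)"
proof -
  interpret \<alpha>: cat_nattr \<alpha> F G A B by fact
  have "\<exists>k. k \<in> Arr B \<and> Dom B k = FOb G x \<and> Cod B k = FOb F x \<and>
      k \<cdot>\<^bsub>B\<^esub> NAt \<alpha> x = Ide B (FOb F x) \<and> NAt \<alpha> x \<cdot>\<^bsub>B\<^esub> k = Ide B (FOb G x)" if x: "x \<in> Obj A" for x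
    by (rule iso_inverse[OF iso[OF x]]) (use x in auto)
  then obtain k where k: "\<And>x. x \<in> Obj A \<Longrightarrow> k x \<in> Arr B" "\<And>x. x \<in> Obj A \<Longrightarrow> Dom B (k x) = FOb G x"
    "\<And>x. x \<in> Obj A \<Longrightarrow> Cod B (k x) = FOb F x"
    "\<And>x. x \<in> Obj A \<Longrightarrow> k x \<cdot>\<^bsub>B\<^esub> NAt \<alpha> x = Ide B (FOb F x)"
    "\<And>x. x \<in> Obj A \<Longrightarrow> NAt \<alpha> x \<cdot>\<^bsub>B\<^esub> k x = Ide B (FOb G x)" by metis
  let ?\<beta> = "\<lparr>NSrc = G, NTgt = F, NAt = (\<lambda>x \<in> Obj A. k x)\<rparr>"
  have "cat_nattr ?\<beta> G F A B"
  proof (rule cat_nattrI[OF \<alpha>.G.cat_functor_axioms \<alpha>.F.cat_functor_axioms])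
    fix f assume f: "f \<in> Arr A"
    let ?x = "Dom A f" and ?y = "Cod A f"
    have xy: "?x \<in> Obj A" "?y \<in> Obj A" using f by simp_all
    \<comment> \<open>Naturality of the pointwise inverse is obtained by conjugation: an inverse
      pair is inserted at the source, the square of \<alpha> is used, and the pair at the target
      cancels.\<close>
    have "k ?y \<cdot>\<^bsub>B\<^esub> FAr G f = k ?y \<cdot>\<^bsub>B\<^esub> (FAr G f \<cdot>\<^bsub>B\<^esub> (NAt \<alpha> ?x \<cdot>\<^bsub>B\<^esub> k ?x))"
      using f xy k by simp
    also have "\<dots> = k ?y \<cdot>\<^bsub>B\<^esub> ((NAt \<alpha> ?y \<cdot>\<^bsub>B\<^esub> FAr F f) \<cdot>\<^bsub>B\<^esub> k ?x)"
      using f xy k(1-3) \<alpha>.natural[OF f] \<alpha>.F.B.Comp_assoc by simp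
    also have "\<dots> = FAr F f \<cdot>\<^bsub>B\<^esub> k ?x"
      using f xy k(1-3) \<alpha>.F.B.Comp_reassoc[OF k(4)[OF xy(2)]] by simp
    finally show "NAt ?\<beta> ?y \<cdot>\<^bsub>B\<^esub> FAr G f = FAr F f \<cdot>\<^bsub>B\<^esub> NAt ?\<beta> ?x" using xy by simp
  qed (use k in simp_all)
  then show thesis by (rule that) (use k in simp_all)
qed

lemma (in cat_functor) FAr_iso:
  assumes "iso A h" shows "iso B (FAr F h)"
proof -
  obtain k where k: "h \<in> Arr A" "k \<in> Arr A" "Dom A k = Cod A h" "Cod A k = Dom A h"
    "k \<cdot>\<^bsub>A\<^esub> h = Ide A (Dom A h)" "h \<cdot>\<^bsub>A\<^esub> k = Ide A (Cod A h)"
    by (rule iso_inverse[OF assms])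
  show ?thesis
    by (rule isoI[of _ _ "FAr F k"])
      (use k(1-4) arg_cong[OF k(5), of "FAr F"] arg_cong[OF k(6), of "FAr F"] in simp_all)
qed

lemma (in category) inverse_unique:
  assumes "h \<in> Arr C" "k \<in> Arr C" "l \<in> Arr C" "Dom C k = Cod C h" "Cod C l = Dom C h"
    "k \<cdot> h = Ide C (Dom C h)" "h \<cdot> l = Ide C (Cod C h)" "Dom C l = Cod C h"
  shows "k = l"
proof -
  have "k = k \<cdot> (h \<cdot> l)" unfolding assms(7) using assms(1-5) by simp
  also have "\<dots> = (k \<cdot> h) \<cdot> l" using assms(1-5) Comp_assoc by simp
  also have "\<dots> = l" unfolding assms(6) using assms(1-5) by simp
  finally show ?thesis .
qed

lemma (in category) iso_Ide: "x \<in> Obj C \<Longrightarrow> iso C (Ide C x)"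
  by (rule isoI[of _ _ "Ide C x"]) simp_all

lemma CAT2_invertibleI:
  assumes \<theta>: "\<theta> = \<lparr>sc_src = P, sc_tgt = Q, sc_total = \<beta>, sc_base = \<alpha>\<rparr>"
    and c: "cat_sqcell P E B Q F C \<beta> T T' \<alpha> S S'" and ls: "loc_small4 \<kappa> E B F C"
    and iso: "\<And>x. x \<in> Obj E \<Longrightarrow> iso F (NAt \<beta> x)" "\<And>b. b \<in> Obj B \<Longrightarrow> iso C (NAt \<alpha> b)"
  shows "invertible2 (CAT\<^sub>2 \<kappa>) \<theta>"
proof -
  interpret c: cat_sqcell P E B Q F C \<beta> T T' \<alpha> S S' by fact
  obtain \<beta>' where \<beta>': "cat_nattr \<beta>' T' T E F"
    "\<And>x. x \<in> Obj E \<Longrightarrow> NAt \<beta>' x \<cdot>\<^bsub>F\<^esub> NAt \<beta> x = Ide F (FOb T x)"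
    "\<And>x. x \<in> Obj E \<Longrightarrow> NAt \<beta> x \<cdot>\<^bsub>F\<^esub> NAt \<beta>' x = Ide F (FOb T' x)"
    using cat_nattr_inverse[OF c.total.cat_nattr_axioms iso(1)] by blast
  obtain \<alpha>' where \<alpha>': "cat_nattr \<alpha>' S' S B C"
    "\<And>x. x \<in> Obj B \<Longrightarrow> NAt \<alpha>' x \<cdot>\<^bsub>C\<^esub> NAt \<alpha> x = Ide C (FOb S x)"
    "\<And>x. x \<in> Obj B \<Longrightarrow> NAt \<alpha> x \<cdot>\<^bsub>C\<^esub> NAt \<alpha>' x = Ide C (FOb S' x)"
    using cat_nattr_inverse[OF c.base.cat_nattr_axioms iso(2)] by blast
  interpret \<beta>': cat_nattr \<beta>' T' T E F by fact
  interpret \<alpha>': cat_nattr \<alpha>' S' S B C by fact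
  \<comment> \<open>The projection of an inverse is an inverse of the projection, and so is the
    component of \<alpha>'. Uniqueness of inverses makes the inverse total cell lie over the inverse
    base cell.\<close>
  have "FAr Q (NAt \<beta>' x) = NAt \<alpha>' (FOb P x)" if x: "x \<in> Obj E" for x
    by (rule c.s.Q.B.inverse_unique[of "NAt \<alpha> (FOb P x)"])
      (use x \<alpha>'(2,3)[of "FOb P x"] arg_cong[OF \<beta>'(2)[OF x], of "FAr Q"] in simp_all)
  then interpret d: cat_sqcell P E B Q F C \<beta>' T' T \<alpha>' S' S by unfold_locales
  let ?\<eta> = "\<lparr>sc_src = P, sc_tgt = Q, sc_total = \<beta>', sc_base = \<alpha>'\<rparr>"
  let ?s = "\<lparr>sq_src = P, sq_tgt = Q, sq_total = T, sq_base = S\<rparr>"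
  let ?t = "\<lparr>sq_src = P, sq_tgt = Q, sq_total = T', sq_base = S'\<rparr>"
  have h\<theta>: "\<theta> \<in> hom2 (CAT\<^sub>2 \<kappa>) ?s ?t"
    using c.Cell2_CAT2_I[OF ls] by (simp add: \<theta> sqcell_src_def sqcell_tgt_def)
  have h\<eta>: "?\<eta> \<in> hom2 (CAT\<^sub>2 \<kappa>) ?t ?s"
    using d.Cell2_CAT2_I[OF ls] by (simp add: sqcell_src_def sqcell_tgt_def)
  have s: "?s \<in> Cell1 (CAT\<^sub>2 \<kappa>)" "?t \<in> Cell1 (CAT\<^sub>2 \<kappa>)"
    using c.s.Cell1_CAT2_I[OF ls] c.t.Cell1_CAT2_I[OF ls] .
  have "?\<eta> \<bullet>\<^bsub>CAT\<^sub>2 \<kappa>\<^esub> \<theta> = one2 (CAT\<^sub>2 \<kappa>) ?s"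
    by (rule CAT2_hom2_eqI[OF CAT2.vcomp_hom2[OF h\<theta> h\<eta>] CAT2.one2_hom2[OF s(1)]])
      (simp_all add: \<theta> \<beta>' \<alpha>')
  moreover have "\<theta> \<bullet>\<^bsub>CAT\<^sub>2 \<kappa>\<^esub> ?\<eta> = one2 (CAT\<^sub>2 \<kappa>) ?t"
    by (rule CAT2_hom2_eqI[OF CAT2.vcomp_hom2[OF h\<eta> h\<theta>] CAT2.one2_hom2[OF s(2)]])
      (simp_all add: \<theta> \<beta>' \<alpha>')
  ultimately show ?thesis by (rule invertible2I[OF h\<theta> h\<eta>])
qed

lemma CAT2_invertibleD:
  assumes \<theta>: "\<theta> = \<lparr>sc_src = P, sc_tgt = Q, sc_total = \<beta>, sc_base = \<alpha>\<rparr>"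
    and c: "cat_sqcell P E B Q F C \<beta> T T' \<alpha> S S'"
    and inv: "invertible2 (CAT\<^sub>2 \<kappa>) \<theta>" and x: "x \<in> Obj E"
  shows "iso F (NAt \<beta> x)"
proof -
  interpret c: cat_sqcell P E B Q F C \<beta> T T' \<alpha> S S' by fact
  obtain \<eta> where h: "\<eta> \<in> hom2 (CAT\<^sub>2 \<kappa>) (tgt2 (CAT\<^sub>2 \<kappa>) \<theta>) (src2 (CAT\<^sub>2 \<kappa>) \<theta>)"
    and inv': "\<eta> \<bullet>\<^bsub>CAT\<^sub>2 \<kappa>\<^esub> \<theta> = one2 (CAT\<^sub>2 \<kappa>) (src2 (CAT\<^sub>2 \<kappa>) \<theta>)" "\<theta> \<bullet>\<^bsub>CAT\<^sub>2 \<kappa>\<^esub> \<eta> = one2 (CAT\<^sub>2 \<kappa>) (tgt2 (CAT\<^sub>2 \<kappa>) \<theta>)"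
    using inv unfolding invertible2_def by (elim conjE bexE)
  have \<eta>: "\<eta> \<in> Cell2 (CAT\<^sub>2 \<kappa>)" "src2 (CAT\<^sub>2 \<kappa>) \<eta> = tgt2 (CAT\<^sub>2 \<kappa>) \<theta>" "tgt2 (CAT\<^sub>2 \<kappa>) \<eta> = src2 (CAT\<^sub>2 \<kappa>) \<theta>"
    using h unfolding in_hom2 by blast+
  obtain \<beta>' T2 \<alpha>' S2 where e: "\<eta> = \<lparr>sc_src = P, sc_tgt = Q, sc_total = \<beta>', sc_base = \<alpha>'\<rparr>"
    "cat_sqcell P E B Q F C \<beta>' T' T2 \<alpha>' S' S2"
    by (rule Cell2_CAT2_E2[OF \<eta>(1) c.t.cat_square_axioms])
      (use \<eta>(2) in \<open>simp add: \<theta> sqcell_src_def sqcell_tgt_def\<close>)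
  interpret d: cat_sqcell P E B Q F C \<beta>' T' T2 \<alpha>' S' S2 by fact
  have "T2 = T" using \<eta>(3) by (simp add: \<theta> e(1) sqcell_src_def sqcell_tgt_def)
  then show ?thesis
    using arg_cong[OF inv'(1), of "\<lambda>c. NAt (sc_total c) x"] arg_cong[OF inv'(2), of "\<lambda>c. NAt (sc_total c) x"] x
    by (intro isoI[of _ _ "NAt \<beta>' x"]) (simp_all add: \<theta> e(1))
qed

section \<open>The pseudoalgebra of a cleavage\<close>

lemma (in cloven) action_square: "cat_square (cod_fun P) (comma P) B P E B L (fun_one B)"
proof -
  interpret cP: cat_functor "cod_fun P" "comma P" B by (rule cod_functor)
  interpret I: cat_functor "fun_one B" B B by (rule cat_functor_one[OF B.category_axioms])
  show ?thesis by unfold_locales (auto simp: carr_parts elim: comma_objE)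
qed

sublocale cloven \<subseteq> a: comma_square "cod_fun P" "comma P" B P E B L "fun_one B"
  using action_square by (simp add: comma_square_def)

sublocale cloven \<subseteq> Ta: comma_square "cod_fun (cod_fun P)" "comma (cod_fun P)" B "cod_fun P" "comma P" B
    "comma_map a.sq" "fun_one B"
  by (rule a.cod_comma_square)

context cloven
begin

lemma action_eq: "action cof = a.sq"
  by (simp add: action_def action_fun_eq)

abbreviation "chi x u v \<equiv> compositor cof v u x"

lemma chi:
  assumes x: "x \<in> Obj E" "u \<in> Arr B" "Dom B u = FOb P x" "v \<in> Arr B" "Dom B v = Cod B u"
  shows chi_Arr [simp]: "chi x u v \<in> Arr E" and chi_Dom [simp]: "Dom E (chi x u v) = Cod E (\<delta> (Cod E (\<delta> x u)) v)"
    and chi_Cod [simp]: "Cod E (chi x u v) = Cod E (\<delta> x (v \<cdot>\<^bsub>B\<^esub> u))"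
    and chi_over [simp]: "FAr P (chi x u v) = Ide B (Cod B v)" and chi_iso: "iso E (chi x u v)"
    and chi_lift: "chi x u v \<cdot>\<^bsub>E\<^esub> (\<delta> (Cod E (\<delta> x u)) v \<cdot>\<^bsub>E\<^esub> \<delta> x u) = \<delta> x (v \<cdot>\<^bsub>B\<^esub> u)"
  using compositor_spec[OF x] by metis+

text \<open>The composite of two lifts is cocartesian, so arrows out of v_!(u_! x) with the same
  projection can be tested on it. Naturality of the compositors and the multiplication axiom for
  comparison cells are proved this way.\<close>

lemma lift_lift_unique:
  assumes x: "x \<in> Obj E" "u \<in> Arr B" "Dom B u = FOb P x" "v \<in> Arr B" "Dom B v = Cod B u"
    and h: "h \<in> Arr E" "Dom E h = Cod E (\<delta> (Cod E (\<delta> x u)) v)"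
    and k: "k \<in> Arr E" "Dom E k = Cod E (\<delta> (Cod E (\<delta> x u)) v)"
    and eq: "h \<cdot>\<^bsub>E\<^esub> (\<delta> (Cod E (\<delta> x u)) v \<cdot>\<^bsub>E\<^esub> \<delta> x u) = k \<cdot>\<^bsub>E\<^esub> (\<delta> (Cod E (\<delta> x u)) v \<cdot>\<^bsub>E\<^esub> \<delta> x u)"
      "FAr P h = FAr P k"
  shows "h = k"
proof -
  have "cocartesian P (\<delta> (Cod E (\<delta> x u)) v \<cdot>\<^bsub>E\<^esub> \<delta> x u)"
    using x by (intro cocartesian_comp lift_cocartesian) simp_all
  then show ?thesis
    by (rule cocartesian_unique[OF _ _ _ _ _ eq]) (use h k x in simp_all)
qed

lemma lift_Ide_Cod [simp]:
  "\<lbrakk>x \<in> Obj E; u \<in> Arr B; Dom B u = FOb P x\<rbrakk> \<Longrightarrow> \<delta> (Cod E (\<delta> x u)) (Ide B (Cod B u)) = Ide E (Cod E (\<delta> x u))"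
  using lift_Ide[of "Cod E (\<delta> x u)"] by simp

text \<open>By normality one of the two lifts is an identity, so the identity satisfies the defining
  equation of the compositor. These are the two unit laws of the pseudoalgebra on
  components.\<close>

lemma chi_unit [simp]:
  assumes x: "x \<in> Obj E" "u \<in> Arr B" "Dom B u = FOb P x"
  shows "chi x (Ide B (FOb P x)) u = Ide E (Cod E (\<delta> x u))"
    and "chi x u (Ide B (Cod B u)) = Ide E (Cod E (\<delta> x u))"
  by (rule compositor_eqI, use x in simp_all)+

text \<open>Both sides are vertical arrows out of w_!(v_!(u_! x)). Composed with the three lifts,
  each becomes the lift of \<open>w \<cdot> (v \<cdot> u)\<close>, and the triple composite of lifts
  is cocartesian. The inner \<chi> passes through L by the lift equation of L.\<close>

lemma chi_assoc:
  assumes x: "x \<in> Obj E" "u \<in> Arr B" "Dom B u = FOb P x" "v \<in> Arr B" "Dom B v = Cod B u"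
    "w \<in> Arr B" "Dom B w = Cod B v"
  shows "chi x (v \<cdot>\<^bsub>B\<^esub> u) w \<cdot>\<^bsub>E\<^esub> FAr L (carr \<langle>Cod E (\<delta> (Cod E (\<delta> x u)) v), w\<rangle> \<langle>Cod E (\<delta> x (v \<cdot>\<^bsub>B\<^esub> u)), w\<rangle>
      (chi x u v) (Ide B (Cod B w))) = chi x u (w \<cdot>\<^bsub>B\<^esub> v) \<cdot>\<^bsub>E\<^esub> chi (Cod E (\<delta> x u)) v w"
    (is "?h \<cdot>\<^bsub>E\<^esub> FAr L ?p = ?k \<cdot>\<^bsub>E\<^esub> ?l")
proof -
  define y where "y = Cod E (\<delta> x u)"
  define z where "z = Cod E (\<delta> y v)"
  have y: "y \<in> Obj E" "FOb P y = Cod B u" and z: "z \<in> Obj E" "FOb P z = Cod B v"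
    using x by (simp_all add: y_def z_def)
  have d: "\<delta> x u \<in> Arr E" "Dom E (\<delta> x u) = x" "Cod E (\<delta> x u) = y"
    "\<delta> y v \<in> Arr E" "Dom E (\<delta> y v) = y" "Cod E (\<delta> y v) = z"
    "\<delta> z w \<in> Arr E" "Dom E (\<delta> z w) = z"
    using x y z by (simp_all add: y_def[symmetric] z_def[symmetric])
  have p: "?p \<in> comma_arr P" using x y z by (simp flip: y_def z_def)
  have hp: "?h \<cdot>\<^bsub>E\<^esub> FAr L ?p \<in> Arr E" "Dom E (?h \<cdot>\<^bsub>E\<^esub> FAr L ?p) = Cod E (\<delta> z w)" "FAr P (?h \<cdot>\<^bsub>E\<^esub> FAr L ?p) = Ide B (Cod B w)"
    using p x y z by (simp_all del: comma_arr_iff flip: y_def z_def)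
  have kl: "?k \<cdot>\<^bsub>E\<^esub> ?l \<in> Arr E" "Dom E (?k \<cdot>\<^bsub>E\<^esub> ?l) = Cod E (\<delta> z w)" "FAr P (?k \<cdot>\<^bsub>E\<^esub> ?l) = Ide B (Cod B w)"
    using x y z by (simp_all flip: y_def z_def)
  have c: "cocartesian P (\<delta> z w \<cdot>\<^bsub>E\<^esub> (\<delta> y v \<cdot>\<^bsub>E\<^esub> \<delta> x u))"
    by (intro cocartesian_comp lift_cocartesian) (use x y z d in simp_all)
  have 1: "FAr L ?p \<cdot>\<^bsub>E\<^esub> \<delta> z w = \<delta> (Cod E (\<delta> x (v \<cdot>\<^bsub>B\<^esub> u))) w \<cdot>\<^bsub>E\<^esub> chi x u v"
    using L_lift[OF p] by (simp flip: y_def z_def)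
  have 2: "chi x u v \<cdot>\<^bsub>E\<^esub> (\<delta> y v \<cdot>\<^bsub>E\<^esub> \<delta> x u) = \<delta> x (v \<cdot>\<^bsub>B\<^esub> u)"
    using chi_lift[of x u v] x by (simp flip: y_def)
  have 3: "?l \<cdot>\<^bsub>E\<^esub> (\<delta> z w \<cdot>\<^bsub>E\<^esub> \<delta> y v) = \<delta> y (w \<cdot>\<^bsub>B\<^esub> v)"
    using chi_lift[of y v w] x y by (simp flip: y_def z_def)
  have FL: "FAr L ?p \<in> Arr E" "Dom E (FAr L ?p) = Cod E (\<delta> z w)" "Cod E (FAr L ?p) = Cod E (\<delta> (Cod E (\<delta> x (v \<cdot>\<^bsub>B\<^esub> u))) w)"
    using p x y z by (simp_all del: comma_arr_iff flip: y_def z_def)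
  have "(?h \<cdot>\<^bsub>E\<^esub> FAr L ?p) \<cdot>\<^bsub>E\<^esub> (\<delta> z w \<cdot>\<^bsub>E\<^esub> (\<delta> y v \<cdot>\<^bsub>E\<^esub> \<delta> x u)) =
      ?h \<cdot>\<^bsub>E\<^esub> (\<delta> (Cod E (\<delta> x (v \<cdot>\<^bsub>B\<^esub> u))) w \<cdot>\<^bsub>E\<^esub> (chi x u v \<cdot>\<^bsub>E\<^esub> (\<delta> y v \<cdot>\<^bsub>E\<^esub> \<delta> x u)))"
    using A.Comp_reassoc[OF 1] FL x y z d by (simp flip: y_def z_def)
  also have "\<dots> = \<delta> x (w \<cdot>\<^bsub>B\<^esub> (v \<cdot>\<^bsub>B\<^esub> u))"
    unfolding 2 using chi_lift[of x "v \<cdot>\<^bsub>B\<^esub> u" w] x by simp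
  also have "\<dots> = ?k \<cdot>\<^bsub>E\<^esub> ((?l \<cdot>\<^bsub>E\<^esub> (\<delta> z w \<cdot>\<^bsub>E\<^esub> \<delta> y v)) \<cdot>\<^bsub>E\<^esub> \<delta> x u)"
    unfolding 3 using chi_lift[of x u "w \<cdot>\<^bsub>B\<^esub> v"] x by (simp flip: y_def)
  also have "\<dots> = (?k \<cdot>\<^bsub>E\<^esub> ?l) \<cdot>\<^bsub>E\<^esub> (\<delta> z w \<cdot>\<^bsub>E\<^esub> (\<delta> y v \<cdot>\<^bsub>E\<^esub> \<delta> x u))"
    using x y z d by (simp flip: y_def z_def)
  finally show ?thesis
    by (rule cocartesian_unique[OF c, rotated 4]) (use hp kl d x y z in simp_all)
qed

abbreviation "chi_total \<equiv> \<lparr>NSrc = fun_comp L (comma_map a.sq), NTgt = fun_comp L (comma_mult_fun P),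
  NAt = (\<lambda>Z \<in> comma_obj (cod_fun P). compositor cof (rgt Z) (rgt (lft Z)) (lft (lft Z)))\<rparr>"

lemma compositor_cell_eq: "compositor_cell \<kappa> cof =
  \<lparr>sc_src = cod_fun (cod_fun P), sc_tgt = P, sc_total = chi_total, sc_base = one2 (CAT \<kappa>) (fun_one B)\<rparr>"
  by (simp add: compositor_cell_def action_fun_eq action_eq)

text \<open>Both legs of the naturality square are tested on the double lift at the source. Three
  lift equations of L, for the top leg of p and for its images under \<open>comma_map\<close> of the
  action and under the multiplication, carry f through the lifts; the defining equations of the two
  compositors close the square.\<close>

lemma chi_nattr: "cat_nattr chi_total (fun_comp L (comma_map a.sq)) (fun_comp L (comma_mult_fun P)) (comma (cod_fun P)) E"
proof (rule cat_nattrI[OF cat_functor_comp[OF Ta.T.cat_functor_axioms L_functor] cat_functor_comp[OF mult_functor L_functor]])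
  fix Z assume "Z \<in> Obj (comma (cod_fun P))"
  then have "Z \<in> comma_obj (cod_fun P)" by simp
  then show "NAt chi_total Z \<in> hom E (FOb (fun_comp L (comma_map a.sq)) Z) (FOb (fun_comp L (comma_mult_fun P)) Z)"
    by (rule comma2_objE) simp
next
  fix p assume "p \<in> Arr (comma (cod_fun P))"
  then have p: "p \<in> comma_arr (cod_fun P)" by simp
  then obtain f v u w V W r where
    q: "p = carr \<langle>\<langle>Dom E f, u\<rangle>, V\<rangle> \<langle>\<langle>Cod E f, w\<rangle>, W\<rangle> (carr \<langle>Dom E f, u\<rangle> \<langle>Cod E f, w\<rangle> f v) r"
    "f \<in> Arr E" "u \<in> Arr B" "Dom B u = FOb P (Dom E f)" "w \<in> Arr B" "Dom B w = FOb P (Cod E f)"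
    "v \<in> Arr B" "Dom B v = Cod B u" "Cod B v = Cod B w" "v \<cdot>\<^bsub>B\<^esub> u = w \<cdot>\<^bsub>B\<^esub> FAr P f"
    "V \<in> Arr B" "Dom B V = Cod B u" "W \<in> Arr B" "Dom B W = Cod B w" "r \<in> Arr B"
    "Dom B r = Cod B V" "Cod B r = Cod B W" "r \<cdot>\<^bsub>B\<^esub> V = W \<cdot>\<^bsub>B\<^esub> v"
    by (rule comma2_arrE)
  define x where "x = Dom E f"
  define y where "y = Cod E f"
  have xy: "x \<in> Obj E" "y \<in> Obj E" using q(2) by (simp_all add: x_def y_def)
  note q' = q(2-3) q(4)[folded x_def] q(5) q(6)[folded y_def] q(7-)
  let ?q = "carr \<langle>x, u\<rangle> \<langle>y, w\<rangle> f v"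
  define x' where "x' = Cod E (\<delta> x u)"
  define y' where "y' = Cod E (\<delta> y w)"
  have xy': "x' \<in> Obj E" "FOb P x' = Cod B u" "y' \<in> Obj E" "FOb P y' = Cod B w"
    using xy q' by (simp_all add: x'_def y'_def)
  have qa: "?q \<in> comma_arr P" using q' by (simp add: x_def y_def)
  have La: "FAr (comma_map a.sq) p \<in> comma_arr P" "FAr (comma_mult_fun P) p \<in> comma_arr P"
    using a.comma_map_arr[OF p] mult_fun_arr[OF p] .
  let ?g = "carr \<langle>x', V\<rangle> \<langle>y', W\<rangle> (FAr L ?q) r" and ?m = "carr \<langle>x, V \<cdot>\<^bsub>B\<^esub> u\<rangle> \<langle>y, W \<cdot>\<^bsub>B\<^esub> w\<rangle> f r"
  have g: "FAr (comma_map a.sq) p = ?g" "FAr (comma_mult_fun P) p = ?m"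
    using p q' xy by (simp_all add: q(1) x'_def y'_def flip: x_def y_def)
  note ga = La[unfolded g]
  have Lq: "FAr L ?q \<in> Arr E" "Dom E (FAr L ?q) = x'" "Cod E (FAr L ?q) = y'"
    using qa q' xy by (simp_all del: comma_arr_iff add: x'_def y'_def)
  have Lg: "FAr L ?g \<in> Arr E" "Dom E (FAr L ?g) = Cod E (\<delta> x' V)" "Cod E (FAr L ?g) = Cod E (\<delta> y' W)"
    using ga(1) q' xy' by (simp_all del: comma_arr_iff)
  have Lm: "FAr L ?m \<in> Arr E" "Dom E (FAr L ?m) = Cod E (\<delta> x (V \<cdot>\<^bsub>B\<^esub> u))" "Cod E (FAr L ?m) = Cod E (\<delta> y (W \<cdot>\<^bsub>B\<^esub> w))"
    using ga(2) q' xy by (simp_all del: comma_arr_iff)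
  note l = L_lift[OF qa, folded x'_def y'_def] L_lift[OF ga(1)] L_lift[OF ga(2)]
  have cx: "chi x u V \<cdot>\<^bsub>E\<^esub> (\<delta> x' V \<cdot>\<^bsub>E\<^esub> \<delta> x u) = \<delta> x (V \<cdot>\<^bsub>B\<^esub> u)"
    "chi y w W \<cdot>\<^bsub>E\<^esub> (\<delta> y' W \<cdot>\<^bsub>E\<^esub> \<delta> y w) = \<delta> y (W \<cdot>\<^bsub>B\<^esub> w)"
    using chi_lift[of x u V] chi_lift[of y w W] q' xy by (simp_all add: x'_def y'_def)
  have chx: "chi x u V \<in> Arr E" "Dom E (chi x u V) = Cod E (\<delta> x' V)" "Cod E (chi x u V) = Cod E (\<delta> x (V \<cdot>\<^bsub>B\<^esub> u))"
     "chi y w W \<in> Arr E" "Dom E (chi y w W) = Cod E (\<delta> y' W)" "Cod E (chi y w W) = Cod E (\<delta> y (W \<cdot>\<^bsub>B\<^esub> w))"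
    using q' xy by (simp_all add: x'_def y'_def)
  have dl: "\<delta> x u \<in> Arr E" "Dom E (\<delta> x u) = x" "Cod E (\<delta> x u) = x'" "\<delta> y w \<in> Arr E" "Dom E (\<delta> y w) = y" "Cod E (\<delta> y w) = y'"
    "\<delta> x' V \<in> Arr E" "Dom E (\<delta> x' V) = x'" "\<delta> y' W \<in> Arr E" "Dom E (\<delta> y' W) = y'"
    using q' xy xy' by (simp_all flip: x'_def y'_def)
  have "(chi y w W \<cdot>\<^bsub>E\<^esub> FAr L ?g) \<cdot>\<^bsub>E\<^esub> (\<delta> x' V \<cdot>\<^bsub>E\<^esub> \<delta> x u)
    = chi y w W \<cdot>\<^bsub>E\<^esub> (\<delta> y' W \<cdot>\<^bsub>E\<^esub> (FAr L ?q \<cdot>\<^bsub>E\<^esub> \<delta> x u))"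
    using A.Comp_reassoc[OF l(2)] Lg Lq chx dl by simp
  also have "\<dots> = (chi y w W \<cdot>\<^bsub>E\<^esub> (\<delta> y' W \<cdot>\<^bsub>E\<^esub> \<delta> y w)) \<cdot>\<^bsub>E\<^esub> f"
    unfolding l(1) using q'(1) chx dl by (simp add: x_def y_def)
  also have "\<dots> = FAr L ?m \<cdot>\<^bsub>E\<^esub> (chi x u V \<cdot>\<^bsub>E\<^esub> (\<delta> x' V \<cdot>\<^bsub>E\<^esub> \<delta> x u))"
    unfolding cx l(3) ..
  also have "\<dots> = (FAr L ?m \<cdot>\<^bsub>E\<^esub> chi x u V) \<cdot>\<^bsub>E\<^esub> (\<delta> x' V \<cdot>\<^bsub>E\<^esub> \<delta> x u)"
    using Lm chx dl by simp
  finally have "chi y w W \<cdot>\<^bsub>E\<^esub> FAr L ?g = FAr L ?m \<cdot>\<^bsub>E\<^esub> chi x u V"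
    by (rule lift_lift_unique[OF xy(1) q'(2,3,10,11), folded x'_def, rotated 4])
      (use Lg Lm chx ga q' xy in \<open>simp_all del: comma_arr_iff\<close>)
  moreover have "carr_src p \<in> comma_obj (cod_fun P)" "carr_tgt p \<in> comma_obj (cod_fun P)" using c.carr_obj[OF p] .
  ultimately show "NAt chi_total (Cod (comma (cod_fun P)) p) \<cdot>\<^bsub>E\<^esub> FAr (fun_comp L (comma_map a.sq)) p =
    FAr (fun_comp L (comma_mult_fun P)) p \<cdot>\<^bsub>E\<^esub> NAt chi_total (Dom (comma (cod_fun P)) p)"
    using p by (simp add: g del: c.comma_arr_iff) (simp add: q(1) x_def y_def)
qed simp_all

end

text \<open>The two identity legs enter as premises instead of patterns, so the rule also applies
  where an identity is written on a different but equal object.\<close>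

lemma (in cloven) L_Ide_carr [simp]:
  assumes "x \<in> Obj E" "u \<in> Arr B" "Dom B u = FOb P x" "f = Ide E x" "v = Ide B (Cod B u)"
  shows "FAr L (carr \<langle>x, u\<rangle> \<langle>x, u\<rangle> f v) = Ide E (Cod E (\<delta> x u))"
  using L.FAr_Ide[of "\<langle>x, u\<rangle>"] assms by (simp add: comma_sel(5))

locale cloven_ambient = cloven P E B \<delta> + comma_ambient \<kappa>
  for P :: "'a univ fnctr" and E B \<delta> and \<kappa> :: "'k rel" +
  assumes small: "locally_small \<kappa> E" "locally_small \<kappa> B"

sublocale cloven_ambient \<subseteq> M: strict_two_monad "CAT\<^sub>2 \<kappa>" CC
  by (rule CC_strict_two_monad)

context cloven_ambient
begin

abbreviation "chi_cell \<equiv> \<lparr>sc_src = cod_fun (cod_fun P), sc_tgt = P, sc_total = chi_total, sc_base = one2 (CAT \<kappa>) (fun_one B)\<rparr>"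

abbreviation "alg \<equiv> \<lparr>pa_obj = P, pa_act = a.sq, pa_iota = one2 (CAT\<^sub>2 \<kappa>) (one1 (CAT\<^sub>2 \<kappa>) P), pa_chi = chi_cell\<rparr>"

lemma assoc_eq: "assoc_pseudoalgebra \<kappa> cof = alg"
  by (simp add: assoc_pseudoalgebra_def action_eq compositor_cell_eq)

lemma P_cell: "P \<in> Cell0 (CAT\<^sub>2 \<kappa>)"
  using Cell1_CAT_I[OF cat_functor_axioms] small by simp

lemma small_comma: "locally_small \<kappa> (comma P)" "locally_small \<kappa> (comma (cod_fun P))"
  using comma_ls[OF cat_functor_axioms] comma_ls[OF c.cat_functor_axioms] small by auto

lemma a_cell: "a.sq \<in> hom1 (CAT\<^sub>2 \<kappa>) (F0 CC P) P"
  using a.Cell1_CAT2_I[of \<kappa>] small small_comma by (simp add: loc_small4_def)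

lemma F1_a: "F1 CC a.sq = Ta.sq"
  by (rule square_eqI) simp_all

lemma fun_one_one: "fun_comp (fun_one B) (fun_one B) = fun_one B"
  by (rule fun_comp_one[OF cat_functor_one[OF B.category_axioms]])

text \<open>Over identities the cleavage lifts to identities, so f is its own filler. This is where
  normality of the cleavage makes the action strictly unital, and hence \<iota> an identity.\<close>

lemma a_unit: "a.sq \<odot>\<^bsub>CAT\<^sub>2 \<kappa>\<^esub> unit CC P = one1 (CAT\<^sub>2 \<kappa>) P"
proof (rule square_eqI)
  have "fun_comp L (comma_unit_fun P) = fun_one E"
  proof (rule cat_functor_eqI[OF cat_functor_comp[OF unit_functor L_functor] cat_functor_one[OF A.category_axioms]])
    fix f assume f: "f \<in> Arr E"
    have p: "carr \<langle>Dom E f, Ide B (FOb P (Dom E f))\<rangle> \<langle>Cod E f, Ide B (FOb P (Cod E f))\<rangle> f (FAr P f) \<in> comma_arr P"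
      using f by simp
    have "FAr L (carr \<langle>Dom E f, Ide B (FOb P (Dom E f))\<rangle> \<langle>Cod E f, Ide B (FOb P (Cod E f))\<rangle> f (FAr P f)) = f"
      using f p by (intro L_eqI[OF p]) (simp add: act_spec_def)
    then show "FAr (fun_comp L (comma_unit_fun P)) f = FAr (fun_one E) f" using f by simp
  qed simp
  then show "sq_total (a.sq \<odot>\<^bsub>CAT\<^sub>2 \<kappa>\<^esub> unit CC P) = sq_total (one1 (CAT\<^sub>2 \<kappa>) P)" by simp
qed (simp_all add: fun_one_one)

lemma chi_sqcell: "cat_sqcell (cod_fun (cod_fun P)) (comma (cod_fun P)) B P E B
  chi_total (fun_comp L (comma_map a.sq)) (fun_comp L (comma_mult_fun P)) (one2 (CAT \<kappa>) (fun_one B)) (fun_one B) (fun_one B)"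
proof -
  interpret s: cat_square "cod_fun (cod_fun P)" "comma (cod_fun P)" B P E B "fun_comp L (comma_map a.sq)" "fun_one B"
    using cat_square_comp[OF Ta.cat_square_axioms a.cat_square_axioms] by (simp add: fun_one_one)
  interpret t: cat_square "cod_fun (cod_fun P)" "comma (cod_fun P)" B P E B "fun_comp L (comma_mult_fun P)" "fun_one B"
    using cat_square_comp[OF mult_square a.cat_square_axioms] by (simp add: fun_one_one)
  interpret n: cat_nattr chi_total "fun_comp L (comma_map a.sq)" "fun_comp L (comma_mult_fun P)" "comma (cod_fun P)" E
    by (rule chi_nattr)
  interpret i: cat_nattr "one2 (CAT \<kappa>) (fun_one B)" "fun_one B" "fun_one B" B B
    by (rule cat_nattr_one2[OF cat_functor_one[OF B.category_axioms]])
  show ?thesis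
  proof
    fix Z assume "Z \<in> Obj (comma (cod_fun P))"
    then have Z: "Z \<in> comma_obj (cod_fun P)" by simp
    then show "FAr P (NAt chi_total Z) = NAt (one2 (CAT \<kappa>) (fun_one B)) (FOb (cod_fun (cod_fun P)) Z)"
      by (rule comma2_objE) simp
  qed
qed

lemma chi_hom2: "chi_cell \<in> hom2 (CAT\<^sub>2 \<kappa>) (a.sq \<odot>\<^bsub>CAT\<^sub>2 \<kappa>\<^esub> F1 CC a.sq) (a.sq \<odot>\<^bsub>CAT\<^sub>2 \<kappa>\<^esub> mult CC P)"
proof -
  have "chi_cell \<in> Cell2 (CAT\<^sub>2 \<kappa>)"
    using cat_sqcell.Cell2_CAT2_I[OF chi_sqcell, of \<kappa>] small small_comma by (simp add: loc_small4_def)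
  moreover have "sqcell_src (CAT \<kappa>) chi_cell = a.sq \<odot>\<^bsub>CAT\<^sub>2 \<kappa>\<^esub> F1 CC a.sq"
    "sqcell_tgt (CAT \<kappa>) chi_cell = a.sq \<odot>\<^bsub>CAT\<^sub>2 \<kappa>\<^esub> mult CC P"
    by (rule square_eqI; simp add: fun_one_one)+
  ultimately show ?thesis unfolding in_hom2 arrow_two_cat_sel by blast
qed

lemma chi_invertible: "invertible2 (CAT\<^sub>2 \<kappa>) chi_cell"
proof (rule CAT2_invertibleI[OF refl chi_sqcell])
  show "loc_small4 \<kappa> (comma (cod_fun P)) B E B" using small small_comma by (simp add: loc_small4_def)
  fix Z assume "Z \<in> Obj (comma (cod_fun P))"
  then have "Z \<in> comma_obj (cod_fun P)" by simp
  then show "iso E (NAt chi_total Z)" by (rule comma2_objE) (simp add: chi_iso)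
qed (simp add: B.iso_Ide)

lemma iota_hom2: "one2 (CAT\<^sub>2 \<kappa>) (one1 (CAT\<^sub>2 \<kappa>) P) \<in> hom2 (CAT\<^sub>2 \<kappa>) (one1 (CAT\<^sub>2 \<kappa>) P) (a.sq \<odot>\<^bsub>CAT\<^sub>2 \<kappa>\<^esub> unit CC P)"
  unfolding a_unit using CAT2.one2_hom2 CAT2.one1_cell[OF P_cell] by blast

lemma alg_unit_laws:
  "chi_cell \<rhd>\<^bsub>CAT\<^sub>2 \<kappa>\<^esub> F1 CC (unit CC P) = one2 (CAT\<^sub>2 \<kappa>) a.sq"
  "chi_cell \<rhd>\<^bsub>CAT\<^sub>2 \<kappa>\<^esub> unit CC (F0 CC P) = one2 (CAT\<^sub>2 \<kappa>) a.sq"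
proof -
  note h = M.normal_psalg_unit_laws(3,4)[OF P_cell a_cell a_unit chi_hom2]
  have o: "one2 (CAT\<^sub>2 \<kappa>) a.sq \<in> hom2 (CAT\<^sub>2 \<kappa>) a.sq a.sq"
    using CAT2.one2_hom2 a_cell unfolding in_hom1 by blast
  interpret u: comma_square P E B "cod_fun P" "comma P" B "comma_unit_fun P" "fun_one B"
    using unit_square by (simp add: comma_square_def)
  interpret Tu: cat_functor "comma_map u.sq" "comma P" "comma (cod_fun P)"
    by (rule u.comma_map_functor)
  have U: "unit CC P = u.sq" by (rule square_eqI) simp_all
  interpret Tu': cat_functor "comma_unit_fun (cod_fun P)" "comma P" "comma (cod_fun P)"
    by (rule c.unit_functor)
  show "chi_cell \<rhd>\<^bsub>CAT\<^sub>2 \<kappa>\<^esub> F1 CC (unit CC P) = one2 (CAT\<^sub>2 \<kappa>) a.sq"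
  proof (rule CAT2_hom2_eqI[OF h(1) o])
    fix Z assume "Z \<in> Obj (FDom (sq_src a.sq))"
    then have Z: "Z \<in> comma_obj P" by simp
    then show "NAt (sc_total (chi_cell \<rhd>\<^bsub>CAT\<^sub>2 \<kappa>\<^esub> F1 CC (unit CC P))) Z = NAt (sc_total (one2 (CAT\<^sub>2 \<kappa>) a.sq)) Z"
      by (rule comma_objE) (simp add: whisker_right_def U)
  qed (simp add: whisker_right_def)
  show "chi_cell \<rhd>\<^bsub>CAT\<^sub>2 \<kappa>\<^esub> unit CC (F0 CC P) = one2 (CAT\<^sub>2 \<kappa>) a.sq"
  proof (rule CAT2_hom2_eqI[OF h(2) o])
    fix Z assume "Z \<in> Obj (FDom (sq_src a.sq))"
    then have Z: "Z \<in> comma_obj P" by simp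
    then show "NAt (sc_total (chi_cell \<rhd>\<^bsub>CAT\<^sub>2 \<kappa>\<^esub> unit CC (F0 CC P))) Z = NAt (sc_total (one2 (CAT\<^sub>2 \<kappa>) a.sq)) Z"
      by (rule comma_objE) (simp add: whisker_right_def)
  qed (simp add: whisker_right_def)
qed

text \<open>At an object (((x, u), v), w) the pasting equation becomes \<open>chi_assoc\<close>; on
  bases both sides are identities.\<close>

lemma alg_assoc:
  "(chi_cell \<rhd>\<^bsub>CAT\<^sub>2 \<kappa>\<^esub> F1 CC (mult CC P)) \<bullet>\<^bsub>CAT\<^sub>2 \<kappa>\<^esub> (a.sq \<lhd>\<^bsub>CAT\<^sub>2 \<kappa>\<^esub> F2 CC chi_cell) =
   (chi_cell \<rhd>\<^bsub>CAT\<^sub>2 \<kappa>\<^esub> mult CC (F0 CC P)) \<bullet>\<^bsub>CAT\<^sub>2 \<kappa>\<^esub> (chi_cell \<rhd>\<^bsub>CAT\<^sub>2 \<kappa>\<^esub> F1 CC (F1 CC a.sq))"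
proof (rule CAT2_hom2_eqI[OF M.psalg_hom2(3,4)[OF P_cell a_cell chi_hom2]])
  interpret m: comma_square "cod_fun (cod_fun P)" "comma (cod_fun P)" B "cod_fun P" "comma P" B "comma_mult_fun P" "fun_one B"
    using mult_square by (simp add: comma_square_def)
  have sm: "mult CC P = m.sq" by (rule square_eqI) simp_all
  interpret Tm: cat_functor "comma_map m.sq" "comma (cod_fun (cod_fun P))" "comma (cod_fun P)"
    by (rule m.comma_map_functor)
  interpret TTa: comma_square "cod_fun (cod_fun (cod_fun P))" "comma (cod_fun (cod_fun P))" B
    "cod_fun (cod_fun P)" "comma (cod_fun P)" B "comma_map Ta.sq" "fun_one B"
    by (rule Ta.cod_comma_square)
  have sT: "F1 CC (F1 CC a.sq) = TTa.sq" unfolding F1_a by (rule square_eqI) simp_all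
  interpret cm: cat_functor "comma_mult_fun (cod_fun P)" "comma (cod_fun (cod_fun P))" "comma (cod_fun P)"
    by (rule a.P.mult_functor)
  interpret x: comma_sqcell "cod_fun (cod_fun P)" "comma (cod_fun P)" B P E B
    chi_total "fun_comp L (comma_map a.sq)" "fun_comp L (comma_mult_fun P)" "one2 (CAT \<kappa>) (fun_one B)" "fun_one B" "fun_one B"
    using chi_sqcell by (simp add: comma_sqcell_def)
  interpret xc: cat_nattr "comma_cell \<kappa> chi_cell" "comma_map x.s.sq" "comma_map x.t.sq" "comma (cod_fun (cod_fun P))" "comma P"
    by (rule x.comma_cell_nattr)
  fix W assume "W \<in> Obj (FDom (sq_src ((a.sq \<odot>\<^bsub>CAT\<^sub>2 \<kappa>\<^esub> F1 CC a.sq) \<odot>\<^bsub>CAT\<^sub>2 \<kappa>\<^esub> F1 CC (F1 CC a.sq))))"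
  then have W: "W \<in> comma_obj (cod_fun (cod_fun P))" by simp
  obtain Z v w where z: "W = \<langle>\<langle>Z, v\<rangle>, w\<rangle>" "Z \<in> Obj (comma P)" "v \<in> Arr B" "Dom B v = FOb (cod_fun P) Z"
    "w \<in> Arr B" "Dom B w = Cod B v" by (rule a.P.comma2_objE[OF W])
  from z(2) have "Z \<in> comma_obj P" by simp
  then obtain x u where y: "Z = \<langle>x, u\<rangle>" "x \<in> Obj E" "u \<in> Arr B" "Dom B u = FOb P x"
    by (rule comma_objE)
  have v: "Dom B v = Cod B u" using z y by simp
  have arr: "carr \<langle>Cod E (\<delta> (Cod E (\<delta> x u)) v), w\<rangle> \<langle>Cod E (\<delta> x (v \<cdot>\<^bsub>B\<^esub> u)), w\<rangle> (chi x u v) (Ide B (Cod B w)) \<in> comma_arr P"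
    using y z(3,5,6) v by simp
  show "NAt (sc_total ((chi_cell \<rhd>\<^bsub>CAT\<^sub>2 \<kappa>\<^esub> F1 CC (mult CC P)) \<bullet>\<^bsub>CAT\<^sub>2 \<kappa>\<^esub> (a.sq \<lhd>\<^bsub>CAT\<^sub>2 \<kappa>\<^esub> F2 CC chi_cell))) W =
    NAt (sc_total ((chi_cell \<rhd>\<^bsub>CAT\<^sub>2 \<kappa>\<^esub> mult CC (F0 CC P)) \<bullet>\<^bsub>CAT\<^sub>2 \<kappa>\<^esub> (chi_cell \<rhd>\<^bsub>CAT\<^sub>2 \<kappa>\<^esub> F1 CC (F1 CC a.sq)))) W"
    using W y(2-) z(3,5,6) v chi_assoc[of x u v w] arr unfolding z(1) y(1)
    by (simp add: whisker_right_def whisker_left_def sm sT)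
qed (simp add: whisker_right_def whisker_left_def)

lemma alg_normal: "normal_pseudoalgebra (CAT\<^sub>2 \<kappa>) CC alg"
proof -
  have "one1 (CAT\<^sub>2 \<kappa>) P \<in> Cell1 (CAT\<^sub>2 \<kappa>)" using CAT2.one1_cell[OF P_cell] by blast
  moreover from this have "invertible2 (CAT\<^sub>2 \<kappa>) (one2 (CAT\<^sub>2 \<kappa>) (one1 (CAT\<^sub>2 \<kappa>) P))"
    by (rule CAT2.invertible2_one2)
  ultimately show ?thesis
    unfolding normal_pseudoalgebra_def pseudoalgebra_def Let_def psalg.simps is_identity2_def
      M.normal_psalg_unit_laws(1,2)[OF P_cell a_cell a_unit chi_hom2]
    using P_cell a_cell iota_hom2 chi_hom2 chi_invertible alg_unit_laws alg_assoc by blast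
qed

end

section \<open>The cleavage of a normal pseudoalgebra\<close>

text \<open>A normal pseudoalgebra read on objects and arrows. That the action lies over the
  identity functor and that \<chi> is vertical are consequences of the axioms, derived in
  \<open>normal_pseudoalgebraE\<close>; here they are starting data.\<close>

locale normal_alg = a: comma_square "cod_fun P" "comma P" B P E B L "fun_one B"
  for P :: "'a univ fnctr" and E B L +
  fixes \<chi>
  assumes unit_ob [simp]: "x \<in> Obj E \<Longrightarrow> FOb L \<langle>x, Ide B (FOb P x)\<rangle> = x"
    and unit_ar [simp]: "f \<in> Arr E \<Longrightarrow>
      FAr L (carr \<langle>Dom E f, Ide B (FOb P (Dom E f))\<rangle> \<langle>Cod E f, Ide B (FOb P (Cod E f))\<rangle> f (FAr P f)) = f"
    and chi_nattr: "cat_nattr \<chi> (fun_comp L (comma_map a.sq)) (fun_comp L (comma_mult_fun P)) (comma (cod_fun P)) E"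
    and chi_over: "Z \<in> comma_obj (cod_fun P) \<Longrightarrow> FAr P (NAt \<chi> Z) = Ide B (Cod B (rgt Z))"
    and chi_unit1: "\<lbrakk>x \<in> Obj E; u \<in> Arr B; Dom B u = FOb P x\<rbrakk> \<Longrightarrow>
      NAt \<chi> \<langle>\<langle>x, Ide B (FOb P x)\<rangle>, u\<rangle> = Ide E (FOb L \<langle>x, u\<rangle>)"
    and chi_unit2: "\<lbrakk>x \<in> Obj E; u \<in> Arr B; Dom B u = FOb P x\<rbrakk> \<Longrightarrow>
      NAt \<chi> \<langle>\<langle>x, u\<rangle>, Ide B (Cod B u)\<rangle> = Ide E (FOb L \<langle>x, u\<rangle>)"

sublocale normal_alg \<subseteq> chi: cat_nattr \<chi> "fun_comp L (comma_map a.sq)" "fun_comp L (comma_mult_fun P)" "comma (cod_fun P)" E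
  by (rule chi_nattr)

sublocale normal_alg \<subseteq> Ta: comma_square "cod_fun (cod_fun P)" "comma (cod_fun P)" B "cod_fun P" "comma P" B
    "comma_map a.sq" "fun_one B"
  by (rule a.cod_comma_square)

context normal_alg
begin

lemma L_comp:
  assumes "carr X Y f v \<in> comma_arr P" "carr Y Z g w \<in> comma_arr P"
  shows "FAr L (carr Y Z g w) \<cdot>\<^bsub>E\<^esub> FAr L (carr X Y f v) = FAr L (carr X Z (g \<cdot>\<^bsub>E\<^esub> f) (w \<cdot>\<^bsub>B\<^esub> v))"
  using a.T.FAr_Comp[of "carr X Y f v" "carr Y Z g w"] assms by simp

text \<open>The value off the liftable pairs is fixed so that a cleavage is determined by the action
  as a function, which literal equality of the object maps requires.\<close>

definition lf where
  "lf x u = (if liftable P x u then FAr L (carr \<langle>x, Ide B (FOb P x)\<rangle> \<langle>x, u\<rangle> (Ide E x) u) else undefined)"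

lemma lf:
  assumes x: "x \<in> Obj E" "u \<in> Arr B" "Dom B u = FOb P x"
  shows lf_eq: "lf x u = FAr L (carr \<langle>x, Ide B (FOb P x)\<rangle> \<langle>x, u\<rangle> (Ide E x) u)"
    and lf_Arr [simp]: "lf x u \<in> Arr E" and lf_Dom [simp]: "Dom E (lf x u) = x"
    and lf_Cod [simp]: "Cod E (lf x u) = FOb L \<langle>x, u\<rangle>" and lf_over [simp]: "FAr P (lf x u) = u"
proof -
  have p: "carr \<langle>x, Ide B (FOb P x)\<rangle> \<langle>x, u\<rangle> (Ide E x) u \<in> comma_arr P" using x by simp
  show e: "lf x u = FAr L (carr \<langle>x, Ide B (FOb P x)\<rangle> \<langle>x, u\<rangle> (Ide E x) u)"
    using x by (simp add: lf_def liftable_def)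
  show "lf x u \<in> Arr E" "Dom E (lf x u) = x" "Cod E (lf x u) = FOb L \<langle>x, u\<rangle>" "FAr P (lf x u) = u"
    unfolding e using p x by (simp_all del: a.Q.comma_arr_iff)
qed

lemma L_lf_left:
  assumes p: "carr \<langle>y, w\<rangle> \<langle>z, t\<rangle> g v \<in> comma_arr P"
  shows "FAr L (carr \<langle>y, w\<rangle> \<langle>z, t\<rangle> g v) \<cdot>\<^bsub>E\<^esub> lf y w = FAr L (carr \<langle>y, Ide B (FOb P y)\<rangle> \<langle>z, t\<rangle> g (v \<cdot>\<^bsub>B\<^esub> w))"
proof -
  have y: "y \<in> Obj E" "w \<in> Arr B" "Dom B w = FOb P y" "g \<in> Arr E" "Dom E g = y" using p by simp_all
  have q: "carr \<langle>y, Ide B (FOb P y)\<rangle> \<langle>y, w\<rangle> (Ide E y) w \<in> comma_arr P" using y by simp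
  show ?thesis using L_comp[OF q p] lf_eq[of y w] y by simp
qed

text \<open>The unit law presents f as the image under L of its unit arrow, so composing a lift with
  f takes place inside the comma category.\<close>

lemma lf_right:
  assumes f: "f \<in> Arr E" "Cod E f = y" and w: "w \<in> Arr B" "Dom B w = FOb P y"
  shows "lf y w \<cdot>\<^bsub>E\<^esub> f = FAr L (carr \<langle>Dom E f, Ide B (FOb P (Dom E f))\<rangle> \<langle>y, w\<rangle> f (w \<cdot>\<^bsub>B\<^esub> FAr P f))"
proof -
  let ?H = "carr \<langle>Dom E f, Ide B (FOb P (Dom E f))\<rangle> \<langle>Cod E f, Ide B (FOb P (Cod E f))\<rangle> f (FAr P f)"
  have y: "y \<in> Obj E" using f by auto
  have p: "?H \<in> comma_arr P" using f y by simp
  have q: "carr \<langle>Cod E f, Ide B (FOb P (Cod E f))\<rangle> \<langle>y, w\<rangle> (Ide E y) w \<in> comma_arr P" using f w y by simp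
  have l: "lf y w = FAr L (carr \<langle>Cod E f, Ide B (FOb P (Cod E f))\<rangle> \<langle>y, w\<rangle> (Ide E y) w)"
    using lf_eq[OF y w] f by simp
  have "lf y w \<cdot>\<^bsub>E\<^esub> f = lf y w \<cdot>\<^bsub>E\<^esub> FAr L ?H" unfolding unit_ar[OF f(1)] ..
  also have "\<dots> = FAr L (carr \<langle>Dom E f, Ide B (FOb P (Dom E f))\<rangle> \<langle>y, w\<rangle> (Ide E y \<cdot>\<^bsub>E\<^esub> f) (w \<cdot>\<^bsub>B\<^esub> FAr P f))"
    unfolding l by (rule L_comp[OF p q])
  finally show ?thesis using f by simp
qed

lemma chi_natural:
  assumes p: "p \<in> comma_arr (cod_fun P)"
  shows "NAt \<chi> (carr_tgt p) \<cdot>\<^bsub>E\<^esub> FAr L (FAr (comma_map a.sq) p) = FAr L (FAr (comma_mult_fun P) p) \<cdot>\<^bsub>E\<^esub> NAt \<chi> (carr_src p)"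
  using chi.natural[of p] p by (simp del: comma_map_sel(4) comma_mult_fun_sel(4))

text \<open>The unit laws for \<open>\<chi>\<close> enter here: they force \<open>L(\<delta>\<^sub>u, 1) = 1\<close>, which makes the fillers unique.\<close>

lemma L_lf_Ide:
  assumes x: "x \<in> Obj E" "u \<in> Arr B" "Dom B u = FOb P x"
  shows "FAr L (carr \<langle>x, u\<rangle> \<langle>FOb L \<langle>x, u\<rangle>, Ide B (Cod B u)\<rangle> (lf x u) (Ide B (Cod B u))) = Ide E (FOb L \<langle>x, u\<rangle>)"
proof -
  let ?q = "carr \<langle>x, Ide B (FOb P x)\<rangle> \<langle>x, u\<rangle> (Ide E x) u"
  \<comment> \<open>The double comma arrow at which both ends of the naturality square of \<chi> are
    trivial: one unit law handles its source, the other its target. The multiplication sends it to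
    the identity on \<open>\<langle>x, u\<rangle>\<close>, so only the value of L on the remaining
    image is left.\<close>
  let ?p = "carr \<langle>\<langle>x, Ide B (FOb P x)\<rangle>, u\<rangle> \<langle>\<langle>x, u\<rangle>, Ide B (Cod B u)\<rangle> ?q (Ide B (Cod B u))"
  have q: "?q \<in> comma_arr P" using x by simp
  have p: "?p \<in> comma_arr (cod_fun P)" using x by simp
  have g: "FAr (comma_map a.sq) ?p = carr \<langle>x, u\<rangle> \<langle>FOb L \<langle>x, u\<rangle>, Ide B (Cod B u)\<rangle> (lf x u) (Ide B (Cod B u))"
    using p x q lf_eq[OF x] by simp
  have m: "FAr (comma_mult_fun P) ?p = Ide (comma P) \<langle>x, u\<rangle>"
    using p x by (simp add: comma_sel(5))
  let ?g = "carr \<langle>x, u\<rangle> \<langle>FOb L \<langle>x, u\<rangle>, Ide B (Cod B u)\<rangle> (lf x u) (Ide B (Cod B u))"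
  have ga: "?g \<in> comma_arr P" using a.comma_map_arr[OF p] unfolding g .
  have "FAr L ?g \<in> Arr E" "Cod E (FAr L ?g) = FOb L \<langle>x, u\<rangle>"
    using ga a.T.FAr_Arr[of ?g] x unit_ob[of "FOb L \<langle>x, u\<rangle>"] by (simp_all del: a.Q.comma_arr_iff)
  then show ?thesis
    using chi_natural[OF p] x unfolding g m
    by (simp add: chi_unit1 chi_unit2 del: a.Q.comma_arr_iff)
qed

text \<open>Recovers h from its composite with the lift and its projection alone, so two fillers
  with the same data are equal. The identity in h = h 1 is replaced by L(\<delta>_u, 1), h itself by
  L of its unit arrow, and the two are composed inside the comma category.\<close>

lemma filler:
  assumes x: "x \<in> Obj E" "u \<in> Arr B" "Dom B u = FOb P x" and h: "h \<in> Arr E" "Dom E h = FOb L \<langle>x, u\<rangle>"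
  shows "h = FAr L (carr \<langle>x, u\<rangle> \<langle>Cod E (h \<cdot>\<^bsub>E\<^esub> lf x u), Ide B (FOb P (Cod E (h \<cdot>\<^bsub>E\<^esub> lf x u)))\<rangle> (h \<cdot>\<^bsub>E\<^esub> lf x u) (FAr P h))"
proof -
  let ?H = "carr \<langle>Dom E h, Ide B (FOb P (Dom E h))\<rangle> \<langle>Cod E h, Ide B (FOb P (Cod E h))\<rangle> h (FAr P h)"
  let ?g = "carr \<langle>x, u\<rangle> \<langle>Dom E h, Ide B (FOb P (Dom E h))\<rangle> (lf x u) (Ide B (Cod B u))"
  have p: "?H \<in> comma_arr P" using h x by simp
  have q: "?g \<in> comma_arr P" using x h by simp
  have "h = FAr L ?H \<cdot>\<^bsub>E\<^esub> Ide E (Dom E h)" unfolding unit_ar[OF h(1)] using h by simp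
  also have "Ide E (Dom E h) = FAr L ?g" using L_lf_Ide[OF x] x h by simp
  also have "FAr L ?H \<cdot>\<^bsub>E\<^esub> FAr L ?g = FAr L (carr \<langle>x, u\<rangle> \<langle>Cod E h, Ide B (FOb P (Cod E h))\<rangle> (h \<cdot>\<^bsub>E\<^esub> lf x u) (FAr P h \<cdot>\<^bsub>B\<^esub> Ide B (Cod B u)))"
    by (rule L_comp[OF q p])
  finally show ?thesis using x h by simp
qed

lemma lf_cocartesian:
  assumes x: "x \<in> Obj E" "u \<in> Arr B" "Dom B u = FOb P x"
  shows "cocartesian P (lf x u)"
proof (rule a.Q.cocartesianI)
  show "lf x u \<in> Arr E" using x by simp
  fix g v assume g: "g \<in> Arr E" "Dom E g = Dom E (lf x u)" "v \<in> Arr B" "Dom B v = FOb P (Cod E (lf x u))"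
      "Cod B v = FOb P (Cod E g)" "FAr P g = v \<cdot>\<^bsub>B\<^esub> FAr P (lf x u)"
  let ?p = "carr \<langle>x, u\<rangle> \<langle>Cod E g, Ide B (FOb P (Cod E g))\<rangle> g v"
  have p: "?p \<in> comma_arr P" using g x by simp
  have "FAr L ?p \<cdot>\<^bsub>E\<^esub> lf x u = g"
    using L_lf_left[OF p] unit_ar[of g] g x by simp
  moreover have "FAr L ?p \<in> Arr E" "Dom E (FAr L ?p) = FOb L \<langle>x, u\<rangle>" "Cod E (FAr L ?p) = Cod E g" "FAr P (FAr L ?p) = v"
    using p a.T.FAr_Arr[of ?p] g by (simp_all del: a.Q.comma_arr_iff)
  ultimately show "\<exists>h. h \<in> Arr E \<and> Dom E h = Cod E (lf x u) \<and> Cod E h = Cod E g \<and> h \<cdot>\<^bsub>E\<^esub> lf x u = g \<and> FAr P h = v"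
    using x by auto
next
  fix h k assume hk: "h \<in> Arr E" "k \<in> Arr E" "Dom E h = Cod E (lf x u)" "Dom E k = Cod E (lf x u)"
    "h \<cdot>\<^bsub>E\<^esub> lf x u = k \<cdot>\<^bsub>E\<^esub> lf x u" "FAr P h = FAr P k"
  then show "h = k" using filler[OF x, of h] filler[OF x, of k] x by (metis lf_Cod)
qed

lemma lf_normal_cleavage: "normal_cleavage P lf"
  unfolding normal_cleavage_def
proof (intro conjI allI impI ballI)
  fix x u assume "liftable P x u"
  then have x: "x \<in> Obj E" "u \<in> Arr B" "Dom B u = FOb P x" by (simp_all add: liftable_def)
  show "cocartesian P (lf x u)" "Dom (FDom P) (lf x u) = x" "FAr P (lf x u) = u"
    using x lf_cocartesian by simp_all
next
  fix x assume "x \<in> Obj (FDom P)"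
  then have x: "x \<in> Obj E" by simp
  then show "lf x (Ide (FCod P) (FOb P x)) = Ide (FDom P) x"
    using lf_eq[of x "Ide B (FOb P x)"] unit_ar[of "Ide E x"] by simp
qed (simp add: lf_def)

end

sublocale normal_alg \<subseteq> C: cloven P E B lf
  by unfold_locales (rule lf_normal_cleavage)

context normal_alg
begin

text \<open>Closes the circle on actions: the lift equation for L has both sides equal to L of one
  and the same arrow out of \<open>\<langle>x, Ide B (FOb P x)\<rangle>\<close>, by composing on the
  left and on the right respectively.\<close>

lemma L_eq: "C.L = L"
proof (rule C.action_fun_eqI[symmetric, OF a.T.cat_functor_axioms])
  show "fun_comp P L = cod_fun P"
    using a.fun_comp_eq fun_comp_one(2)[OF a.Q.cod_functor] by simp
  fix x u y w f v assume p: "carr \<langle>x, u\<rangle> \<langle>y, w\<rangle> f v \<in> comma_arr P"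
  then show "FAr L (carr \<langle>x, u\<rangle> \<langle>y, w\<rangle> f v) \<cdot>\<^bsub>E\<^esub> lf x u = lf y w \<cdot>\<^bsub>E\<^esub> f"
    using L_lf_left[OF p] lf_right[of f y w] by simp
qed simp

lemma chi_eq: "\<chi> = C.chi_total"
proof (rule cat_nattr_eqI[OF chi_nattr])
  show "cat_nattr C.chi_total (fun_comp L (comma_map a.sq)) (fun_comp L (comma_mult_fun P)) (comma (cod_fun P)) E"
    using C.chi_nattr unfolding L_eq .
  fix Z assume "Z \<in> Obj (comma (cod_fun P))"
  then have Z: "Z \<in> comma_obj (cod_fun P)" by simp
  obtain x u v where z: "Z = \<langle>\<langle>x, u\<rangle>, v\<rangle>" and x: "x \<in> Obj E" "u \<in> Arr B" "Dom B u = FOb P x"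
    "v \<in> Arr B" "Dom B v = Cod B u"
    by (rule a.Q.comma2_objE[OF Z])
  let ?q = "carr \<langle>x, Ide B (FOb P x)\<rangle> \<langle>x, u\<rangle> (Ide E x) u"
  \<comment> \<open>This arrow starts at ((x, 1), 1), where \<chi> is an identity by the unit law.
    Naturality along it turns into the equation that defines the compositor: one image is the
    composite of two lifts, the other the lift of the composite.\<close>
  let ?p = "carr \<langle>\<langle>x, Ide B (FOb P x)\<rangle>, Ide B (FOb P x)\<rangle> \<langle>\<langle>x, u\<rangle>, v\<rangle> ?q (v \<cdot>\<^bsub>B\<^esub> u)"
  have q: "?q \<in> comma_arr P" using x by simp
  have p: "?p \<in> comma_arr (cod_fun P)" using x by simp
  have g: "FAr (comma_map a.sq) ?p = carr \<langle>x, Ide B (FOb P x)\<rangle> \<langle>FOb L \<langle>x, u\<rangle>, v\<rangle> (lf x u) (v \<cdot>\<^bsub>B\<^esub> u)"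
    using p x q lf_eq[OF x(1-3)] by simp
  have m: "FAr (comma_mult_fun P) ?p = carr \<langle>x, Ide B (FOb P x)\<rangle> \<langle>x, v \<cdot>\<^bsub>B\<^esub> u\<rangle> (Ide E x) (v \<cdot>\<^bsub>B\<^esub> u)"
    using p x by simp
  have l: "FAr L (carr \<langle>x, Ide B (FOb P x)\<rangle> \<langle>FOb L \<langle>x, u\<rangle>, v\<rangle> (lf x u) (v \<cdot>\<^bsub>B\<^esub> u)) = lf (FOb L \<langle>x, u\<rangle>) v \<cdot>\<^bsub>E\<^esub> lf x u"
    using lf_right[of "lf x u" "FOb L \<langle>x, u\<rangle>" v] x by simp
  have l': "FAr L (carr \<langle>x, Ide B (FOb P x)\<rangle> \<langle>x, v \<cdot>\<^bsub>B\<^esub> u\<rangle> (Ide E x) (v \<cdot>\<^bsub>B\<^esub> u)) = lf x (v \<cdot>\<^bsub>B\<^esub> u)"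
    using lf_eq[of x "v \<cdot>\<^bsub>B\<^esub> u"] x by simp
  have "NAt \<chi> Z \<cdot>\<^bsub>E\<^esub> (lf (FOb L \<langle>x, u\<rangle>) v \<cdot>\<^bsub>E\<^esub> lf x u) = lf x (v \<cdot>\<^bsub>B\<^esub> u)"
    using chi_natural[OF p] x unfolding g m l l' by (simp add: z chi_unit1)
  moreover have "NAt \<chi> Z \<in> Arr E" "Dom E (NAt \<chi> Z) = Cod E (lf (FOb L \<langle>x, u\<rangle>) v)" "FAr P (NAt \<chi> Z) = Ide B (Cod B v)"
    using chi.NAt_Arr[of Z] Z chi_over[OF Z] x by (simp_all add: z)
  ultimately have "compositor C.cof v u x = NAt \<chi> Z"
    by (intro C.compositor_eqI[OF x]) (use x in simp_all)
  then show "NAt \<chi> Z = NAt C.chi_total Z" using Z z by simp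
qed

end

context comma_ambient
begin

text \<open>Surjectivity of the object map. The abstract cells are taken apart until the assumptions
  of \<open>normal_alg\<close> can be read off; the recovered action and \<chi> are then compared
  with the given ones as whole cells.\<close>

lemma normal_pseudoalgebraE:
  fixes A :: "('a univ fnctr, 'a univ fnctr square, ('a univ fnctr, 'a univ nattr) sqcell) psalg"
  assumes "normal_pseudoalgebra (CAT\<^sub>2 \<kappa>) CC A"
  obtains P E B \<delta> where "cloven_ambient P E B \<delta> \<kappa>" "A = assoc_pseudoalgebra \<kappa> \<lparr>cf_fun = P, cf_lift = \<delta>\<rparr>"
proof -
  interpret M: strict_two_monad "CAT\<^sub>2 \<kappa>" "CC :: ('a univ fnctr, 'a univ fnctr square, ('a univ fnctr, 'a univ nattr) sqcell) two_monad"
    by (rule CC_strict_two_monad)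
  obtain P a \<iota> \<chi> where A: "A = \<lparr>pa_obj = P, pa_act = a, pa_iota = \<iota>, pa_chi = \<chi>\<rparr>" by (cases A)
  note d = assms[unfolded A normal_pseudoalgebra_def pseudoalgebra_def Let_def psalg.simps]
  have P: "P \<in> Cell0 (CAT\<^sub>2 \<kappa>)" and a: "a \<in> hom1 (CAT\<^sub>2 \<kappa>) (F0 CC P) P"
    and i: "\<iota> \<in> hom2 (CAT\<^sub>2 \<kappa>) (one1 (CAT\<^sub>2 \<kappa>) P) (a \<odot>\<^bsub>CAT\<^sub>2 \<kappa>\<^esub> unit CC P)"
    and c: "\<chi> \<in> hom2 (CAT\<^sub>2 \<kappa>) (a \<odot>\<^bsub>CAT\<^sub>2 \<kappa>\<^esub> F1 CC a) (a \<odot>\<^bsub>CAT\<^sub>2 \<kappa>\<^esub> mult CC P)"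
    and u1: "(\<chi> \<rhd>\<^bsub>CAT\<^sub>2 \<kappa>\<^esub> F1 CC (unit CC P)) \<bullet>\<^bsub>CAT\<^sub>2 \<kappa>\<^esub> (a \<lhd>\<^bsub>CAT\<^sub>2 \<kappa>\<^esub> F2 CC \<iota>) = one2 (CAT\<^sub>2 \<kappa>) a"
    and u2: "(\<chi> \<rhd>\<^bsub>CAT\<^sub>2 \<kappa>\<^esub> unit CC (F0 CC P)) \<bullet>\<^bsub>CAT\<^sub>2 \<kappa>\<^esub> (\<iota> \<rhd>\<^bsub>CAT\<^sub>2 \<kappa>\<^esub> a) = one2 (CAT\<^sub>2 \<kappa>) a"
    and idi: "is_identity2 (CAT\<^sub>2 \<kappa>) \<iota>"
    using d by blast+
  obtain f where f: "f \<in> Cell1 (CAT\<^sub>2 \<kappa>)" "\<iota> = one2 (CAT\<^sub>2 \<kappa>) f" using idi unfolding is_identity2_def by blast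
  \<comment> \<open>An identity 2-cell is determined by its source, here 1_P; its target then yields
    that the action is strictly unital.\<close>
  have fo: "f = one1 (CAT\<^sub>2 \<kappa>) P" and n: "a \<odot>\<^bsub>CAT\<^sub>2 \<kappa>\<^esub> unit CC P = one1 (CAT\<^sub>2 \<kappa>) P"
    using i CAT2_one2_bd[OF f(1)] unfolding f(2) in_hom2 arrow_two_cat_sel by auto
  note i' = f(2)[unfolded fo]
  obtain E B where e: "FDom P = E" "FCod P = B" by blast
  have Pf: "cat_functor P E B" and ls: "locally_small \<kappa> E" "locally_small \<kappa> B"
    using P e by (simp_all add: Cell1_CAT)
  interpret P: comma_cat2 P E B using Pf by (simp add: comma_cat2_def comma_cat_def)
  obtain Q F C L S where s: "a = \<lparr>sq_src = cod_fun P, sq_tgt = Q, sq_total = L, sq_base = S\<rparr>"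
    "cat_square (cod_fun P) (comma P) B Q F C L S"
    by (rule Cell1_CAT2_E'[of a \<kappa> "cod_fun P" "comma P" B]) (use a P.cod_functor in simp_all)
  have "Q = P" using a s(1) by simp
  then have "F = E" "C = B" using s(2) e cat_functor.FDom_eq cat_functor.FCod_eq
    unfolding cat_square_def by metis+
  have s': "cat_square (cod_fun P) (comma P) B P E B L S"
    using s(2) \<open>Q = P\<close> \<open>F = E\<close> \<open>C = B\<close> by simp
  \<comment> \<open>The unit square is the identity on bases, so the base part of a \<eta> = 1 says
    directly that the action lies over the identity.\<close>
  have "sq_base (a \<odot>\<^bsub>CAT\<^sub>2 \<kappa>\<^esub> unit CC P) = sq_base (one1 (CAT\<^sub>2 \<kappa>) P)" unfolding n ..
  then have S: "S = fun_one B" using fun_comp_one(1)[of S B B] s' by (simp add: s(1) e cat_square_def)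
  have sa: "a = \<lparr>sq_src = cod_fun P, sq_tgt = P, sq_total = L, sq_base = fun_one B\<rparr>"
    using s(1) S \<open>Q = P\<close> by simp
  interpret a: comma_square "cod_fun P" "comma P" B P E B L "fun_one B"
    using s' S by (simp add: comma_square_def)
  interpret Ta: comma_square "cod_fun (cod_fun P)" "comma (cod_fun P)" B "cod_fun P" "comma P" B "comma_map a.sq" "fun_one B"
    by (rule a.cod_comma_square)
  have "sq_total (a \<odot>\<^bsub>CAT\<^sub>2 \<kappa>\<^esub> unit CC P) = sq_total (one1 (CAT\<^sub>2 \<kappa>) P)" unfolding n ..
  then have LH: "fun_comp L (comma_unit_fun P) = fun_one E" by (simp add: sa)
  have F1a: "F1 CC a = Ta.sq" by (rule square_eqI) (simp_all add: sa)
  have fo1: "fun_comp (fun_one B) (fun_one B) = fun_one B"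
    by (rule fun_comp_one[OF cat_functor_one[OF P.B.category_axioms]])
  interpret LTa: cat_functor "fun_comp L (comma_map a.sq)" "comma (cod_fun P)" E
    by (rule cat_functor_comp[OF Ta.T.cat_functor_axioms a.T.cat_functor_axioms])
  have sqs: "cat_square (cod_fun (cod_fun P)) (comma (cod_fun P)) B P E B (fun_comp L (comma_map a.sq)) (fun_one B)"
    using cat_square_comp[OF Ta.cat_square_axioms a.cat_square_axioms] by (simp add: fo1)
  have csrc: "sqcell_src (CAT \<kappa>) \<chi> = \<lparr>sq_src = cod_fun (cod_fun P), sq_tgt = P, sq_total = fun_comp L (comma_map a.sq), sq_base = fun_one B\<rparr>"
    and ctgt: "sqcell_tgt (CAT \<kappa>) \<chi> = \<lparr>sq_src = cod_fun (cod_fun P), sq_tgt = P, sq_total = fun_comp L (comma_mult_fun P), sq_base = fun_one B\<rparr>"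
    and c2: "\<chi> \<in> Cell2 (CAT\<^sub>2 \<kappa>)"
    using c unfolding in_hom2 by (auto simp: F1a sa fo1)
  obtain \<chi>t T' \<chi>b S' where ch: "\<chi> = \<lparr>sc_src = cod_fun (cod_fun P), sc_tgt = P, sc_total = \<chi>t, sc_base = \<chi>b\<rparr>"
    "cat_sqcell (cod_fun (cod_fun P)) (comma (cod_fun P)) B P E B \<chi>t (fun_comp L (comma_map a.sq)) T' \<chi>b (fun_one B) S'"
    by (rule Cell2_CAT2_E2[OF c2 sqs csrc])
  interpret x: cat_sqcell "cod_fun (cod_fun P)" "comma (cod_fun P)" B P E B \<chi>t "fun_comp L (comma_map a.sq)" T' \<chi>b "fun_one B" S'
    by (rule ch(2))
  have T': "T' = fun_comp L (comma_mult_fun P)" and S': "S' = fun_one B"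
    using ctgt by (simp_all add: ch(1) sqcell_tgt_def)
  note ul = M.normal_psalg_unit_laws[OF P a n c]
  have U1: "\<chi> \<rhd>\<^bsub>CAT\<^sub>2 \<kappa>\<^esub> F1 CC (unit CC P) = one2 (CAT\<^sub>2 \<kappa>) a" using u1 unfolding i' ul(1) .
  have U2: "\<chi> \<rhd>\<^bsub>CAT\<^sub>2 \<kappa>\<^esub> unit CC (F0 CC P) = one2 (CAT\<^sub>2 \<kappa>) a" using u2 unfolding i' ul(2) .
  \<comment> \<open>Whiskering with a unit square changes nothing on bases, so the unit law forces
    the base part of \<chi> to be the identity; this is what makes \<chi> vertical.\<close>
  have b: "NAt \<chi>b b = Ide B b" if "b \<in> Obj B" for b
    using that arg_cong[OF U2, of "\<lambda>c. NAt (sc_base c) b"] by (simp add: whisker_right_def ch(1) sa)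
  interpret u: comma_square P E B "cod_fun P" "comma P" B "comma_unit_fun P" "fun_one B"
    using P.unit_square by (simp add: comma_square_def)
  interpret Tu: cat_functor "comma_map u.sq" "comma P" "comma (cod_fun P)"
    by (rule u.comma_map_functor)
  have U: "unit CC P = u.sq" by (rule square_eqI) simp_all
  interpret Tu': cat_functor "comma_unit_fun (cod_fun P)" "comma P" "comma (cod_fun P)"
    by (rule P.c.unit_functor)
  \<comment> \<open>In the component formula for horizontal composition a whiskering contributes the
    image of an identity arrow as a second factor; this evaluates that factor.\<close>
  have IdeL: "FAr L (FAr (comma_map a.sq) (Ide (comma (cod_fun P)) Z)) = Ide E (FOb L (FOb (comma_map a.sq) Z))"
    if "Z \<in> comma_obj (cod_fun P)" for Z using that LTa.FAr_Ide[of Z] P.c.Ide_comma(1)[OF that]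
    by (simp del: comma_map_sel)
  have "normal_alg P E B L \<chi>t"
  proof (intro normal_alg.intro normal_alg_axioms.intro)
    show "comma_square (cod_fun P) (comma P) B P E B L (fun_one B)"
      by (rule a.comma_square_axioms)
  next
    fix x assume x: "x \<in> Obj E"
    have "FOb (fun_comp L (comma_unit_fun P)) x = FOb (fun_one E) x" unfolding LH ..
    then show "FOb L \<langle>x, Ide B (FOb P x)\<rangle> = x" using x by simp
  next
    fix f assume f: "f \<in> Arr E"
    have "FAr (fun_comp L (comma_unit_fun P)) f = FAr (fun_one E) f" unfolding LH ..
    then show "FAr L (carr \<langle>Dom E f, Ide B (FOb P (Dom E f))\<rangle> \<langle>Cod E f, Ide B (FOb P (Cod E f))\<rangle> f (FAr P f)) = f"
      using f by simp
  next
    show "cat_nattr \<chi>t (fun_comp L (comma_map a.sq)) (fun_comp L (comma_mult_fun P)) (comma (cod_fun P)) E"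
      using x.total.cat_nattr_axioms T' by simp
  next
    fix Z assume Z: "Z \<in> comma_obj (cod_fun P)"
    then show "FAr P (NAt \<chi>t Z) = Ide B (Cod B (rgt Z))"
      using x.total_base[of Z] b P.c.comma_obj_parts[OF Z] by simp
  next
    fix x u assume x: "x \<in> Obj E" "u \<in> Arr B" "Dom B u = FOb P x"
    then have xu: "\<langle>x, u\<rangle> \<in> comma_obj P" by simp
    have k: "FOb (comma_map u.sq) \<langle>x, u\<rangle> = \<langle>\<langle>x, Ide B (FOb P x)\<rangle>, u\<rangle>" using x by simp
    show "NAt \<chi>t \<langle>\<langle>x, Ide B (FOb P x)\<rangle>, u\<rangle> = Ide E (FOb L \<langle>x, u\<rangle>)"
      using x arg_cong[OF U1, of "\<lambda>c. NAt (sc_total c) \<langle>x, u\<rangle>"] Tu.FOb_Obj[of "\<langle>x, u\<rangle>"]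
        LTa.FAr_Ide[of "\<langle>\<langle>x, Ide B (FOb P x)\<rangle>, u\<rangle>"] x.total.NAt_Arr(1,2)[of "\<langle>\<langle>x, Ide B (FOb P x)\<rangle>, u\<rangle>"]
      by (simp add: whisker_right_def ch(1) sa U IdeL k del: fun_comp_sel comma_map_sel)
    show "NAt \<chi>t \<langle>\<langle>x, u\<rangle>, Ide B (Cod B u)\<rangle> = Ide E (FOb L \<langle>x, u\<rangle>)"
      using x arg_cong[OF U2, of "\<lambda>c. NAt (sc_total c) \<langle>x, u\<rangle>"] Tu'.FOb_Obj[of "\<langle>x, u\<rangle>"]
        LTa.FAr_Ide[of "\<langle>\<langle>x, u\<rangle>, Ide B (Cod B u)\<rangle>"] x.total.NAt_Arr(1,2)[of "\<langle>\<langle>x, u\<rangle>, Ide B (Cod B u)\<rangle>"]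
      by (simp add: whisker_right_def ch(1) sa IdeL del: fun_comp_sel comma_map_sel)
  qed
  then interpret N: normal_alg P E B L \<chi>t .
  have "\<chi>b = one2 (CAT \<kappa>) (fun_one B)"
    by (rule cat_nattr_eqI[OF x.base.cat_nattr_axioms[unfolded S'] cat_nattr_one2[OF cat_functor_one[OF P.B.category_axioms]]])
      (simp add: b)
  moreover have ca: "cloven_ambient P E B N.lf \<kappa>"
    using N.C.cloven_axioms comma_ambient_axioms ls by (simp add: cloven_ambient_def cloven_ambient_axioms_def)
  moreover have "assoc_pseudoalgebra \<kappa> N.C.cof = \<lparr>pa_obj = P, pa_act = N.C.a.sq, pa_iota = one2 (CAT\<^sub>2 \<kappa>) (one1 (CAT\<^sub>2 \<kappa>) P),
    pa_chi = \<lparr>sc_src = cod_fun (cod_fun P), sc_tgt = P, sc_total = N.C.chi_total, sc_base = one2 (CAT \<kappa>) (fun_one B)\<rparr>\<rparr>"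
    using cloven_ambient.assoc_eq[OF ca] .
  ultimately show thesis
    using that[OF ca] N.chi_eq unfolding N.L_eq by (simp add: A i' ch(1) sa)
qed

end

section \<open>Pseudomorphisms\<close>

text \<open>The lift at the source \<open>\<langle>x, Ide B (FOb P x)\<rangle>\<close> is an
  identity, so the lift equation returns the value of L itself. Hence the action determines the
  cleavage.\<close>

lemma (in cloven) L_vertical_part:
  assumes x: "x \<in> Obj E" "u \<in> Arr B" "Dom B u = FOb P x"
  shows "FAr L (carr \<langle>x, Ide B (FOb P x)\<rangle> \<langle>x, u\<rangle> (Ide E x) u) = \<delta> x u"
proof -
  have p: "carr \<langle>x, Ide B (FOb P x)\<rangle> \<langle>x, u\<rangle> (Ide E x) u \<in> comma_arr P" using x by simp
  show ?thesis using L_lift[OF p] p x by (simp del: comma_arr_iff)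
qed

locale cloven_square =
  X: cloven_ambient P E B \<delta> \<kappa> + Y: cloven_ambient Q F C \<epsilon> \<kappa> + s: comma_square P E B Q F C T S
  for P :: "'a univ fnctr" and E B \<delta> and \<kappa> :: "'k rel" and Q :: "'a univ fnctr" and F C \<epsilon> T S
begin

lemma small: "loc_small4 \<kappa> E B F C"
  using X.small Y.small by (simp add: loc_small4_def)

lemma sq_cell: "s.sq \<in> hom1 (CAT\<^sub>2 \<kappa>) P Q"
  using s.Cell1_CAT2_I[OF small] by simp

lemma lift_Ide_T [simp]: "x \<in> Obj E \<Longrightarrow> \<epsilon> (FOb T x) (Ide C (FOb S (FOb P x))) = Ide F (FOb T x)"
  using Y.lift_Ide[of "FOb T x"] by simp

lemma source_square: "cat_square (cod_fun P) (comma P) B Q F C (fun_comp Y.L (comma_map s.sq)) S"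
  using cat_square_comp[OF s.cod_square Y.a.cat_square_axioms] fun_comp_one[OF s.S.cat_functor_axioms] by simp

lemma target_square: "cat_square (cod_fun P) (comma P) B Q F C (fun_comp T X.L) S"
  using cat_square_comp[OF X.a.cat_square_axioms s.cat_square_axioms] fun_comp_one[OF s.S.cat_functor_axioms] by simp

lemma source_eq: "Y.a.sq \<odot>\<^bsub>CAT\<^sub>2 \<kappa>\<^esub> F1 X.CC s.sq =
    \<lparr>sq_src = cod_fun P, sq_tgt = Q, sq_total = fun_comp Y.L (comma_map s.sq), sq_base = S\<rparr>"
  by (rule square_eqI) (simp_all add: fun_comp_one[OF s.S.cat_functor_axioms])

lemma target_eq: "s.sq \<odot>\<^bsub>CAT\<^sub>2 \<kappa>\<^esub> X.a.sq =
    \<lparr>sq_src = cod_fun P, sq_tgt = Q, sq_total = fun_comp T X.L, sq_base = S\<rparr>"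
  by (rule square_eqI) (simp_all add: fun_comp_one[OF s.S.cat_functor_axioms])

end

text \<open>The cell of a pseudomorphism in reduced form: vertical isomorphisms from (S u)_!(T x) to
  T(u_! x), tied to the lifts. \<open>pseudomorphism_phi\<close> and
  \<open>comparison_of_pseudomorphism\<close> translate in the two directions, so that questions
  about such cells become questions about fillers.\<close>

locale comparison = cloven_square P E B \<delta> \<kappa> Q F C \<epsilon> T S
  for P :: "'a univ fnctr" and E B \<delta> and \<kappa> :: "'k rel" and Q :: "'a univ fnctr" and F C \<epsilon> T S +
  fixes \<phi>
  assumes nattr: "cat_nattr \<phi> (fun_comp Y.L (comma_map s.sq)) (fun_comp T X.L) (comma P) F"
    and over [simp]: "\<lbrakk>x \<in> Obj E; u \<in> Arr B; Dom B u = FOb P x\<rbrakk> \<Longrightarrow> FAr Q (NAt \<phi> \<langle>x, u\<rangle>) = Ide C (FOb S (Cod B u))"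
    and lift: "\<lbrakk>x \<in> Obj E; u \<in> Arr B; Dom B u = FOb P x\<rbrakk> \<Longrightarrow>
      NAt \<phi> \<langle>x, u\<rangle> \<cdot>\<^bsub>F\<^esub> \<epsilon> (FOb T x) (FAr S u) = FAr T (\<delta> x u)"
    and iso: "\<lbrakk>x \<in> Obj E; u \<in> Arr B; Dom B u = FOb P x\<rbrakk> \<Longrightarrow> iso F (NAt \<phi> \<langle>x, u\<rangle>)"

sublocale comparison \<subseteq> phi: cat_nattr \<phi> "fun_comp Y.L (comma_map s.sq)" "fun_comp T X.L" "comma P" F
  by (rule nattr)

context comparison
begin

abbreviation "phi_cell \<equiv> \<lparr>sc_src = cod_fun P, sc_tgt = Q, sc_total = \<phi>, sc_base = one2 (CAT \<kappa>) S\<rparr>"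

lemma phi [simp]:
  assumes x: "x \<in> Obj E" "u \<in> Arr B" "Dom B u = FOb P x"
  shows "NAt \<phi> \<langle>x, u\<rangle> \<in> Arr F" "Dom F (NAt \<phi> \<langle>x, u\<rangle>) = Cod F (\<epsilon> (FOb T x) (FAr S u))"
    "Cod F (NAt \<phi> \<langle>x, u\<rangle>) = FOb T (Cod E (\<delta> x u))"
  using phi.NAt_Arr[of "\<langle>x, u\<rangle>"] x by simp_all

text \<open>Every cocartesian arrow is a designated lift followed by an isomorphism, and T sends a
  designated lift to a designated lift followed by the isomorphism \<phi>. All factors of the image
  are therefore cocartesian.\<close>

lemma preserves: "preserves_cocartesian s.sq"
  unfolding preserves_cocartesian_def
proof (intro allI impI)
  fix e assume "cocartesian (sq_src s.sq) e"
  then have e: "cocartesian P e" by simp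
  have eA: "e \<in> Arr E" using e by (rule X.cocartesian_Arr)
  let ?d = "\<delta> (Dom E e) (FAr P e)"
  have x: "Dom E e \<in> Obj E" "FAr P e \<in> Arr B" "Dom B (FAr P e) = FOb P (Dom E e)" using eA by simp_all
  obtain k where k: "k \<in> Arr E" "Dom E k = Cod E ?d" "Cod E k = Cod E e" "k \<cdot>\<^bsub>E\<^esub> ?d = e" "iso E k"
    by (rule X.cocartesian_iso[OF X.lift_cocartesian[OF x] e]) (use x in simp_all)
  have "FAr T e = FAr T (k \<cdot>\<^bsub>E\<^esub> ?d)" using k by simp
  also have "\<dots> = FAr T k \<cdot>\<^bsub>F\<^esub> (NAt \<phi> \<langle>Dom E e, FAr P e\<rangle> \<cdot>\<^bsub>F\<^esub> \<epsilon> (FOb T (Dom E e)) (FAr S (FAr P e)))"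
    unfolding lift[OF x] using k(1,2) x by simp
  finally have t: "FAr T e = FAr T k \<cdot>\<^bsub>F\<^esub> (NAt \<phi> \<langle>Dom E e, FAr P e\<rangle> \<cdot>\<^bsub>F\<^esub> \<epsilon> (FOb T (Dom E e)) (FAr S (FAr P e)))" .
  have "cocartesian Q (FAr T e)"
    unfolding t
    by (intro Y.cocartesian_comp Y.iso_cocartesian s.T.FAr_iso iso k(5) Y.lift_cocartesian)
      (use k(1,2) x in simp_all)
  then show "cocartesian (sq_tgt s.sq) (FAr (sq_total s.sq) e)" by simp
qed

lemma phi_unit [simp]: "x \<in> Obj E \<Longrightarrow> NAt \<phi> \<langle>x, Ide B (FOb P x)\<rangle> = Ide F (FOb T x)"
  using lift[of x "Ide B (FOb P x)"] phi[of x "Ide B (FOb P x)"] by simp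

text \<open>The multiplication axiom on components. Both sides start at the double push-forward of T
  x; composed with the two lifts there, each becomes the image under T of the lift of
  \<open>v \<cdot> u\<close>, and both project to an identity.\<close>

lemma phi_comp:
  assumes x: "x \<in> Obj E" "u \<in> Arr B" "Dom B u = FOb P x" "v \<in> Arr B" "Dom B v = Cod B u"
  shows "NAt \<phi> \<langle>x, v \<cdot>\<^bsub>B\<^esub> u\<rangle> \<cdot>\<^bsub>F\<^esub> Y.chi (FOb T x) (FAr S u) (FAr S v) =
    FAr T (X.chi x u v) \<cdot>\<^bsub>F\<^esub> (NAt \<phi> \<langle>Cod E (\<delta> x u), v\<rangle> \<cdot>\<^bsub>F\<^esub>
      FAr Y.L (carr \<langle>Cod F (\<epsilon> (FOb T x) (FAr S u)), FAr S v\<rangle> \<langle>FOb T (Cod E (\<delta> x u)), FAr S v\<rangle>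
        (NAt \<phi> \<langle>x, u\<rangle>) (Ide C (FOb S (Cod B v)))))"
    (is "?a \<cdot>\<^bsub>F\<^esub> ?b = ?t \<cdot>\<^bsub>F\<^esub> (?c \<cdot>\<^bsub>F\<^esub> FAr Y.L ?p)")
proof -
  define y where "y = Cod E (\<delta> x u)"
  define y' where "y' = Cod F (\<epsilon> (FOb T x) (FAr S u))"
  have y: "y \<in> Obj E" "FOb P y = Cod B u" using x by (simp_all add: y_def)
  have y': "y' \<in> Obj F" "FOb Q y' = FOb S (Cod B u)" using x by (simp_all add: y'_def)
  have Tx: "FOb T x \<in> Obj F" "FAr S u \<in> Arr C" "Dom C (FAr S u) = FOb Q (FOb T x)" "FAr S v \<in> Arr C" "Dom C (FAr S v) = Cod C (FAr S u)"
    using x by simp_all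
  have p: "?p \<in> comma_arr Q" using x y y' by (simp flip: y_def y'_def)
  have FL: "FAr Y.L ?p \<in> Arr F" "Dom F (FAr Y.L ?p) = Cod F (\<epsilon> y' (FAr S v))" "Cod F (FAr Y.L ?p) = Cod F (\<epsilon> (FOb T y) (FAr S v))"
    using p x y y' by (simp_all del: Y.comma_arr_iff flip: y_def y'_def)
  have l: "FAr Y.L ?p \<cdot>\<^bsub>F\<^esub> \<epsilon> y' (FAr S v) = \<epsilon> (FOb T y) (FAr S v) \<cdot>\<^bsub>F\<^esub> NAt \<phi> \<langle>x, u\<rangle>"
    using Y.L_lift[OF p] by (simp flip: y_def y'_def)
  have c: "NAt \<phi> \<langle>y, v\<rangle> \<cdot>\<^bsub>F\<^esub> \<epsilon> (FOb T y) (FAr S v) = FAr T (\<delta> y v)"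
    using lift[of y v] x y by simp
  have b: "?b \<cdot>\<^bsub>F\<^esub> (\<epsilon> y' (FAr S v) \<cdot>\<^bsub>F\<^esub> \<epsilon> (FOb T x) (FAr S u)) = \<epsilon> (FOb T x) (FAr S v \<cdot>\<^bsub>C\<^esub> FAr S u)"
    using Y.chi_lift[OF Tx] by (simp add: y'_def)
  have d: "\<epsilon> (FOb T x) (FAr S u) \<in> Arr F" "Dom F (\<epsilon> (FOb T x) (FAr S u)) = FOb T x" "Cod F (\<epsilon> (FOb T x) (FAr S u)) = y'"
    "\<epsilon> y' (FAr S v) \<in> Arr F" "Dom F (\<epsilon> y' (FAr S v)) = y'"
    "\<epsilon> (FOb T y) (FAr S v) \<in> Arr F" "Dom F (\<epsilon> (FOb T y) (FAr S v)) = FOb T y"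
    "NAt \<phi> \<langle>x, u\<rangle> \<in> Arr F" "Dom F (NAt \<phi> \<langle>x, u\<rangle>) = y'" "Cod F (NAt \<phi> \<langle>x, u\<rangle>) = FOb T y"
    "NAt \<phi> \<langle>y, v\<rangle> \<in> Arr F" "Dom F (NAt \<phi> \<langle>y, v\<rangle>) = Cod F (\<epsilon> (FOb T y) (FAr S v))" "Cod F (NAt \<phi> \<langle>y, v\<rangle>) = FOb T (Cod E (\<delta> y v))"
    using x y y' by (simp_all flip: y_def y'_def)
  have t: "?t \<in> Arr F" "Dom F ?t = FOb T (Cod E (\<delta> y v))" using x by (simp_all flip: y_def)
  have ab: "?a \<in> Arr F" "?b \<in> Arr F" "Dom F ?a = Cod F ?b" "Dom F ?b = Cod F (\<epsilon> y' (FAr S v))"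
    using x by (simp_all flip: y_def y'_def)
  have "(?a \<cdot>\<^bsub>F\<^esub> ?b) \<cdot>\<^bsub>F\<^esub> (\<epsilon> y' (FAr S v) \<cdot>\<^bsub>F\<^esub> \<epsilon> (FOb T x) (FAr S u)) = ?a \<cdot>\<^bsub>F\<^esub> \<epsilon> (FOb T x) (FAr S v \<cdot>\<^bsub>C\<^esub> FAr S u)"
    using d ab b by simp
  also have "\<dots> = FAr T (\<delta> x (v \<cdot>\<^bsub>B\<^esub> u))" using lift[of x "v \<cdot>\<^bsub>B\<^esub> u"] x by simp
  also have "\<dots> = FAr T (X.chi x u v \<cdot>\<^bsub>E\<^esub> (\<delta> y v \<cdot>\<^bsub>E\<^esub> \<delta> x u))" using X.chi_lift[OF x] by (simp add: y_def)
  also have "\<dots> = ?t \<cdot>\<^bsub>F\<^esub> (FAr T (\<delta> y v) \<cdot>\<^bsub>F\<^esub> FAr T (\<delta> x u))" using x y by (simp flip: y_def)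
  also have "\<dots> = ?t \<cdot>\<^bsub>F\<^esub> ((NAt \<phi> \<langle>y, v\<rangle> \<cdot>\<^bsub>F\<^esub> \<epsilon> (FOb T y) (FAr S v)) \<cdot>\<^bsub>F\<^esub> (NAt \<phi> \<langle>x, u\<rangle> \<cdot>\<^bsub>F\<^esub> \<epsilon> (FOb T x) (FAr S u)))"
    unfolding c lift[OF x(1-3)] ..
  also have "\<dots> = (?t \<cdot>\<^bsub>F\<^esub> (?c \<cdot>\<^bsub>F\<^esub> FAr Y.L ?p)) \<cdot>\<^bsub>F\<^esub> (\<epsilon> y' (FAr S v) \<cdot>\<^bsub>F\<^esub> \<epsilon> (FOb T x) (FAr S u))"
    using d FL t Y.A.Comp_reassoc[OF l, of "\<epsilon> (FOb T x) (FAr S u)"] by (simp flip: y_def y'_def)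
  finally show ?thesis
    by (rule Y.lift_lift_unique[OF Tx, folded y'_def, rotated 4])
      (use d FL t ab x y y' p in \<open>simp_all del: Y.comma_arr_iff flip: y_def y'_def\<close>)
qed

lemma phi_sqcell: "cat_sqcell (cod_fun P) (comma P) B Q F C \<phi> (fun_comp Y.L (comma_map s.sq)) (fun_comp T X.L)
  (one2 (CAT \<kappa>) S) S S"
proof -
  interpret ss: cat_square "cod_fun P" "comma P" B Q F C "fun_comp Y.L (comma_map s.sq)" S by (rule source_square)
  interpret tt: cat_square "cod_fun P" "comma P" B Q F C "fun_comp T X.L" S by (rule target_square)
  interpret i: cat_nattr "one2 (CAT \<kappa>) S" S S B C by (rule cat_nattr_one2[OF s.S.cat_functor_axioms])
  show ?thesis
  proof
    fix Z assume "Z \<in> Obj (comma P)"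
    then have "Z \<in> comma_obj P" by simp
    then show "FAr Q (NAt \<phi> Z) = NAt (one2 (CAT \<kappa>) S) (FOb (cod_fun P) Z)"
      by (rule X.comma_objE) simp
  qed
qed

lemma small': "loc_small4 \<kappa> (comma P) B F C"
  using small X.small_comma by (simp add: loc_small4_def)

lemma phi_hom2: "phi_cell \<in> hom2 (CAT\<^sub>2 \<kappa>) (Y.a.sq \<odot>\<^bsub>CAT\<^sub>2 \<kappa>\<^esub> F1 X.CC s.sq) (s.sq \<odot>\<^bsub>CAT\<^sub>2 \<kappa>\<^esub> X.a.sq)"
  using cat_sqcell.Cell2_CAT2_I[OF phi_sqcell small'] unfolding source_eq target_eq
  by (simp add: sqcell_src_def sqcell_tgt_def)

lemma phi_invertible: "invertible2 (CAT\<^sub>2 \<kappa>) phi_cell"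
proof (rule CAT2_invertibleI[OF refl phi_sqcell small'])
  fix Z assume "Z \<in> Obj (comma P)"
  then have "Z \<in> comma_obj P" by simp
  then show "iso F (NAt \<phi> Z)" by (rule X.comma_objE) (simp add: iso)
qed (simp add: Y.B.iso_Ide)

text \<open>With the boundaries known from the abstract 2-monad, the two axioms are
  \<open>phi_unit\<close> and \<open>phi_comp\<close> on components.\<close>

lemma pseudomorphism_phi:
  "pseudomorphism (CAT\<^sub>2 \<kappa>) X.CC \<lparr>pm_src = X.alg, pm_tgt = Y.alg, pm_map = s.sq, pm_cell = phi_cell\<rparr>"
proof -
  note ul = X.M.normal_psmor_unit_law[OF X.P_cell X.a_cell Y.P_cell Y.a_cell sq_cell phi_hom2 X.a_unit Y.a_unit]
  have "phi_cell \<rhd>\<^bsub>CAT\<^sub>2 \<kappa>\<^esub> unit X.CC P = one2 (CAT\<^sub>2 \<kappa>) s.sq"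
  proof (rule CAT2_hom2_eqI[OF ul(3)])
    show "one2 (CAT\<^sub>2 \<kappa>) s.sq \<in> hom2 (CAT\<^sub>2 \<kappa>) s.sq s.sq"
      using CAT2.one2_hom2 sq_cell unfolding in_hom1 by blast
  qed (simp_all add: whisker_right_def)
  moreover have "(phi_cell \<rhd>\<^bsub>CAT\<^sub>2 \<kappa>\<^esub> mult X.CC P) \<bullet>\<^bsub>CAT\<^sub>2 \<kappa>\<^esub> (Y.chi_cell \<rhd>\<^bsub>CAT\<^sub>2 \<kappa>\<^esub> F1 X.CC (F1 X.CC s.sq)) =
      (s.sq \<lhd>\<^bsub>CAT\<^sub>2 \<kappa>\<^esub> X.chi_cell) \<bullet>\<^bsub>CAT\<^sub>2 \<kappa>\<^esub> (phi_cell \<rhd>\<^bsub>CAT\<^sub>2 \<kappa>\<^esub> F1 X.CC X.a.sq) \<bullet>\<^bsub>CAT\<^sub>2 \<kappa>\<^esub> (Y.a.sq \<lhd>\<^bsub>CAT\<^sub>2 \<kappa>\<^esub> F2 X.CC phi_cell)"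
  proof (rule CAT2_hom2_eqI[OF X.M.psmor_hom2(2,3)[OF X.P_cell X.a_cell Y.P_cell Y.a_cell sq_cell phi_hom2 X.chi_hom2 Y.chi_hom2]])
    interpret Ts: comma_square "cod_fun P" "comma P" B "cod_fun Q" "comma Q" C "comma_map s.sq" S
      by (rule s.cod_comma_square)
    interpret TTs: comma_square "cod_fun (cod_fun P)" "comma (cod_fun P)" B "cod_fun (cod_fun Q)" "comma (cod_fun Q)" C "comma_map Ts.sq" S
      by (rule Ts.cod_comma_square)
    have F1s: "F1 X.CC s.sq = Ts.sq" by (rule square_eqI) simp_all
    have F1Ts: "F1 X.CC Ts.sq = TTs.sq" by (rule square_eqI) simp_all
    interpret m: cat_functor "comma_mult_fun P" "comma (cod_fun P)" "comma P" by (rule X.mult_functor)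
    fix Z assume "Z \<in> Obj (FDom (sq_src ((Y.a.sq \<odot>\<^bsub>CAT\<^sub>2 \<kappa>\<^esub> F1 X.CC Y.a.sq) \<odot>\<^bsub>CAT\<^sub>2 \<kappa>\<^esub> F1 X.CC (F1 X.CC s.sq))))"
    then have Z: "Z \<in> comma_obj (cod_fun P)" by simp
    obtain x u v where z: "Z = \<langle>\<langle>x, u\<rangle>, v\<rangle>" and x: "x \<in> Obj E" "u \<in> Arr B" "Dom B u = FOb P x"
      "v \<in> Arr B" "Dom B v = Cod B u"
      by (rule X.comma2_objE[OF Z])
    have arr: "carr \<langle>Cod F (\<epsilon> (FOb T x) (FAr S u)), FAr S v\<rangle> \<langle>FOb T (Cod E (\<delta> x u)), FAr S v\<rangle>
        (NAt \<phi> \<langle>x, u\<rangle>) (Ide C (FOb S (Cod B v))) \<in> comma_arr Q"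
      using x by simp
    show "NAt (sc_total ((phi_cell \<rhd>\<^bsub>CAT\<^sub>2 \<kappa>\<^esub> mult X.CC P) \<bullet>\<^bsub>CAT\<^sub>2 \<kappa>\<^esub> (Y.chi_cell \<rhd>\<^bsub>CAT\<^sub>2 \<kappa>\<^esub> F1 X.CC (F1 X.CC s.sq)))) Z =
      NAt (sc_total ((s.sq \<lhd>\<^bsub>CAT\<^sub>2 \<kappa>\<^esub> X.chi_cell) \<bullet>\<^bsub>CAT\<^sub>2 \<kappa>\<^esub> (phi_cell \<rhd>\<^bsub>CAT\<^sub>2 \<kappa>\<^esub> F1 X.CC X.a.sq) \<bullet>\<^bsub>CAT\<^sub>2 \<kappa>\<^esub> (Y.a.sq \<lhd>\<^bsub>CAT\<^sub>2 \<kappa>\<^esub> F2 X.CC phi_cell))) Z"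
      using x phi_comp[OF x] arr Z unfolding z
      by (simp add: whisker_right_def whisker_left_def F1s F1Ts X.F1_a)
  qed (simp add: whisker_right_def whisker_left_def)
  moreover have "pseudoalgebra (CAT\<^sub>2 \<kappa>) X.CC X.alg" "pseudoalgebra (CAT\<^sub>2 \<kappa>) X.CC Y.alg"
    using X.alg_normal Y.alg_normal unfolding normal_pseudoalgebra_def by blast+
  ultimately show ?thesis
    unfolding pseudomorphism_def Let_def psalg.simps psmor.simps ul(1,2)
    using sq_cell phi_hom2 phi_invertible by blast
qed

lemma phi_determined:
  assumes "comparison P E B \<delta> \<kappa> Q F C \<epsilon> T S \<psi>" shows "\<psi> = \<phi>"
proof -
  interpret p: comparison P E B \<delta> \<kappa> Q F C \<epsilon> T S \<psi> by fact
  show ?thesis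
  proof (rule cat_nattr_eqI[OF p.nattr nattr])
    fix Z assume "Z \<in> Obj (comma P)"
    then have "Z \<in> comma_obj P" by simp
    then obtain x u where z: "Z = \<langle>x, u\<rangle>" and x: "x \<in> Obj E" "u \<in> Arr B" "Dom B u = FOb P x"
      by (rule X.comma_objE)
    have "cocartesian Q (\<epsilon> (FOb T x) (FAr S u))" using x by (intro Y.lift_cocartesian) simp_all
    then show "NAt \<psi> Z = NAt \<phi> Z" unfolding z
      by (rule Y.cocartesian_unique) (use x lift[OF x] p.lift[OF x] p.phi[OF x] in simp_all)
  qed
qed

end

context cloven_square
begin

text \<open>If T preserves cocartesian arrows, then \<open>FAr T (\<delta> x u)\<close> and the lift
  of \<open>FAr S u\<close> at T x are cocartesian with the same source and image, which gives the
  components. They are chosen object by object; as unique fillers they are natural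
  automatically.\<close>

lemma comparison_exists:
  assumes pres: "preserves_cocartesian s.sq"
  obtains \<phi> where "comparison P E B \<delta> \<kappa> Q F C \<epsilon> T S \<phi>"
proof -
  define spec where "spec x u h \<longleftrightarrow> h \<in> Arr F \<and> Dom F h = Cod F (\<epsilon> (FOb T x) (FAr S u)) \<and> Cod F h = FOb T (Cod E (\<delta> x u)) \<and>
    h \<cdot>\<^bsub>F\<^esub> \<epsilon> (FOb T x) (FAr S u) = FAr T (\<delta> x u) \<and> FAr Q h = Ide C (FOb S (Cod B u)) \<and> iso F h" for x u h
  have ex: "\<exists>h. spec x u h" if x: "x \<in> Obj E" "u \<in> Arr B" "Dom B u = FOb P x" for x u
  proof -
    have e: "cocartesian Q (\<epsilon> (FOb T x) (FAr S u))" using x by (intro Y.lift_cocartesian) simp_all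
    have d: "cocartesian Q (FAr T (\<delta> x u))"
      using pres X.lift_cocartesian[OF x] by (simp add: preserves_cocartesian_def)
    obtain h where "h \<in> Arr F" "Dom F h = Cod F (\<epsilon> (FOb T x) (FAr S u))" "Cod F h = Cod F (FAr T (\<delta> x u))"
      "h \<cdot>\<^bsub>F\<^esub> \<epsilon> (FOb T x) (FAr S u) = FAr T (\<delta> x u)" "FAr Q h = Ide C (FOb Q (Cod F (FAr T (\<delta> x u))))" "iso F h"
      by (rule Y.cocartesian_iso[OF e d]) (use x in simp_all)
    then show ?thesis using x by (intro exI[of _ h]) (simp add: spec_def)
  qed
  define h where "h Z = (SOME k. spec (lft Z) (rgt Z) k)" for Z
  define \<phi> where "\<phi> = \<lparr>NSrc = fun_comp Y.L (comma_map s.sq), NTgt = fun_comp T X.L, NAt = (\<lambda>Z \<in> comma_obj P. h Z)\<rparr>"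
  have h: "spec x u (h \<langle>x, u\<rangle>)" if "x \<in> Obj E" "u \<in> Arr B" "Dom B u = FOb P x" for x u
    unfolding h_def using someI_ex[OF ex[OF that]] by simp
  note h' = h[unfolded spec_def]
  have at: "NAt \<phi> \<langle>x, u\<rangle> = h \<langle>x, u\<rangle>" if "x \<in> Obj E" "u \<in> Arr B" "Dom B u = FOb P x" for x u
    using that by (simp add: \<phi>_def)
  have "cat_nattr \<phi> (fun_comp Y.L (comma_map s.sq)) (fun_comp T X.L) (comma P) F"
  proof (rule cat_nattrI[OF cat_functor_comp[OF s.comma_map_functor Y.L_functor] cat_functor_comp[OF X.L_functor s.T.cat_functor_axioms]])
    fix Z assume "Z \<in> Obj (comma P)"
    then have "Z \<in> comma_obj P" by simp
    then show "NAt \<phi> Z \<in> hom F (FOb (fun_comp Y.L (comma_map s.sq)) Z) (FOb (fun_comp T X.L) Z)"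
      by (rule X.comma_objE) (simp add: at h')
  next
    fix p assume "p \<in> Arr (comma P)"
    then have p: "p \<in> comma_arr P" by simp
    obtain f v u w where e: "p = carr \<langle>Dom E f, u\<rangle> \<langle>Cod E f, w\<rangle> f v"
      "f \<in> Arr E" "u \<in> Arr B" "Dom B u = FOb P (Dom E f)" "w \<in> Arr B" "Dom B w = FOb P (Cod E f)"
      "v \<in> Arr B" "Dom B v = Cod B u" "Cod B v = Cod B w" "v \<cdot>\<^bsub>B\<^esub> u = w \<cdot>\<^bsub>B\<^esub> FAr P f"
      by (rule X.comma_arrE[OF p])
    define x where "x = Dom E f"
    define y where "y = Cod E f"
    have xy: "x \<in> Obj E" "y \<in> Obj E" using e(2) by (simp_all add: x_def y_def)
    note e' = e(1)[folded x_def y_def] e(2-3) e(4)[folded x_def] e(5) e(6)[folded y_def] e(7-9)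
    have q: "FAr (comma_map s.sq) p = carr \<langle>FOb T x, FAr S u\<rangle> \<langle>FOb T y, FAr S w\<rangle> (FAr T f) (FAr S v)"
      using p by (simp add: e'(1))
    let ?q = "carr \<langle>FOb T x, FAr S u\<rangle> \<langle>FOb T y, FAr S w\<rangle> (FAr T f) (FAr S v)"
    have qa: "?q \<in> comma_arr Q" using s.comma_map_arr[OF p] unfolding q .
    have LL: "FAr Y.L ?q \<cdot>\<^bsub>F\<^esub> \<epsilon> (FOb T x) (FAr S u) = \<epsilon> (FOb T y) (FAr S w) \<cdot>\<^bsub>F\<^esub> FAr T f" by (rule Y.L_lift[OF qa])
    have lp: "FAr X.L p \<cdot>\<^bsub>E\<^esub> \<delta> x u = \<delta> y w \<cdot>\<^bsub>E\<^esub> f" using X.L_lift p unfolding e'(1) .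
    have Lp: "FAr X.L p \<in> Arr E" "Dom E (FAr X.L p) = Cod E (\<delta> x u)" "Cod E (FAr X.L p) = Cod E (\<delta> y w)"
      using X.L.FAr_Arr[of p] p e' xy by (simp_all del: X.comma_arr_iff)
    have Lq: "FAr Y.L ?q \<in> Arr F" "Dom F (FAr Y.L ?q) = Cod F (\<epsilon> (FOb T x) (FAr S u))" "Cod F (FAr Y.L ?q) = Cod F (\<epsilon> (FOb T y) (FAr S w))"
      using qa e' xy by (simp_all del: Y.comma_arr_iff)
    have hx: "h \<langle>x, u\<rangle> \<in> Arr F" "Dom F (h \<langle>x, u\<rangle>) = Cod F (\<epsilon> (FOb T x) (FAr S u))" "Cod F (h \<langle>x, u\<rangle>) = FOb T (Cod E (\<delta> x u))"
      "h \<langle>x, u\<rangle> \<cdot>\<^bsub>F\<^esub> \<epsilon> (FOb T x) (FAr S u) = FAr T (\<delta> x u)" "FAr Q (h \<langle>x, u\<rangle>) = Ide C (FOb S (Cod B u))"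
      using h'[of x u] e' xy by simp_all
    have hy: "h \<langle>y, w\<rangle> \<in> Arr F" "Dom F (h \<langle>y, w\<rangle>) = Cod F (\<epsilon> (FOb T y) (FAr S w))" "Cod F (h \<langle>y, w\<rangle>) = FOb T (Cod E (\<delta> y w))"
      "h \<langle>y, w\<rangle> \<cdot>\<^bsub>F\<^esub> \<epsilon> (FOb T y) (FAr S w) = FAr T (\<delta> y w)" "FAr Q (h \<langle>y, w\<rangle>) = Ide C (FOb S (Cod B w))"
      using h'[of y w] e' xy by simp_all
    have c: "cocartesian Q (\<epsilon> (FOb T x) (FAr S u))" using e' xy by (intro Y.lift_cocartesian) simp_all
    have eps: "\<epsilon> (FOb T x) (FAr S u) \<in> Arr F" "Dom F (\<epsilon> (FOb T x) (FAr S u)) = FOb T x"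
      "\<epsilon> (FOb T y) (FAr S w) \<in> Arr F" "Dom F (\<epsilon> (FOb T y) (FAr S w)) = FOb T y"
      using e' xy by simp_all
    have f: "f \<in> Arr E" "Dom E f = x" "Cod E f = y" using e(2) by (simp_all add: x_def y_def)
    \<comment> \<open>Naturality is tested on the designated lift at T x: the lift equations for the
      two actions move f across, and the equations of the fillers replace lifts in F by images of
      lifts in E.\<close>
    have "(h \<langle>y, w\<rangle> \<cdot>\<^bsub>F\<^esub> FAr Y.L ?q) \<cdot>\<^bsub>F\<^esub> \<epsilon> (FOb T x) (FAr S u) = (h \<langle>y, w\<rangle> \<cdot>\<^bsub>F\<^esub> \<epsilon> (FOb T y) (FAr S w)) \<cdot>\<^bsub>F\<^esub> FAr T f"
      using LL hy(1-3) Lq eps f by simp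
    also have "\<dots> = FAr T (\<delta> y w \<cdot>\<^bsub>E\<^esub> f)" unfolding hy(4) using e' xy f by simp
    also have "\<dots> = FAr T (FAr X.L p) \<cdot>\<^bsub>F\<^esub> (h \<langle>x, u\<rangle> \<cdot>\<^bsub>F\<^esub> \<epsilon> (FOb T x) (FAr S u))"
      unfolding lp[symmetric] hx(4) using Lp e' xy by simp
    also have "\<dots> = (FAr T (FAr X.L p) \<cdot>\<^bsub>F\<^esub> h \<langle>x, u\<rangle>) \<cdot>\<^bsub>F\<^esub> \<epsilon> (FOb T x) (FAr S u)"
      using Lp hx(1-3) eps by simp
    finally have "h \<langle>y, w\<rangle> \<cdot>\<^bsub>F\<^esub> FAr Y.L ?q = FAr T (FAr X.L p) \<cdot>\<^bsub>F\<^esub> h \<langle>x, u\<rangle>"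
      by (rule Y.cocartesian_unique[OF c, rotated 4])
        (use Lp Lq hx hy qa p e' xy in \<open>simp_all del: X.comma_arr_iff Y.comma_arr_iff\<close>)
    then show "NAt \<phi> (Cod (comma P) p) \<cdot>\<^bsub>F\<^esub> FAr (fun_comp Y.L (comma_map s.sq)) p =
        FAr (fun_comp T X.L) p \<cdot>\<^bsub>F\<^esub> NAt \<phi> (Dom (comma P) p)"
      using p q e' xy at[of x u] at[of y w] by (simp del: X.comma_arr_iff comma_map_sel(4))
  qed (simp_all add: \<phi>_def)
  then have "comparison P E B \<delta> \<kappa> Q F C \<epsilon> T S \<phi>"
    using cloven_square_axioms at h' by (auto simp: comparison_def comparison_axioms_def)
  then show thesis by (rule that)
qed

text \<open>The unit axiom supplies everything beyond naturality: its base part makes the base cell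
  an identity, and its total part makes \<phi> trivial at the objects (x, 1), from which the lift
  equation spreads along the arrows (1, u).\<close>

lemma comparison_of_pseudomorphism:
  assumes "pseudomorphism (CAT\<^sub>2 \<kappa>) X.CC m" "pm_src m = X.alg" "pm_tgt m = Y.alg" "pm_map m = s.sq"
  obtains \<phi> where "comparison P E B \<delta> \<kappa> Q F C \<epsilon> T S \<phi>"
    "pm_cell m = \<lparr>sc_src = cod_fun P, sc_tgt = Q, sc_total = \<phi>, sc_base = one2 (CAT \<kappa>) S\<rparr>"
proof -
  note d = assms(1)[unfolded pseudomorphism_def Let_def assms(2-4) psalg.simps]
  have h: "pm_cell m \<in> hom2 (CAT\<^sub>2 \<kappa>) (Y.a.sq \<odot>\<^bsub>CAT\<^sub>2 \<kappa>\<^esub> F1 X.CC s.sq) (s.sq \<odot>\<^bsub>CAT\<^sub>2 \<kappa>\<^esub> X.a.sq)"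
    and inv: "invertible2 (CAT\<^sub>2 \<kappa>) (pm_cell m)"
    and un: "(pm_cell m \<rhd>\<^bsub>CAT\<^sub>2 \<kappa>\<^esub> unit X.CC P) \<bullet>\<^bsub>CAT\<^sub>2 \<kappa>\<^esub> (one2 (CAT\<^sub>2 \<kappa>) (one1 (CAT\<^sub>2 \<kappa>) Q) \<rhd>\<^bsub>CAT\<^sub>2 \<kappa>\<^esub> s.sq) =
      s.sq \<lhd>\<^bsub>CAT\<^sub>2 \<kappa>\<^esub> one2 (CAT\<^sub>2 \<kappa>) (one1 (CAT\<^sub>2 \<kappa>) P)"
    using d by blast+
  note ul = X.M.normal_psmor_unit_law[OF X.P_cell X.a_cell Y.P_cell Y.a_cell sq_cell h X.a_unit Y.a_unit]
  have U: "pm_cell m \<rhd>\<^bsub>CAT\<^sub>2 \<kappa>\<^esub> unit X.CC P = one2 (CAT\<^sub>2 \<kappa>) s.sq" using un unfolding ul(1,2) .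
  have c2: "pm_cell m \<in> Cell2 (CAT\<^sub>2 \<kappa>)"
    and cs: "sqcell_src (CAT \<kappa>) (pm_cell m) = \<lparr>sq_src = cod_fun P, sq_tgt = Q, sq_total = fun_comp Y.L (comma_map s.sq), sq_base = S\<rparr>"
    and ct: "sqcell_tgt (CAT \<kappa>) (pm_cell m) = \<lparr>sq_src = cod_fun P, sq_tgt = Q, sq_total = fun_comp T X.L, sq_base = S\<rparr>"
    using h unfolding in_hom2 arrow_two_cat_sel source_eq target_eq by blast+
  obtain \<phi> T' \<alpha> S' where e: "pm_cell m = \<lparr>sc_src = cod_fun P, sc_tgt = Q, sc_total = \<phi>, sc_base = \<alpha>\<rparr>"
    "cat_sqcell (cod_fun P) (comma P) B Q F C \<phi> (fun_comp Y.L (comma_map s.sq)) T' \<alpha> S S'"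
    by (rule Cell2_CAT2_E2[OF c2 source_square cs])
  interpret x: cat_sqcell "cod_fun P" "comma P" B Q F C \<phi> "fun_comp Y.L (comma_map s.sq)" T' \<alpha> S S' by (rule e(2))
  have T': "T' = fun_comp T X.L" "S' = S" using ct by (simp_all add: e(1) sqcell_tgt_def)
  \<comment> \<open>The unit square is an identity on bases, so whiskering with it leaves the base
    part of the cell unchanged and the unit axiom evaluates that part at every object of B.\<close>
  have b: "NAt \<alpha> b = Ide C (FOb S b)" if "b \<in> Obj B" for b
    using that arg_cong[OF U, of "\<lambda>c. NAt (sc_base c) b"] x.base.NAt_Arr[of b] by (simp add: whisker_right_def e(1))
  have al: "\<alpha> = one2 (CAT \<kappa>) S"
    by (rule cat_nattr_eqI[OF x.base.cat_nattr_axioms[unfolded T'] cat_nattr_one2[OF s.S.cat_functor_axioms]])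
      (simp add: b)
  have un': "NAt \<phi> \<langle>x, Ide B (FOb P x)\<rangle> = Ide F (FOb T x)" if x: "x \<in> Obj E" for x
    using x arg_cong[OF U, of "\<lambda>c. NAt (sc_total c) x"] x.total.NAt_Arr[of "\<langle>x, Ide B (FOb P x)\<rangle>"]
    by (simp add: whisker_right_def e(1))
  have "comparison P E B \<delta> \<kappa> Q F C \<epsilon> T S \<phi>"
  proof (intro comparison.intro comparison_axioms.intro)
    show "cloven_square P E B \<delta> \<kappa> Q F C \<epsilon> T S" by (rule cloven_square_axioms)
    show "cat_nattr \<phi> (fun_comp Y.L (comma_map s.sq)) (fun_comp T X.L) (comma P) F"
      using x.total.cat_nattr_axioms unfolding T' .
    fix x u assume x: "x \<in> Obj E" "u \<in> Arr B" "Dom B u = FOb P x"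
    show "FAr Q (NAt \<phi> \<langle>x, u\<rangle>) = Ide C (FOb S (Cod B u))"
      using x.total_base[of "\<langle>x, u\<rangle>"] x b by simp
    show "iso F (NAt \<phi> \<langle>x, u\<rangle>)" by (rule CAT2_invertibleD[OF e inv]) (use x in simp)
    let ?p = "carr \<langle>x, Ide B (FOb P x)\<rangle> \<langle>x, u\<rangle> (Ide E x) u"
    have p: "?p \<in> comma_arr P" using x by simp
    have q: "FAr (comma_map s.sq) ?p = carr \<langle>FOb T x, Ide C (FOb Q (FOb T x))\<rangle> \<langle>FOb T x, FAr S u\<rangle> (Ide F (FOb T x)) (FAr S u)"
      using p x by simp
    have "FAr Y.L (FAr (comma_map s.sq) ?p) = \<epsilon> (FOb T x) (FAr S u)"
      unfolding q by (rule Y.L_vertical_part) (use x in simp_all)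
    moreover have "FAr X.L ?p = \<delta> x u" by (rule X.L_vertical_part[OF x])
    ultimately show "NAt \<phi> \<langle>x, u\<rangle> \<cdot>\<^bsub>F\<^esub> \<epsilon> (FOb T x) (FAr S u) = FAr T (\<delta> x u)"
      using x.total.natural[of ?p] p x un'[of x] unfolding T'
      by (simp del: X.comma_arr_iff comma_map_sel(4))
  qed
  then show thesis using that e(1) al by blast
qed

text \<open>The argument of \<open>preserves\<close> with an identity in place of \<phi>. It makes a
  lift-preserving square underlie some pseudomorphism, which can then be recognised as
  strict.\<close>

lemma preserves_lifts_cocartesian:
  assumes "preserves_lifts X.cof Y.cof s.sq"
  shows "preserves_cocartesian s.sq"
  unfolding preserves_cocartesian_def
proof (intro allI impI)
  fix e assume "cocartesian (sq_src s.sq) e"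
  then have e: "cocartesian P e" by simp
  have eA: "e \<in> Arr E" using e by (rule X.cocartesian_Arr)
  let ?d = "\<delta> (Dom E e) (FAr P e)"
  have x: "Dom E e \<in> Obj E" "FAr P e \<in> Arr B" "Dom B (FAr P e) = FOb P (Dom E e)" using eA by simp_all
  have l: "FAr T ?d = \<epsilon> (FOb T (Dom E e)) (FAr S (FAr P e))"
    using assms x by (simp add: preserves_lifts_def liftable_def)
  obtain k where k: "k \<in> Arr E" "Dom E k = Cod E ?d" "Cod E k = Cod E e" "k \<cdot>\<^bsub>E\<^esub> ?d = e" "iso E k"
    by (rule X.cocartesian_iso[OF X.lift_cocartesian[OF x] e]) (use x in simp_all)
  have "FAr T e = FAr T (k \<cdot>\<^bsub>E\<^esub> ?d)" using k by simp
  also have t: "\<dots> = FAr T k \<cdot>\<^bsub>F\<^esub> FAr T ?d" using k(1,2) x by simp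
  finally have t: "FAr T e = FAr T k \<cdot>\<^bsub>F\<^esub> FAr T ?d" .
  have d: "cocartesian Q (FAr T ?d)" unfolding l by (rule Y.lift_cocartesian) (use x in simp_all)
  have "cocartesian Q (FAr T e)"
    unfolding t by (rule Y.cocartesian_comp[OF d Y.iso_cocartesian[OF s.T.FAr_iso[OF k(5)]]]) (use k(1,2) x in simp)
  then show "cocartesian (sq_tgt s.sq) (FAr (sq_total s.sq) e)" by simp
qed

end

text \<open>By the lift equation the component of \<phi> at \<open>\<langle>x, u\<rangle>\<close> is
  an identity exactly if T sends the lift to the lift; cancellation of the cocartesian lift gives
  the converse half.\<close>

lemma (in comparison) identity_iff: "is_identity2 (CAT\<^sub>2 \<kappa>) phi_cell \<longleftrightarrow> preserves_lifts X.cof Y.cof s.sq"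
proof
  assume "is_identity2 (CAT\<^sub>2 \<kappa>) phi_cell"
  then obtain f where f: "phi_cell = one2 (CAT\<^sub>2 \<kappa>) f" unfolding is_identity2_def by blast
  have "sc_total phi_cell = sc_total (one2 (CAT\<^sub>2 \<kappa>) f)" unfolding f ..
  then have t: "\<phi> = one2 (CAT \<kappa>) (sq_total f)" by simp
  \<comment> \<open>The witness for an identity 2-cell is some square; the source of \<phi>
    determines its total functor.\<close>
  have "sq_total f = fun_comp Y.L (comma_map s.sq)" using phi.NSrc_eq unfolding t by simp
  with t have t: "\<phi> = one2 (CAT \<kappa>) (fun_comp Y.L (comma_map s.sq))" by simp
  show "preserves_lifts X.cof Y.cof s.sq"
    unfolding preserves_lifts_def
  proof (intro allI impI)
    fix x u assume "liftable (cf_fun X.cof) x u"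
    then have x: "x \<in> Obj E" "u \<in> Arr B" "Dom B u = FOb P x" by (simp_all add: liftable_def)
    have "NAt \<phi> \<langle>x, u\<rangle> = Ide F (Cod F (\<epsilon> (FOb T x) (FAr S u)))" unfolding t using x by simp
    then show "FAr (sq_total s.sq) (cf_lift X.cof x u) = cf_lift Y.cof (FOb (sq_total s.sq) x) (FAr (sq_base s.sq) u)"
      using lift[OF x] x by simp
  qed
next
  assume pl: "preserves_lifts X.cof Y.cof s.sq"
  have l: "FAr T (\<delta> x u) = \<epsilon> (FOb T x) (FAr S u)" if "x \<in> Obj E" "u \<in> Arr B" "Dom B u = FOb P x" for x u
    using pl that by (simp add: preserves_lifts_def liftable_def)
  have ide: "NAt \<phi> \<langle>x, u\<rangle> = Ide F (Cod F (\<epsilon> (FOb T x) (FAr S u)))" if x: "x \<in> Obj E" "u \<in> Arr B" "Dom B u = FOb P x" for x u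
  proof -
    have "cocartesian Q (\<epsilon> (FOb T x) (FAr S u))" using x by (intro Y.lift_cocartesian) simp_all
    then show ?thesis
      by (rule Y.cocartesian_unique) (use x lift[OF x] l[OF x] phi[OF x] in simp_all)
  qed
  have ob: "NAt \<phi> Z = Ide F (FOb (fun_comp Y.L (comma_map s.sq)) Z)" if "Z \<in> comma_obj P" for Z
    by (rule X.comma_objE[OF that]) (simp add: ide)
  \<comment> \<open>An identity component has equal domain and codomain, which are the values of the
    two boundary functors.\<close>
  have obe: "FOb (fun_comp Y.L (comma_map s.sq)) Z = FOb (fun_comp T X.L) Z" if "Z \<in> comma_obj P" for Z
  proof -
    have Z: "Z \<in> Obj (comma P)" using that by simp
    have "Cod F (NAt \<phi> Z) = FOb (fun_comp Y.L (comma_map s.sq)) Z"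
      unfolding ob[OF that] using phi.F.FOb_Obj[OF Z] by (simp del: fun_comp_sel)
    then show ?thesis using phi.NAt_Arr(3)[OF Z] by simp
  qed
  \<comment> \<open>Identity components alone do not yet make an identity 2-cell: the two boundary
    functors must be equal. On arrows this is the naturality square with identity sides.\<close>
  have eq: "fun_comp Y.L (comma_map s.sq) = fun_comp T X.L"
  proof (rule cat_functor_eqI[OF phi.F.cat_functor_axioms phi.G.cat_functor_axioms])
    fix Z assume "Z \<in> Obj (comma P)"
    then show "FOb (fun_comp Y.L (comma_map s.sq)) Z = FOb (fun_comp T X.L) Z" using obe by simp
  next
    fix p assume p: "p \<in> Arr (comma P)"
    then have o: "carr_src p \<in> comma_obj P" "carr_tgt p \<in> comma_obj P" using X.carr_obj by auto
    show "FAr (fun_comp Y.L (comma_map s.sq)) p = FAr (fun_comp T X.L) p"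
      using phi.natural[OF p] p phi.F.FAr_Arr[OF p] phi.G.FAr_Arr[OF p] obe[OF o(1)]
      by (simp add: ob o del: fun_comp_sel)
  qed
  have "\<phi> = one2 (CAT \<kappa>) (fun_comp Y.L (comma_map s.sq))"
    by (rule cat_nattr_eqI[OF nattr[folded eq] cat_nattr_one2[OF phi.F.cat_functor_axioms]]) (simp add: ob del: fun_comp_sel(3,4))
  then have "phi_cell = one2 (CAT\<^sub>2 \<kappa>) \<lparr>sq_src = cod_fun P, sq_tgt = Q, sq_total = fun_comp Y.L (comma_map s.sq), sq_base = S\<rparr>"
    by (intro sqcell_eqI) simp_all
  moreover have "\<lparr>sq_src = cod_fun P, sq_tgt = Q, sq_total = fun_comp Y.L (comma_map s.sq), sq_base = S\<rparr> \<in> Cell1 (CAT\<^sub>2 \<kappa>)"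
    by (rule cat_square.Cell1_CAT2_I[OF source_square small'])
  ultimately show "is_identity2 (CAT\<^sub>2 \<kappa>) phi_cell" unfolding is_identity2_def by blast
qed

text \<open>Both sides of the equation are tested on the designated lift at T x. There the
  comparison cells turn lifts into images of lifts, and what remains is naturality of \<beta> at
  \<open>\<delta> x u\<close> together with the lift equation of L at the arrow (\<beta>, \<alpha>).
  The statement stands outside the locales because it combines two comparisons between the same
  cleavages.\<close>

lemma algebra_transformation_comparison:
  fixes P :: "'a univ fnctr"
  assumes "comparison P E B \<delta> \<kappa> Q F C \<epsilon> T S \<phi>" "comparison P E B \<delta> \<kappa> Q F C \<epsilon> T' S' \<psi>"
    and "cat_sqcell P E B Q F C \<beta> T T' \<alpha> S S'"
    and m: "pm_src m = assoc_pseudoalgebra \<kappa> \<lparr>cf_fun = P, cf_lift = \<delta>\<rparr>" "pm_tgt m = assoc_pseudoalgebra \<kappa> \<lparr>cf_fun = Q, cf_lift = \<epsilon>\<rparr>"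
      "pm_map m = \<lparr>sq_src = P, sq_tgt = Q, sq_total = T, sq_base = S\<rparr>"
      "pm_cell m = \<lparr>sc_src = cod_fun P, sc_tgt = Q, sc_total = \<phi>, sc_base = one2 (CAT \<kappa>) S\<rparr>"
    and n: "pm_src n = pm_src m" "pm_tgt n = pm_tgt m"
      "pm_map n = \<lparr>sq_src = P, sq_tgt = Q, sq_total = T', sq_base = S'\<rparr>"
      "pm_cell n = \<lparr>sc_src = cod_fun P, sc_tgt = Q, sc_total = \<psi>, sc_base = one2 (CAT \<kappa>) S'\<rparr>"
    and mn: "pseudomorphism (CAT\<^sub>2 \<kappa>) (comma_monad \<kappa>) m" "pseudomorphism (CAT\<^sub>2 \<kappa>) (comma_monad \<kappa>) n"
  shows "algebra_transformation (CAT\<^sub>2 \<kappa>) (comma_monad \<kappa>)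
    \<lparr>at_src = m, at_tgt = n, at_cell = \<lparr>sc_src = P, sc_tgt = Q, sc_total = \<beta>, sc_base = \<alpha>\<rparr>\<rparr>"
proof -
  interpret p: comparison P E B \<delta> \<kappa> Q F C \<epsilon> T S \<phi> by fact
  interpret q: comparison P E B \<delta> \<kappa> Q F C \<epsilon> T' S' \<psi> by fact
  interpret t: comma_sqcell P E B Q F C \<beta> T T' \<alpha> S S' using assms(3) by (simp add: comma_sqcell_def)
  interpret tc: cat_nattr "comma_cell \<kappa> t.sqc" "comma_map p.s.sq" "comma_map q.s.sq" "comma P" "comma Q"
    by (rule t.comma_cell_nattr)
  have th: "t.sqc \<in> hom2 (CAT\<^sub>2 \<kappa>) p.s.sq q.s.sq"
    using t.Cell2_CAT2_I[OF p.small] by (simp add: sqcell_src_def sqcell_tgt_def)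
  note h = p.X.M.algtr_hom2[OF p.X.P_cell p.X.a_cell p.Y.P_cell p.Y.a_cell p.sq_cell p.phi_hom2 q.sq_cell q.phi_hom2 th]
  have "(t.sqc \<rhd>\<^bsub>CAT\<^sub>2 \<kappa>\<^esub> p.X.a.sq) \<bullet>\<^bsub>CAT\<^sub>2 \<kappa>\<^esub> p.phi_cell = q.phi_cell \<bullet>\<^bsub>CAT\<^sub>2 \<kappa>\<^esub> (p.Y.a.sq \<lhd>\<^bsub>CAT\<^sub>2 \<kappa>\<^esub> F2 p.X.CC t.sqc)"
  proof (rule CAT2_hom2_eqI[OF h])
    fix Z assume "Z \<in> Obj (FDom (sq_src (p.Y.a.sq \<odot>\<^bsub>CAT\<^sub>2 \<kappa>\<^esub> F1 p.X.CC p.s.sq)))"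
    then have Z: "Z \<in> comma_obj P" by simp
    then obtain x u where z: "Z = \<langle>x, u\<rangle>" and x: "x \<in> Obj E" "u \<in> Arr B" "Dom B u = FOb P x"
      by (rule p.X.comma_objE)
    let ?g = "carr \<langle>FOb T x, FAr S u\<rangle> \<langle>FOb T' x, FAr S' u\<rangle> (NAt \<beta> x) (NAt \<alpha> (Cod B u))"
    have g: "NAt (comma_cell \<kappa> t.sqc) Z = ?g" using x Z by (simp add: z t.sqc_src)
    have ga: "?g \<in> comma_arr Q" using tc.NAt_Arr(1)[of Z] Z unfolding g by simp
    have Lg: "FAr p.Y.L ?g \<in> Arr F" "Dom F (FAr p.Y.L ?g) = Cod F (\<epsilon> (FOb T x) (FAr S u))" "Cod F (FAr p.Y.L ?g) = Cod F (\<epsilon> (FOb T' x) (FAr S' u))"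
      using ga x by (simp_all del: p.Y.comma_arr_iff)
    have l: "FAr p.Y.L ?g \<cdot>\<^bsub>F\<^esub> \<epsilon> (FOb T x) (FAr S u) = \<epsilon> (FOb T' x) (FAr S' u) \<cdot>\<^bsub>F\<^esub> NAt \<beta> x" by (rule p.Y.L_lift[OF ga])
    have c: "cocartesian Q (\<epsilon> (FOb T x) (FAr S u))" using x by (intro p.Y.lift_cocartesian) simp_all
    have d: "\<delta> x u \<in> Arr E" "Dom E (\<delta> x u) = x" using x by simp_all
    have eps: "\<epsilon> (FOb T x) (FAr S u) \<in> Arr F" "Dom F (\<epsilon> (FOb T x) (FAr S u)) = FOb T x"
      "\<epsilon> (FOb T' x) (FAr S' u) \<in> Arr F" "Dom F (\<epsilon> (FOb T' x) (FAr S' u)) = FOb T' x"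
      using x by simp_all
    have "(NAt \<beta> (Cod E (\<delta> x u)) \<cdot>\<^bsub>F\<^esub> NAt \<phi> \<langle>x, u\<rangle>) \<cdot>\<^bsub>F\<^esub> \<epsilon> (FOb T x) (FAr S u) = NAt \<beta> (Cod E (\<delta> x u)) \<cdot>\<^bsub>F\<^esub> FAr T (\<delta> x u)"
      using p.lift[OF x] x eps by simp
    also have "\<dots> = FAr T' (\<delta> x u) \<cdot>\<^bsub>F\<^esub> NAt \<beta> x" using t.total.natural[OF d(1)] d(2) by simp
    also have "\<dots> = NAt \<psi> \<langle>x, u\<rangle> \<cdot>\<^bsub>F\<^esub> (\<epsilon> (FOb T' x) (FAr S' u) \<cdot>\<^bsub>F\<^esub> NAt \<beta> x)"
      unfolding q.lift[OF x, symmetric] using x eps by simp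
    also have "\<dots> = (NAt \<psi> \<langle>x, u\<rangle> \<cdot>\<^bsub>F\<^esub> FAr p.Y.L ?g) \<cdot>\<^bsub>F\<^esub> \<epsilon> (FOb T x) (FAr S u)"
      unfolding l[symmetric] using x eps Lg by simp
    finally have "NAt \<beta> (Cod E (\<delta> x u)) \<cdot>\<^bsub>F\<^esub> NAt \<phi> \<langle>x, u\<rangle> = NAt \<psi> \<langle>x, u\<rangle> \<cdot>\<^bsub>F\<^esub> FAr p.Y.L ?g"
      by (rule p.Y.cocartesian_unique[OF c, rotated 4]) (use x Lg ga in \<open>simp_all del: p.Y.comma_arr_iff\<close>)
    then show "NAt (sc_total ((t.sqc \<rhd>\<^bsub>CAT\<^sub>2 \<kappa>\<^esub> p.X.a.sq) \<bullet>\<^bsub>CAT\<^sub>2 \<kappa>\<^esub> p.phi_cell)) Z =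
      NAt (sc_total (q.phi_cell \<bullet>\<^bsub>CAT\<^sub>2 \<kappa>\<^esub> (p.Y.a.sq \<lhd>\<^bsub>CAT\<^sub>2 \<kappa>\<^esub> F2 p.X.CC t.sqc))) Z"
      using x Z Lg by (simp add: whisker_right_def whisker_left_def g[unfolded z] z t.sqc_src del: comma_cell_sel(3) p.Y.comma_arr_iff)
  qed (simp add: whisker_right_def whisker_left_def)
  then show ?thesis
    using mn th unfolding algebra_transformation_def Let_def algtr.simps n m p.X.assoc_eq p.Y.assoc_eq psalg.simps
    by blast
qed

section \<open>2-categories over a base\<close>

text \<open>A candidate 2-category with a boundary-preserving map to K that respects the operations
  and is injective on parallel cells. Each law of a 2-category equates parallel cells, so the laws
  are inherited from K; what has to be verified by hand is only closure under the
  operations.\<close>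

locale two_cat_over = K: two_category K for K :: "('q, 'k, 'e) two_cat" +
  fixes L :: "('p, 'n, 'd) two_cat" and U :: "('p, 'n, 'd, 'q, 'k, 'e) two_fun"
  assumes U0: "x \<in> Cell0 L \<Longrightarrow> F0 U x \<in> Cell0 K"
    and cell1: "f \<in> Cell1 L \<Longrightarrow> src1 L f \<in> Cell0 L \<and> tgt1 L f \<in> Cell0 L \<and>
      F1 U f \<in> hom1 K (F0 U (src1 L f)) (F0 U (tgt1 L f))"
    and cell2: "\<alpha> \<in> Cell2 L \<Longrightarrow> src2 L \<alpha> \<in> Cell1 L \<and> tgt2 L \<alpha> \<in> Cell1 L \<and>
      src1 L (tgt2 L \<alpha>) = src1 L (src2 L \<alpha>) \<and> tgt1 L (tgt2 L \<alpha>) = tgt1 L (src2 L \<alpha>) \<and>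
      F2 U \<alpha> \<in> hom2 K (F1 U (src2 L \<alpha>)) (F1 U (tgt2 L \<alpha>))"
    and one1: "x \<in> Cell0 L \<Longrightarrow> one1 L x \<in> hom1 L x x \<and> F1 U (one1 L x) = one1 K (F0 U x)"
    and one2: "f \<in> Cell1 L \<Longrightarrow> one2 L f \<in> hom2 L f f \<and> F2 U (one2 L f) = one2 K (F1 U f)"
    and comp1: "\<lbrakk>f \<in> Cell1 L; g \<in> Cell1 L; tgt1 L f = src1 L g\<rbrakk> \<Longrightarrow>
      g \<odot>\<^bsub>L\<^esub> f \<in> hom1 L (src1 L f) (tgt1 L g) \<and> F1 U (g \<odot>\<^bsub>L\<^esub> f) = F1 U g \<odot>\<^bsub>K\<^esub> F1 U f"
    and vcomp: "\<lbrakk>\<alpha> \<in> Cell2 L; \<beta> \<in> Cell2 L; tgt2 L \<alpha> = src2 L \<beta>\<rbrakk> \<Longrightarrow>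
      \<beta> \<bullet>\<^bsub>L\<^esub> \<alpha> \<in> hom2 L (src2 L \<alpha>) (tgt2 L \<beta>) \<and> F2 U (\<beta> \<bullet>\<^bsub>L\<^esub> \<alpha>) = F2 U \<beta> \<bullet>\<^bsub>K\<^esub> F2 U \<alpha>"
    and hcomp: "\<lbrakk>\<alpha> \<in> Cell2 L; \<beta> \<in> Cell2 L; tgt1 L (src2 L \<alpha>) = src1 L (src2 L \<beta>)\<rbrakk> \<Longrightarrow>
      \<beta> \<star>\<^bsub>L\<^esub> \<alpha> \<in> hom2 L (src2 L \<beta> \<odot>\<^bsub>L\<^esub> src2 L \<alpha>) (tgt2 L \<beta> \<odot>\<^bsub>L\<^esub> tgt2 L \<alpha>) \<and>
      F2 U (\<beta> \<star>\<^bsub>L\<^esub> \<alpha>) = F2 U \<beta> \<star>\<^bsub>K\<^esub> F2 U \<alpha>"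
    and faithful1: "\<lbrakk>f \<in> Cell1 L; g \<in> Cell1 L; src1 L f = src1 L g; tgt1 L f = tgt1 L g; F1 U f = F1 U g\<rbrakk> \<Longrightarrow> f = g"
    and faithful2: "\<lbrakk>\<alpha> \<in> Cell2 L; \<beta> \<in> Cell2 L; src2 L \<alpha> = src2 L \<beta>; tgt2 L \<alpha> = tgt2 L \<beta>; F2 U \<alpha> = F2 U \<beta>\<rbrakk> \<Longrightarrow> \<alpha> = \<beta>"
begin

lemma simps [simp]:
  "x \<in> Cell0 L \<Longrightarrow> F0 U x \<in> Cell0 K"
  "f \<in> Cell1 L \<Longrightarrow> src1 L f \<in> Cell0 L" "f \<in> Cell1 L \<Longrightarrow> tgt1 L f \<in> Cell0 L"
  "f \<in> Cell1 L \<Longrightarrow> F1 U f \<in> Cell1 K"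
  "f \<in> Cell1 L \<Longrightarrow> src1 K (F1 U f) = F0 U (src1 L f)" "f \<in> Cell1 L \<Longrightarrow> tgt1 K (F1 U f) = F0 U (tgt1 L f)"
  "\<alpha> \<in> Cell2 L \<Longrightarrow> src2 L \<alpha> \<in> Cell1 L" "\<alpha> \<in> Cell2 L \<Longrightarrow> tgt2 L \<alpha> \<in> Cell1 L"
  "\<alpha> \<in> Cell2 L \<Longrightarrow> src1 L (src2 L \<alpha>) = src1 L (tgt2 L \<alpha>)" "\<alpha> \<in> Cell2 L \<Longrightarrow> tgt1 L (src2 L \<alpha>) = tgt1 L (tgt2 L \<alpha>)"
  "\<alpha> \<in> Cell2 L \<Longrightarrow> F2 U \<alpha> \<in> Cell2 K"
  "\<alpha> \<in> Cell2 L \<Longrightarrow> src2 K (F2 U \<alpha>) = F1 U (src2 L \<alpha>)" "\<alpha> \<in> Cell2 L \<Longrightarrow> tgt2 K (F2 U \<alpha>) = F1 U (tgt2 L \<alpha>)"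
  using U0 cell1 cell2 by auto

lemma simps1 [simp]:
  assumes "x \<in> Cell0 L"
  shows "one1 L x \<in> Cell1 L" "src1 L (one1 L x) = x" "tgt1 L (one1 L x) = x" "F1 U (one1 L x) = one1 K (F0 U x)"
  using one1[OF assms] by auto

lemma simps2 [simp]:
  assumes "f \<in> Cell1 L"
  shows "one2 L f \<in> Cell2 L" "src2 L (one2 L f) = f" "tgt2 L (one2 L f) = f" "F2 U (one2 L f) = one2 K (F1 U f)"
  using one2[OF assms] by auto

lemma simps3 [simp]:
  assumes "f \<in> Cell1 L" "g \<in> Cell1 L" "tgt1 L f = src1 L g"
  shows "g \<odot>\<^bsub>L\<^esub> f \<in> Cell1 L" "src1 L (g \<odot>\<^bsub>L\<^esub> f) = src1 L f" "tgt1 L (g \<odot>\<^bsub>L\<^esub> f) = tgt1 L g"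
    "F1 U (g \<odot>\<^bsub>L\<^esub> f) = F1 U g \<odot>\<^bsub>K\<^esub> F1 U f"
  using comp1[OF assms] by auto

lemma simps4 [simp]:
  assumes "\<alpha> \<in> Cell2 L" "\<beta> \<in> Cell2 L" "tgt2 L \<alpha> = src2 L \<beta>"
  shows "\<beta> \<bullet>\<^bsub>L\<^esub> \<alpha> \<in> Cell2 L" "src2 L (\<beta> \<bullet>\<^bsub>L\<^esub> \<alpha>) = src2 L \<alpha>" "tgt2 L (\<beta> \<bullet>\<^bsub>L\<^esub> \<alpha>) = tgt2 L \<beta>"
    "F2 U (\<beta> \<bullet>\<^bsub>L\<^esub> \<alpha>) = F2 U \<beta> \<bullet>\<^bsub>K\<^esub> F2 U \<alpha>"
  using vcomp[OF assms] by auto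

lemma simps5 [simp]:
  assumes "\<alpha> \<in> Cell2 L" "\<beta> \<in> Cell2 L" "tgt1 L (src2 L \<alpha>) = src1 L (src2 L \<beta>)"
  shows "\<beta> \<star>\<^bsub>L\<^esub> \<alpha> \<in> Cell2 L" "src2 L (\<beta> \<star>\<^bsub>L\<^esub> \<alpha>) = src2 L \<beta> \<odot>\<^bsub>L\<^esub> src2 L \<alpha>"
    "tgt2 L (\<beta> \<star>\<^bsub>L\<^esub> \<alpha>) = tgt2 L \<beta> \<odot>\<^bsub>L\<^esub> tgt2 L \<alpha>" "F2 U (\<beta> \<star>\<^bsub>L\<^esub> \<alpha>) = F2 U \<beta> \<star>\<^bsub>K\<^esub> F2 U \<alpha>"
  using hcomp[OF assms] by auto

text \<open>These come first because the two sides of the corresponding laws for horizontal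
  composition are parallel only by virtue of the laws for 1-cells.\<close>

lemma comp1_laws:
  "f \<in> Cell1 L \<Longrightarrow> f \<odot>\<^bsub>L\<^esub> one1 L (src1 L f) = f" "f \<in> Cell1 L \<Longrightarrow> one1 L (tgt1 L f) \<odot>\<^bsub>L\<^esub> f = f"
  "\<lbrakk>f \<in> Cell1 L; g \<in> Cell1 L; h \<in> Cell1 L; tgt1 L f = src1 L g; tgt1 L g = src1 L h\<rbrakk> \<Longrightarrow>
    h \<odot>\<^bsub>L\<^esub> (g \<odot>\<^bsub>L\<^esub> f) = (h \<odot>\<^bsub>L\<^esub> g) \<odot>\<^bsub>L\<^esub> f"
  subgoal by (rule faithful1) (use K.comp1_one_right[of "F1 U f"] in simp_all)
  subgoal by (rule faithful1) (use K.comp1_one_left[of "F1 U f"] in simp_all)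
  subgoal by (rule faithful1) (simp_all add: K.comp1_assoc)
  done

lemma two_category: "two_category L"
proof
  fix \<alpha> assume a: "\<alpha> \<in> Cell2 L"
  show "\<alpha> \<bullet>\<^bsub>L\<^esub> one2 L (src2 L \<alpha>) = \<alpha>"
    by (rule faithful2) (use a K.vcomp_one_right[of "F2 U \<alpha>"] in simp_all)
  show "one2 L (tgt2 L \<alpha>) \<bullet>\<^bsub>L\<^esub> \<alpha> = \<alpha>"
    by (rule faithful2) (use a K.vcomp_one_left[of "F2 U \<alpha>"] in simp_all)
  show "\<alpha> \<star>\<^bsub>L\<^esub> one2 L (one1 L (src1 L (src2 L \<alpha>))) = \<alpha>"
    by (rule faithful2)
      (use a K.hcomp_one_right[of "F2 U \<alpha>"] comp1_laws(1)[of "src2 L \<alpha>"] comp1_laws(1)[of "tgt2 L \<alpha>"] in simp_all)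
  show "one2 L (one1 L (tgt1 L (src2 L \<alpha>))) \<star>\<^bsub>L\<^esub> \<alpha> = \<alpha>"
    by (rule faithful2)
      (use a K.hcomp_one_left[of "F2 U \<alpha>"] comp1_laws(2)[of "src2 L \<alpha>"] comp1_laws(2)[of "tgt2 L \<alpha>"] in simp_all)
next
  fix f g assume "f \<in> Cell1 L" "g \<in> Cell1 L" "tgt1 L f = src1 L g"
  then show "one2 L g \<star>\<^bsub>L\<^esub> one2 L f = one2 L (g \<odot>\<^bsub>L\<^esub> f)"
    by (intro faithful2) (simp_all add: K.hcomp_one2)
next
  fix \<alpha> \<beta> \<gamma> assume h: "\<alpha> \<in> Cell2 L" "\<beta> \<in> Cell2 L" "\<gamma> \<in> Cell2 L" "tgt2 L \<alpha> = src2 L \<beta>" "tgt2 L \<beta> = src2 L \<gamma>"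
  show "\<gamma> \<bullet>\<^bsub>L\<^esub> (\<beta> \<bullet>\<^bsub>L\<^esub> \<alpha>) = (\<gamma> \<bullet>\<^bsub>L\<^esub> \<beta>) \<bullet>\<^bsub>L\<^esub> \<alpha>"
    by (rule faithful2) (use h K.vcomp_assoc[of "F2 U \<alpha>" "F2 U \<beta>" "F2 U \<gamma>"] in simp_all)
next
  fix \<alpha> \<beta> \<gamma> assume h: "\<alpha> \<in> Cell2 L" "\<beta> \<in> Cell2 L" "\<gamma> \<in> Cell2 L"
    "tgt1 L (src2 L \<alpha>) = src1 L (src2 L \<beta>)" "tgt1 L (src2 L \<beta>) = src1 L (src2 L \<gamma>)"
  show "\<gamma> \<star>\<^bsub>L\<^esub> (\<beta> \<star>\<^bsub>L\<^esub> \<alpha>) = (\<gamma> \<star>\<^bsub>L\<^esub> \<beta>) \<star>\<^bsub>L\<^esub> \<alpha>"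
    by (rule faithful2) (use h K.hcomp_assoc[of "F2 U \<alpha>" "F2 U \<beta>" "F2 U \<gamma>"] in \<open>simp_all add: comp1_laws(3)\<close>)
next
  fix \<alpha> \<alpha>' \<beta> \<beta>' assume h: "\<alpha> \<in> Cell2 L" "\<alpha>' \<in> Cell2 L" "\<beta> \<in> Cell2 L" "\<beta>' \<in> Cell2 L"
    "tgt2 L \<alpha> = src2 L \<alpha>'" "tgt2 L \<beta> = src2 L \<beta>'" "tgt1 L (src2 L \<alpha>) = src1 L (src2 L \<beta>)"
  show "(\<beta>' \<bullet>\<^bsub>L\<^esub> \<beta>) \<star>\<^bsub>L\<^esub> (\<alpha>' \<bullet>\<^bsub>L\<^esub> \<alpha>) = (\<beta>' \<star>\<^bsub>L\<^esub> \<alpha>') \<bullet>\<^bsub>L\<^esub> (\<beta> \<star>\<^bsub>L\<^esub> \<alpha>)"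
    by (rule faithful2)
      (use h K.interchange[of "F2 U \<alpha>" "F2 U \<alpha>'" "F2 U \<beta>" "F2 U \<beta>'"] in simp_all)
qed (simp_all add: comp1_laws)

end

text \<open>Only boundaries and compatibility with the projections to K are recorded. Compatibility
  with identities and compositions follows from faithfulness of the target.\<close>

definition over_map where
  "over_map L U L' U' \<Phi> \<longleftrightarrow>
    (\<forall>x \<in> Cell0 L. F0 \<Phi> x \<in> Cell0 L' \<and> F0 U' (F0 \<Phi> x) = F0 U x) \<and>
    (\<forall>f \<in> Cell1 L. F1 \<Phi> f \<in> hom1 L' (F0 \<Phi> (src1 L f)) (F0 \<Phi> (tgt1 L f)) \<and> F1 U' (F1 \<Phi> f) = F1 U f) \<and>
    (\<forall>\<alpha> \<in> Cell2 L. F2 \<Phi> \<alpha> \<in> hom2 L' (F1 \<Phi> (src2 L \<alpha>)) (F1 \<Phi> (tgt2 L \<alpha>)) \<and> F2 U' (F2 \<Phi> \<alpha>) = F2 U \<alpha>)"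

lemma over_map_two_functor:
  fixes \<Phi> :: "('o, 'm, 'c, 'p, 'n, 'd) two_fun"
  assumes "two_cat_over K L U" "two_cat_over K L' U'" and o: "over_map L U L' U' \<Phi>"
  shows "two_functor L L' \<Phi>"
proof -
  interpret L: two_cat_over K L U by fact
  interpret L': two_cat_over K L' U' by fact
  interpret C: two_category L by (rule L.two_category)
  interpret C': two_category L' by (rule L'.two_category)
  have 0: "F0 \<Phi> x \<in> Cell0 L'" "F0 U' (F0 \<Phi> x) = F0 U x" if "x \<in> Cell0 L" for x
    using o that unfolding over_map_def by blast+
  have 1: "F1 \<Phi> f \<in> Cell1 L'" "src1 L' (F1 \<Phi> f) = F0 \<Phi> (src1 L f)" "tgt1 L' (F1 \<Phi> f) = F0 \<Phi> (tgt1 L f)" "F1 U' (F1 \<Phi> f) = F1 U f"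
    if "f \<in> Cell1 L" for f
    using o that unfolding over_map_def in_hom1 by blast+
  have 2: "F2 \<Phi> f \<in> Cell2 L'" "src2 L' (F2 \<Phi> f) = F1 \<Phi> (src2 L f)" "tgt2 L' (F2 \<Phi> f) = F1 \<Phi> (tgt2 L f)" "F2 U' (F2 \<Phi> f) = F2 U f"
    if "f \<in> Cell2 L" for f
    using o that unfolding over_map_def in_hom2 by blast+
  note [simp] = 0 1 2
  have c1: "F1 \<Phi> (g \<odot>\<^bsub>L\<^esub> f) = F1 \<Phi> g \<odot>\<^bsub>L'\<^esub> F1 \<Phi> f" if "f \<in> Cell1 L" "g \<in> Cell1 L" "tgt1 L f = src1 L g" for f g
    by (rule L'.faithful1) (use that in simp_all)
  show ?thesis
  proof
    fix x assume "x \<in> Cell0 L"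
    then show "F1 \<Phi> (one1 L x) = one1 L' (F0 \<Phi> x)" by (intro L'.faithful1) simp_all
  next
    fix f assume "f \<in> Cell1 L"
    then show "F2 \<Phi> (one2 L f) = one2 L' (F1 \<Phi> f)" by (intro L'.faithful2) simp_all
  next
    fix \<alpha> \<beta> assume h: "\<alpha> \<in> Cell2 L" "\<beta> \<in> Cell2 L" "tgt2 L \<alpha> = src2 L \<beta>"
    show "F2 \<Phi> (\<beta> \<bullet>\<^bsub>L\<^esub> \<alpha>) = F2 \<Phi> \<beta> \<bullet>\<^bsub>L'\<^esub> F2 \<Phi> \<alpha>" by (rule L'.faithful2) (use h in simp_all)
  next
    fix \<alpha> \<beta> assume h: "\<alpha> \<in> Cell2 L" "\<beta> \<in> Cell2 L" "tgt1 L (src2 L \<alpha>) = src1 L (src2 L \<beta>)"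
    show "F2 \<Phi> (\<beta> \<star>\<^bsub>L\<^esub> \<alpha>) = F2 \<Phi> \<beta> \<star>\<^bsub>L'\<^esub> F2 \<Phi> \<alpha>" by (rule L'.faithful2) (use h in \<open>simp_all add: c1\<close>)
  qed (simp_all add: c1)
qed

text \<open>Once the round trip is the identity on objects, the round trip of a 1-cell is parallel
  to it and has the same image in K, hence is equal to it; the same reasoning then applies one
  dimension higher.\<close>

lemma over_map_inverse:
  assumes "two_cat_over K L U" and o: "over_map L U L' U' \<Phi>" and p: "over_map L' U' L U \<Psi>"
    and inv: "\<And>x. x \<in> Cell0 L \<Longrightarrow> F0 \<Psi> (F0 \<Phi> x) = x"
  shows "f \<in> Cell1 L \<Longrightarrow> F1 \<Psi> (F1 \<Phi> f) = f" "\<alpha> \<in> Cell2 L \<Longrightarrow> F2 \<Psi> (F2 \<Phi> \<alpha>) = \<alpha>"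
proof -
  interpret L: two_cat_over K L U by fact
  have 1: "F1 \<Phi> f \<in> Cell1 L'" "src1 L' (F1 \<Phi> f) = F0 \<Phi> (src1 L f)" "tgt1 L' (F1 \<Phi> f) = F0 \<Phi> (tgt1 L f)" "F1 U' (F1 \<Phi> f) = F1 U f"
    if "f \<in> Cell1 L" for f
    using o that unfolding over_map_def in_hom1 by blast+
  have 2: "F2 \<Phi> f \<in> Cell2 L'" "src2 L' (F2 \<Phi> f) = F1 \<Phi> (src2 L f)" "tgt2 L' (F2 \<Phi> f) = F1 \<Phi> (tgt2 L f)" "F2 U' (F2 \<Phi> f) = F2 U f"
    if "f \<in> Cell2 L" for f
    using o that unfolding over_map_def in_hom2 by blast+
  have 3: "F1 \<Psi> f \<in> Cell1 L" "src1 L (F1 \<Psi> f) = F0 \<Psi> (src1 L' f)" "tgt1 L (F1 \<Psi> f) = F0 \<Psi> (tgt1 L' f)" "F1 U (F1 \<Psi> f) = F1 U' f"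
    if "f \<in> Cell1 L'" for f
    using p that unfolding over_map_def in_hom1 by blast+
  have 4: "F2 \<Psi> f \<in> Cell2 L" "src2 L (F2 \<Psi> f) = F1 \<Psi> (src2 L' f)" "tgt2 L (F2 \<Psi> f) = F1 \<Psi> (tgt2 L' f)" "F2 U (F2 \<Psi> f) = F2 U' f"
    if "f \<in> Cell2 L'" for f
    using p that unfolding over_map_def in_hom2 by blast+
  show r: "F1 \<Psi> (F1 \<Phi> f) = f" if "f \<in> Cell1 L" for f
    by (rule L.faithful1) (use that in \<open>simp_all add: 1 3 inv\<close>)
  show "F2 \<Psi> (F2 \<Phi> \<alpha>) = \<alpha>" if "\<alpha> \<in> Cell2 L"
    by (rule L.faithful2) (use that in \<open>simp_all add: 2 4 r\<close>)
qed

lemma two_isomorphism_over: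
  fixes \<Phi> :: "('o, 'm, 'c, 'p, 'n, 'd) two_fun" and \<Psi> :: "('p, 'n, 'd, 'o, 'm, 'c) two_fun"
  assumes L: "two_cat_over K L U" and L': "two_cat_over K L' U'"
    and o: "over_map L U L' U' \<Phi>" and p: "over_map L' U' L U \<Psi>"
    and inv: "\<And>x. x \<in> Cell0 L \<Longrightarrow> F0 \<Psi> (F0 \<Phi> x) = x" "\<And>y. y \<in> Cell0 L' \<Longrightarrow> F0 \<Phi> (F0 \<Psi> y) = y"
  shows "two_isomorphism L L' \<Phi>"
  unfolding two_isomorphism_def
  using over_map_two_functor[OF L L' o] over_map_two_functor[OF L' L p]
    over_map_inverse[OF L o p inv(1)] over_map_inverse[OF L' p o inv(2)] inv
  by (intro conjI exI[of _ \<Psi>]) blast+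

section \<open>The isomorphism\<close>

declare arrow_two_cat_sel [simp del]

context comma_ambient
begin

lemma normally_clovenE:
  fixes X :: "'a univ cofib"
  assumes "normally_cloven \<kappa> X"
  obtains P E B \<delta> where "X = \<lparr>cf_fun = P, cf_lift = \<delta>\<rparr>" "cloven_ambient P E B \<delta> \<kappa>"
proof -
  obtain P \<delta> where X: "X = \<lparr>cf_fun = P, cf_lift = \<delta>\<rparr>" by (cases X)
  have "cloven_ambient P (FDom P) (FCod P) \<delta> \<kappa>"
    using assms comma_ambient_axioms
    by (simp add: X normally_cloven_def arrow_two_cat_sel Cell1_CAT cloven_ambient_def cloven_def
        cloven_axioms_def cloven_ambient_axioms_def comma_cat2_def comma_cat_def)
  with X show thesis by (rule that)
qed

lemma normally_clovenI: "cloven_ambient P E B \<delta> \<kappa> \<Longrightarrow> normally_cloven \<kappa> \<lparr>cf_fun = P, cf_lift = \<delta>\<rparr>"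
proof -
  assume "cloven_ambient P E B \<delta> \<kappa>"
  then interpret cloven_ambient P E B \<delta> \<kappa> .
  show ?thesis using P_cell cleavage by (simp add: normally_cloven_def)
qed

lemma assoc_normal: "normally_cloven \<kappa> X \<Longrightarrow> normal_pseudoalgebra (CAT\<^sub>2 \<kappa>) CC (assoc_pseudoalgebra \<kappa> X)"
  for X :: "'a univ cofib"
  by (erule normally_clovenE) (simp add: cloven_ambient.assoc_eq cloven_ambient.alg_normal)

lemma pa_obj_assoc: "pa_obj (assoc_pseudoalgebra \<kappa> X) = cf_fun X"
  by (simp add: assoc_pseudoalgebra_def)

text \<open>Injectivity of the object map: the underlying functor is the carrier of the algebra, the
  lifts are values of the action by \<open>L_vertical_part\<close>, and off the liftable pairs both
  cleavages are \<open>undefined\<close>.\<close>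

lemma assoc_inj:
  fixes X Y :: "'a univ cofib"
  assumes "normally_cloven \<kappa> X" "normally_cloven \<kappa> Y" "assoc_pseudoalgebra \<kappa> X = assoc_pseudoalgebra \<kappa> Y"
  shows "X = Y"
proof -
  obtain P E B \<delta> where X: "X = \<lparr>cf_fun = P, cf_lift = \<delta>\<rparr>" "cloven_ambient P E B \<delta> \<kappa>"
    by (rule normally_clovenE[OF assms(1)])
  obtain Q F C \<epsilon> where Y: "Y = \<lparr>cf_fun = Q, cf_lift = \<epsilon>\<rparr>" "cloven_ambient Q F C \<epsilon> \<kappa>"
    by (rule normally_clovenE[OF assms(2)])
  interpret X: cloven_ambient P E B \<delta> \<kappa> by (rule X(2))
  have "cf_fun X = cf_fun Y" using arg_cong[OF assms(3), of pa_obj] by (simp add: pa_obj_assoc)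
  then have PQ: "Q = P" using X Y by simp
  then have FC: "F = E" "C = B"
    using Y(2) X.FDom_eq X.FCod_eq
    by (auto simp: cloven_ambient_def cloven_def comma_cat2_def comma_cat_def cat_functor_def)
  interpret Y: cloven_ambient P E B \<epsilon> \<kappa> using Y(2) unfolding PQ FC .
  have "X.a.sq = Y.a.sq"
    using arg_cong[OF assms(3), of pa_act] unfolding X(1) Y(1) PQ X.assoc_eq Y.assoc_eq by simp
  then have LL: "X.L = Y.L" by simp
  have "\<delta> x u = \<epsilon> x u" for x u
  proof (cases "liftable P x u")
    case True
    then have x: "x \<in> Obj E" "u \<in> Arr B" "Dom B u = FOb P x" by (simp_all add: liftable_def)
    show ?thesis using X.L_vertical_part[OF x] Y.L_vertical_part[OF x] unfolding LL by simp
  next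
    case False
    then show ?thesis using X.cleavage Y.cleavage by (simp add: normal_cleavage_def)
  qed
  then show ?thesis using X(1) Y(1) PQ by (auto intro!: ext)
qed

lemma cloven_squareE:
  fixes X Y :: "'a univ cofib"
  assumes "normally_cloven \<kappa> X" "normally_cloven \<kappa> Y" "s \<in> hom1 (CAT\<^sub>2 \<kappa>) (cf_fun X) (cf_fun Y)"
  obtains P E B \<delta> Q F C \<epsilon> T S where "X = \<lparr>cf_fun = P, cf_lift = \<delta>\<rparr>" "Y = \<lparr>cf_fun = Q, cf_lift = \<epsilon>\<rparr>"
    "s = \<lparr>sq_src = P, sq_tgt = Q, sq_total = T, sq_base = S\<rparr>" "cloven_square P E B \<delta> \<kappa> Q F C \<epsilon> T S"
proof -
  obtain P E B \<delta> where X: "X = \<lparr>cf_fun = P, cf_lift = \<delta>\<rparr>" "cloven_ambient P E B \<delta> \<kappa>"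
    by (rule normally_clovenE[OF assms(1)])
  obtain Q F C \<epsilon> where Y: "Y = \<lparr>cf_fun = Q, cf_lift = \<epsilon>\<rparr>" "cloven_ambient Q F C \<epsilon> \<kappa>"
    by (rule normally_clovenE[OF assms(2)])
  interpret X: cloven_ambient P E B \<delta> \<kappa> by (rule X(2))
  interpret Y: cloven_ambient Q F C \<epsilon> \<kappa> by (rule Y(2))
  have s1: "s \<in> Cell1 (CAT\<^sub>2 \<kappa>)" "sq_src s = P" "sq_tgt s = Q"
    using assms(3) X(1) Y(1) by (simp_all add: arrow_two_cat_sel)
  obtain Q' F' C' T S where s: "s = \<lparr>sq_src = P, sq_tgt = Q', sq_total = T, sq_base = S\<rparr>" "cat_square P E B Q' F' C' T S"
    by (rule Cell1_CAT2_E'[OF s1(1,2) X.cat_functor_axioms])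
  have Q: "Q' = Q" using s(1) s1(3) by simp
  then have FC: "F' = F" "C' = C" using s(2) Y.FDom_eq Y.FCod_eq by (auto simp: cat_square_def cat_functor_def)
  have "comma_square P E B Q F C T S" using s(2) unfolding Q FC by (simp add: comma_square_def)
  then have "cloven_square P E B \<delta> \<kappa> Q F C \<epsilon> T S"
    using X(2) Y(2) by (simp add: cloven_square_def)
  with X(1) Y(1) s(1) Q show thesis using that by simp
qed

text \<open>Says that n is a pseudomorphism structure on the square s, indexed by the cofibrations
  instead of their algebras. This keeps the cleavages at hand when such structures are compared or
  composed.\<close>

definition is_psm where
  "is_psm X Y s n \<longleftrightarrow> pseudomorphism (CAT\<^sub>2 \<kappa>) CC n \<and> pm_src n = assoc_pseudoalgebra \<kappa> X \<and>
    pm_tgt n = assoc_pseudoalgebra \<kappa> Y \<and> pm_map n = s"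

lemma is_psm_hom1:
  fixes X Y :: "'a univ cofib"
  assumes "is_psm X Y s n" shows "s \<in> hom1 (CAT\<^sub>2 \<kappa>) (cf_fun X) (cf_fun Y)"
  using assms unfolding is_psm_def pseudomorphism_def Let_def by (metis pa_obj_assoc)

lemma is_psmE:
  fixes X Y :: "'a univ cofib"
  assumes X: "normally_cloven \<kappa> X" and Y: "normally_cloven \<kappa> Y" and n: "is_psm X Y s n"
  obtains P E B \<delta> Q F C \<epsilon> T S \<phi> where "X = \<lparr>cf_fun = P, cf_lift = \<delta>\<rparr>" "Y = \<lparr>cf_fun = Q, cf_lift = \<epsilon>\<rparr>"
    "s = \<lparr>sq_src = P, sq_tgt = Q, sq_total = T, sq_base = S\<rparr>" "comparison P E B \<delta> \<kappa> Q F C \<epsilon> T S \<phi>"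
    "pm_cell n = \<lparr>sc_src = cod_fun P, sc_tgt = Q, sc_total = \<phi>, sc_base = one2 (CAT \<kappa>) S\<rparr>"
proof -
  obtain P E B \<delta> Q F C \<epsilon> T S where s: "X = \<lparr>cf_fun = P, cf_lift = \<delta>\<rparr>" "Y = \<lparr>cf_fun = Q, cf_lift = \<epsilon>\<rparr>"
    "s = \<lparr>sq_src = P, sq_tgt = Q, sq_total = T, sq_base = S\<rparr>" "cloven_square P E B \<delta> \<kappa> Q F C \<epsilon> T S"
    by (rule cloven_squareE[OF X Y is_psm_hom1[OF n]])
  interpret s: cloven_square P E B \<delta> \<kappa> Q F C \<epsilon> T S by (rule s(4))
  note n' = n[unfolded is_psm_def s(1,2,3) s.X.assoc_eq s.Y.assoc_eq]
  obtain \<phi> where "comparison P E B \<delta> \<kappa> Q F C \<epsilon> T S \<phi>"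
    "pm_cell n = \<lparr>sc_src = cod_fun P, sc_tgt = Q, sc_total = \<phi>, sc_base = one2 (CAT \<kappa>) S\<rparr>"
    by (rule s.comparison_of_pseudomorphism[of n]) (use n' in blast)+
  with s(1-3) show thesis by (rule that)
qed

lemma is_psm_preserves:
  fixes X Y :: "'a univ cofib"
  assumes "normally_cloven \<kappa> X" "normally_cloven \<kappa> Y" "is_psm X Y s n"
  shows "preserves_cocartesian s"
  by (rule is_psmE[OF assms]) (simp add: comparison.preserves)

lemma is_psm_strict:
  fixes X Y :: "'a univ cofib"
  assumes "normally_cloven \<kappa> X" "normally_cloven \<kappa> Y" "is_psm X Y s n"
  shows "strict_morphism (CAT\<^sub>2 \<kappa>) CC n \<longleftrightarrow> preserves_lifts X Y s"
proof -
  have "is_identity2 (CAT\<^sub>2 \<kappa>) (pm_cell n) \<longleftrightarrow> preserves_lifts X Y s"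
    by (rule is_psmE[OF assms]) (simp add: comparison.identity_iff)
  then show ?thesis using assms(3) by (simp add: strict_morphism_def is_psm_def)
qed

lemma is_psm_unique:
  fixes X Y :: "'a univ cofib"
  assumes X: "normally_cloven \<kappa> X" and Y: "normally_cloven \<kappa> Y" and n: "is_psm X Y s n" and m: "is_psm X Y s m"
  shows "m = n"
proof -
  obtain P E B \<delta> Q F C \<epsilon> T S \<phi> where s: "X = \<lparr>cf_fun = P, cf_lift = \<delta>\<rparr>" "Y = \<lparr>cf_fun = Q, cf_lift = \<epsilon>\<rparr>"
    "s = \<lparr>sq_src = P, sq_tgt = Q, sq_total = T, sq_base = S\<rparr>" "comparison P E B \<delta> \<kappa> Q F C \<epsilon> T S \<phi>"
    "pm_cell n = \<lparr>sc_src = cod_fun P, sc_tgt = Q, sc_total = \<phi>, sc_base = one2 (CAT \<kappa>) S\<rparr>"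
    by (rule is_psmE[OF X Y n])
  interpret s: comparison P E B \<delta> \<kappa> Q F C \<epsilon> T S \<phi> by (rule s(4))
  note m' = m[unfolded is_psm_def s(1,2,3) s.X.assoc_eq s.Y.assoc_eq]
  obtain \<psi> where p: "comparison P E B \<delta> \<kappa> Q F C \<epsilon> T S \<psi>"
    "pm_cell m = \<lparr>sc_src = cod_fun P, sc_tgt = Q, sc_total = \<psi>, sc_base = one2 (CAT \<kappa>) S\<rparr>"
    by (rule s.comparison_of_pseudomorphism[of m]) (use m' in blast)+
  have "pm_cell m = pm_cell n" unfolding p(2) s(5) s.phi_determined[OF p(1)] ..
  then show ?thesis using n m by (intro psmor.equality) (simp_all add: is_psm_def)
qed

lemma is_psm_exists:
  fixes X Y :: "'a univ cofib"
  assumes X: "normally_cloven \<kappa> X" and Y: "normally_cloven \<kappa> Y" and s: "s \<in> hom1 (CAT\<^sub>2 \<kappa>) (cf_fun X) (cf_fun Y)"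
    and p: "preserves_cocartesian s"
  obtains n where "is_psm X Y s n"
proof -
  obtain P E B \<delta> Q F C \<epsilon> T S where s: "X = \<lparr>cf_fun = P, cf_lift = \<delta>\<rparr>" "Y = \<lparr>cf_fun = Q, cf_lift = \<epsilon>\<rparr>"
    "s = \<lparr>sq_src = P, sq_tgt = Q, sq_total = T, sq_base = S\<rparr>" "cloven_square P E B \<delta> \<kappa> Q F C \<epsilon> T S"
    by (rule cloven_squareE[OF X Y s])
  interpret s: cloven_square P E B \<delta> \<kappa> Q F C \<epsilon> T S by (rule s(4))
  obtain \<phi> where "comparison P E B \<delta> \<kappa> Q F C \<epsilon> T S \<phi>" by (rule s.comparison_exists[OF p[unfolded s(3)]])
  then interpret c: comparison P E B \<delta> \<kappa> Q F C \<epsilon> T S \<phi> .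
  have "is_psm X Y s \<lparr>pm_src = s.X.alg, pm_tgt = s.Y.alg, pm_map = s.s.sq, pm_cell = c.phi_cell\<rparr>"
    unfolding is_psm_def s(1,2,3) s.X.assoc_eq s.Y.assoc_eq using c.pseudomorphism_phi by simp
  then show thesis by (rule that)
qed

lemma is_psm_algtr:
  fixes X Y :: "'a univ cofib"
  assumes X: "normally_cloven \<kappa> X" and Y: "normally_cloven \<kappa> Y" and m: "is_psm X Y s m" and n: "is_psm X Y t n"
    and th: "\<theta> \<in> hom2 (CAT\<^sub>2 \<kappa>) s t"
  shows "algebra_transformation (CAT\<^sub>2 \<kappa>) CC \<lparr>at_src = m, at_tgt = n, at_cell = \<theta>\<rparr>"
proof -
  obtain P E B \<delta> Q F C \<epsilon> T S \<phi> where s: "X = \<lparr>cf_fun = P, cf_lift = \<delta>\<rparr>" "Y = \<lparr>cf_fun = Q, cf_lift = \<epsilon>\<rparr>"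
    "s = \<lparr>sq_src = P, sq_tgt = Q, sq_total = T, sq_base = S\<rparr>" "comparison P E B \<delta> \<kappa> Q F C \<epsilon> T S \<phi>"
    "pm_cell m = \<lparr>sc_src = cod_fun P, sc_tgt = Q, sc_total = \<phi>, sc_base = one2 (CAT \<kappa>) S\<rparr>"
    by (rule is_psmE[OF X Y m])
  interpret s: comparison P E B \<delta> \<kappa> Q F C \<epsilon> T S \<phi> by (rule s(4))
  have th': "\<theta> \<in> Cell2 (CAT\<^sub>2 \<kappa>)" "sqcell_src (CAT \<kappa>) \<theta> = \<lparr>sq_src = P, sq_tgt = Q, sq_total = T, sq_base = S\<rparr>"
    "sqcell_tgt (CAT \<kappa>) \<theta> = t"
    using th unfolding in_hom2 arrow_two_cat_sel s(3) by blast+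
  obtain \<beta> T' \<alpha> S' where e: "\<theta> = \<lparr>sc_src = P, sc_tgt = Q, sc_total = \<beta>, sc_base = \<alpha>\<rparr>"
    "cat_sqcell P E B Q F C \<beta> T T' \<alpha> S S'"
    by (rule Cell2_CAT2_E2[OF th'(1) s.s.cat_square_axioms th'(2)])
  interpret e: cat_sqcell P E B Q F C \<beta> T T' \<alpha> S S' by (rule e(2))
  have t: "t = \<lparr>sq_src = P, sq_tgt = Q, sq_total = T', sq_base = S'\<rparr>"
    using th'(3) by (simp add: e(1) sqcell_tgt_def)
  have "comma_square P E B Q F C T' S'" using e.t.cat_square_axioms by (simp add: comma_square_def)
  then interpret t: cloven_square P E B \<delta> \<kappa> Q F C \<epsilon> T' S'
    using s.cloven_square_axioms by (simp add: cloven_square_def)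
  note n' = n[unfolded is_psm_def s(1,2) t s.X.assoc_eq s.Y.assoc_eq]
  obtain \<psi> where p: "comparison P E B \<delta> \<kappa> Q F C \<epsilon> T' S' \<psi>"
    "pm_cell n = \<lparr>sc_src = cod_fun P, sc_tgt = Q, sc_total = \<psi>, sc_base = one2 (CAT \<kappa>) S'\<rparr>"
    by (rule t.comparison_of_pseudomorphism[of n]) (use n' in blast)+
  show ?thesis
    unfolding e(1)
    by (rule algebra_transformation_comparison[OF s(4) p(1) e(2)])
      (use m n s p t in \<open>auto simp: is_psm_def\<close>)
qed

lemma preserves_cocartesian_one: "P \<in> Cell1 (CAT \<kappa>) \<Longrightarrow> preserves_cocartesian (one1 (CAT\<^sub>2 \<kappa>) P)"
  by (auto simp: preserves_cocartesian_def cocartesian_def)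

lemma preserves_cocartesian_comp:
  assumes s: "s \<in> Cell1 (CAT\<^sub>2 \<kappa>)" and st: "sq_tgt s = sq_src t"
    and ps: "preserves_cocartesian s" and pt: "preserves_cocartesian t"
  shows "preserves_cocartesian (t \<odot>\<^bsub>CAT\<^sub>2 \<kappa>\<^esub> s)"
proof -
  obtain P E B Q F C T S where e: "s = \<lparr>sq_src = P, sq_tgt = Q, sq_total = T, sq_base = S\<rparr>" "cat_square P E B Q F C T S"
    by (rule Cell1_CAT2_E[OF s])
  interpret cat_square P E B Q F C T S by (rule e(2))
  show ?thesis
    unfolding preserves_cocartesian_def
  proof (intro allI impI)
    fix a assume "cocartesian (sq_src (t \<odot>\<^bsub>CAT\<^sub>2 \<kappa>\<^esub> s)) a"
    then have a: "cocartesian P a" by (simp add: e(1))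
    then have "a \<in> Arr E" by (rule P.cocartesian_Arr)
    moreover have "cocartesian (sq_src t) (FAr T a)"
      using ps a st by (simp add: preserves_cocartesian_def e(1))
    then have "cocartesian (sq_tgt t) (FAr (sq_total t) (FAr T a))"
      using pt by (simp add: preserves_cocartesian_def)
    ultimately show "cocartesian (sq_tgt (t \<odot>\<^bsub>CAT\<^sub>2 \<kappa>\<^esub> s)) (FAr (sq_total (t \<odot>\<^bsub>CAT\<^sub>2 \<kappa>\<^esub> s)) a)"
      by (simp add: e(1))
  qed
qed

text \<open>The content of \<open>is_psmE\<close> with projections in place of new names, so that
  facts about several pseudomorphisms with a common middle object fit together without matching
  variables.\<close>

lemma is_psm_comparison:
  fixes X Y :: "'a univ cofib"
  assumes "normally_cloven \<kappa> X" "normally_cloven \<kappa> Y" "is_psm X Y s n"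
  shows "comparison (cf_fun X) (FDom (cf_fun X)) (FCod (cf_fun X)) (cf_lift X) \<kappa>
      (cf_fun Y) (FDom (cf_fun Y)) (FCod (cf_fun Y)) (cf_lift Y) (sq_total s) (sq_base s) (sc_total (pm_cell n))"
    and "pm_cell n = \<lparr>sc_src = cod_fun (cf_fun X), sc_tgt = cf_fun Y, sc_total = sc_total (pm_cell n),
      sc_base = one2 (CAT \<kappa>) (sq_base s)\<rparr>"
    and "s = \<lparr>sq_src = cf_fun X, sq_tgt = cf_fun Y, sq_total = sq_total s, sq_base = sq_base s\<rparr>"
proof -
  obtain P E B \<delta> Q F C \<epsilon> T S \<phi> where s: "X = \<lparr>cf_fun = P, cf_lift = \<delta>\<rparr>" "Y = \<lparr>cf_fun = Q, cf_lift = \<epsilon>\<rparr>"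
    "s = \<lparr>sq_src = P, sq_tgt = Q, sq_total = T, sq_base = S\<rparr>" "comparison P E B \<delta> \<kappa> Q F C \<epsilon> T S \<phi>"
    "pm_cell n = \<lparr>sc_src = cod_fun P, sc_tgt = Q, sc_total = \<phi>, sc_base = one2 (CAT \<kappa>) S\<rparr>"
    by (rule is_psmE[OF assms])
  interpret c: comparison P E B \<delta> \<kappa> Q F C \<epsilon> T S \<phi> by (rule s(4))
  show "comparison (cf_fun X) (FDom (cf_fun X)) (FCod (cf_fun X)) (cf_lift X) \<kappa>
      (cf_fun Y) (FDom (cf_fun Y)) (FCod (cf_fun Y)) (cf_lift Y) (sq_total s) (sq_base s) (sc_total (pm_cell n))"
    using c.comparison_axioms by (simp add: s(1-3,5))
qed (use is_psmE[OF assms] in force)+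

text \<open>For the identity square both boundary functors reduce to L, and the identity
  transformation of L satisfies the conditions of a comparison.\<close>

lemma is_psm_one:
  fixes X :: "'a univ cofib"
  assumes X: "normally_cloven \<kappa> X"
  shows "is_psm X X (one1 (CAT\<^sub>2 \<kappa>) (cf_fun X)) (psmor_one (CAT\<^sub>2 \<kappa>) (assoc_pseudoalgebra \<kappa> X))"
proof -
  obtain P E B \<delta> where e: "X = \<lparr>cf_fun = P, cf_lift = \<delta>\<rparr>" "cloven_ambient P E B \<delta> \<kappa>"
    by (rule normally_clovenE[OF X])
  interpret c: cloven_ambient P E B \<delta> \<kappa> by (rule e(2))
  interpret s: cloven_square P E B \<delta> \<kappa> P E B \<delta> "fun_one E" "fun_one B"
    using e(2) cat_square_one[OF c.cat_functor_axioms] by (simp add: cloven_square_def comma_square_def)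
  have L: "fun_comp c.L (comma_map s.s.sq) = c.L" "fun_comp (fun_one E) c.L = c.L"
    by (simp_all add: comma_map_one[OF c.cat_functor_axioms] fun_comp_one[OF c.L_functor])
  interpret p: comparison P E B \<delta> \<kappa> P E B \<delta> "fun_one E" "fun_one B" "one2 (CAT \<kappa>) c.L"
  proof (intro comparison.intro comparison_axioms.intro)
    show "cat_nattr (one2 (CAT \<kappa>) c.L) (fun_comp c.L (comma_map s.s.sq)) (fun_comp (fun_one E) c.L) (comma P) E"
      unfolding L by (rule cat_nattr_one2[OF c.L_functor])
  qed (simp_all add: s.cloven_square_axioms c.A.iso_Ide)
  have one: "one1 (CAT\<^sub>2 \<kappa>) P = s.s.sq" by (rule square_eqI) simp_all
  have cell: "one2 (CAT\<^sub>2 \<kappa>) c.a.sq = p.phi_cell" by (rule sqcell_eqI) simp_all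
  show ?thesis
    using p.pseudomorphism_phi unfolding is_psm_def psmor_one_def e(1) c.assoc_eq
    by (simp add: one cell)
qed

text \<open>The comparison of the composite square and the pasting of the two given comparisons are
  fillers of the same problem: composed with the lift at T' T x, both yield the image of the lift
  under T' T.\<close>

lemma comparison_comp_cell:
  fixes P :: "'a univ fnctr"
  assumes "comparison P E B \<delta> \<kappa> Q F C \<epsilon> T S \<phi>" "comparison Q F C \<epsilon> \<kappa> R G D \<zeta> T' S' \<psi>"
    and "comparison P E B \<delta> \<kappa> R G D \<zeta> (fun_comp T' T) (fun_comp S' S) \<chi>"
  shows "\<lparr>sc_src = cod_fun P, sc_tgt = R, sc_total = \<chi>, sc_base = one2 (CAT \<kappa>) (fun_comp S' S)\<rparr> =
    (\<lparr>sq_src = Q, sq_tgt = R, sq_total = T', sq_base = S'\<rparr> \<lhd>\<^bsub>CAT\<^sub>2 \<kappa>\<^esub>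
      \<lparr>sc_src = cod_fun P, sc_tgt = Q, sc_total = \<phi>, sc_base = one2 (CAT \<kappa>) S\<rparr>) \<bullet>\<^bsub>CAT\<^sub>2 \<kappa>\<^esub>
    (\<lparr>sc_src = cod_fun Q, sc_tgt = R, sc_total = \<psi>, sc_base = one2 (CAT \<kappa>) S'\<rparr> \<rhd>\<^bsub>CAT\<^sub>2 \<kappa>\<^esub>
      F1 CC \<lparr>sq_src = P, sq_tgt = Q, sq_total = T, sq_base = S\<rparr>)"
proof -
  interpret p: comparison P E B \<delta> \<kappa> Q F C \<epsilon> T S \<phi> by fact
  interpret q: comparison Q F C \<epsilon> \<kappa> R G D \<zeta> T' S' \<psi> by fact
  interpret r: comparison P E B \<delta> \<kappa> R G D \<zeta> "fun_comp T' T" "fun_comp S' S" \<chi> by fact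
  have comp: "q.s.sq \<odot>\<^bsub>CAT\<^sub>2 \<kappa>\<^esub> p.s.sq = r.s.sq" by (rule square_eqI) simp_all
  have "(q.s.sq \<lhd>\<^bsub>CAT\<^sub>2 \<kappa>\<^esub> p.phi_cell) \<bullet>\<^bsub>CAT\<^sub>2 \<kappa>\<^esub> (q.phi_cell \<rhd>\<^bsub>CAT\<^sub>2 \<kappa>\<^esub> F1 CC p.s.sq) \<in>
      hom2 (CAT\<^sub>2 \<kappa>) (q.Y.a.sq \<odot>\<^bsub>CAT\<^sub>2 \<kappa>\<^esub> F1 CC r.s.sq) (r.s.sq \<odot>\<^bsub>CAT\<^sub>2 \<kappa>\<^esub> p.X.a.sq)"
    using p.X.M.psmor_comp_hom2[OF p.X.P_cell p.X.a_cell p.Y.P_cell p.Y.a_cell q.Y.P_cell q.Y.a_cell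
      p.sq_cell p.phi_hom2 q.sq_cell q.phi_hom2] unfolding comp .
  then show ?thesis
  proof (rule CAT2_hom2_eqI[OF r.phi_hom2])
    fix Z assume "Z \<in> Obj (FDom (sq_src (q.Y.a.sq \<odot>\<^bsub>CAT\<^sub>2 \<kappa>\<^esub> F1 CC r.s.sq)))"
    then have Z: "Z \<in> comma_obj P" by simp
    then obtain x u where z: "Z = \<langle>x, u\<rangle>" and x: "x \<in> Obj E" "u \<in> Arr B" "Dom B u = FOb P x"
      by (rule p.X.comma_objE)
    have c: "cocartesian R (\<zeta> (FOb T' (FOb T x)) (FAr S' (FAr S u)))"
      using x by (intro q.Y.lift_cocartesian) simp_all
    have l: "NAt \<chi> \<langle>x, u\<rangle> \<cdot>\<^bsub>G\<^esub> \<zeta> (FOb T' (FOb T x)) (FAr S' (FAr S u)) = FAr T' (FAr T (\<delta> x u))"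
      using r.lift[OF x] x by simp
    have m: "NAt \<psi> \<langle>FOb T x, FAr S u\<rangle> \<cdot>\<^bsub>G\<^esub> \<zeta> (FOb T' (FOb T x)) (FAr S' (FAr S u)) = FAr T' (\<epsilon> (FOb T x) (FAr S u))"
      using q.lift[of "FOb T x" "FAr S u"] x by simp
    have chi: "NAt \<chi> \<langle>x, u\<rangle> \<in> Arr G" "Dom G (NAt \<chi> \<langle>x, u\<rangle>) = Cod G (\<zeta> (FOb T' (FOb T x)) (FAr S' (FAr S u)))"
      "FAr R (NAt \<chi> \<langle>x, u\<rangle>) = Ide D (FOb S' (FOb S (Cod B u)))"
      using r.phi[OF x] r.over[OF x] x by simp_all
    have psi: "NAt \<psi> \<langle>FOb T x, FAr S u\<rangle> \<in> Arr G"
      "Dom G (NAt \<psi> \<langle>FOb T x, FAr S u\<rangle>) = Cod G (\<zeta> (FOb T' (FOb T x)) (FAr S' (FAr S u)))"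
      "Cod G (NAt \<psi> \<langle>FOb T x, FAr S u\<rangle>) = FOb T' (Cod F (\<epsilon> (FOb T x) (FAr S u)))"
      "FAr R (NAt \<psi> \<langle>FOb T x, FAr S u\<rangle>) = Ide D (FOb S' (FOb S (Cod B u)))"
      using q.phi[of "FOb T x" "FAr S u"] q.over[of "FOb T x" "FAr S u"] x by simp_all
    have t: "FAr T' (NAt \<phi> \<langle>x, u\<rangle>) \<cdot>\<^bsub>G\<^esub> FAr T' (\<epsilon> (FOb T x) (FAr S u)) = FAr T' (FAr T (\<delta> x u))"
      using arg_cong[OF p.lift[OF x], of "FAr T'"] x by simp
    have "NAt \<chi> \<langle>x, u\<rangle> = FAr T' (NAt \<phi> \<langle>x, u\<rangle>) \<cdot>\<^bsub>G\<^esub> NAt \<psi> \<langle>FOb T x, FAr S u\<rangle>"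
      by (rule q.Y.cocartesian_unique[OF c]) (use x chi psi l m t in simp_all)
    then show "NAt (sc_total r.phi_cell) Z = NAt (sc_total ((q.s.sq \<lhd>\<^bsub>CAT\<^sub>2 \<kappa>\<^esub> p.phi_cell) \<bullet>\<^bsub>CAT\<^sub>2 \<kappa>\<^esub> (q.phi_cell \<rhd>\<^bsub>CAT\<^sub>2 \<kappa>\<^esub> F1 CC p.s.sq))) Z"
      using x Z psi by (simp add: z whisker_left_def whisker_right_def)
  qed (simp add: whisker_left_def whisker_right_def)
qed

text \<open>The axioms for the pasted cell are not verified by a diagram chase. The composite square
  preserves cocartesian arrows, so it underlies a pseudomorphism, and the cell of that one is then
  identified with the pasting by uniqueness of fillers.\<close>

lemma is_psm_comp:
  fixes X Y Z :: "'a univ cofib"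
  assumes X: "normally_cloven \<kappa> X" and Y: "normally_cloven \<kappa> Y" and Z: "normally_cloven \<kappa> Z"
    and m: "is_psm X Y s m" and n: "is_psm Y Z t n"
  shows "is_psm X Z (t \<odot>\<^bsub>CAT\<^sub>2 \<kappa>\<^esub> s) (psmor_comp (CAT\<^sub>2 \<kappa>) CC n m)"
proof -
  note s = is_psm_hom1[OF m, unfolded in_hom1] and t = is_psm_hom1[OF n, unfolded in_hom1]
  have st: "t \<odot>\<^bsub>CAT\<^sub>2 \<kappa>\<^esub> s \<in> hom1 (CAT\<^sub>2 \<kappa>) (cf_fun X) (cf_fun Z)" using s t by simp
  have "sq_tgt s = sq_src t" using s t by (simp add: arrow_two_cat_sel)
  then have "preserves_cocartesian (t \<odot>\<^bsub>CAT\<^sub>2 \<kappa>\<^esub> s)"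
    using s is_psm_preserves[OF X Y m] is_psm_preserves[OF Y Z n] by (intro preserves_cocartesian_comp) simp_all
  then obtain r where r: "is_psm X Z (t \<odot>\<^bsub>CAT\<^sub>2 \<kappa>\<^esub> s) r"
    using is_psm_exists[OF X Z st] by blast
  note cm = is_psm_comparison[OF X Y m] and cn = is_psm_comparison[OF Y Z n] and cr = is_psm_comparison[OF X Z r]
  have cr1: "comparison (cf_fun X) (FDom (cf_fun X)) (FCod (cf_fun X)) (cf_lift X) \<kappa>
      (cf_fun Z) (FDom (cf_fun Z)) (FCod (cf_fun Z)) (cf_lift Z) (fun_comp (sq_total t) (sq_total s)) (fun_comp (sq_base t) (sq_base s)) (sc_total (pm_cell r))"
    using cr(1) by simp
  have "pm_cell r = (t \<lhd>\<^bsub>CAT\<^sub>2 \<kappa>\<^esub> pm_cell m) \<bullet>\<^bsub>CAT\<^sub>2 \<kappa>\<^esub> (pm_cell n \<rhd>\<^bsub>CAT\<^sub>2 \<kappa>\<^esub> F1 CC s)"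
    using comparison_comp_cell[OF cm(1) cn(1) cr1] cr(2)
    unfolding cm(3)[symmetric] cn(3)[symmetric] cm(2)[symmetric] cn(2)[symmetric] by simp
  then have "r = psmor_comp (CAT\<^sub>2 \<kappa>) CC n m"
    using m n r by (intro psmor.equality) (simp_all add: is_psm_def psmor_comp_def)
  then show ?thesis using r by simp
qed

end

section \<open>Both 2-categories as 2-categories over \<open>CAT\<^sub>2\<close>\<close>

lemma NClCoFib_sel [simp]:
  "Cell0 (NClCoFib \<kappa>) = Collect (normally_cloven \<kappa>)" "Cell1 (NClCoFib \<kappa>) = Collect (cofmor_ok \<kappa>)"
  "c \<in> Cell2 (NClCoFib \<kappa>) \<longleftrightarrow> cc_cell c \<in> Cell2 (CAT\<^sub>2 \<kappa>) \<and> cofmor_ok \<kappa> (cofcell_src \<kappa> c) \<and> cofmor_ok \<kappa> (cofcell_tgt \<kappa> c)"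
  "src1 (NClCoFib \<kappa>) = cm_src" "tgt1 (NClCoFib \<kappa>) = cm_tgt"
  "src2 (NClCoFib \<kappa>) = cofcell_src \<kappa>" "tgt2 (NClCoFib \<kappa>) = cofcell_tgt \<kappa>"
  "one1 (NClCoFib \<kappa>) X = \<lparr>cm_src = X, cm_tgt = X, cm_sq = one1 (CAT\<^sub>2 \<kappa>) (cf_fun X)\<rparr>"
  "one2 (NClCoFib \<kappa>) m = \<lparr>cc_src = cm_src m, cc_tgt = cm_tgt m, cc_cell = one2 (CAT\<^sub>2 \<kappa>) (cm_sq m)\<rparr>"
  "n \<odot>\<^bsub>NClCoFib \<kappa>\<^esub> m = \<lparr>cm_src = cm_src m, cm_tgt = cm_tgt n, cm_sq = cm_sq n \<odot>\<^bsub>CAT\<^sub>2 \<kappa>\<^esub> cm_sq m\<rparr>"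
  "d \<bullet>\<^bsub>NClCoFib \<kappa>\<^esub> c = \<lparr>cc_src = cc_src c, cc_tgt = cc_tgt c, cc_cell = cc_cell d \<bullet>\<^bsub>CAT\<^sub>2 \<kappa>\<^esub> cc_cell c\<rparr>"
  "d \<star>\<^bsub>NClCoFib \<kappa>\<^esub> c = \<lparr>cc_src = cc_src c, cc_tgt = cc_tgt d, cc_cell = cc_cell d \<star>\<^bsub>CAT\<^sub>2 \<kappa>\<^esub> cc_cell c\<rparr>"
  by (simp_all add: NClCoFib_def)

lemma NClCoFib_forget_sel [simp]:
  "F0 NClCoFib_forget = cf_fun" "F1 NClCoFib_forget = cm_sq" "F2 NClCoFib_forget = cc_cell"
  by (simp_all add: NClCoFib_forget_def)

lemma PsAlg_forget_sel [simp]: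
  "F0 PsAlg_forget = pa_obj" "F1 PsAlg_forget = pm_map" "F2 PsAlg_forget = at_cell"
  by (simp_all add: PsAlg_forget_def)

lemma PsAlg_sel [simp]:
  "Cell0 (PsAlg\<^sub>n K T) = Collect (normal_pseudoalgebra K T)"
  "m \<in> Cell1 (PsAlg\<^sub>n K T) \<longleftrightarrow> pseudomorphism K T m \<and> normal_pseudoalgebra K T (pm_src m) \<and> normal_pseudoalgebra K T (pm_tgt m)"
  "t \<in> Cell2 (PsAlg\<^sub>n K T) \<longleftrightarrow> algebra_transformation K T t \<and> normal_pseudoalgebra K T (pm_src (at_src t)) \<and> normal_pseudoalgebra K T (pm_tgt (at_src t))"
  "src1 (PsAlg\<^sub>n K T) = pm_src" "tgt1 (PsAlg\<^sub>n K T) = pm_tgt" "src2 (PsAlg\<^sub>n K T) = at_src" "tgt2 (PsAlg\<^sub>n K T) = at_tgt"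
  "one1 (PsAlg\<^sub>n K T) = psmor_one K" "comp1 (PsAlg\<^sub>n K T) = psmor_comp K T"
  "one2 (PsAlg\<^sub>n K T) m = \<lparr>at_src = m, at_tgt = m, at_cell = one2 K (pm_map m)\<rparr>"
  "t \<bullet>\<^bsub>PsAlg\<^sub>n K T\<^esub> s = \<lparr>at_src = at_src s, at_tgt = at_tgt t, at_cell = at_cell t \<bullet>\<^bsub>K\<^esub> at_cell s\<rparr>"
  "t \<star>\<^bsub>PsAlg\<^sub>n K T\<^esub> s = \<lparr>at_src = psmor_comp K T (at_src t) (at_src s), at_tgt = psmor_comp K T (at_tgt t) (at_tgt s),
    at_cell = at_cell t \<star>\<^bsub>K\<^esub> at_cell s\<rparr>"
  by (simp_all add: PsAlg\<^sub>n_def)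

lemma cofcell_sel [simp]:
  "cm_src (cofcell_src \<kappa> c) = cc_src c" "cm_tgt (cofcell_src \<kappa> c) = cc_tgt c" "cm_sq (cofcell_src \<kappa> c) = src2 (CAT\<^sub>2 \<kappa>) (cc_cell c)"
  "cm_src (cofcell_tgt \<kappa> c) = cc_src c" "cm_tgt (cofcell_tgt \<kappa> c) = cc_tgt c" "cm_sq (cofcell_tgt \<kappa> c) = tgt2 (CAT\<^sub>2 \<kappa>) (cc_cell c)"
  by (simp_all add: cofcell_src_def cofcell_tgt_def)

lemma cofmor_eqI: "\<lbrakk>cm_src m = cm_src n; cm_tgt m = cm_tgt n; cm_sq m = cm_sq n\<rbrakk> \<Longrightarrow> m = n" for m n :: "'u cofmor"
  by simp

lemma psmor_comp_sel: "pm_src (psmor_comp K T n m) = pm_src m" "pm_tgt (psmor_comp K T n m) = pm_tgt n"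
  "pm_map (psmor_comp K T n m) = pm_map n \<odot>\<^bsub>K\<^esub> pm_map m"
  by (simp_all add: psmor_comp_def)

context comma_ambient
begin

abbreviation "CoF \<equiv> (NClCoFib \<kappa> :: ('a univ cofib, 'a univ cofmor, 'a univ cofcell) two_cat)"
abbreviation "PsA \<equiv> PsAlg\<^sub>n (CAT\<^sub>2 \<kappa>) (comma_monad \<kappa> :: ('a univ fnctr, 'a univ fnctr square, ('a univ fnctr, 'a univ nattr) sqcell) two_monad)"

lemma cofmor_comp_ok:
  fixes m n :: "'a univ cofmor"
  assumes "cofmor_ok \<kappa> m" "cofmor_ok \<kappa> n" "cm_tgt m = cm_src n"
  shows "cofmor_ok \<kappa> \<lparr>cm_src = cm_src m, cm_tgt = cm_tgt n, cm_sq = cm_sq n \<odot>\<^bsub>CAT\<^sub>2 \<kappa>\<^esub> cm_sq m\<rparr>"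
proof -
  have "sq_tgt (cm_sq m) = sq_src (cm_sq n)"
    using assms by (simp add: cofmor_ok_def arrow_two_cat_sel)
  then have "preserves_cocartesian (cm_sq n \<odot>\<^bsub>CAT\<^sub>2 \<kappa>\<^esub> cm_sq m)"
    using assms by (intro preserves_cocartesian_comp) (simp_all add: cofmor_ok_def)
  then show ?thesis using assms by (simp add: cofmor_ok_def)
qed

lemma CoF_over: "two_cat_over (CAT\<^sub>2 \<kappa>) CoF NClCoFib_forget"
proof
  fix X assume "X \<in> Cell0 CoF"
  then show "F0 NClCoFib_forget X \<in> Cell0 (CAT\<^sub>2 \<kappa>)" by (simp add: normally_cloven_def)
next
  fix f assume "f \<in> Cell1 CoF"
  then show "src1 CoF f \<in> Cell0 CoF \<and> tgt1 CoF f \<in> Cell0 CoF \<and>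
      F1 NClCoFib_forget f \<in> hom1 (CAT\<^sub>2 \<kappa>) (F0 NClCoFib_forget (src1 CoF f)) (F0 NClCoFib_forget (tgt1 CoF f))"
    by (simp add: cofmor_ok_def)
next
  fix c assume "c \<in> Cell2 CoF"
  then show "src2 CoF c \<in> Cell1 CoF \<and> tgt2 CoF c \<in> Cell1 CoF \<and>
      src1 CoF (tgt2 CoF c) = src1 CoF (src2 CoF c) \<and> tgt1 CoF (tgt2 CoF c) = tgt1 CoF (src2 CoF c) \<and>
      F2 NClCoFib_forget c \<in> hom2 (CAT\<^sub>2 \<kappa>) (F1 NClCoFib_forget (src2 CoF c)) (F1 NClCoFib_forget (tgt2 CoF c))"
    by simp
next
  fix X assume "X \<in> Cell0 CoF"
  then show "one1 CoF X \<in> hom1 CoF X X \<and> F1 NClCoFib_forget (one1 CoF X) = one1 (CAT\<^sub>2 \<kappa>) (F0 NClCoFib_forget X)"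
    by (simp add: cofmor_ok_def normally_cloven_def arrow_two_cat_sel(1) preserves_cocartesian_one)
next
  fix f assume f: "f \<in> Cell1 CoF"
  then have "cm_sq f \<in> Cell1 (CAT\<^sub>2 \<kappa>)" by (simp add: cofmor_ok_def)
  then have e: "cofcell_src \<kappa> (one2 CoF f) = f" "cofcell_tgt \<kappa> (one2 CoF f) = f" and "one2 (CAT\<^sub>2 \<kappa>) (cm_sq f) \<in> Cell2 (CAT\<^sub>2 \<kappa>)"
    by (auto intro!: cofmor_eqI)
  then show "one2 CoF f \<in> hom2 CoF f f \<and> F2 NClCoFib_forget (one2 CoF f) = one2 (CAT\<^sub>2 \<kappa>) (F1 NClCoFib_forget f)"
    using f unfolding in_hom2 NClCoFib_sel(3,6,7) e by simp
next
  fix f g assume "f \<in> Cell1 CoF" "g \<in> Cell1 CoF" "tgt1 CoF f = src1 CoF g"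
  then show "g \<odot>\<^bsub>CoF\<^esub> f \<in> hom1 CoF (src1 CoF f) (tgt1 CoF g) \<and>
      F1 NClCoFib_forget (g \<odot>\<^bsub>CoF\<^esub> f) = F1 NClCoFib_forget g \<odot>\<^bsub>CAT\<^sub>2 \<kappa>\<^esub> F1 NClCoFib_forget f"
    using cofmor_comp_ok[of f g] by simp
next
  fix c d assume h: "c \<in> Cell2 CoF" "d \<in> Cell2 CoF" "tgt2 CoF c = src2 CoF d"
  have e: "cc_src d = cc_src c" "cc_tgt d = cc_tgt c" "tgt2 (CAT\<^sub>2 \<kappa>) (cc_cell c) = src2 (CAT\<^sub>2 \<kappa>) (cc_cell d)"
    using arg_cong[OF h(3), of cm_src] arg_cong[OF h(3), of cm_tgt] arg_cong[OF h(3), of cm_sq] by simp_all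
  have s: "cofcell_src \<kappa> (d \<bullet>\<^bsub>CoF\<^esub> c) = cofcell_src \<kappa> c" "cofcell_tgt \<kappa> (d \<bullet>\<^bsub>CoF\<^esub> c) = cofcell_tgt \<kappa> d"
    using h(1,2) e by (auto intro!: cofmor_eqI)
  then show "d \<bullet>\<^bsub>CoF\<^esub> c \<in> hom2 CoF (src2 CoF c) (tgt2 CoF d) \<and>
      F2 NClCoFib_forget (d \<bullet>\<^bsub>CoF\<^esub> c) = F2 NClCoFib_forget d \<bullet>\<^bsub>CAT\<^sub>2 \<kappa>\<^esub> F2 NClCoFib_forget c"
    using h(1,2) e unfolding in_hom2 NClCoFib_sel(3,6,7) s by simp
next
  fix c d assume h: "c \<in> Cell2 CoF" "d \<in> Cell2 CoF" "tgt1 CoF (src2 CoF c) = src1 CoF (src2 CoF d)"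
  have e: "tgt1 (CAT\<^sub>2 \<kappa>) (src2 (CAT\<^sub>2 \<kappa>) (cc_cell c)) = src1 (CAT\<^sub>2 \<kappa>) (src2 (CAT\<^sub>2 \<kappa>) (cc_cell d))"
    using h by (simp add: cofmor_ok_def)
  have s: "cofcell_src \<kappa> (d \<star>\<^bsub>CoF\<^esub> c) = cofcell_src \<kappa> d \<odot>\<^bsub>CoF\<^esub> cofcell_src \<kappa> c"
    "cofcell_tgt \<kappa> (d \<star>\<^bsub>CoF\<^esub> c) = cofcell_tgt \<kappa> d \<odot>\<^bsub>CoF\<^esub> cofcell_tgt \<kappa> c"
    using CAT2.hcomp_cell[OF _ _ e] h(1,2) by (auto intro!: cofmor_eqI)
  show "d \<star>\<^bsub>CoF\<^esub> c \<in> hom2 CoF (src2 CoF d \<odot>\<^bsub>CoF\<^esub> src2 CoF c) (tgt2 CoF d \<odot>\<^bsub>CoF\<^esub> tgt2 CoF c) \<and>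
      F2 NClCoFib_forget (d \<star>\<^bsub>CoF\<^esub> c) = F2 NClCoFib_forget d \<star>\<^bsub>CAT\<^sub>2 \<kappa>\<^esub> F2 NClCoFib_forget c"
    using s CAT2.hcomp_cell[OF _ _ e] h cofmor_comp_ok[of "cofcell_src \<kappa> c" "cofcell_src \<kappa> d"]
      cofmor_comp_ok[of "cofcell_tgt \<kappa> c" "cofcell_tgt \<kappa> d"]
    unfolding in_hom2 NClCoFib_sel(3,6,7) s by simp
next
  fix f g assume "f \<in> Cell1 CoF" "g \<in> Cell1 CoF" "src1 CoF f = src1 CoF g" "tgt1 CoF f = tgt1 CoF g"
    "F1 NClCoFib_forget f = F1 NClCoFib_forget g"
  then show "f = g" by (intro cofmor_eqI) simp_all
next
  fix c d assume h: "c \<in> Cell2 CoF" "d \<in> Cell2 CoF" "src2 CoF c = src2 CoF d" "tgt2 CoF c = tgt2 CoF d"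
    "F2 NClCoFib_forget c = F2 NClCoFib_forget d"
  have "cc_src c = cc_src d" "cc_tgt c = cc_tgt d"
    using arg_cong[OF h(3), of cm_src] arg_cong[OF h(3), of cm_tgt] by simp_all
  then show "c = d" using h(5) by simp
qed

lemma PsA_obE:
  assumes "A \<in> Cell0 PsA"
  obtains X :: "'a univ cofib" where "normally_cloven \<kappa> X" "A = assoc_pseudoalgebra \<kappa> X"
  using assms normal_pseudoalgebraE[of A] normally_clovenI by (metis PsAlg_sel(1) mem_Collect_eq)

lemma PsA_hom1:
  fixes X Y :: "'a univ cofib"
  assumes "normally_cloven \<kappa> X" "normally_cloven \<kappa> Y"
  shows "m \<in> hom1 PsA (assoc_pseudoalgebra \<kappa> X) (assoc_pseudoalgebra \<kappa> Y) \<longleftrightarrow> is_psm X Y (pm_map m) m"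
  using assoc_normal[OF assms(1)] assoc_normal[OF assms(2)] by (auto simp: is_psm_def)

lemma PsA_cell1E:
  assumes "m \<in> Cell1 PsA"
  obtains X Y :: "'a univ cofib" where "normally_cloven \<kappa> X" "normally_cloven \<kappa> Y" "is_psm X Y (pm_map m) m"
proof -
  obtain X :: "'a univ cofib" where X: "normally_cloven \<kappa> X" "pm_src m = assoc_pseudoalgebra \<kappa> X"
    using assms PsA_obE[of "pm_src m"] by auto
  obtain Y :: "'a univ cofib" where Y: "normally_cloven \<kappa> Y" "pm_tgt m = assoc_pseudoalgebra \<kappa> Y"
    using assms PsA_obE[of "pm_tgt m"] by auto
  show thesis using that[OF X(1) Y(1)] assms X(2) Y(2) by (simp add: is_psm_def)
qed

lemma algtrD:
  assumes "algebra_transformation (CAT\<^sub>2 \<kappa>) CC t"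
  shows "pseudomorphism (CAT\<^sub>2 \<kappa>) CC (at_src t)" "pseudomorphism (CAT\<^sub>2 \<kappa>) CC (at_tgt t)"
    "pm_src (at_tgt t) = pm_src (at_src t)" "pm_tgt (at_tgt t) = pm_tgt (at_src t)"
    "at_cell t \<in> hom2 (CAT\<^sub>2 \<kappa>) (pm_map (at_src t)) (pm_map (at_tgt t))"
  using assms unfolding algebra_transformation_def Let_def by auto

text \<open>Fullness on 2-cells. With it, closure of algebra transformations under vertical and
  horizontal composition is only a matter of boundaries, since any 2-cell between the underlying
  squares qualifies.\<close>

lemma PsA_cell2I:
  assumes m: "m \<in> Cell1 PsA" and n: "n \<in> Cell1 PsA" and mn: "pm_src n = pm_src m" "pm_tgt n = pm_tgt m"
    and th: "\<theta> \<in> hom2 (CAT\<^sub>2 \<kappa>) (pm_map m) (pm_map n)"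
  shows "\<lparr>at_src = m, at_tgt = n, at_cell = \<theta>\<rparr> \<in> hom2 PsA m n"
proof -
  obtain X Y :: "'a univ cofib" where XY: "normally_cloven \<kappa> X" "normally_cloven \<kappa> Y" "is_psm X Y (pm_map m) m"
    by (rule PsA_cell1E[OF m])
  have "is_psm X Y (pm_map n) n" using XY(3) n mn by (simp add: is_psm_def)
  from is_psm_algtr[OF XY this th] show ?thesis using m by simp
qed

lemma PsA_cell2D:
  assumes "t \<in> Cell2 PsA"
  shows "at_src t \<in> Cell1 PsA" "at_tgt t \<in> Cell1 PsA"
    "pm_src (at_tgt t) = pm_src (at_src t)" "pm_tgt (at_tgt t) = pm_tgt (at_src t)"
    "at_cell t \<in> Cell2 (CAT\<^sub>2 \<kappa>)" "src2 (CAT\<^sub>2 \<kappa>) (at_cell t) = pm_map (at_src t)" "tgt2 (CAT\<^sub>2 \<kappa>) (at_cell t) = pm_map (at_tgt t)"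
  using assms algtrD[of t] by auto

lemma PsA_comp:
  assumes m: "m \<in> Cell1 PsA" and n: "n \<in> Cell1 PsA" and mn: "pm_tgt m = pm_src n"
  shows "psmor_comp (CAT\<^sub>2 \<kappa>) CC n m \<in> Cell1 PsA"
proof -
  obtain X Y :: "'a univ cofib" where XY: "normally_cloven \<kappa> X" "normally_cloven \<kappa> Y" "is_psm X Y (pm_map m) m"
    by (rule PsA_cell1E[OF m])
  obtain Y' Z :: "'a univ cofib" where YZ: "normally_cloven \<kappa> Y'" "normally_cloven \<kappa> Z" "is_psm Y' Z (pm_map n) n"
    by (rule PsA_cell1E[OF n])
  \<comment> \<open>The two eliminations produce the middle cofibration twice; they agree because
    its pseudoalgebra determines it.\<close>
  have "Y' = Y" using XY YZ mn by (intro assoc_inj) (simp_all add: is_psm_def)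
  then have "is_psm X Z (pm_map n \<odot>\<^bsub>CAT\<^sub>2 \<kappa>\<^esub> pm_map m) (psmor_comp (CAT\<^sub>2 \<kappa>) CC n m)"
    using XY YZ by (intro is_psm_comp) simp_all
  then show ?thesis using m n by (simp add: is_psm_def psmor_comp_sel)
qed

lemma PsA_map:
  assumes "m \<in> Cell1 PsA"
  shows "pm_map m \<in> Cell1 (CAT\<^sub>2 \<kappa>)" "src1 (CAT\<^sub>2 \<kappa>) (pm_map m) = pa_obj (pm_src m)" "tgt1 (CAT\<^sub>2 \<kappa>) (pm_map m) = pa_obj (pm_tgt m)"
proof -
  have "pseudomorphism (CAT\<^sub>2 \<kappa>) CC m" using assms by simp
  then have "pm_map m \<in> hom1 (CAT\<^sub>2 \<kappa>) (pa_obj (pm_src m)) (pa_obj (pm_tgt m))"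
    unfolding pseudomorphism_def Let_def by blast
  then show "pm_map m \<in> Cell1 (CAT\<^sub>2 \<kappa>)" "src1 (CAT\<^sub>2 \<kappa>) (pm_map m) = pa_obj (pm_src m)" "tgt1 (CAT\<^sub>2 \<kappa>) (pm_map m) = pa_obj (pm_tgt m)"
    by auto
qed

text \<open>Closure comes from fullness on 2-cells and from composability of pseudomorphisms;
  faithfulness on 1-cells is the uniqueness of the comparison cell over a given square.\<close>

lemma PsA_over: "two_cat_over (CAT\<^sub>2 \<kappa>) PsA PsAlg_forget"
proof
  fix A assume "A \<in> Cell0 PsA"
  then show "F0 PsAlg_forget A \<in> Cell0 (CAT\<^sub>2 \<kappa>)"
    by (simp add: normal_pseudoalgebra_def pseudoalgebra_def Let_def)
next
  fix m assume m: "m \<in> Cell1 PsA"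
  then show "src1 PsA m \<in> Cell0 PsA \<and> tgt1 PsA m \<in> Cell0 PsA \<and>
      F1 PsAlg_forget m \<in> hom1 (CAT\<^sub>2 \<kappa>) (F0 PsAlg_forget (src1 PsA m)) (F0 PsAlg_forget (tgt1 PsA m))"
    using PsA_map[OF m] by simp
next
  fix t assume t: "t \<in> Cell2 PsA"
  show "src2 PsA t \<in> Cell1 PsA \<and> tgt2 PsA t \<in> Cell1 PsA \<and>
      src1 PsA (tgt2 PsA t) = src1 PsA (src2 PsA t) \<and> tgt1 PsA (tgt2 PsA t) = tgt1 PsA (src2 PsA t) \<and>
      F2 PsAlg_forget t \<in> hom2 (CAT\<^sub>2 \<kappa>) (F1 PsAlg_forget (src2 PsA t)) (F1 PsAlg_forget (tgt2 PsA t))"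
    using PsA_cell2D[OF t] by (simp del: PsAlg_sel(2))
next
  fix A assume A: "A \<in> Cell0 PsA"
  obtain X where X: "normally_cloven \<kappa> X" "A = assoc_pseudoalgebra \<kappa> X" by (rule PsA_obE[OF A])
  show "one1 PsA A \<in> hom1 PsA A A \<and> F1 PsAlg_forget (one1 PsA A) = one1 (CAT\<^sub>2 \<kappa>) (F0 PsAlg_forget A)"
    using is_psm_one[OF X(1)] A by (simp add: is_psm_def psmor_one_def X(2) pa_obj_assoc)
next
  fix m assume m: "m \<in> Cell1 PsA"
  show "one2 PsA m \<in> hom2 PsA m m \<and> F2 PsAlg_forget (one2 PsA m) = one2 (CAT\<^sub>2 \<kappa>) (F1 PsAlg_forget m)"
    using PsA_cell2I[OF m m refl refl, of "one2 (CAT\<^sub>2 \<kappa>) (pm_map m)"] PsA_map[OF m] by simp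
next
  fix m n assume h: "m \<in> Cell1 PsA" "n \<in> Cell1 PsA" "tgt1 PsA m = src1 PsA n"
  then show "n \<odot>\<^bsub>PsA\<^esub> m \<in> hom1 PsA (src1 PsA m) (tgt1 PsA n) \<and>
      F1 PsAlg_forget (n \<odot>\<^bsub>PsA\<^esub> m) = F1 PsAlg_forget n \<odot>\<^bsub>CAT\<^sub>2 \<kappa>\<^esub> F1 PsAlg_forget m"
    using PsA_comp[OF h(1,2)] by (simp add: psmor_comp_sel del: PsAlg_sel(2))
next
  fix s t assume h: "s \<in> Cell2 PsA" "t \<in> Cell2 PsA" "tgt2 PsA s = src2 PsA t"
  note S = PsA_cell2D[OF h(1)] and T = PsA_cell2D[OF h(2)]
  have e: "at_tgt s = at_src t" using h(3) by simp
  have "at_cell t \<bullet>\<^bsub>CAT\<^sub>2 \<kappa>\<^esub> at_cell s \<in> hom2 (CAT\<^sub>2 \<kappa>) (pm_map (at_src s)) (pm_map (at_tgt t))"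
    using S T e by (simp del: PsAlg_sel(2))
  then have "t \<bullet>\<^bsub>PsA\<^esub> s \<in> hom2 PsA (at_src s) (at_tgt t)"
    unfolding PsAlg_sel by (intro PsA_cell2I S(1) T(2)) (use S T e in \<open>simp_all del: PsAlg_sel(2)\<close>)
  then show "t \<bullet>\<^bsub>PsA\<^esub> s \<in> hom2 PsA (src2 PsA s) (tgt2 PsA t) \<and>
      F2 PsAlg_forget (t \<bullet>\<^bsub>PsA\<^esub> s) = F2 PsAlg_forget t \<bullet>\<^bsub>CAT\<^sub>2 \<kappa>\<^esub> F2 PsAlg_forget s" by simp
next
  fix s t assume h: "s \<in> Cell2 PsA" "t \<in> Cell2 PsA" "tgt1 PsA (src2 PsA s) = src1 PsA (src2 PsA t)"
  note S = PsA_cell2D[OF h(1)] and T = PsA_cell2D[OF h(2)]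
  have e: "pm_tgt (at_src s) = pm_src (at_src t)" using h(3) by simp
  then have e': "pm_tgt (at_tgt s) = pm_src (at_tgt t)" using S T by simp
  have hc: "tgt1 (CAT\<^sub>2 \<kappa>) (src2 (CAT\<^sub>2 \<kappa>) (at_cell s)) = src1 (CAT\<^sub>2 \<kappa>) (src2 (CAT\<^sub>2 \<kappa>) (at_cell t))"
    using S T e PsA_map[OF S(1)] PsA_map[OF T(1)] by (simp del: PsAlg_sel(2) CAT2.globular_src CAT2.globular_tgt)
  have "at_cell t \<star>\<^bsub>CAT\<^sub>2 \<kappa>\<^esub> at_cell s \<in> hom2 (CAT\<^sub>2 \<kappa>)
      (pm_map (psmor_comp (CAT\<^sub>2 \<kappa>) CC (at_src t) (at_src s))) (pm_map (psmor_comp (CAT\<^sub>2 \<kappa>) CC (at_tgt t) (at_tgt s)))"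
    using CAT2.hcomp_cell[OF S(5) T(5) hc] S(6,7) T(6,7) by (simp add: psmor_comp_sel)
  then have "t \<star>\<^bsub>PsA\<^esub> s \<in> hom2 PsA (psmor_comp (CAT\<^sub>2 \<kappa>) CC (at_src t) (at_src s)) (psmor_comp (CAT\<^sub>2 \<kappa>) CC (at_tgt t) (at_tgt s))"
    unfolding PsAlg_sel by (intro PsA_cell2I PsA_comp S(1,2) T(1,2) e e') (use S T in \<open>simp_all add: psmor_comp_sel\<close>)
  then show "t \<star>\<^bsub>PsA\<^esub> s \<in> hom2 PsA (src2 PsA t \<odot>\<^bsub>PsA\<^esub> src2 PsA s) (tgt2 PsA t \<odot>\<^bsub>PsA\<^esub> tgt2 PsA s) \<and>
      F2 PsAlg_forget (t \<star>\<^bsub>PsA\<^esub> s) = F2 PsAlg_forget t \<star>\<^bsub>CAT\<^sub>2 \<kappa>\<^esub> F2 PsAlg_forget s" by simp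
next
  fix m n assume h: "m \<in> Cell1 PsA" "n \<in> Cell1 PsA" "src1 PsA m = src1 PsA n" "tgt1 PsA m = tgt1 PsA n"
    "F1 PsAlg_forget m = F1 PsAlg_forget n"
  obtain X Y where XY: "normally_cloven \<kappa> X" "normally_cloven \<kappa> Y" "is_psm X Y (pm_map m) m"
    by (rule PsA_cell1E[OF h(1)])
  have "is_psm X Y (pm_map m) n" using XY(3) h by (simp add: is_psm_def)
  from is_psm_unique[OF XY(1,2) this XY(3)] show "m = n" .
next
  fix s t assume "s \<in> Cell2 PsA" "t \<in> Cell2 PsA" "src2 PsA s = src2 PsA t" "tgt2 PsA s = tgt2 PsA t"
    "F2 PsAlg_forget s = F2 PsAlg_forget t"
  then show "s = t" by simp
qed

section \<open>The 2-functor, its inverse and the description of the morphisms\<close>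

definition Gamma1 :: "'a univ cofmor \<Rightarrow> _" where
  "Gamma1 m = (SOME n. is_psm (cm_src m) (cm_tgt m) (cm_sq m) n)"

definition Gamma :: "('a univ cofib, 'a univ cofmor, 'a univ cofcell, _, _, _) two_fun" where
  "Gamma = \<lparr>F0 = assoc_pseudoalgebra \<kappa>, F1 = Gamma1,
    F2 = (\<lambda>c. \<lparr>at_src = Gamma1 (cofcell_src \<kappa> c), at_tgt = Gamma1 (cofcell_tgt \<kappa> c), at_cell = cc_cell c\<rparr>)\<rparr>"

text \<open>The cofibration chosen here is in fact determined by the algebra, by
  \<open>assoc_inj\<close>; choice merely names the inverse of a bijection.\<close>

definition Psi0 :: "_ \<Rightarrow> 'a univ cofib" where
  "Psi0 A = (SOME X. normally_cloven \<kappa> X \<and> assoc_pseudoalgebra \<kappa> X = A)"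

definition Psi :: "(_, _, _, 'a univ cofib, 'a univ cofmor, 'a univ cofcell) two_fun" where
  "Psi = \<lparr>F0 = Psi0, F1 = (\<lambda>m. \<lparr>cm_src = Psi0 (pm_src m), cm_tgt = Psi0 (pm_tgt m), cm_sq = pm_map m\<rparr>),
    F2 = (\<lambda>t. \<lparr>cc_src = Psi0 (pm_src (at_src t)), cc_tgt = Psi0 (pm_tgt (at_src t)), cc_cell = at_cell t\<rparr>)\<rparr>"

text \<open>Existence is \<open>is_psm_exists\<close>; by \<open>is_psm_unique\<close> there is only
  one candidate, so the choice in \<open>Gamma1\<close> leaves no freedom.\<close>

lemma Gamma1:
  fixes m :: "'a univ cofmor"
  assumes "cofmor_ok \<kappa> m"
  shows "is_psm (cm_src m) (cm_tgt m) (cm_sq m) (Gamma1 m)"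
proof -
  have m: "normally_cloven \<kappa> (cm_src m)" "normally_cloven \<kappa> (cm_tgt m)"
    "cm_sq m \<in> hom1 (CAT\<^sub>2 \<kappa>) (cf_fun (cm_src m)) (cf_fun (cm_tgt m))" "preserves_cocartesian (cm_sq m)"
    using assms unfolding cofmor_ok_def by blast+
  have "\<exists>n. is_psm (cm_src m) (cm_tgt m) (cm_sq m) n" by (rule is_psm_exists[OF m]) (rule exI)
  then show ?thesis unfolding Gamma1_def by (rule someI_ex)
qed

lemma Psi0:
  assumes "A \<in> Cell0 PsA"
  shows "normally_cloven \<kappa> (Psi0 A :: 'a univ cofib)" "assoc_pseudoalgebra \<kappa> (Psi0 A :: 'a univ cofib) = A"
  using someI_ex[of "\<lambda>X :: 'a univ cofib. normally_cloven \<kappa> X \<and> assoc_pseudoalgebra \<kappa> X = A"] PsA_obE[OF assms]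
  unfolding Psi0_def by metis+

text \<open>A chosen right inverse is two-sided because the object map is injective.\<close>

lemma Psi0_assoc: "normally_cloven \<kappa> X \<Longrightarrow> Psi0 (assoc_pseudoalgebra \<kappa> X) = X" for X :: "'a univ cofib"
  using Psi0[of "assoc_pseudoalgebra \<kappa> X"] assoc_normal[of X] assoc_inj by simp

lemma Gamma1_hom1:
  fixes m :: "'a univ cofmor"
  assumes "cofmor_ok \<kappa> m"
  shows "Gamma1 m \<in> hom1 PsA (assoc_pseudoalgebra \<kappa> (cm_src m)) (assoc_pseudoalgebra \<kappa> (cm_tgt m))"
    and "pm_map (Gamma1 m) = cm_sq m"
proof -
  have XY: "normally_cloven \<kappa> (cm_src m)" "normally_cloven \<kappa> (cm_tgt m)"
    using assms unfolding cofmor_ok_def by blast+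
  show map: "pm_map (Gamma1 m) = cm_sq m" using Gamma1[OF assms] unfolding is_psm_def by blast
  show "Gamma1 m \<in> hom1 PsA (assoc_pseudoalgebra \<kappa> (cm_src m)) (assoc_pseudoalgebra \<kappa> (cm_tgt m))"
    unfolding PsA_hom1[OF XY] map by (rule Gamma1[OF assms])
qed

lemma Gamma_over: "over_map CoF NClCoFib_forget PsA PsAlg_forget Gamma"
  unfolding over_map_def
proof (intro conjI ballI)
  fix X assume "X \<in> Cell0 CoF"
  then show "F0 Gamma X \<in> Cell0 PsA" "F0 PsAlg_forget (F0 Gamma X) = F0 NClCoFib_forget X"
    using assoc_normal[of X] by (simp_all add: Gamma_def pa_obj_assoc)
next
  fix m assume "m \<in> Cell1 CoF"
  then show "F1 Gamma m \<in> hom1 PsA (F0 Gamma (src1 CoF m)) (F0 Gamma (tgt1 CoF m))"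
    "F1 PsAlg_forget (F1 Gamma m) = F1 NClCoFib_forget m"
    using Gamma1_hom1[of m] by (simp_all add: Gamma_def del: PsAlg_sel(2))
next
  fix c assume c: "c \<in> Cell2 CoF"
  show "F2 PsAlg_forget (F2 Gamma c) = F2 NClCoFib_forget c" by (simp add: Gamma_def)
  have "\<lparr>at_src = Gamma1 (cofcell_src \<kappa> c), at_tgt = Gamma1 (cofcell_tgt \<kappa> c), at_cell = cc_cell c\<rparr>
      \<in> hom2 PsA (Gamma1 (cofcell_src \<kappa> c)) (Gamma1 (cofcell_tgt \<kappa> c))"
    using Gamma1_hom1[of "cofcell_src \<kappa> c"] Gamma1_hom1[of "cofcell_tgt \<kappa> c"] c
    by (intro PsA_cell2I) (simp_all del: PsAlg_sel(2))
  then show "F2 Gamma c \<in> hom2 PsA (F1 Gamma (src2 CoF c)) (F1 Gamma (tgt2 CoF c))"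
    by (simp add: Gamma_def)
qed

lemma cofmor_ok_Psi:
  assumes "m \<in> Cell1 PsA"
  shows "cofmor_ok \<kappa> \<lparr>cm_src = Psi0 (pm_src m), cm_tgt = Psi0 (pm_tgt m), cm_sq = pm_map m\<rparr>"
proof -
  obtain X Y where XY: "normally_cloven \<kappa> X" "normally_cloven \<kappa> Y" "is_psm X Y (pm_map m) m"
    by (rule PsA_cell1E[OF assms])
  have "Psi0 (pm_src m) = X" "Psi0 (pm_tgt m) = Y"
    using XY Psi0_assoc by (auto simp: is_psm_def)
  then show ?thesis using XY is_psm_hom1[OF XY(3)] is_psm_preserves[OF XY] by (simp add: cofmor_ok_def)
qed

lemma Psi_over: "over_map PsA PsAlg_forget CoF NClCoFib_forget Psi"
  unfolding over_map_def
proof (intro conjI ballI)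
  fix A assume "A \<in> Cell0 PsA"
  then show "F0 Psi A \<in> Cell0 CoF" "F0 NClCoFib_forget (F0 Psi A) = F0 PsAlg_forget A"
    using Psi0[of A] pa_obj_assoc[of "Psi0 A"] by (simp_all add: Psi_def)
next
  fix m assume "m \<in> Cell1 PsA"
  then show "F1 Psi m \<in> hom1 CoF (F0 Psi (src1 PsA m)) (F0 Psi (tgt1 PsA m))"
    "F1 NClCoFib_forget (F1 Psi m) = F1 PsAlg_forget m"
    using cofmor_ok_Psi[of m] by (simp_all add: Psi_def)
next
  fix t assume t: "t \<in> Cell2 PsA"
  note T = PsA_cell2D[OF t]
  show "F2 NClCoFib_forget (F2 Psi t) = F2 PsAlg_forget t" by (simp add: Psi_def)
  have e: "cofcell_src \<kappa> (F2 Psi t) = F1 Psi (at_src t)" "cofcell_tgt \<kappa> (F2 Psi t) = F1 Psi (at_tgt t)"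
    using T by (auto intro!: cofmor_eqI simp: Psi_def)
  have "cofmor_ok \<kappa> (F1 Psi (at_src t))" "cofmor_ok \<kappa> (F1 Psi (at_tgt t))" "cc_cell (F2 Psi t) \<in> Cell2 (CAT\<^sub>2 \<kappa>)"
    using T(5) cofmor_ok_Psi[OF T(1)] cofmor_ok_Psi[OF T(2)] by (simp_all add: Psi_def)
  then show "F2 Psi t \<in> hom2 CoF (F1 Psi (src2 PsA t)) (F1 Psi (tgt2 PsA t))"
    using e unfolding in_hom2 NClCoFib_sel(3,6,7) PsAlg_sel(6,7) by metis
qed

lemma Gamma_isomorphism: "two_isomorphism CoF PsA Gamma"
proof (rule two_isomorphism_over[OF CoF_over PsA_over Gamma_over Psi_over])
  fix X assume "X \<in> Cell0 CoF"
  then show "F0 Psi (F0 Gamma X) = X" by (simp add: Psi_def Gamma_def Psi0_assoc)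
next
  fix A assume "A \<in> Cell0 PsA"
  then show "F0 Gamma (F0 Psi A) = A" using Psi0(2)[of A] by (simp add: Psi_def Gamma_def)
qed

text \<open>The underlying square of a pseudomorphism determines it, which gives injectivity in both
  cases. The images are identified by existence of the comparison and by the criterion for its cell
  to be an identity.\<close>

lemma bij_pseudomorphisms:
  fixes X Y :: "'a univ cofib"
  assumes X: "normally_cloven \<kappa> X" and Y: "normally_cloven \<kappa> Y"
  shows "bij_betw pm_map (hom1 PsA (assoc_pseudoalgebra \<kappa> X) (assoc_pseudoalgebra \<kappa> Y))
      {s \<in> hom1 (CAT\<^sub>2 \<kappa>) (cf_fun X) (cf_fun Y). preserves_cocartesian s}"
    and "bij_betw pm_map
      {m \<in> hom1 PsA (assoc_pseudoalgebra \<kappa> X) (assoc_pseudoalgebra \<kappa> Y). strict_morphism (CAT\<^sub>2 \<kappa>) (comma_monad \<kappa>) m}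
      {s \<in> hom1 (CAT\<^sub>2 \<kappa>) (cf_fun X) (cf_fun Y). preserves_lifts X Y s}"
proof -
  have H: "hom1 PsA (assoc_pseudoalgebra \<kappa> X) (assoc_pseudoalgebra \<kappa> Y) = {m. is_psm X Y (pm_map m) m}"
    using PsA_hom1[OF X Y] by blast
  have inj: "inj_on pm_map {m. is_psm X Y (pm_map m) m}"
  proof (rule inj_onI)
    fix m n assume "m \<in> {m. is_psm X Y (pm_map m) m}" "n \<in> {m. is_psm X Y (pm_map m) m}" "pm_map m = pm_map n"
    then have "is_psm X Y (pm_map n) n" "is_psm X Y (pm_map n) m" by simp_all
    then show "m = n" by (rule is_psm_unique[OF X Y])
  qed
  \<comment> \<open>Needed for surjectivity onto the lift-preserving squares: such a square must
    first carry some pseudomorphism before that one can be seen to be strict.\<close>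
  have lifts: "preserves_cocartesian s" if "s \<in> hom1 (CAT\<^sub>2 \<kappa>) (cf_fun X) (cf_fun Y)" "preserves_lifts X Y s" for s
    by (rule cloven_squareE[OF X Y that(1)])
      (use that(2) in \<open>simp add: cloven_square.preserves_lifts_cocartesian\<close>)
  have ex: "\<exists>m. is_psm X Y (pm_map m) m \<and> pm_map m = s"
    if "s \<in> hom1 (CAT\<^sub>2 \<kappa>) (cf_fun X) (cf_fun Y)" "preserves_cocartesian s" for s
    using is_psm_exists[OF X Y that] unfolding is_psm_def by metis
  show "bij_betw pm_map (hom1 PsA (assoc_pseudoalgebra \<kappa> X) (assoc_pseudoalgebra \<kappa> Y))
      {s \<in> hom1 (CAT\<^sub>2 \<kappa>) (cf_fun X) (cf_fun Y). preserves_cocartesian s}"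
    unfolding H bij_betw_def
  proof (intro conjI inj subset_antisym subsetI)
    fix s assume "s \<in> pm_map ` {m. is_psm X Y (pm_map m) m}"
    then show "s \<in> {s \<in> hom1 (CAT\<^sub>2 \<kappa>) (cf_fun X) (cf_fun Y). preserves_cocartesian s}"
      using is_psm_hom1 is_psm_preserves[OF X Y] by blast
  next
    fix s assume "s \<in> {s \<in> hom1 (CAT\<^sub>2 \<kappa>) (cf_fun X) (cf_fun Y). preserves_cocartesian s}"
    then show "s \<in> pm_map ` {m. is_psm X Y (pm_map m) m}" using ex[of s] by blast
  qed
  show "bij_betw pm_map
      {m \<in> hom1 PsA (assoc_pseudoalgebra \<kappa> X) (assoc_pseudoalgebra \<kappa> Y). strict_morphism (CAT\<^sub>2 \<kappa>) (comma_monad \<kappa>) m}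
      {s \<in> hom1 (CAT\<^sub>2 \<kappa>) (cf_fun X) (cf_fun Y). preserves_lifts X Y s}"
    unfolding H bij_betw_def
  proof (intro conjI subset_antisym subsetI)
    show "inj_on pm_map {m \<in> {m. is_psm X Y (pm_map m) m}. strict_morphism (CAT\<^sub>2 \<kappa>) (comma_monad \<kappa>) m}"
      by (rule inj_on_subset[OF inj]) blast
    fix s assume "s \<in> pm_map ` {m \<in> {m. is_psm X Y (pm_map m) m}. strict_morphism (CAT\<^sub>2 \<kappa>) (comma_monad \<kappa>) m}"
    then show "s \<in> {s \<in> hom1 (CAT\<^sub>2 \<kappa>) (cf_fun X) (cf_fun Y). preserves_lifts X Y s}"
      using is_psm_hom1 is_psm_strict[OF X Y] by blast
  next
    fix s assume "s \<in> {s \<in> hom1 (CAT\<^sub>2 \<kappa>) (cf_fun X) (cf_fun Y). preserves_lifts X Y s}"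
    then show "s \<in> pm_map ` {m \<in> {m. is_psm X Y (pm_map m) m}. strict_morphism (CAT\<^sub>2 \<kappa>) (comma_monad \<kappa>) m}"
      using ex[of s] lifts[of s] is_psm_strict[OF X Y] by blast
  qed
qed

end

theorem theorem5p4:
  fixes \<kappa> :: "'k rel"
  assumes "Cinfinite \<kappa>"
  shows "strict_two_monad (CAT\<^sub>2 \<kappa>) (comma_monad \<kappa> ::
      ('a univ fnctr, 'a univ fnctr square, ('a univ fnctr, 'a univ nattr) sqcell) two_monad) \<and>
    (\<exists>\<Gamma> :: ('a univ cofib, 'a univ cofmor, 'a univ cofcell, _, _, _) two_fun.
    two_isomorphism (NClCoFib \<kappa>) (PsAlg\<^sub>n (CAT\<^sub>2 \<kappa>) (comma_monad \<kappa>)) \<Gamma> \<and>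
    commutes_over (NClCoFib \<kappa>) NClCoFib_forget PsAlg_forget \<Gamma> \<and>
    (\<forall>X \<in> Cell0 (NClCoFib \<kappa>). F0 \<Gamma> X = assoc_pseudoalgebra \<kappa> X) \<and>
    (\<forall>X \<in> Cell0 (NClCoFib \<kappa>). \<forall>Y \<in> Cell0 (NClCoFib \<kappa>).
       bij_betw pm_map
         (hom1 (PsAlg\<^sub>n (CAT\<^sub>2 \<kappa>) (comma_monad \<kappa>)) (F0 \<Gamma> X) (F0 \<Gamma> Y))
         {s \<in> hom1 (CAT\<^sub>2 \<kappa>) (cf_fun X) (cf_fun Y). preserves_cocartesian s} \<and>
       bij_betw pm_map
         {m \<in> hom1 (PsAlg\<^sub>n (CAT\<^sub>2 \<kappa>) (comma_monad \<kappa>)) (F0 \<Gamma> X) (F0 \<Gamma> Y).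
            strict_morphism (CAT\<^sub>2 \<kappa>) (comma_monad \<kappa>) m}
         {s \<in> hom1 (CAT\<^sub>2 \<kappa>) (cf_fun X) (cf_fun Y). preserves_lifts X Y s} \<and>
       (\<forall>m \<in> hom1 (PsAlg\<^sub>n (CAT\<^sub>2 \<kappa>) (comma_monad \<kappa>)) (F0 \<Gamma> X) (F0 \<Gamma> Y).
        \<forall>n \<in> hom1 (PsAlg\<^sub>n (CAT\<^sub>2 \<kappa>) (comma_monad \<kappa>)) (F0 \<Gamma> X) (F0 \<Gamma> Y).
        \<forall>\<theta> \<in> hom2 (CAT\<^sub>2 \<kappa>) (pm_map m) (pm_map n).
          algebra_transformation (CAT\<^sub>2 \<kappa>) (comma_monad \<kappa>)
            \<lparr>at_src = m, at_tgt = n, at_cell = \<theta>\<rparr>)))"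
proof -
  interpret comma_ambient \<kappa> by (rule comma_ambient.intro[OF assms])
  have ob: "F0 Gamma X = assoc_pseudoalgebra \<kappa> X" for X by (simp add: Gamma_def)
  show ?thesis
  proof (intro conjI exI[of _ Gamma] ballI)
    show "strict_two_monad (CAT\<^sub>2 \<kappa>) (comma_monad \<kappa> ::
        ('a univ fnctr, 'a univ fnctr square, ('a univ fnctr, 'a univ nattr) sqcell) two_monad)"
      by (rule CC_strict_two_monad)
    show "two_isomorphism CoF PsA Gamma" by (rule Gamma_isomorphism)
    show "commutes_over CoF NClCoFib_forget PsAlg_forget Gamma"
      using Gamma_over unfolding over_map_def commutes_over_def by blast
    fix X :: "'a univ cofib" show "F0 Gamma X = assoc_pseudoalgebra \<kappa> X" by (rule ob)
  next
    fix X Y :: "'a univ cofib" assume "X \<in> Cell0 CoF" "Y \<in> Cell0 CoF"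
    then have XY: "normally_cloven \<kappa> X" "normally_cloven \<kappa> Y" by simp_all
    show "bij_betw pm_map (hom1 PsA (F0 Gamma X) (F0 Gamma Y))
        {s \<in> hom1 (CAT\<^sub>2 \<kappa>) (cf_fun X) (cf_fun Y). preserves_cocartesian s}"
      "bij_betw pm_map
        {m \<in> hom1 PsA (F0 Gamma X) (F0 Gamma Y). strict_morphism (CAT\<^sub>2 \<kappa>) (comma_monad \<kappa>) m}
        {s \<in> hom1 (CAT\<^sub>2 \<kappa>) (cf_fun X) (cf_fun Y). preserves_lifts X Y s}"
      unfolding ob by (rule bij_pseudomorphisms[OF XY])+
    fix m n \<theta>
    assume mn: "m \<in> hom1 PsA (F0 Gamma X) (F0 Gamma Y)" "n \<in> hom1 PsA (F0 Gamma X) (F0 Gamma Y)"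
      and th: "\<theta> \<in> hom2 (CAT\<^sub>2 \<kappa>) (pm_map m) (pm_map n)"
    show "algebra_transformation (CAT\<^sub>2 \<kappa>) (comma_monad \<kappa>) \<lparr>at_src = m, at_tgt = n, at_cell = \<theta>\<rparr>"
      using mn unfolding ob PsA_hom1[OF XY] by (rule is_psm_algtr[OF XY _ _ th])
  qed
qed

end
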